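(* For any cartesian 2-category $\mathbf{A}$ and cartesian equipment $\mathbb{E}$ with local coequalizers, there is an isomorphism of 2-categories $$\mathbf{CartLax}_\ell(\mathrm{VerDbl}(\mathbf{A}),\mathbb{E})\xrightarrow{\ \cong\ }\mathbf{Cart2Cat}_\ell(\mathbf{A},\mathbf{Cat}(\mathbb{E})).$$ In particular, there is an isomorphism of 2-categories $$\mathbf{CartLax}_\ell(\mathrm{VerDbl}(\mathbf{A}),\mathbb{S}\mathrm{pan})\xrightarrow{\ \cong\ }\mathbf{Cart2Cat}_\ell(\mathbf{A},\mathbf{Cat}).$$
   Context: Double categories are pseudo: strict in the direction of arrows, weak in the direction of proarrows. A double category $\mathbb{D}$ has underlying categories $\mathbb{D}_0$ (objects and arrows) and $\mathbb{D}_1$ (proarrows, written $m: x \nrightarrow y$, and cells). A cell $\alpha: m \to n$ from $m: x \nrightarrow y$ to $n: w \nrightarrow z$ over $(f,g)$ has source arrow $f: x\to w$ and target arrow $g: y \to z$; it is globular if $f,g$ are identities. Composition in $\mathbb{D}_0,\mathbb{D}_1$ is written $\cdot$ in diagrammatic order; external composition of proarrows and cells is written $\odot$ in diagrammatic order, with external identities $\mathrm{id}_x,\mathrm{id}_f$. Coherence isomorphisms for $\odot$ are suppressed in formulas. $\mathbb{S}\mathrm{pan}$ is the double category of sets, functions, spans, maps of spans. A double category $\mathbb{D}$ is cartesian if $\mathbb{D}\to\mathbb{D}\times\mathbb{D}$ (diagonal) and $\mathbb{D}\to\mathbb{1}$ have right adjoints in the 2-category of double categories, pseudo double functors and natural transformations;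 explicitly, $\mathbb{D}_0,\mathbb{D}_1$ have finite products, preserved by source and target, and external composition and external identity preserve finite products up to the canonical comparison isomorphisms. An equipment is a double category for which $\langle s,t\rangle:\mathbb{D}_1\to\mathbb{D}_0\times\mathbb{D}_0$ is a fibration; a cartesian equipment is a cartesian double category that is an equipment. Local coequalizers: each hom-category $\mathbb{D}(x,y)$ (proarrows $x\nrightarrow y$, globular cells) has coequalizers, preserved by external composition in each argument. A cartesian 2-category is a 2-category with finite (strict) 2-products. $\mathrm{VerDbl}(\mathbf{A})$ is the strict double category with the objects of $\mathbf{A}$, arrows the morphisms of $\mathbf{A}$, only identity proarrows, and cells $\mathrm{id}_x\to\mathrm{id}_y$ over $(f,g)$ the 2-cells $f\Rightarrow g$ of $\mathbf{A}$; it is cartesian when $\mathbf{A}$ is. Lax double functor $F:\mathbb{D}\to\mathbb{E}$: functors $F_0,F_1$ compatible with source and target, with globular laxators $F_{m,n}:Fm\odot Fn\to F(m\odot n)$ and unitors $F_x:\mathrm{id}_{Fx}\to F\mathrm{id}_x$, natural ($(F\alpha\odot F\beta)\cdot F_{m',n'}=F_{m,n}\cdot F(\alpha\odot\beta)$, $\mathrm{id}_{Ff}\cdot F_y=F_x\cdot F\mathrm{id}_f$), associative and unital. $F_{x,m}:F\mathrm{id}_x\odot Fm\to Fm$, $F_{m,y}:Fm\odot F\mathrm{id}_y\to Fm$ denote laxators at identity proarrows. Between cartesian double categories, $F$ is cartesian if $F_0$ and $F_1$ preserve finite products. Lax natural transformation $\alpha:F\Rightarrow G$ of lax functors $\mathbb{D}\to\mathbb{E}$: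 arrows $\alpha_x:Fx\to Gx$; cells $\alpha_m:Fm\to Gm$ over $(\alpha_x,\alpha_y)$ for $m:x\nrightarrow y$; for each arrow $f:x\to y$ a cell $\alpha_f:\mathrm{id}_{Fx}\to G\mathrm{id}_y$ over $(\alpha_x\cdot Gf,\ Ff\cdot\alpha_y)$; such that (1) for each cell $\gamma:m\to n$ over $(f,g)$, $m:x\nrightarrow y$, $n:w\nrightarrow z$: $(\alpha_f\odot(F\gamma\cdot\alpha_n))\cdot G_{w,n}=((\alpha_m\cdot G\gamma)\odot\alpha_g)\cdot G_{n,z}$; (2) $F_{m,n}\cdot\alpha_{m\odot n}=(\alpha_m\odot\alpha_n)\cdot G_{m,n}$ and $F_x\cdot\alpha_{\mathrm{id}_x}=\mathrm{id}_{\alpha_x}\cdot G_x$; (3) for $x\xrightarrow{f}y\xrightarrow{g}z$, $\alpha_{f\cdot g}=((\alpha_f\cdot G\mathrm{id}_g)\odot(\mathrm{id}_{Ff}\cdot\alpha_g))\cdot G_{z,z}$ and $\alpha_{1_x}=\mathrm{id}_{\alpha_x}\cdot G_x$. Composition: $(\alpha\beta)_x=\alpha_x\cdot\beta_x$, $(\alpha\beta)_m=\alpha_m\cdot\beta_m$, $(\alpha\beta)_f=((\mathrm{id}_{\alpha_x}\cdot\beta_f)\odot(\alpha_f\cdot\beta_{\mathrm{id}_y}))\cdot H_{y,y}$; the identity on $F$ has $(1_F)_f=\mathrm{id}_{Ff}\cdot F_y$ and identity components. $\alpha$ is cartesian if for each projection $\pi:x_1\times x_2\to x_i$ it is strictly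 natural: $\alpha_{x_1\times x_2}\cdot G\pi=F\pi\cdot\alpha_{x_i}$, and $\alpha_\pi=\mathrm{id}_{F\pi\cdot\alpha_{x_i}}\cdot G_{x_i}$. Modulation $\mu:\alpha\Rrightarrow\beta$ of lax transformations $\alpha,\beta:F\Rightarrow G$: for each object $x$ of $\mathbb{D}$ a cell $\mu_x:\mathrm{id}_{Fx}\to G\mathrm{id}_x$ over $(\alpha_x,\beta_x)$ such that for each $m:x\nrightarrow y$, $(\mu_x\odot\beta_m)\cdot G_{x,m}=(\alpha_m\odot\mu_y)\cdot G_{m,y}$ (this common cell is denoted $\mu_m$), and for each cell $\gamma:m\to n$ over $(f,g)$, $m:x\nrightarrow y$, $n:w\nrightarrow z$, $(\alpha_f\odot(F\gamma\cdot\mu_n))\cdot G_{w,n}=((\mu_m\cdot G\gamma)\odot\beta_g)\cdot G_{n,z}$. Compositions: $(\mu\cdot\nu)_x=(\mu_x\odot\nu_x)\cdot G_{x,x}$; identities $(1_\alpha)_x=\mathrm{id}_{\alpha_x}\cdot G_x$; $(\mu*\nu)_x=\mu_x\cdot\nu_{\mathrm{id}_x}$ along transformations $F\Rightarrow G\Rightarrow H$. $\mathbf{CartLax}_\ell(\mathbb{D},\mathbb{E})$ is the 2-category of cartesian lax functors, cartesian lax natural transformations and modulations. $\mathbf{Cat}(\mathbb{E})$ is the 2-category of category objects in $\mathbb{E}$: objects $(x,r,\mu,\upsilon)$ with $r:x\nrightarrow x$ and globular $\mu:r\odot r\to r$, $\upsilon:\mathrm{id}_x\to r$, associative and unital; morphisms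 (functors) $(f,\phi):(x,r,\mu,\upsilon)\to(y,s,\nu,\theta)$ with $f:x\to y$ and $\phi:r\to s$ over $(f,f)$, $(\phi\odot\phi)\cdot\nu=\mu\cdot\phi$, $\mathrm{id}_f\cdot\theta=\upsilon\cdot\phi$; 2-morphisms $(f,\phi)\Rightarrow(g,\psi)$ the cells $\alpha:\mathrm{id}_x\to s$ over $(f,g)$ with $(\alpha\odot\psi)\cdot\nu=(\phi\odot\alpha)\cdot\nu$; composition is the evident one. $\mathbf{Cat}$ is the 2-category of small categories. For cartesian 2-categories $\mathbf{A},\mathbf{B}$, $\mathbf{Cart2Cat}_\ell(\mathbf{A},\mathbf{B})$ is the 2-category of (strict) 2-functors preserving finite products, lax natural transformations (comparison 2-cells $\alpha_f:\alpha_x\cdot Gf\Rightarrow Ff\cdot\alpha_y$) that are cartesian, i.e. strictly natural with respect to product projections, and modifications. *)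

theory Defs
  imports "HOL-Library.FuncSet"
begin

text \<open>
  All structures are records with explicit carriers.  Composition is written in diagrammatic
  order throughout.  Maps that occur as components of objects, 1-cells or 2-cells of one of the
  2-categories below are required to be \<^emph>\<open>extensional\<close> (\<^term>\<open>undefined\<close> outside their carrier), so
  that equality of records is equality of the mathematical objects, and morphisms carry their
  source and target.
\<close>

section \<open>Categories\<close>

record ('o, 'a) cat =
  Ob :: "'o set"
  Ar :: "'a set"
  Dom :: "'a \<Rightarrow> 'o"
  Cod :: "'a \<Rightarrow> 'o"
  Ide :: "'o \<Rightarrow> 'a"
  Cmp :: "'a \<Rightarrow> 'a \<Rightarrow> 'a"

abbreviation cmp_in :: "'a \<Rightarrow> ('o, 'a) cat \<Rightarrow> 'a \<Rightarrow> 'a"  ("(_ \<cdot>\<^bsub>_\<^esub> _)" [70, 0, 71] 70)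
  where "f \<cdot>\<^bsub>C\<^esub> g \<equiv> Cmp C f g"

definition hom :: "('o, 'a) cat \<Rightarrow> 'o \<Rightarrow> 'o \<Rightarrow> 'a set"
  where "hom C x y = {f \<in> Ar C. Dom C f = x \<and> Cod C f = y}"

locale category =
  fixes C :: "('o, 'a) cat"
  assumes dom_in: "f \<in> Ar C \<Longrightarrow> Dom C f \<in> Ob C"
    and cod_in: "f \<in> Ar C \<Longrightarrow> Cod C f \<in> Ob C"
    and ide_in: "x \<in> Ob C \<Longrightarrow> Ide C x \<in> hom C x x"
    and cmp_in: "f \<in> hom C x y \<Longrightarrow> g \<in> hom C y z \<Longrightarrow> f \<cdot>\<^bsub>C\<^esub> g \<in> hom C x z"
    and ide_left: "f \<in> hom C x y \<Longrightarrow> Ide C x \<cdot>\<^bsub>C\<^esub> f = f"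
    and ide_right: "f \<in> hom C x y \<Longrightarrow> f \<cdot>\<^bsub>C\<^esub> Ide C y = f"
    and cmp_assoc: "f \<in> hom C w x \<Longrightarrow> g \<in> hom C x y \<Longrightarrow> h \<in> hom C y z \<Longrightarrow>
      (f \<cdot>\<^bsub>C\<^esub> g) \<cdot>\<^bsub>C\<^esub> h = f \<cdot>\<^bsub>C\<^esub> (g \<cdot>\<^bsub>C\<^esub> h)"

definition inverse_arrows :: "('o, 'a) cat \<Rightarrow> 'a \<Rightarrow> 'a \<Rightarrow> bool"
  where "inverse_arrows C f g \<longleftrightarrow>
    f \<in> Ar C \<and> g \<in> hom C (Cod C f) (Dom C f) \<and>
    f \<cdot>\<^bsub>C\<^esub> g = Ide C (Dom C f) \<and> g \<cdot>\<^bsub>C\<^esub> f = Ide C (Cod C f)"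

definition iso_arrow :: "('o, 'a) cat \<Rightarrow> 'a \<Rightarrow> bool"
  where "iso_arrow C f \<longleftrightarrow> (\<exists>g. inverse_arrows C f g)"

definition inv_arrow :: "('o, 'a) cat \<Rightarrow> 'a \<Rightarrow> 'a"
  where "inv_arrow C f = (THE g. inverse_arrows C f g)"

definition is_product :: "('o, 'a) cat \<Rightarrow> 'o \<Rightarrow> 'o \<Rightarrow> 'o \<Rightarrow> 'a \<Rightarrow> 'a \<Rightarrow> bool"
  where "is_product C x y p \<pi>\<^sub>1 \<pi>\<^sub>2 \<longleftrightarrow>
    x \<in> Ob C \<and> y \<in> Ob C \<and> p \<in> Ob C \<and> \<pi>\<^sub>1 \<in> hom C p x \<and> \<pi>\<^sub>2 \<in> hom C p y \<and>
    (\<forall>w \<in> Ob C. \<forall>f \<in> hom C w x. \<forall>g \<in> hom C w y.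
      \<exists>!h. h \<in> hom C w p \<and> h \<cdot>\<^bsub>C\<^esub> \<pi>\<^sub>1 = f \<and> h \<cdot>\<^bsub>C\<^esub> \<pi>\<^sub>2 = g)"

definition is_terminal :: "('o, 'a) cat \<Rightarrow> 'o \<Rightarrow> bool"
  where "is_terminal C t \<longleftrightarrow> t \<in> Ob C \<and> (\<forall>w \<in> Ob C. \<exists>!h. h \<in> hom C w t)"

record ('o, 'a, 'p, 'b) fctr =
  onOb :: "'o \<Rightarrow> 'p"
  onAr :: "'a \<Rightarrow> 'b"

locale cat_functor =
  fixes C :: "('o, 'a) cat" and D :: "('p, 'b) cat" and F :: "('o, 'a, 'p, 'b) fctr"
  assumes ob_ext: "onOb F \<in> extensional (Ob C)"
    and ar_ext: "onAr F \<in> extensional (Ar C)"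
    and ob_in: "x \<in> Ob C \<Longrightarrow> onOb F x \<in> Ob D"
    and ar_in: "f \<in> hom C x y \<Longrightarrow> onAr F f \<in> hom D (onOb F x) (onOb F y)"
    and pres_ide: "x \<in> Ob C \<Longrightarrow> onAr F (Ide C x) = Ide D (onOb F x)"
    and pres_cmp: "f \<in> hom C x y \<Longrightarrow> g \<in> hom C y z \<Longrightarrow>
      onAr F (f \<cdot>\<^bsub>C\<^esub> g) = onAr F f \<cdot>\<^bsub>D\<^esub> onAr F g"

definition preserves_products ::
  "('o, 'a) cat \<Rightarrow> ('p, 'b) cat \<Rightarrow> ('o, 'a, 'p, 'b) fctr \<Rightarrow> bool"
  where "preserves_products C D F \<longleftrightarrow>
    (\<forall>x y p \<pi>\<^sub>1 \<pi>\<^sub>2. is_product C x y p \<pi>\<^sub>1 \<pi>\<^sub>2 \<longrightarrow>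
      is_product D (onOb F x) (onOb F y) (onOb F p) (onAr F \<pi>\<^sub>1) (onAr F \<pi>\<^sub>2)) \<and>
    (\<forall>t. is_terminal C t \<longrightarrow> is_terminal D (onOb F t))"

text \<open>A choice of binary products, with their projections, and of a terminal object.\<close>

record ('o, 'a) prods =
  Prod :: "'o \<Rightarrow> 'o \<Rightarrow> 'o"
  Proj1 :: "'o \<Rightarrow> 'o \<Rightarrow> 'a"
  Proj2 :: "'o \<Rightarrow> 'o \<Rightarrow> 'a"
  One :: "'o"

definition chosen_products :: "('o, 'a) cat \<Rightarrow> ('o, 'a) prods \<Rightarrow> bool"
  where "chosen_products C P \<longleftrightarrow>
    (\<forall>x \<in> Ob C. \<forall>y \<in> Ob C. is_product C x y (Prod P x y) (Proj1 P x y) (Proj2 P x y)) \<and>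
    is_terminal C (One P)"


section \<open>2-categories\<close>

text \<open>
  \<open>C1 A\<close> is the underlying category.  The objects of \<open>C2 A\<close> are the arrows of \<open>C1 A\<close>, its arrows
  are the 2-cells, and its composition is vertical composition.
\<close>

record ('o, 'a, 't) two_cat =
  C1 :: "('o, 'a) cat"
  C2 :: "('a, 't) cat"
  HCmp :: "'t \<Rightarrow> 't \<Rightarrow> 't"

abbreviation hcmp_in :: "'t \<Rightarrow> ('o, 'a, 't) two_cat \<Rightarrow> 't \<Rightarrow> 't"  ("(_ *\<^bsub>_\<^esub> _)" [70, 0, 71] 70)
  where "s *\<^bsub>A\<^esub> t \<equiv> HCmp A s t"

definition two_hom :: "('o, 'a, 't) two_cat \<Rightarrow> 'o \<Rightarrow> 'o \<Rightarrow> 't set"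
  where "two_hom A x y = {s. \<exists>f \<in> hom (C1 A) x y. \<exists>g \<in> hom (C1 A) x y. s \<in> hom (C2 A) f g}"

locale two_category =
  fixes A :: "('o, 'a, 't) two_cat"
  assumes cat1: "category (C1 A)"
    and cat2: "category (C2 A)"
    and ob2: "Ob (C2 A) = Ar (C1 A)"
    and parallel_dom: "s \<in> hom (C2 A) f g \<Longrightarrow> Dom (C1 A) f = Dom (C1 A) g"
    and parallel_cod: "s \<in> hom (C2 A) f g \<Longrightarrow> Cod (C1 A) f = Cod (C1 A) g"
    and hcmp_hom: "f \<in> hom (C1 A) x y \<Longrightarrow> h \<in> hom (C1 A) y z \<Longrightarrow>
      s \<in> hom (C2 A) f g \<Longrightarrow> t \<in> hom (C2 A) h k \<Longrightarrow>
      s *\<^bsub>A\<^esub> t \<in> hom (C2 A) (f \<cdot>\<^bsub>C1 A\<^esub> h) (g \<cdot>\<^bsub>C1 A\<^esub> k)"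
    and hcmp_ide: "f \<in> hom (C1 A) x y \<Longrightarrow> g \<in> hom (C1 A) y z \<Longrightarrow>
      Ide (C2 A) f *\<^bsub>A\<^esub> Ide (C2 A) g = Ide (C2 A) (f \<cdot>\<^bsub>C1 A\<^esub> g)"
    and interchange: "f \<in> hom (C1 A) x y \<Longrightarrow> f' \<in> hom (C1 A) y z \<Longrightarrow>
      s \<in> hom (C2 A) f g \<Longrightarrow> t \<in> hom (C2 A) g h \<Longrightarrow>
      s' \<in> hom (C2 A) f' g' \<Longrightarrow> t' \<in> hom (C2 A) g' h' \<Longrightarrow>
      (s \<cdot>\<^bsub>C2 A\<^esub> t) *\<^bsub>A\<^esub> (s' \<cdot>\<^bsub>C2 A\<^esub> t') = (s *\<^bsub>A\<^esub> s') \<cdot>\<^bsub>C2 A\<^esub> (t *\<^bsub>A\<^esub> t')"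
    and hcmp_left: "s \<in> two_hom A x y \<Longrightarrow> Ide (C2 A) (Ide (C1 A) x) *\<^bsub>A\<^esub> s = s"
    and hcmp_right: "s \<in> two_hom A x y \<Longrightarrow> s *\<^bsub>A\<^esub> Ide (C2 A) (Ide (C1 A) y) = s"
    and hcmp_assoc: "s \<in> two_hom A w x \<Longrightarrow> t \<in> two_hom A x y \<Longrightarrow> u \<in> two_hom A y z \<Longrightarrow>
      (s *\<^bsub>A\<^esub> t) *\<^bsub>A\<^esub> u = s *\<^bsub>A\<^esub> (t *\<^bsub>A\<^esub> u)"

text \<open>Strict 2-products: \<open>Hom(w, p) \<cong> Hom(w, x) \<times> Hom(w, y)\<close>, bijectively on arrows and on 2-cells.\<close>

definition is_2product :: "('o, 'a, 't) two_cat \<Rightarrow> 'o \<Rightarrow> 'o \<Rightarrow> 'o \<Rightarrow> 'a \<Rightarrow> 'a \<Rightarrow> bool"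
  where "is_2product A x y p \<pi>\<^sub>1 \<pi>\<^sub>2 \<longleftrightarrow>
    is_product (C1 A) x y p \<pi>\<^sub>1 \<pi>\<^sub>2 \<and>
    (\<forall>w \<in> Ob (C1 A). \<forall>s \<in> two_hom A w x. \<forall>t \<in> two_hom A w y.
      \<exists>!u. u \<in> two_hom A w p \<and>
        u *\<^bsub>A\<^esub> Ide (C2 A) \<pi>\<^sub>1 = s \<and> u *\<^bsub>A\<^esub> Ide (C2 A) \<pi>\<^sub>2 = t)"

definition is_2terminal :: "('o, 'a, 't) two_cat \<Rightarrow> 'o \<Rightarrow> bool"
  where "is_2terminal A t \<longleftrightarrow>
    is_terminal (C1 A) t \<and> (\<forall>w \<in> Ob (C1 A). \<exists>!u. u \<in> two_hom A w t)"

definition cartesian_two_category :: "('o, 'a, 't) two_cat \<Rightarrow> ('o, 'a) prods \<Rightarrow> bool"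
  where "cartesian_two_category A P \<longleftrightarrow>
    two_category A \<and>
    (\<forall>x \<in> Ob (C1 A). \<forall>y \<in> Ob (C1 A).
      is_2product A x y (Prod P x y) (Proj1 P x y) (Proj2 P x y)) \<and>
    is_2terminal A (One P)"

record ('o, 'a, 't, 'p, 'b, 'u) two_fctr =
  on0 :: "'o \<Rightarrow> 'p"
  on1 :: "'a \<Rightarrow> 'b"
  on2 :: "'t \<Rightarrow> 'u"

locale two_functor =
  fixes A :: "('o, 'a, 't) two_cat" and B :: "('p, 'b, 'u) two_cat"
    and F :: "('o, 'a, 't, 'p, 'b, 'u) two_fctr"
  assumes functor1: "cat_functor (C1 A) (C1 B) \<lparr>onOb = on0 F, onAr = on1 F\<rparr>"
    and functor2: "cat_functor (C2 A) (C2 B) \<lparr>onOb = on1 F, onAr = on2 F\<rparr>"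
    and pres_hcmp: "s \<in> two_hom A x y \<Longrightarrow> t \<in> two_hom A y z \<Longrightarrow>
      on2 F (s *\<^bsub>A\<^esub> t) = on2 F s *\<^bsub>B\<^esub> on2 F t"

definition isomorphic_two_categories ::
  "('o, 'a, 't) two_cat \<Rightarrow> ('p, 'b, 'u) two_cat \<Rightarrow> bool"
  where "isomorphic_two_categories A B \<longleftrightarrow>
    two_category A \<and> two_category B \<and>
    (\<exists>F G. two_functor A B F \<and> two_functor B A G \<and>
      (\<forall>x \<in> Ob (C1 A). on0 G (on0 F x) = x) \<and> (\<forall>y \<in> Ob (C1 B). on0 F (on0 G y) = y) \<and>
      (\<forall>f \<in> Ar (C1 A). on1 G (on1 F f) = f) \<and> (\<forall>g \<in> Ar (C1 B). on1 F (on1 G g) = g) \<and>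
      (\<forall>s \<in> Ar (C2 A). on2 G (on2 F s) = s) \<and> (\<forall>t \<in> Ar (C2 B). on2 F (on2 G t) = t))"


section \<open>Lax natural transformations of 2-functors\<close>

definition preserves_2products ::
  "('o, 'a, 't) two_cat \<Rightarrow> ('p, 'b, 'u) two_cat \<Rightarrow> ('o, 'a, 't, 'p, 'b, 'u) two_fctr \<Rightarrow> bool"
  where "preserves_2products A B F \<longleftrightarrow>
    (\<forall>x y p \<pi>\<^sub>1 \<pi>\<^sub>2. is_2product A x y p \<pi>\<^sub>1 \<pi>\<^sub>2 \<longrightarrow>
      is_2product B (on0 F x) (on0 F y) (on0 F p) (on1 F \<pi>\<^sub>1) (on1 F \<pi>\<^sub>2)) \<and>
    (\<forall>t. is_2terminal A t \<longrightarrow> is_2terminal B (on0 F t))"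

record ('o, 'a, 't, 'p, 'b, 'u) lax_nat =
  nsrc :: "('o, 'a, 't, 'p, 'b, 'u) two_fctr"
  ntgt :: "('o, 'a, 't, 'p, 'b, 'u) two_fctr"
  nob :: "'o \<Rightarrow> 'b"
  nar :: "'a \<Rightarrow> 'u"

locale two_lax_transformation =
  fixes A :: "('o, 'a, 't) two_cat" and B :: "('p, 'b, 'u) two_cat"
    and \<alpha> :: "('o, 'a, 't, 'p, 'b, 'u) lax_nat"
  assumes ob_ext: "nob \<alpha> \<in> extensional (Ob (C1 A))"
    and ar_ext: "nar \<alpha> \<in> extensional (Ar (C1 A))"
    and ob_hom: "x \<in> Ob (C1 A) \<Longrightarrow> nob \<alpha> x \<in> hom (C1 B) (on0 (nsrc \<alpha>) x) (on0 (ntgt \<alpha>) x)"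
    and ar_hom: "f \<in> hom (C1 A) x y \<Longrightarrow>
      nar \<alpha> f \<in> hom (C2 B) (nob \<alpha> x \<cdot>\<^bsub>C1 B\<^esub> on1 (ntgt \<alpha>) f) (on1 (nsrc \<alpha>) f \<cdot>\<^bsub>C1 B\<^esub> nob \<alpha> y)"
    and natural: "f \<in> hom (C1 A) x y \<Longrightarrow> g \<in> hom (C1 A) x y \<Longrightarrow> s \<in> hom (C2 A) f g \<Longrightarrow>
      nar \<alpha> f \<cdot>\<^bsub>C2 B\<^esub> (on2 (nsrc \<alpha>) s *\<^bsub>B\<^esub> Ide (C2 B) (nob \<alpha> y)) =
      (Ide (C2 B) (nob \<alpha> x) *\<^bsub>B\<^esub> on2 (ntgt \<alpha>) s) \<cdot>\<^bsub>C2 B\<^esub> nar \<alpha> g"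
    and ar_cmp: "f \<in> hom (C1 A) x y \<Longrightarrow> g \<in> hom (C1 A) y z \<Longrightarrow>
      nar \<alpha> (f \<cdot>\<^bsub>C1 A\<^esub> g) =
      (nar \<alpha> f *\<^bsub>B\<^esub> Ide (C2 B) (on1 (ntgt \<alpha>) g)) \<cdot>\<^bsub>C2 B\<^esub>
      (Ide (C2 B) (on1 (nsrc \<alpha>) f) *\<^bsub>B\<^esub> nar \<alpha> g)"
    and ar_ide: "x \<in> Ob (C1 A) \<Longrightarrow> nar \<alpha> (Ide (C1 A) x) = Ide (C2 B) (nob \<alpha> x)"

definition two_strict_at ::
  "('p, 'b, 'u) two_cat \<Rightarrow> ('o, 'a, 't, 'p, 'b, 'u) lax_nat \<Rightarrow> 'o \<Rightarrow> 'o \<Rightarrow> 'a \<Rightarrow> bool"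
  where "two_strict_at B \<alpha> x y f \<longleftrightarrow>
    nob \<alpha> x \<cdot>\<^bsub>C1 B\<^esub> on1 (ntgt \<alpha>) f = on1 (nsrc \<alpha>) f \<cdot>\<^bsub>C1 B\<^esub> nob \<alpha> y \<and>
    nar \<alpha> f = Ide (C2 B) (on1 (nsrc \<alpha>) f \<cdot>\<^bsub>C1 B\<^esub> nob \<alpha> y)"

text \<open>
  Only the projections of the chosen products are required to be strictly natural.  Requiring this
  for every product cone would force strict naturality at every isomorphism, since an isomorphism
  followed by the projections of a product is again a product cone.
\<close>

definition two_cartesian_transformation ::
  "('o, 'a, 't) two_cat \<Rightarrow> ('o, 'a) prods \<Rightarrow> ('p, 'b, 'u) two_cat \<Rightarrow>
    ('o, 'a, 't, 'p, 'b, 'u) lax_nat \<Rightarrow> bool"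
  where "two_cartesian_transformation A P B \<alpha> \<longleftrightarrow>
    (\<forall>x\<^sub>1 \<in> Ob (C1 A). \<forall>x\<^sub>2 \<in> Ob (C1 A).
      two_strict_at B \<alpha> (Prod P x\<^sub>1 x\<^sub>2) x\<^sub>1 (Proj1 P x\<^sub>1 x\<^sub>2) \<and>
      two_strict_at B \<alpha> (Prod P x\<^sub>1 x\<^sub>2) x\<^sub>2 (Proj2 P x\<^sub>1 x\<^sub>2))"

record ('o, 'a, 't, 'p, 'b, 'u) modif =
  msrc :: "('o, 'a, 't, 'p, 'b, 'u) lax_nat"
  mtgt :: "('o, 'a, 't, 'p, 'b, 'u) lax_nat"
  mob :: "'o \<Rightarrow> 'u"

locale modification =
  fixes A :: "('o, 'a, 't) two_cat" and B :: "('p, 'b, 'u) two_cat"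
    and \<mu> :: "('o, 'a, 't, 'p, 'b, 'u) modif"
  assumes same_src: "nsrc (msrc \<mu>) = nsrc (mtgt \<mu>)"
    and same_tgt: "ntgt (msrc \<mu>) = ntgt (mtgt \<mu>)"
    and ob_ext: "mob \<mu> \<in> extensional (Ob (C1 A))"
    and ob_hom: "x \<in> Ob (C1 A) \<Longrightarrow> mob \<mu> x \<in> hom (C2 B) (nob (msrc \<mu>) x) (nob (mtgt \<mu>) x)"
    and natural: "f \<in> hom (C1 A) x y \<Longrightarrow>
      nar (msrc \<mu>) f \<cdot>\<^bsub>C2 B\<^esub> (Ide (C2 B) (on1 (nsrc (msrc \<mu>)) f) *\<^bsub>B\<^esub> mob \<mu> y) =
      (mob \<mu> x *\<^bsub>B\<^esub> Ide (C2 B) (on1 (ntgt (msrc \<mu>)) f)) \<cdot>\<^bsub>C2 B\<^esub> nar (mtgt \<mu>) f"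

definition lax_nat_ide ::
  "('o, 'a, 't) two_cat \<Rightarrow> ('p, 'b, 'u) two_cat \<Rightarrow> ('o, 'a, 't, 'p, 'b, 'u) two_fctr \<Rightarrow>
    ('o, 'a, 't, 'p, 'b, 'u) lax_nat"
  where "lax_nat_ide A B F =
    \<lparr>nsrc = F, ntgt = F,
     nob = (\<lambda>x \<in> Ob (C1 A). Ide (C1 B) (on0 F x)),
     nar = (\<lambda>f \<in> Ar (C1 A). Ide (C2 B) (on1 F f))\<rparr>"

definition lax_nat_cmp ::
  "('o, 'a, 't) two_cat \<Rightarrow> ('p, 'b, 'u) two_cat \<Rightarrow> ('o, 'a, 't, 'p, 'b, 'u) lax_nat \<Rightarrow>
    ('o, 'a, 't, 'p, 'b, 'u) lax_nat \<Rightarrow> ('o, 'a, 't, 'p, 'b, 'u) lax_nat"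
  where "lax_nat_cmp A B \<alpha> \<beta> =
    \<lparr>nsrc = nsrc \<alpha>, ntgt = ntgt \<beta>,
     nob = (\<lambda>x \<in> Ob (C1 A). nob \<alpha> x \<cdot>\<^bsub>C1 B\<^esub> nob \<beta> x),
     nar = (\<lambda>f \<in> Ar (C1 A).
       (Ide (C2 B) (nob \<alpha> (Dom (C1 A) f)) *\<^bsub>B\<^esub> nar \<beta> f) \<cdot>\<^bsub>C2 B\<^esub>
       (nar \<alpha> f *\<^bsub>B\<^esub> Ide (C2 B) (nob \<beta> (Cod (C1 A) f))))\<rparr>"

definition Cart2Cat ::
  "('o, 'a, 't) two_cat \<Rightarrow> ('o, 'a) prods \<Rightarrow> ('p, 'b, 'u) two_cat \<Rightarrow>
    (('o, 'a, 't, 'p, 'b, 'u) two_fctr, ('o, 'a, 't, 'p, 'b, 'u) lax_nat,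
     ('o, 'a, 't, 'p, 'b, 'u) modif) two_cat"
  where "Cart2Cat A P B =
    (let functors = {F. two_functor A B F \<and> preserves_2products A B F};
         transfs = {\<alpha>. nsrc \<alpha> \<in> functors \<and> ntgt \<alpha> \<in> functors \<and>
           two_lax_transformation A B \<alpha> \<and> two_cartesian_transformation A P B \<alpha>};
         modifs = {\<mu>. msrc \<mu> \<in> transfs \<and> mtgt \<mu> \<in> transfs \<and> modification A B \<mu>}
     in \<lparr>C1 = \<lparr>Ob = functors, Ar = transfs, Dom = nsrc, Cod = ntgt,
          Ide = lax_nat_ide A B, Cmp = lax_nat_cmp A B\<rparr>,
         C2 = \<lparr>Ob = transfs, Ar = modifs, Dom = msrc, Cod = mtgt,
          Ide = (\<lambda>\<alpha>. \<lparr>msrc = \<alpha>, mtgt = \<alpha>,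
            mob = (\<lambda>x \<in> Ob (C1 A). Ide (C2 B) (nob \<alpha> x))\<rparr>),
          Cmp = (\<lambda>\<mu> \<nu>. \<lparr>msrc = msrc \<mu>, mtgt = mtgt \<nu>,
            mob = (\<lambda>x \<in> Ob (C1 A). mob \<mu> x \<cdot>\<^bsub>C2 B\<^esub> mob \<nu> x)\<rparr>)\<rparr>,
         HCmp = (\<lambda>\<mu> \<nu>. \<lparr>msrc = lax_nat_cmp A B (msrc \<mu>) (msrc \<nu>),
            mtgt = lax_nat_cmp A B (mtgt \<mu>) (mtgt \<nu>),
            mob = (\<lambda>x \<in> Ob (C1 A). mob \<mu> x *\<^bsub>B\<^esub> mob \<nu> x)\<rparr>)\<rparr>)"


section \<open>Pseudo double categories\<close>

text \<open>
  Proarrows are the objects of \<open>D1 D\<close> and cells its arrows.  The fields \<open>assoc\<close>, \<open>lunit\<close>, \<open>runit\<close>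
  are the coherence cells \<open>(m \<odot> n) \<odot> p \<rightarrow> m \<odot> (n \<odot> p)\<close>, \<open>id \<odot> m \<rightarrow> m\<close> and \<open>m \<odot> id \<rightarrow> m\<close>.
  Equations that are usually written with these suppressed are stated with the coherence cells
  (or their inverses) inserted.
\<close>

record ('o, 'a, 'p, 'c) dbl =
  D0 :: "('o, 'a) cat"
  D1 :: "('p, 'c) cat"
  psrc :: "'p \<Rightarrow> 'o"
  ptgt :: "'p \<Rightarrow> 'o"
  csrc :: "'c \<Rightarrow> 'a"
  ctgt :: "'c \<Rightarrow> 'a"
  pid :: "'o \<Rightarrow> 'p"
  cid :: "'a \<Rightarrow> 'c"
  pcmp :: "'p \<Rightarrow> 'p \<Rightarrow> 'p"
  ccmp :: "'c \<Rightarrow> 'c \<Rightarrow> 'c"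
  assoc :: "'p \<Rightarrow> 'p \<Rightarrow> 'p \<Rightarrow> 'c"
  lunit :: "'p \<Rightarrow> 'c"
  runit :: "'p \<Rightarrow> 'c"

abbreviation pcmp_in :: "'p \<Rightarrow> ('o, 'a, 'p, 'c) dbl \<Rightarrow> 'p \<Rightarrow> 'p"  ("(_ \<odot>\<^bsub>_\<^esub> _)" [75, 0, 76] 75)
  where "m \<odot>\<^bsub>D\<^esub> n \<equiv> pcmp D m n"

abbreviation ccmp_in :: "'c \<Rightarrow> ('o, 'a, 'p, 'c) dbl \<Rightarrow> 'c \<Rightarrow> 'c"  ("(_ \<circledcirc>\<^bsub>_\<^esub> _)" [75, 0, 76] 75)
  where "\<alpha> \<circledcirc>\<^bsub>D\<^esub> \<beta> \<equiv> ccmp D \<alpha> \<beta>"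

definition pro :: "('o, 'a, 'p, 'c) dbl \<Rightarrow> 'o \<Rightarrow> 'o \<Rightarrow> 'p set"
  where "pro D x y = {m \<in> Ob (D1 D). psrc D m = x \<and> ptgt D m = y}"

text \<open>Cells \<open>m \<rightarrow> n\<close> over \<open>(f, g)\<close>.\<close>

definition cells :: "('o, 'a, 'p, 'c) dbl \<Rightarrow> 'p \<Rightarrow> 'p \<Rightarrow> 'a \<Rightarrow> 'a \<Rightarrow> 'c set"
  where "cells D m n f g = {\<alpha> \<in> hom (D1 D) m n. csrc D \<alpha> = f \<and> ctgt D \<alpha> = g}"

definition globular :: "('o, 'a, 'p, 'c) dbl \<Rightarrow> 'p \<Rightarrow> 'p \<Rightarrow> 'c set"
  where "globular D m n = cells D m n (Ide (D0 D) (psrc D m)) (Ide (D0 D) (ptgt D m))"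

abbreviation linv :: "('o, 'a, 'p, 'c) dbl \<Rightarrow> 'p \<Rightarrow> 'c"
  where "linv D m \<equiv> inv_arrow (D1 D) (lunit D m)"

abbreviation rinv :: "('o, 'a, 'p, 'c) dbl \<Rightarrow> 'p \<Rightarrow> 'c"
  where "rinv D m \<equiv> inv_arrow (D1 D) (runit D m)"

locale double_category =
  fixes D :: "('o, 'a, 'p, 'c) dbl"
  assumes cat0: "category (D0 D)"
    and cat1: "category (D1 D)"
    and psrc_in: "m \<in> Ob (D1 D) \<Longrightarrow> psrc D m \<in> Ob (D0 D)"
    and ptgt_in: "m \<in> Ob (D1 D) \<Longrightarrow> ptgt D m \<in> Ob (D0 D)"
    and csrc_hom: "\<alpha> \<in> hom (D1 D) m n \<Longrightarrow> csrc D \<alpha> \<in> hom (D0 D) (psrc D m) (psrc D n)"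
    and ctgt_hom: "\<alpha> \<in> hom (D1 D) m n \<Longrightarrow> ctgt D \<alpha> \<in> hom (D0 D) (ptgt D m) (ptgt D n)"
    and csrc_ide: "m \<in> Ob (D1 D) \<Longrightarrow> csrc D (Ide (D1 D) m) = Ide (D0 D) (psrc D m)"
    and ctgt_ide: "m \<in> Ob (D1 D) \<Longrightarrow> ctgt D (Ide (D1 D) m) = Ide (D0 D) (ptgt D m)"
    and csrc_cmp: "\<alpha> \<in> hom (D1 D) m n \<Longrightarrow> \<beta> \<in> hom (D1 D) n p \<Longrightarrow>
      csrc D (\<alpha> \<cdot>\<^bsub>D1 D\<^esub> \<beta>) = csrc D \<alpha> \<cdot>\<^bsub>D0 D\<^esub> csrc D \<beta>"
    and ctgt_cmp: "\<alpha> \<in> hom (D1 D) m n \<Longrightarrow> \<beta> \<in> hom (D1 D) n p \<Longrightarrow>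
      ctgt D (\<alpha> \<cdot>\<^bsub>D1 D\<^esub> \<beta>) = ctgt D \<alpha> \<cdot>\<^bsub>D0 D\<^esub> ctgt D \<beta>"
    and pid_in: "x \<in> Ob (D0 D) \<Longrightarrow> pid D x \<in> pro D x x"
    and cid_in: "f \<in> hom (D0 D) x y \<Longrightarrow> cid D f \<in> cells D (pid D x) (pid D y) f f"
    and cid_ide: "x \<in> Ob (D0 D) \<Longrightarrow> cid D (Ide (D0 D) x) = Ide (D1 D) (pid D x)"
    and cid_cmp: "f \<in> hom (D0 D) x y \<Longrightarrow> g \<in> hom (D0 D) y z \<Longrightarrow>
      cid D (f \<cdot>\<^bsub>D0 D\<^esub> g) = cid D f \<cdot>\<^bsub>D1 D\<^esub> cid D g"
    and pcmp_in: "m \<in> pro D x y \<Longrightarrow> n \<in> pro D y z \<Longrightarrow> m \<odot>\<^bsub>D\<^esub> n \<in> pro D x z"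
    and ccmp_in: "m \<in> pro D x y \<Longrightarrow> n \<in> pro D y z \<Longrightarrow>
      \<alpha> \<in> cells D m m' f g \<Longrightarrow> \<beta> \<in> cells D n n' g h \<Longrightarrow>
      \<alpha> \<circledcirc>\<^bsub>D\<^esub> \<beta> \<in> cells D (m \<odot>\<^bsub>D\<^esub> n) (m' \<odot>\<^bsub>D\<^esub> n') f h"
    and ccmp_ide: "m \<in> pro D x y \<Longrightarrow> n \<in> pro D y z \<Longrightarrow>
      Ide (D1 D) m \<circledcirc>\<^bsub>D\<^esub> Ide (D1 D) n = Ide (D1 D) (m \<odot>\<^bsub>D\<^esub> n)"
    and interchange:
      "m \<in> pro D x y \<Longrightarrow> n \<in> pro D y z \<Longrightarrow>
      \<alpha> \<in> cells D m m' f g \<Longrightarrow> \<alpha>' \<in> cells D m' m'' f' g' \<Longrightarrow>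
      \<beta> \<in> cells D n n' g h \<Longrightarrow> \<beta>' \<in> cells D n' n'' g' h' \<Longrightarrow>
      (\<alpha> \<cdot>\<^bsub>D1 D\<^esub> \<alpha>') \<circledcirc>\<^bsub>D\<^esub> (\<beta> \<cdot>\<^bsub>D1 D\<^esub> \<beta>') = (\<alpha> \<circledcirc>\<^bsub>D\<^esub> \<beta>) \<cdot>\<^bsub>D1 D\<^esub> (\<alpha>' \<circledcirc>\<^bsub>D\<^esub> \<beta>')"
    and assoc_in: "m \<in> pro D w x \<Longrightarrow> n \<in> pro D x y \<Longrightarrow> p \<in> pro D y z \<Longrightarrow>
      assoc D m n p \<in> globular D ((m \<odot>\<^bsub>D\<^esub> n) \<odot>\<^bsub>D\<^esub> p) (m \<odot>\<^bsub>D\<^esub> (n \<odot>\<^bsub>D\<^esub> p)) \<and>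
      iso_arrow (D1 D) (assoc D m n p)"
    and lunit_in: "m \<in> pro D x y \<Longrightarrow>
      lunit D m \<in> globular D (pid D x \<odot>\<^bsub>D\<^esub> m) m \<and> iso_arrow (D1 D) (lunit D m)"
    and runit_in: "m \<in> pro D x y \<Longrightarrow>
      runit D m \<in> globular D (m \<odot>\<^bsub>D\<^esub> pid D y) m \<and> iso_arrow (D1 D) (runit D m)"
    and assoc_natural:
      "m \<in> pro D w x \<Longrightarrow> n \<in> pro D x y \<Longrightarrow> p \<in> pro D y z \<Longrightarrow>
      \<alpha> \<in> cells D m m' f g \<Longrightarrow> \<beta> \<in> cells D n n' g h \<Longrightarrow> \<gamma> \<in> cells D p p' h k \<Longrightarrow>
      ((\<alpha> \<circledcirc>\<^bsub>D\<^esub> \<beta>) \<circledcirc>\<^bsub>D\<^esub> \<gamma>) \<cdot>\<^bsub>D1 D\<^esub> assoc D m' n' p' =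
      assoc D m n p \<cdot>\<^bsub>D1 D\<^esub> (\<alpha> \<circledcirc>\<^bsub>D\<^esub> (\<beta> \<circledcirc>\<^bsub>D\<^esub> \<gamma>))"
    and lunit_natural: "m \<in> pro D x y \<Longrightarrow> \<alpha> \<in> cells D m n f g \<Longrightarrow>
      (cid D f \<circledcirc>\<^bsub>D\<^esub> \<alpha>) \<cdot>\<^bsub>D1 D\<^esub> lunit D n = lunit D m \<cdot>\<^bsub>D1 D\<^esub> \<alpha>"
    and runit_natural: "m \<in> pro D x y \<Longrightarrow> \<alpha> \<in> cells D m n f g \<Longrightarrow>
      (\<alpha> \<circledcirc>\<^bsub>D\<^esub> cid D g) \<cdot>\<^bsub>D1 D\<^esub> runit D n = runit D m \<cdot>\<^bsub>D1 D\<^esub> \<alpha>"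
    and pentagon:
      "m \<in> pro D v w \<Longrightarrow> n \<in> pro D w x \<Longrightarrow> p \<in> pro D x y \<Longrightarrow> q \<in> pro D y z \<Longrightarrow>
      (assoc D m n p \<circledcirc>\<^bsub>D\<^esub> Ide (D1 D) q) \<cdot>\<^bsub>D1 D\<^esub> assoc D m (n \<odot>\<^bsub>D\<^esub> p) q \<cdot>\<^bsub>D1 D\<^esub>
        (Ide (D1 D) m \<circledcirc>\<^bsub>D\<^esub> assoc D n p q) =
      assoc D (m \<odot>\<^bsub>D\<^esub> n) p q \<cdot>\<^bsub>D1 D\<^esub> assoc D m n (p \<odot>\<^bsub>D\<^esub> q)"
    and triangle: "m \<in> pro D x y \<Longrightarrow> n \<in> pro D y z \<Longrightarrow>
      runit D m \<circledcirc>\<^bsub>D\<^esub> Ide (D1 D) n =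
      assoc D m (pid D y) n \<cdot>\<^bsub>D1 D\<^esub> (Ide (D1 D) m \<circledcirc>\<^bsub>D\<^esub> lunit D n)"

text \<open>
  A right adjoint to the diagonal \<open>D \<rightarrow> D \<times> D\<close> among pseudo double functors amounts to products in
  \<open>D0\<close> and \<open>D1\<close>, chosen so that source and target preserve the choice on the nose, such that the
  canonical comparisons \<open>(m \<times> m') \<odot> (n \<times> n') \<rightarrow> (m \<odot> n) \<times> (m' \<odot> n')\<close> and
  \<open>id \<rightarrow> id \<times> id\<close> are isomorphisms, i.e. such that the cones below are product cones.
  Likewise for \<open>D \<rightarrow> 1\<close>.
\<close>

definition cartesian_double_structure ::
  "('o, 'a, 'p, 'c) dbl \<Rightarrow> ('o, 'a) prods \<Rightarrow> ('p, 'c) prods \<Rightarrow> bool"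
  where "cartesian_double_structure D P Q \<longleftrightarrow>
    chosen_products (D0 D) P \<and> chosen_products (D1 D) Q \<and>
    (\<forall>m \<in> Ob (D1 D). \<forall>n \<in> Ob (D1 D).
      psrc D (Prod Q m n) = Prod P (psrc D m) (psrc D n) \<and>
      ptgt D (Prod Q m n) = Prod P (ptgt D m) (ptgt D n) \<and>
      csrc D (Proj1 Q m n) = Proj1 P (psrc D m) (psrc D n) \<and>
      ctgt D (Proj1 Q m n) = Proj1 P (ptgt D m) (ptgt D n) \<and>
      csrc D (Proj2 Q m n) = Proj2 P (psrc D m) (psrc D n) \<and>
      ctgt D (Proj2 Q m n) = Proj2 P (ptgt D m) (ptgt D n)) \<and>
    psrc D (One Q) = One P \<and> ptgt D (One Q) = One P \<and>
    (\<forall>x y z x' y' z'. \<forall>m \<in> pro D x y. \<forall>n \<in> pro D y z. \<forall>m' \<in> pro D x' y'. \<forall>n' \<in> pro D y' z'.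
      is_product (D1 D) (m \<odot>\<^bsub>D\<^esub> n) (m' \<odot>\<^bsub>D\<^esub> n') (Prod Q m m' \<odot>\<^bsub>D\<^esub> Prod Q n n')
        (Proj1 Q m m' \<circledcirc>\<^bsub>D\<^esub> Proj1 Q n n') (Proj2 Q m m' \<circledcirc>\<^bsub>D\<^esub> Proj2 Q n n')) \<and>
    (\<forall>x \<in> Ob (D0 D). \<forall>y \<in> Ob (D0 D).
      is_product (D1 D) (pid D x) (pid D y) (pid D (Prod P x y))
        (cid D (Proj1 P x y)) (cid D (Proj2 P x y))) \<and>
    is_terminal (D1 D) (One Q \<odot>\<^bsub>D\<^esub> One Q) \<and>
    is_terminal (D1 D) (pid D (One P))"

definition cartesian_double_category :: "('o, 'a, 'p, 'c) dbl \<Rightarrow> bool"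
  where "cartesian_double_category D \<longleftrightarrow>
    double_category D \<and> (\<exists>P Q. cartesian_double_structure D P Q)"

definition cartesian_cell :: "('o, 'a, 'p, 'c) dbl \<Rightarrow> 'c \<Rightarrow> bool"
  where "cartesian_cell D \<alpha> \<longleftrightarrow>
    \<alpha> \<in> Ar (D1 D) \<and>
    (\<forall>p \<in> Ob (D1 D). \<forall>h \<in> hom (D0 D) (psrc D p) (Dom (D0 D) (csrc D \<alpha>)).
      \<forall>k \<in> hom (D0 D) (ptgt D p) (Dom (D0 D) (ctgt D \<alpha>)).
      \<forall>\<beta> \<in> cells D p (Cod (D1 D) \<alpha>) (h \<cdot>\<^bsub>D0 D\<^esub> csrc D \<alpha>) (k \<cdot>\<^bsub>D0 D\<^esub> ctgt D \<alpha>).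
      \<exists>!\<gamma>. \<gamma> \<in> cells D p (Dom (D1 D) \<alpha>) h k \<and> \<gamma> \<cdot>\<^bsub>D1 D\<^esub> \<alpha> = \<beta>)"

text \<open>The functor \<open>\<langle>s, t\<rangle> : D1 \<rightarrow> D0 \<times> D0\<close> is a (Grothendieck) fibration.\<close>

definition equipment :: "('o, 'a, 'p, 'c) dbl \<Rightarrow> bool"
  where "equipment D \<longleftrightarrow>
    double_category D \<and>
    (\<forall>w x y z. \<forall>n \<in> pro D w z. \<forall>f \<in> hom (D0 D) x w. \<forall>g \<in> hom (D0 D) y z.
      \<exists>m \<in> pro D x y. \<exists>\<alpha> \<in> cells D m n f g. cartesian_cell D \<alpha>)"

definition cartesian_equipment :: "('o, 'a, 'p, 'c) dbl \<Rightarrow> bool"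
  where "cartesian_equipment D \<longleftrightarrow> cartesian_double_category D \<and> equipment D"

text \<open>\<open>q : n \<rightarrow> c\<close> is a coequalizer of \<open>\<alpha>, \<beta> : m \<rightarrow> n\<close> in the category of proarrows \<open>x \<rightarrow> y\<close>
  and globular cells.\<close>

definition is_local_coequalizer ::
  "('o, 'a, 'p, 'c) dbl \<Rightarrow> 'o \<Rightarrow> 'o \<Rightarrow> 'p \<Rightarrow> 'p \<Rightarrow> 'c \<Rightarrow> 'c \<Rightarrow> 'p \<Rightarrow> 'c \<Rightarrow> bool"
  where "is_local_coequalizer D x y m n \<alpha> \<beta> c q \<longleftrightarrow>
    m \<in> pro D x y \<and> n \<in> pro D x y \<and> c \<in> pro D x y \<and>
    \<alpha> \<in> globular D m n \<and> \<beta> \<in> globular D m n \<and> q \<in> globular D n c \<and>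
    \<alpha> \<cdot>\<^bsub>D1 D\<^esub> q = \<beta> \<cdot>\<^bsub>D1 D\<^esub> q \<and>
    (\<forall>d \<in> pro D x y. \<forall>r \<in> globular D n d. \<alpha> \<cdot>\<^bsub>D1 D\<^esub> r = \<beta> \<cdot>\<^bsub>D1 D\<^esub> r \<longrightarrow>
      (\<exists>!u. u \<in> globular D c d \<and> q \<cdot>\<^bsub>D1 D\<^esub> u = r))"

definition local_coequalizers :: "('o, 'a, 'p, 'c) dbl \<Rightarrow> bool"
  where "local_coequalizers D \<longleftrightarrow>
    (\<forall>x y. \<forall>m \<in> pro D x y. \<forall>n \<in> pro D x y. \<forall>\<alpha> \<in> globular D m n. \<forall>\<beta> \<in> globular D m n.
      \<exists>c q. is_local_coequalizer D x y m n \<alpha> \<beta> c q) \<and>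
    (\<forall>x y m n \<alpha> \<beta> c q. is_local_coequalizer D x y m n \<alpha> \<beta> c q \<longrightarrow>
      (\<forall>w. \<forall>p \<in> pro D w x.
        is_local_coequalizer D w y (p \<odot>\<^bsub>D\<^esub> m) (p \<odot>\<^bsub>D\<^esub> n)
          (Ide (D1 D) p \<circledcirc>\<^bsub>D\<^esub> \<alpha>) (Ide (D1 D) p \<circledcirc>\<^bsub>D\<^esub> \<beta>) (p \<odot>\<^bsub>D\<^esub> c) (Ide (D1 D) p \<circledcirc>\<^bsub>D\<^esub> q)) \<and>
      (\<forall>z. \<forall>p \<in> pro D y z.
        is_local_coequalizer D x z (m \<odot>\<^bsub>D\<^esub> p) (n \<odot>\<^bsub>D\<^esub> p)
          (\<alpha> \<circledcirc>\<^bsub>D\<^esub> Ide (D1 D) p) (\<beta> \<circledcirc>\<^bsub>D\<^esub> Ide (D1 D) p) (c \<odot>\<^bsub>D\<^esub> p) (q \<circledcirc>\<^bsub>D\<^esub> Ide (D1 D) p)))"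

text \<open>The proarrows of \<open>VerDbl A\<close> are identities and are represented by the objects of \<open>A\<close>.
  Cells compose horizontally in \<open>A\<close> in the direction of arrows, and vertically in \<open>A\<close> externally.\<close>

definition VerDbl :: "('o, 'a, 't) two_cat \<Rightarrow> ('o, 'a, 'o, 't) dbl"
  where "VerDbl A =
    \<lparr>D0 = C1 A,
     D1 = \<lparr>Ob = Ob (C1 A), Ar = Ar (C2 A),
       Dom = (\<lambda>s. Dom (C1 A) (Dom (C2 A) s)),
       Cod = (\<lambda>s. Cod (C1 A) (Dom (C2 A) s)),
       Ide = (\<lambda>x. Ide (C2 A) (Ide (C1 A) x)),
       Cmp = HCmp A\<rparr>,
     psrc = (\<lambda>x. x), ptgt = (\<lambda>x. x),
     csrc = Dom (C2 A), ctgt = Cod (C2 A),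
     pid = (\<lambda>x. x), cid = Ide (C2 A),
     pcmp = (\<lambda>x y. x), ccmp = Cmp (C2 A),
     assoc = (\<lambda>x y z. Ide (C2 A) (Ide (C1 A) x)),
     lunit = (\<lambda>x. Ide (C2 A) (Ide (C1 A) x)),
     runit = (\<lambda>x. Ide (C2 A) (Ide (C1 A) x))\<rparr>"


section \<open>Lax double functors, lax transformations and modulations\<close>

record ('o, 'a, 'p, 'c, 'o2, 'a2, 'p2, 'c2) lax_fctr =
  F0 :: "('o, 'a, 'o2, 'a2) fctr"
  F1 :: "('p, 'c, 'p2, 'c2) fctr"
  laxator :: "'p \<Rightarrow> 'p \<Rightarrow> 'c2"
  unitor :: "'o \<Rightarrow> 'c2"

locale lax_double_functor =
  fixes D :: "('o, 'a, 'p, 'c) dbl" and E :: "('o2, 'a2, 'p2, 'c2) dbl"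
    and F :: "('o, 'a, 'p, 'c, 'o2, 'a2, 'p2, 'c2) lax_fctr"
  assumes functor0: "cat_functor (D0 D) (D0 E) (F0 F)"
    and functor1: "cat_functor (D1 D) (D1 E) (F1 F)"
    and psrc_compat: "m \<in> Ob (D1 D) \<Longrightarrow> psrc E (onOb (F1 F) m) = onOb (F0 F) (psrc D m)"
    and ptgt_compat: "m \<in> Ob (D1 D) \<Longrightarrow> ptgt E (onOb (F1 F) m) = onOb (F0 F) (ptgt D m)"
    and csrc_compat: "\<alpha> \<in> Ar (D1 D) \<Longrightarrow> csrc E (onAr (F1 F) \<alpha>) = onAr (F0 F) (csrc D \<alpha>)"
    and ctgt_compat: "\<alpha> \<in> Ar (D1 D) \<Longrightarrow> ctgt E (onAr (F1 F) \<alpha>) = onAr (F0 F) (ctgt D \<alpha>)"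
    and laxator_ext: "\<not> (m \<in> Ob (D1 D) \<and> n \<in> Ob (D1 D) \<and> ptgt D m = psrc D n) \<Longrightarrow>
      laxator F m n = undefined"
    and unitor_ext: "unitor F \<in> extensional (Ob (D0 D))"
    and laxator_in: "m \<in> pro D x y \<Longrightarrow> n \<in> pro D y z \<Longrightarrow>
      laxator F m n \<in> globular E (onOb (F1 F) m \<odot>\<^bsub>E\<^esub> onOb (F1 F) n) (onOb (F1 F) (m \<odot>\<^bsub>D\<^esub> n))"
    and unitor_in: "x \<in> Ob (D0 D) \<Longrightarrow>
      unitor F x \<in> globular E (pid E (onOb (F0 F) x)) (onOb (F1 F) (pid D x))"
    and laxator_natural:
      "m \<in> pro D x y \<Longrightarrow> n \<in> pro D y z \<Longrightarrow>
      \<alpha> \<in> cells D m m' f g \<Longrightarrow> \<beta> \<in> cells D n n' g h \<Longrightarrow>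
      (onAr (F1 F) \<alpha> \<circledcirc>\<^bsub>E\<^esub> onAr (F1 F) \<beta>) \<cdot>\<^bsub>D1 E\<^esub> laxator F m' n' =
      laxator F m n \<cdot>\<^bsub>D1 E\<^esub> onAr (F1 F) (\<alpha> \<circledcirc>\<^bsub>D\<^esub> \<beta>)"
    and unitor_natural: "f \<in> hom (D0 D) x y \<Longrightarrow>
      cid E (onAr (F0 F) f) \<cdot>\<^bsub>D1 E\<^esub> unitor F y = unitor F x \<cdot>\<^bsub>D1 E\<^esub> onAr (F1 F) (cid D f)"
    and lax_assoc:
      "m \<in> pro D w x \<Longrightarrow> n \<in> pro D x y \<Longrightarrow> p \<in> pro D y z \<Longrightarrow>
      (laxator F m n \<circledcirc>\<^bsub>E\<^esub> Ide (D1 E) (onOb (F1 F) p)) \<cdot>\<^bsub>D1 E\<^esub>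
        laxator F (m \<odot>\<^bsub>D\<^esub> n) p \<cdot>\<^bsub>D1 E\<^esub> onAr (F1 F) (assoc D m n p) =
      assoc E (onOb (F1 F) m) (onOb (F1 F) n) (onOb (F1 F) p) \<cdot>\<^bsub>D1 E\<^esub>
        (Ide (D1 E) (onOb (F1 F) m) \<circledcirc>\<^bsub>E\<^esub> laxator F n p) \<cdot>\<^bsub>D1 E\<^esub> laxator F m (n \<odot>\<^bsub>D\<^esub> p)"
    and lax_unit_left: "m \<in> pro D x y \<Longrightarrow>
      (unitor F x \<circledcirc>\<^bsub>E\<^esub> Ide (D1 E) (onOb (F1 F) m)) \<cdot>\<^bsub>D1 E\<^esub>
        laxator F (pid D x) m \<cdot>\<^bsub>D1 E\<^esub> onAr (F1 F) (lunit D m) =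
      lunit E (onOb (F1 F) m)"
    and lax_unit_right: "m \<in> pro D x y \<Longrightarrow>
      (Ide (D1 E) (onOb (F1 F) m) \<circledcirc>\<^bsub>E\<^esub> unitor F y) \<cdot>\<^bsub>D1 E\<^esub>
        laxator F m (pid D y) \<cdot>\<^bsub>D1 E\<^esub> onAr (F1 F) (runit D m) =
      runit E (onOb (F1 F) m)"

definition cartesian_lax_functor ::
  "('o, 'a, 'p, 'c) dbl \<Rightarrow> ('o2, 'a2, 'p2, 'c2) dbl \<Rightarrow>
    ('o, 'a, 'p, 'c, 'o2, 'a2, 'p2, 'c2) lax_fctr \<Rightarrow> bool"
  where "cartesian_lax_functor D E F \<longleftrightarrow>
    lax_double_functor D E F \<and>
    preserves_products (D0 D) (D0 E) (F0 F) \<and> preserves_products (D1 D) (D1 E) (F1 F)"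

text \<open>\<open>F\<^bsub>x,m\<^esub> : F id\<^sub>x \<odot> F m \<rightarrow> F m\<close> and \<open>F\<^bsub>m,y\<^esub> : F m \<odot> F id\<^sub>y \<rightarrow> F m\<close>\<close>

definition laxL ::
  "('o, 'a, 'p, 'c) dbl \<Rightarrow> ('o2, 'a2, 'p2, 'c2) dbl \<Rightarrow>
    ('o, 'a, 'p, 'c, 'o2, 'a2, 'p2, 'c2) lax_fctr \<Rightarrow> 'p \<Rightarrow> 'c2"
  where "laxL D E F m =
    laxator F (pid D (psrc D m)) m \<cdot>\<^bsub>D1 E\<^esub> onAr (F1 F) (lunit D m)"

definition laxR ::
  "('o, 'a, 'p, 'c) dbl \<Rightarrow> ('o2, 'a2, 'p2, 'c2) dbl \<Rightarrow>
    ('o, 'a, 'p, 'c, 'o2, 'a2, 'p2, 'c2) lax_fctr \<Rightarrow> 'p \<Rightarrow> 'c2"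
  where "laxR D E F m =
    laxator F m (pid D (ptgt D m)) \<cdot>\<^bsub>D1 E\<^esub> onAr (F1 F) (runit D m)"

record ('o, 'a, 'p, 'c, 'o2, 'a2, 'p2, 'c2) lax_transf =
  tsrc :: "('o, 'a, 'p, 'c, 'o2, 'a2, 'p2, 'c2) lax_fctr"
  ttgt :: "('o, 'a, 'p, 'c, 'o2, 'a2, 'p2, 'c2) lax_fctr"
  tob :: "'o \<Rightarrow> 'a2"
  tpro :: "'p \<Rightarrow> 'c2"
  tar :: "'a \<Rightarrow> 'c2"

locale lax_transformation =
  fixes D :: "('o, 'a, 'p, 'c) dbl" and E :: "('o2, 'a2, 'p2, 'c2) dbl"
    and \<alpha> :: "('o, 'a, 'p, 'c, 'o2, 'a2, 'p2, 'c2) lax_transf"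
    and F G
  defines "F \<equiv> tsrc \<alpha>" and "G \<equiv> ttgt \<alpha>"
  assumes ob_ext: "tob \<alpha> \<in> extensional (Ob (D0 D))"
    and pro_ext: "tpro \<alpha> \<in> extensional (Ob (D1 D))"
    and ar_ext: "tar \<alpha> \<in> extensional (Ar (D0 D))"
    and ob_in: "x \<in> Ob (D0 D) \<Longrightarrow> tob \<alpha> x \<in> hom (D0 E) (onOb (F0 F) x) (onOb (F0 G) x)"
    and pro_in: "m \<in> pro D x y \<Longrightarrow>
      tpro \<alpha> m \<in> cells E (onOb (F1 F) m) (onOb (F1 G) m) (tob \<alpha> x) (tob \<alpha> y)"
    and ar_in: "f \<in> hom (D0 D) x y \<Longrightarrow>
      tar \<alpha> f \<in> cells E (pid E (onOb (F0 F) x)) (onOb (F1 G) (pid D y))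
        (tob \<alpha> x \<cdot>\<^bsub>D0 E\<^esub> onAr (F0 G) f) (onAr (F0 F) f \<cdot>\<^bsub>D0 E\<^esub> tob \<alpha> y)"
    and natural: "m \<in> pro D x y \<Longrightarrow> n \<in> pro D w z \<Longrightarrow> \<gamma> \<in> cells D m n f g \<Longrightarrow>
      linv E (onOb (F1 F) m) \<cdot>\<^bsub>D1 E\<^esub>
        (tar \<alpha> f \<circledcirc>\<^bsub>E\<^esub> (onAr (F1 F) \<gamma> \<cdot>\<^bsub>D1 E\<^esub> tpro \<alpha> n)) \<cdot>\<^bsub>D1 E\<^esub> laxL D E G n =
      rinv E (onOb (F1 F) m) \<cdot>\<^bsub>D1 E\<^esub>
        ((tpro \<alpha> m \<cdot>\<^bsub>D1 E\<^esub> onAr (F1 G) \<gamma>) \<circledcirc>\<^bsub>E\<^esub> tar \<alpha> g) \<cdot>\<^bsub>D1 E\<^esub> laxR D E G n"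
    and pro_cmp: "m \<in> pro D x y \<Longrightarrow> n \<in> pro D y z \<Longrightarrow>
      laxator F m n \<cdot>\<^bsub>D1 E\<^esub> tpro \<alpha> (m \<odot>\<^bsub>D\<^esub> n) =
      (tpro \<alpha> m \<circledcirc>\<^bsub>E\<^esub> tpro \<alpha> n) \<cdot>\<^bsub>D1 E\<^esub> laxator G m n"
    and pro_unit: "x \<in> Ob (D0 D) \<Longrightarrow>
      unitor F x \<cdot>\<^bsub>D1 E\<^esub> tpro \<alpha> (pid D x) = cid E (tob \<alpha> x) \<cdot>\<^bsub>D1 E\<^esub> unitor G x"
    and ar_cmp: "f \<in> hom (D0 D) x y \<Longrightarrow> g \<in> hom (D0 D) y z \<Longrightarrow>
      tar \<alpha> (f \<cdot>\<^bsub>D0 D\<^esub> g) =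
      linv E (pid E (onOb (F0 F) x)) \<cdot>\<^bsub>D1 E\<^esub>
        ((tar \<alpha> f \<cdot>\<^bsub>D1 E\<^esub> onAr (F1 G) (cid D g)) \<circledcirc>\<^bsub>E\<^esub>
         (cid E (onAr (F0 F) f) \<cdot>\<^bsub>D1 E\<^esub> tar \<alpha> g)) \<cdot>\<^bsub>D1 E\<^esub> laxL D E G (pid D z)"
    and ar_ide: "x \<in> Ob (D0 D) \<Longrightarrow>
      tar \<alpha> (Ide (D0 D) x) = cid E (tob \<alpha> x) \<cdot>\<^bsub>D1 E\<^esub> unitor G x"

definition strict_at ::
  "('o2, 'a2, 'p2, 'c2) dbl \<Rightarrow> ('o, 'a, 'p, 'c, 'o2, 'a2, 'p2, 'c2) lax_transf \<Rightarrow>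
    'o \<Rightarrow> 'o \<Rightarrow> 'a \<Rightarrow> bool"
  where "strict_at E \<alpha> x y f \<longleftrightarrow>
    tob \<alpha> x \<cdot>\<^bsub>D0 E\<^esub> onAr (F0 (ttgt \<alpha>)) f = onAr (F0 (tsrc \<alpha>)) f \<cdot>\<^bsub>D0 E\<^esub> tob \<alpha> y \<and>
    tar \<alpha> f = cid E (onAr (F0 (tsrc \<alpha>)) f \<cdot>\<^bsub>D0 E\<^esub> tob \<alpha> y) \<cdot>\<^bsub>D1 E\<^esub> unitor (ttgt \<alpha>) y"

text \<open>\<open>P\<close> is the choice of products in \<open>D0 D\<close>.\<close>

definition cartesian_transformation ::
  "('o, 'a, 'p, 'c) dbl \<Rightarrow> ('o, 'a) prods \<Rightarrow> ('o2, 'a2, 'p2, 'c2) dbl \<Rightarrow>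
    ('o, 'a, 'p, 'c, 'o2, 'a2, 'p2, 'c2) lax_transf \<Rightarrow> bool"
  where "cartesian_transformation D P E \<alpha> \<longleftrightarrow>
    (\<forall>x\<^sub>1 \<in> Ob (D0 D). \<forall>x\<^sub>2 \<in> Ob (D0 D).
      strict_at E \<alpha> (Prod P x\<^sub>1 x\<^sub>2) x\<^sub>1 (Proj1 P x\<^sub>1 x\<^sub>2) \<and>
      strict_at E \<alpha> (Prod P x\<^sub>1 x\<^sub>2) x\<^sub>2 (Proj2 P x\<^sub>1 x\<^sub>2))"

record ('o, 'a, 'p, 'c, 'o2, 'a2, 'p2, 'c2) modul =
  usrc :: "('o, 'a, 'p, 'c, 'o2, 'a2, 'p2, 'c2) lax_transf"
  utgt :: "('o, 'a, 'p, 'c, 'o2, 'a2, 'p2, 'c2) lax_transf"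
  uob :: "'o \<Rightarrow> 'c2"

text \<open>The cell \<open>\<mu>\<^sub>m\<close> of a modulation at a proarrow \<open>m\<close>.\<close>

definition modul_at ::
  "('o, 'a, 'p, 'c) dbl \<Rightarrow> ('o2, 'a2, 'p2, 'c2) dbl \<Rightarrow>
    ('o, 'a, 'p, 'c, 'o2, 'a2, 'p2, 'c2) modul \<Rightarrow> 'p \<Rightarrow> 'c2"
  where "modul_at D E \<mu> m =
    linv E (onOb (F1 (tsrc (usrc \<mu>))) m) \<cdot>\<^bsub>D1 E\<^esub>
      (uob \<mu> (psrc D m) \<circledcirc>\<^bsub>E\<^esub> tpro (utgt \<mu>) m) \<cdot>\<^bsub>D1 E\<^esub> laxL D E (ttgt (usrc \<mu>)) m"

locale modulation =
  fixes D :: "('o, 'a, 'p, 'c) dbl" and E :: "('o2, 'a2, 'p2, 'c2) dbl"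
    and \<mu> :: "('o, 'a, 'p, 'c, 'o2, 'a2, 'p2, 'c2) modul"
    and F G \<alpha> \<beta>
  defines "\<alpha> \<equiv> usrc \<mu>" and "\<beta> \<equiv> utgt \<mu>" and "F \<equiv> tsrc (usrc \<mu>)" and "G \<equiv> ttgt (usrc \<mu>)"
  assumes same_src: "tsrc \<beta> = F"
    and same_tgt: "ttgt \<beta> = G"
    and ob_ext: "uob \<mu> \<in> extensional (Ob (D0 D))"
    and ob_in: "x \<in> Ob (D0 D) \<Longrightarrow>
      uob \<mu> x \<in> cells E (pid E (onOb (F0 F) x)) (onOb (F1 G) (pid D x)) (tob \<alpha> x) (tob \<beta> x)"
    and equivariant: "m \<in> pro D x y \<Longrightarrow>
      modul_at D E \<mu> m =
      rinv E (onOb (F1 F) m) \<cdot>\<^bsub>D1 E\<^esub> (tpro \<alpha> m \<circledcirc>\<^bsub>E\<^esub> uob \<mu> y) \<cdot>\<^bsub>D1 E\<^esub> laxR D E G m"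
    and natural: "m \<in> pro D x y \<Longrightarrow> n \<in> pro D w z \<Longrightarrow> \<gamma> \<in> cells D m n f g \<Longrightarrow>
      linv E (onOb (F1 F) m) \<cdot>\<^bsub>D1 E\<^esub>
        (tar \<alpha> f \<circledcirc>\<^bsub>E\<^esub> (onAr (F1 F) \<gamma> \<cdot>\<^bsub>D1 E\<^esub> modul_at D E \<mu> n)) \<cdot>\<^bsub>D1 E\<^esub> laxL D E G n =
      rinv E (onOb (F1 F) m) \<cdot>\<^bsub>D1 E\<^esub>
        ((modul_at D E \<mu> m \<cdot>\<^bsub>D1 E\<^esub> onAr (F1 G) \<gamma>) \<circledcirc>\<^bsub>E\<^esub> tar \<beta> g) \<cdot>\<^bsub>D1 E\<^esub> laxR D E G n"

definition lax_transf_ide ::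
  "('o, 'a, 'p, 'c) dbl \<Rightarrow> ('o2, 'a2, 'p2, 'c2) dbl \<Rightarrow>
    ('o, 'a, 'p, 'c, 'o2, 'a2, 'p2, 'c2) lax_fctr \<Rightarrow>
    ('o, 'a, 'p, 'c, 'o2, 'a2, 'p2, 'c2) lax_transf"
  where "lax_transf_ide D E F =
    \<lparr>tsrc = F, ttgt = F,
     tob = (\<lambda>x \<in> Ob (D0 D). Ide (D0 E) (onOb (F0 F) x)),
     tpro = (\<lambda>m \<in> Ob (D1 D). Ide (D1 E) (onOb (F1 F) m)),
     tar = (\<lambda>f \<in> Ar (D0 D). cid E (onAr (F0 F) f) \<cdot>\<^bsub>D1 E\<^esub> unitor F (Cod (D0 D) f))\<rparr>"

definition lax_transf_cmp ::
  "('o, 'a, 'p, 'c) dbl \<Rightarrow> ('o2, 'a2, 'p2, 'c2) dbl \<Rightarrow>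
    ('o, 'a, 'p, 'c, 'o2, 'a2, 'p2, 'c2) lax_transf \<Rightarrow>
    ('o, 'a, 'p, 'c, 'o2, 'a2, 'p2, 'c2) lax_transf \<Rightarrow>
    ('o, 'a, 'p, 'c, 'o2, 'a2, 'p2, 'c2) lax_transf"
  where "lax_transf_cmp D E \<alpha> \<beta> =
    \<lparr>tsrc = tsrc \<alpha>, ttgt = ttgt \<beta>,
     tob = (\<lambda>x \<in> Ob (D0 D). tob \<alpha> x \<cdot>\<^bsub>D0 E\<^esub> tob \<beta> x),
     tpro = (\<lambda>m \<in> Ob (D1 D). tpro \<alpha> m \<cdot>\<^bsub>D1 E\<^esub> tpro \<beta> m),
     tar = (\<lambda>f \<in> Ar (D0 D).
       let x = Dom (D0 D) f; y = Cod (D0 D) f in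
       linv E (pid E (onOb (F0 (tsrc \<alpha>)) x)) \<cdot>\<^bsub>D1 E\<^esub>
         ((cid E (tob \<alpha> x) \<cdot>\<^bsub>D1 E\<^esub> tar \<beta> f) \<circledcirc>\<^bsub>E\<^esub>
          (tar \<alpha> f \<cdot>\<^bsub>D1 E\<^esub> tpro \<beta> (pid D y))) \<cdot>\<^bsub>D1 E\<^esub> laxL D E (ttgt \<beta>) (pid D y))\<rparr>"

definition CartLax ::
  "('o, 'a, 'p, 'c) dbl \<Rightarrow> ('o, 'a) prods \<Rightarrow> ('o2, 'a2, 'p2, 'c2) dbl \<Rightarrow>
    (('o, 'a, 'p, 'c, 'o2, 'a2, 'p2, 'c2) lax_fctr,
     ('o, 'a, 'p, 'c, 'o2, 'a2, 'p2, 'c2) lax_transf,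
     ('o, 'a, 'p, 'c, 'o2, 'a2, 'p2, 'c2) modul) two_cat"
  where "CartLax D P E =
    (let functors = {F. cartesian_lax_functor D E F};
         transfs = {\<alpha>. tsrc \<alpha> \<in> functors \<and> ttgt \<alpha> \<in> functors \<and>
           lax_transformation D E \<alpha> \<and> cartesian_transformation D P E \<alpha>};
         moduls = {\<mu>. usrc \<mu> \<in> transfs \<and> utgt \<mu> \<in> transfs \<and> modulation D E \<mu>}
     in \<lparr>C1 = \<lparr>Ob = functors, Ar = transfs, Dom = tsrc, Cod = ttgt,
          Ide = lax_transf_ide D E, Cmp = lax_transf_cmp D E\<rparr>,
         C2 = \<lparr>Ob = transfs, Ar = moduls, Dom = usrc, Cod = utgt,
          Ide = (\<lambda>\<alpha>. \<lparr>usrc = \<alpha>, utgt = \<alpha>,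
            uob = (\<lambda>x \<in> Ob (D0 D). cid E (tob \<alpha> x) \<cdot>\<^bsub>D1 E\<^esub> unitor (ttgt \<alpha>) x)\<rparr>),
          Cmp = (\<lambda>\<mu> \<nu>. \<lparr>usrc = usrc \<mu>, utgt = utgt \<nu>,
            uob = (\<lambda>x \<in> Ob (D0 D).
              linv E (pid E (onOb (F0 (tsrc (usrc \<mu>))) x)) \<cdot>\<^bsub>D1 E\<^esub>
                (uob \<mu> x \<circledcirc>\<^bsub>E\<^esub> uob \<nu> x) \<cdot>\<^bsub>D1 E\<^esub> laxL D E (ttgt (usrc \<mu>)) (pid D x))\<rparr>)\<rparr>,
         HCmp = (\<lambda>\<mu> \<nu>. \<lparr>usrc = lax_transf_cmp D E (usrc \<mu>) (usrc \<nu>),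
            utgt = lax_transf_cmp D E (utgt \<mu>) (utgt \<nu>),
            uob = (\<lambda>x \<in> Ob (D0 D). uob \<mu> x \<cdot>\<^bsub>D1 E\<^esub> modul_at D E \<nu> (pid D x))\<rparr>)\<rparr>)"


section \<open>Category objects in a double category\<close>

record ('o, 'p, 'c) cat_ob =
  base :: "'o"
  loop :: "'p"
  mult :: "'c"
  unit :: "'c"

locale category_object =
  fixes E :: "('o, 'a, 'p, 'c) dbl" and X :: "('o, 'p, 'c) cat_ob"
  assumes base_in: "base X \<in> Ob (D0 E)"
    and loop_in: "loop X \<in> pro E (base X) (base X)"
    and mult_in: "mult X \<in> globular E (loop X \<odot>\<^bsub>E\<^esub> loop X) (loop X)"
    and unit_in: "unit X \<in> globular E (pid E (base X)) (loop X)"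
    and mult_assoc:
      "(mult X \<circledcirc>\<^bsub>E\<^esub> Ide (D1 E) (loop X)) \<cdot>\<^bsub>D1 E\<^esub> mult X =
       assoc E (loop X) (loop X) (loop X) \<cdot>\<^bsub>D1 E\<^esub>
         (Ide (D1 E) (loop X) \<circledcirc>\<^bsub>E\<^esub> mult X) \<cdot>\<^bsub>D1 E\<^esub> mult X"
    and unit_left: "(unit X \<circledcirc>\<^bsub>E\<^esub> Ide (D1 E) (loop X)) \<cdot>\<^bsub>D1 E\<^esub> mult X = lunit E (loop X)"
    and unit_right: "(Ide (D1 E) (loop X) \<circledcirc>\<^bsub>E\<^esub> unit X) \<cdot>\<^bsub>D1 E\<^esub> mult X = runit E (loop X)"

record ('o, 'a, 'p, 'c) cat_ob_fun =
  fsrc :: "('o, 'p, 'c) cat_ob"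
  ftgt :: "('o, 'p, 'c) cat_ob"
  farr :: "'a"
  fcell :: "'c"

definition category_object_functor ::
  "('o, 'a, 'p, 'c) dbl \<Rightarrow> ('o, 'a, 'p, 'c) cat_ob_fun \<Rightarrow> bool"
  where "category_object_functor E H \<longleftrightarrow>
    category_object E (fsrc H) \<and> category_object E (ftgt H) \<and>
    farr H \<in> hom (D0 E) (base (fsrc H)) (base (ftgt H)) \<and>
    fcell H \<in> cells E (loop (fsrc H)) (loop (ftgt H)) (farr H) (farr H) \<and>
    (fcell H \<circledcirc>\<^bsub>E\<^esub> fcell H) \<cdot>\<^bsub>D1 E\<^esub> mult (ftgt H) = mult (fsrc H) \<cdot>\<^bsub>D1 E\<^esub> fcell H \<and>
    cid E (farr H) \<cdot>\<^bsub>D1 E\<^esub> unit (ftgt H) = unit (fsrc H) \<cdot>\<^bsub>D1 E\<^esub> fcell H"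

record ('o, 'a, 'p, 'c) cat_ob_trans =
  xsrc :: "('o, 'a, 'p, 'c) cat_ob_fun"
  xtgt :: "('o, 'a, 'p, 'c) cat_ob_fun"
  xcell :: "'c"

text \<open>The cell \<open>r \<rightarrow> s\<close> over \<open>(f, g)\<close> induced by a 2-morphism \<open>\<alpha> : (f, \<phi>) \<Rightarrow> (g, \<psi>)\<close> between functors
  \<open>(x, r) \<rightarrow> (y, s)\<close>, namely the common value of \<open>(\<alpha> \<odot> \<psi>) \<cdot> \<nu>\<close> and \<open>(\<phi> \<odot> \<alpha>) \<cdot> \<nu>\<close>.\<close>

definition cat_ob_trans_loop ::
  "('o, 'a, 'p, 'c) dbl \<Rightarrow> ('o, 'a, 'p, 'c) cat_ob_trans \<Rightarrow> 'c"
  where "cat_ob_trans_loop E s =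
    linv E (loop (fsrc (xsrc s))) \<cdot>\<^bsub>D1 E\<^esub>
      (xcell s \<circledcirc>\<^bsub>E\<^esub> fcell (xtgt s)) \<cdot>\<^bsub>D1 E\<^esub> mult (ftgt (xsrc s))"

definition category_object_transformation ::
  "('o, 'a, 'p, 'c) dbl \<Rightarrow> ('o, 'a, 'p, 'c) cat_ob_trans \<Rightarrow> bool"
  where "category_object_transformation E s \<longleftrightarrow>
    category_object_functor E (xsrc s) \<and> category_object_functor E (xtgt s) \<and>
    fsrc (xsrc s) = fsrc (xtgt s) \<and> ftgt (xsrc s) = ftgt (xtgt s) \<and>
    xcell s \<in> cells E (pid E (base (fsrc (xsrc s)))) (loop (ftgt (xsrc s)))
      (farr (xsrc s)) (farr (xtgt s)) \<and>
    cat_ob_trans_loop E s =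
    rinv E (loop (fsrc (xsrc s))) \<cdot>\<^bsub>D1 E\<^esub>
      (fcell (xsrc s) \<circledcirc>\<^bsub>E\<^esub> xcell s) \<cdot>\<^bsub>D1 E\<^esub> mult (ftgt (xsrc s))"

definition cat_ob_fun_cmp ::
  "('o, 'a, 'p, 'c) dbl \<Rightarrow> ('o, 'a, 'p, 'c) cat_ob_fun \<Rightarrow> ('o, 'a, 'p, 'c) cat_ob_fun \<Rightarrow>
    ('o, 'a, 'p, 'c) cat_ob_fun"
  where "cat_ob_fun_cmp E H K =
    \<lparr>fsrc = fsrc H, ftgt = ftgt K,
     farr = farr H \<cdot>\<^bsub>D0 E\<^esub> farr K, fcell = fcell H \<cdot>\<^bsub>D1 E\<^esub> fcell K\<rparr>"

definition CatObjects ::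
  "('o, 'a, 'p, 'c) dbl \<Rightarrow>
    (('o, 'p, 'c) cat_ob, ('o, 'a, 'p, 'c) cat_ob_fun, ('o, 'a, 'p, 'c) cat_ob_trans) two_cat"
  where "CatObjects E =
    \<lparr>C1 = \<lparr>Ob = {X. category_object E X}, Ar = {H. category_object_functor E H},
       Dom = fsrc, Cod = ftgt,
       Ide = (\<lambda>X. \<lparr>fsrc = X, ftgt = X,
         farr = Ide (D0 E) (base X), fcell = Ide (D1 E) (loop X)\<rparr>),
       Cmp = cat_ob_fun_cmp E\<rparr>,
     C2 = \<lparr>Ob = {H. category_object_functor E H},
       Ar = {s. category_object_transformation E s},
       Dom = xsrc, Cod = xtgt,
       Ide = (\<lambda>H. \<lparr>xsrc = H, xtgt = H, xcell = cid E (farr H) \<cdot>\<^bsub>D1 E\<^esub> unit (ftgt H)\<rparr>),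
       Cmp = (\<lambda>s t. \<lparr>xsrc = xsrc s, xtgt = xtgt t,
         xcell = linv E (pid E (base (fsrc (xsrc s)))) \<cdot>\<^bsub>D1 E\<^esub>
           (xcell s \<circledcirc>\<^bsub>E\<^esub> xcell t) \<cdot>\<^bsub>D1 E\<^esub> mult (ftgt (xsrc s))\<rparr>)\<rparr>,
     HCmp = (\<lambda>s t. \<lparr>xsrc = cat_ob_fun_cmp E (xsrc s) (xsrc t),
       xtgt = cat_ob_fun_cmp E (xtgt s) (xtgt t),
       xcell = xcell s \<cdot>\<^bsub>D1 E\<^esub> cat_ob_trans_loop E t\<rparr>)\<rparr>"


section \<open>Sets, spans and small categories\<close>

text \<open>
  HOL has no type of all sets.  \<open>U\<close> is the collection of sets under consideration, with elements
  taken from an ambient type equipped with a pairing; it is only required to support the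
  constructions of finite limits (and quotients, by choosing representatives).  Examples are all
  subsets of an infinite type, and the sets belonging to a Grothendieck universe.
\<close>

locale set_universe =
  fixes U :: "'u set set" and pair :: "'u \<Rightarrow> 'u \<Rightarrow> 'u"
  assumes pair_inject: "pair a b = pair c d \<longleftrightarrow> a = c \<and> b = d"
    and subset_closed: "X \<in> U \<Longrightarrow> Y \<subseteq> X \<Longrightarrow> Y \<in> U"
    and product_closed: "X \<in> U \<Longrightarrow> Y \<in> U \<Longrightarrow> {pair a b | a b. a \<in> X \<and> b \<in> Y} \<in> U"
    and has_singleton: "\<exists>a. {a} \<in> U"

record 'u fn =
  fnDom :: "'u set"
  fnCod :: "'u set"
  fnMap :: "'u \<Rightarrow> 'u"

definition SetCat :: "'u set set \<Rightarrow> ('u set, 'u fn) cat"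
  where "SetCat U =
    \<lparr>Ob = U,
     Ar = {f. fnDom f \<in> U \<and> fnCod f \<in> U \<and> fnMap f \<in> fnDom f \<rightarrow>\<^sub>E fnCod f},
     Dom = fnDom, Cod = fnCod,
     Ide = (\<lambda>X. \<lparr>fnDom = X, fnCod = X, fnMap = (\<lambda>a \<in> X. a)\<rparr>),
     Cmp = (\<lambda>f g. \<lparr>fnDom = fnDom f, fnCod = fnCod g,
       fnMap = (\<lambda>a \<in> fnDom f. fnMap g (fnMap f a))\<rparr>)\<rparr>"

record 'u span =
  spSrc :: "'u set"
  spTgt :: "'u set"
  apex :: "'u set"
  legL :: "'u \<Rightarrow> 'u"
  legR :: "'u \<Rightarrow> 'u"

record 'u span_map =
  smDom :: "'u span"
  smCod :: "'u span"
  smSrc :: "'u fn"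
  smTgt :: "'u fn"
  smMap :: "'u \<Rightarrow> 'u"

definition fst_of :: "('u \<Rightarrow> 'u \<Rightarrow> 'u) \<Rightarrow> 'u \<Rightarrow> 'u"
  where "fst_of pair c = (THE a. \<exists>b. c = pair a b)"

definition snd_of :: "('u \<Rightarrow> 'u \<Rightarrow> 'u) \<Rightarrow> 'u \<Rightarrow> 'u"
  where "snd_of pair c = (THE b. \<exists>a. c = pair a b)"

definition is_span :: "'u set set \<Rightarrow> 'u span \<Rightarrow> bool"
  where "is_span U m \<longleftrightarrow>
    spSrc m \<in> U \<and> spTgt m \<in> U \<and> apex m \<in> U \<and>
    legL m \<in> apex m \<rightarrow>\<^sub>E spSrc m \<and> legR m \<in> apex m \<rightarrow>\<^sub>E spTgt m"

definition is_span_map :: "'u set set \<Rightarrow> 'u span_map \<Rightarrow> bool"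
  where "is_span_map U \<sigma> \<longleftrightarrow>
    is_span U (smDom \<sigma>) \<and> is_span U (smCod \<sigma>) \<and>
    smSrc \<sigma> \<in> hom (SetCat U) (spSrc (smDom \<sigma>)) (spSrc (smCod \<sigma>)) \<and>
    smTgt \<sigma> \<in> hom (SetCat U) (spTgt (smDom \<sigma>)) (spTgt (smCod \<sigma>)) \<and>
    smMap \<sigma> \<in> apex (smDom \<sigma>) \<rightarrow>\<^sub>E apex (smCod \<sigma>) \<and>
    (\<forall>a \<in> apex (smDom \<sigma>).
      legL (smCod \<sigma>) (smMap \<sigma> a) = fnMap (smSrc \<sigma>) (legL (smDom \<sigma>) a) \<and>
      legR (smCod \<sigma>) (smMap \<sigma> a) = fnMap (smTgt \<sigma>) (legR (smDom \<sigma>) a))"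

definition span_id :: "'u set \<Rightarrow> 'u span"
  where "span_id X =
    \<lparr>spSrc = X, spTgt = X, apex = X, legL = (\<lambda>a \<in> X. a), legR = (\<lambda>a \<in> X. a)\<rparr>"

definition span_cmp :: "('u \<Rightarrow> 'u \<Rightarrow> 'u) \<Rightarrow> 'u span \<Rightarrow> 'u span \<Rightarrow> 'u span"
  where "span_cmp pair m n =
    (let R = {pair a b | a b. a \<in> apex m \<and> b \<in> apex n \<and> legR m a = legL n b}
     in \<lparr>spSrc = spSrc m, spTgt = spTgt n, apex = R,
         legL = (\<lambda>c \<in> R. legL m (fst_of pair c)), legR = (\<lambda>c \<in> R. legR n (snd_of pair c))\<rparr>)"

definition span_glob :: "'u set set \<Rightarrow> 'u span \<Rightarrow> 'u span \<Rightarrow> ('u \<Rightarrow> 'u) \<Rightarrow> 'u span_map"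
  where "span_glob U m n h =
    \<lparr>smDom = m, smCod = n,
     smSrc = Ide (SetCat U) (spSrc m), smTgt = Ide (SetCat U) (spTgt m),
     smMap = restrict h (apex m)\<rparr>"

definition Span :: "'u set set \<Rightarrow> ('u \<Rightarrow> 'u \<Rightarrow> 'u) \<Rightarrow> ('u set, 'u fn, 'u span, 'u span_map) dbl"
  where "Span U pair =
    \<lparr>D0 = SetCat U,
     D1 = \<lparr>Ob = {m. is_span U m}, Ar = {\<sigma>. is_span_map U \<sigma>}, Dom = smDom, Cod = smCod,
       Ide = (\<lambda>m. span_glob U m m (\<lambda>a. a)),
       Cmp = (\<lambda>\<sigma> \<tau>. \<lparr>smDom = smDom \<sigma>, smCod = smCod \<tau>,
         smSrc = smSrc \<sigma> \<cdot>\<^bsub>SetCat U\<^esub> smSrc \<tau>, smTgt = smTgt \<sigma> \<cdot>\<^bsub>SetCat U\<^esub> smTgt \<tau>,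
         smMap = (\<lambda>a \<in> apex (smDom \<sigma>). smMap \<tau> (smMap \<sigma> a))\<rparr>)\<rparr>,
     psrc = spSrc, ptgt = spTgt, csrc = smSrc, ctgt = smTgt,
     pid = span_id,
     cid = (\<lambda>f. \<lparr>smDom = span_id (fnDom f), smCod = span_id (fnCod f),
       smSrc = f, smTgt = f, smMap = fnMap f\<rparr>),
     pcmp = span_cmp pair,
     ccmp = (\<lambda>\<sigma> \<tau>. \<lparr>smDom = span_cmp pair (smDom \<sigma>) (smDom \<tau>),
       smCod = span_cmp pair (smCod \<sigma>) (smCod \<tau>),
       smSrc = smSrc \<sigma>, smTgt = smTgt \<tau>,
       smMap = (\<lambda>c \<in> apex (span_cmp pair (smDom \<sigma>) (smDom \<tau>)).
         pair (smMap \<sigma> (fst_of pair c)) (smMap \<tau> (snd_of pair c)))\<rparr>),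
     assoc = (\<lambda>m n p. span_glob U
       (span_cmp pair (span_cmp pair m n) p) (span_cmp pair m (span_cmp pair n p))
       (\<lambda>c. pair (fst_of pair (fst_of pair c))
              (pair (snd_of pair (fst_of pair c)) (snd_of pair c)))),
     lunit = (\<lambda>m. span_glob U (span_cmp pair (span_id (spSrc m)) m) m (snd_of pair)),
     runit = (\<lambda>m. span_glob U (span_cmp pair m (span_id (spTgt m))) m (fst_of pair))\<rparr>"

definition small_category :: "'u set set \<Rightarrow> ('u, 'u) cat \<Rightarrow> bool"
  where "small_category U C \<longleftrightarrow>
    category C \<and> Ob C \<in> U \<and> Ar C \<in> U \<and>
    Dom C \<in> extensional (Ar C) \<and> Cod C \<in> extensional (Ar C) \<and> Ide C \<in> extensional (Ob C) \<and>
    (\<forall>f g. \<not> (f \<in> Ar C \<and> g \<in> Ar C \<and> Cod C f = Dom C g) \<longrightarrow> f \<cdot>\<^bsub>C\<^esub> g = undefined)"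

record 'u small_functor =
  sfDom :: "('u, 'u) cat"
  sfCod :: "('u, 'u) cat"
  sfFun :: "('u, 'u, 'u, 'u) fctr"

definition is_small_functor :: "'u set set \<Rightarrow> 'u small_functor \<Rightarrow> bool"
  where "is_small_functor U F \<longleftrightarrow>
    small_category U (sfDom F) \<and> small_category U (sfCod F) \<and>
    cat_functor (sfDom F) (sfCod F) (sfFun F)"

record 'u small_nat =
  snDom :: "'u small_functor"
  snCod :: "'u small_functor"
  snMap :: "'u \<Rightarrow> 'u"

definition is_small_nat :: "'u set set \<Rightarrow> 'u small_nat \<Rightarrow> bool"
  where "is_small_nat U s \<longleftrightarrow>
    (let F = snDom s; G = snCod s; C = sfDom F; D = sfCod F in
     is_small_functor U F \<and> is_small_functor U G \<and> sfDom G = C \<and> sfCod G = D \<and>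
     snMap s \<in> extensional (Ob C) \<and>
     (\<forall>x \<in> Ob C. snMap s x \<in> hom D (onOb (sfFun F) x) (onOb (sfFun G) x)) \<and>
     (\<forall>x y. \<forall>f \<in> hom C x y.
       onAr (sfFun F) f \<cdot>\<^bsub>D\<^esub> snMap s y = snMap s x \<cdot>\<^bsub>D\<^esub> onAr (sfFun G) f))"

definition small_functor_cmp :: "'u small_functor \<Rightarrow> 'u small_functor \<Rightarrow> 'u small_functor"
  where "small_functor_cmp F G =
    \<lparr>sfDom = sfDom F, sfCod = sfCod G,
     sfFun = \<lparr>onOb = (\<lambda>x \<in> Ob (sfDom F). onOb (sfFun G) (onOb (sfFun F) x)),
       onAr = (\<lambda>f \<in> Ar (sfDom F). onAr (sfFun G) (onAr (sfFun F) f))\<rparr>\<rparr>"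

definition CAT :: "'u set set \<Rightarrow> (('u, 'u) cat, 'u small_functor, 'u small_nat) two_cat"
  where "CAT U =
    \<lparr>C1 = \<lparr>Ob = {C. small_category U C}, Ar = {F. is_small_functor U F},
       Dom = sfDom, Cod = sfCod,
       Ide = (\<lambda>C. \<lparr>sfDom = C, sfCod = C,
         sfFun = \<lparr>onOb = (\<lambda>x \<in> Ob C. x), onAr = (\<lambda>f \<in> Ar C. f)\<rparr>\<rparr>),
       Cmp = small_functor_cmp\<rparr>,
     C2 = \<lparr>Ob = {F. is_small_functor U F}, Ar = {s. is_small_nat U s},
       Dom = snDom, Cod = snCod,
       Ide = (\<lambda>F. \<lparr>snDom = F, snCod = F,
         snMap = (\<lambda>x \<in> Ob (sfDom F). Ide (sfCod F) (onOb (sfFun F) x))\<rparr>),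
       Cmp = (\<lambda>s t. \<lparr>snDom = snDom s, snCod = snCod t,
         snMap = (\<lambda>x \<in> Ob (sfDom (snDom s)). snMap s x \<cdot>\<^bsub>sfCod (snDom s)\<^esub> snMap t x)\<rparr>)\<rparr>,
     HCmp = (\<lambda>s t. \<lparr>snDom = small_functor_cmp (snDom s) (snDom t),
       snCod = small_functor_cmp (snCod s) (snCod t),
       snMap = (\<lambda>x \<in> Ob (sfDom (snDom s)).
         onAr (sfFun (snDom t)) (snMap s x) \<cdot>\<^bsub>sfCod (snDom t)\<^esub>
         snMap t (onOb (sfFun (snCod s)) x))\<rparr>)\<rparr>"

end

theory Submission
  imports Defs
begin

text \<open>
  A 2-morphism \<open>\<xi> : id \<rightarrow> s\<close> between functors of category objects \<open>(f, \<phi>)\<close> and \<open>(g, \<psi>)\<close> from \<open>r\<close>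
  to \<open>s\<close> is the same thing as a cell \<open>r \<rightarrow> s\<close> over \<open>(f, g)\<close> that is compatible with the actions: the cell
  is obtained by acting with \<open>\<xi>\<close> on \<open>\<psi>\<close>, and \<open>\<xi>\<close> is recovered by precomposing it with the unit of \<open>r\<close>.
  In \<open>VerDbl A\<close> all proarrows are identities, so a lax functor sends each object to a category
  object, each arrow to a functor, and each 2-cell \<open>s\<close> to a cell between the underlying proarrows, hence to
  a 2-morphism. Under this correspondence the axioms of lax functors, lax transformations and
  modulations turn into those of 2-functors, lax transformations and modifications. Products of category
  objects are created by the underlying proarrows, which matches up the two cartesianness conditions; the
  2-category axioms are transported along the bijection. For spans, category objects are
  small categories, and post-composition with an isomorphism of 2-categories preserves everything in sight.
\<close>

section \<open>Categories and 2-categories\<close>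

text \<open>The obstacle is the coherence of a pseudo double category: written out, every formula
  about category objects contains unitors and associators. They are absorbed once and for all by two
  actions, \<open>lact\<close> and \<open>ract\<close>, of a cell from an identity proarrow on cells
  into a category object. Each hides one inverse unitor, and the mixed associativity and unit laws
  of the actions contain no associators. A 2-morphism is then handled through its induced cell
  \<open>cat_ob_trans_loop\<close>. This cell determines it, turns horizontal composition into
  composition in \<open>D1\<close>, and turns vertical composition into a one-sided action, so every
  square of 2-morphisms becomes an equation between one left and one right action. That equation has
  the shape of the lax transformation axiom. At the identity 2-cell on \<open>f\<close> it says that
  the cell at \<open>f\<close> is a 2-morphism; at a general 2-cell it is naturality in
  2-cells.\<close>

lemma hom_iff: "f \<in> hom C x y \<longleftrightarrow> f \<in> Ar C \<and> Dom C f = x \<and> Cod C f = y"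
  by (auto simp: hom_def)

section \<open>Elementary consequences of the category axioms\<close>

context category
begin

lemma dom_cod_Ob [simp]:
  assumes "f \<in> Ar C" shows "Dom C f \<in> Ob C" "Cod C f \<in> Ob C"
  using assms dom_in cod_in by auto

lemma ide_simps [simp]:
  assumes "x \<in> Ob C"
  shows "Ide C x \<in> Ar C" "Dom C (Ide C x) = x" "Cod C (Ide C x) = x"
  using ide_in[OF assms] by (auto simp: hom_iff)

lemma cmp_simps [simp]:
  assumes "f \<in> Ar C" "g \<in> Ar C" "Cod C f = Dom C g"
  shows "f \<cdot>\<^bsub>C\<^esub> g \<in> Ar C" "Dom C (f \<cdot>\<^bsub>C\<^esub> g) = Dom C f" "Cod C (f \<cdot>\<^bsub>C\<^esub> g) = Cod C g"
  using cmp_in[of f "Dom C f" "Cod C f" g "Cod C g"] assms by (auto simp: hom_iff)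

lemma ide_cmp [simp]: "f \<in> Ar C \<Longrightarrow> Dom C f = x \<Longrightarrow> Ide C x \<cdot>\<^bsub>C\<^esub> f = f"
  using ide_left[of f x "Cod C f"] by (simp add: hom_iff)

lemma cmp_ide [simp]: "f \<in> Ar C \<Longrightarrow> Cod C f = x \<Longrightarrow> f \<cdot>\<^bsub>C\<^esub> Ide C x = f"
  using ide_right[of f "Dom C f" x] by (simp add: hom_iff)

lemma assoc_cmp [simp]:
  "\<lbrakk>f \<in> Ar C; g \<in> Ar C; h \<in> Ar C; Cod C f = Dom C g; Cod C g = Dom C h\<rbrakk> \<Longrightarrow>
    f \<cdot>\<^bsub>C\<^esub> g \<cdot>\<^bsub>C\<^esub> h = f \<cdot>\<^bsub>C\<^esub> (g \<cdot>\<^bsub>C\<^esub> h)"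
  using cmp_assoc[of f "Dom C f" "Dom C g" g "Cod C g" h "Cod C h"] by (simp add: hom_iff)

lemma inverse_unique:
  assumes "inverse_arrows C f g" "inverse_arrows C f h" shows "g = h"
proof -
  have f: "f \<in> Ar C" and g: "g \<in> Ar C" "Dom C g = Cod C f" "Cod C g = Dom C f"
    and h: "h \<in> Ar C" "Dom C h = Cod C f" "Cod C h = Dom C f"
    and e: "f \<cdot>\<^bsub>C\<^esub> h = Ide C (Dom C f)" "g \<cdot>\<^bsub>C\<^esub> f = Ide C (Cod C f)"
    using assms by (auto simp: inverse_arrows_def hom_iff)
  have "g = g \<cdot>\<^bsub>C\<^esub> (f \<cdot>\<^bsub>C\<^esub> h)" using g by (simp add: e)
  also have "\<dots> = (g \<cdot>\<^bsub>C\<^esub> f) \<cdot>\<^bsub>C\<^esub> h" using f g h by simp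
  also have "\<dots> = h" using h by (simp add: e)
  finally show ?thesis .
qed

lemma inv_arrow_eqI: "inverse_arrows C f g \<Longrightarrow> inv_arrow C f = g"
  unfolding inv_arrow_def using inverse_unique by blast

lemma inv_arrow:
  assumes "iso_arrow C f"
  shows "f \<in> Ar C" "inv_arrow C f \<in> Ar C" "Dom C (inv_arrow C f) = Cod C f"
    "Cod C (inv_arrow C f) = Dom C f"
    "f \<cdot>\<^bsub>C\<^esub> inv_arrow C f = Ide C (Dom C f)" "inv_arrow C f \<cdot>\<^bsub>C\<^esub> f = Ide C (Cod C f)"
proof -
  obtain g where g: "inverse_arrows C f g" using assms by (auto simp: iso_arrow_def)
  with inv_arrow_eqI[OF g] show "f \<in> Ar C" "inv_arrow C f \<in> Ar C"
    "Dom C (inv_arrow C f) = Cod C f" "Cod C (inv_arrow C f) = Dom C f"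
    "f \<cdot>\<^bsub>C\<^esub> inv_arrow C f = Ide C (Dom C f)" "inv_arrow C f \<cdot>\<^bsub>C\<^esub> f = Ide C (Cod C f)"
    by (auto simp: inverse_arrows_def hom_iff)
qed

end


section \<open>Products and terminal objects\<close>

context category
begin

lemma productD:
  assumes "is_product C x y p \<pi>\<^sub>1 \<pi>\<^sub>2"
  shows "x \<in> Ob C" "y \<in> Ob C" "p \<in> Ob C" "\<pi>\<^sub>1 \<in> Ar C" "Dom C \<pi>\<^sub>1 = p" "Cod C \<pi>\<^sub>1 = x"
    "\<pi>\<^sub>2 \<in> Ar C" "Dom C \<pi>\<^sub>2 = p" "Cod C \<pi>\<^sub>2 = y"
  using assms by (auto simp: is_product_def hom_iff)

lemma product_pairing:
  assumes "is_product C x y p \<pi>\<^sub>1 \<pi>\<^sub>2" "f \<in> Ar C" "g \<in> Ar C" "Dom C f = Dom C g"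
    "Cod C f = x" "Cod C g = y"
  obtains h where "h \<in> Ar C" "Dom C h = Dom C f" "Cod C h = p"
    "h \<cdot>\<^bsub>C\<^esub> \<pi>\<^sub>1 = f" "h \<cdot>\<^bsub>C\<^esub> \<pi>\<^sub>2 = g"
proof -
  have "f \<in> hom C (Dom C f) x" "g \<in> hom C (Dom C f) y" "Dom C f \<in> Ob C"
    using assms by (auto simp: hom_iff)
  then have "\<exists>h. h \<in> hom C (Dom C f) p \<and> h \<cdot>\<^bsub>C\<^esub> \<pi>\<^sub>1 = f \<and> h \<cdot>\<^bsub>C\<^esub> \<pi>\<^sub>2 = g"
    using assms(1) unfolding is_product_def by blast
  then show thesis using that by (auto simp: hom_iff)
qed

lemma product_eqI:
  assumes p: "is_product C x y p \<pi>\<^sub>1 \<pi>\<^sub>2" and h: "h \<in> Ar C" "Cod C h = p"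
    and k: "k \<in> Ar C" "Cod C k = p"  and "Dom C h = Dom C k"
    and e: "h \<cdot>\<^bsub>C\<^esub> \<pi>\<^sub>1 = k \<cdot>\<^bsub>C\<^esub> \<pi>\<^sub>1" "h \<cdot>\<^bsub>C\<^esub> \<pi>\<^sub>2 = k \<cdot>\<^bsub>C\<^esub> \<pi>\<^sub>2"
  shows "h = k"
proof -
  note [simp] = productD[OF p]
  have "k \<cdot>\<^bsub>C\<^esub> \<pi>\<^sub>1 \<in> hom C (Dom C k) x" "k \<cdot>\<^bsub>C\<^esub> \<pi>\<^sub>2 \<in> hom C (Dom C k) y" "Dom C k \<in> Ob C"
    using k by (auto simp: hom_iff)
  then have "\<exists>!u. u \<in> hom C (Dom C k) p \<and> u \<cdot>\<^bsub>C\<^esub> \<pi>\<^sub>1 = k \<cdot>\<^bsub>C\<^esub> \<pi>\<^sub>1 \<and> u \<cdot>\<^bsub>C\<^esub> \<pi>\<^sub>2 = k \<cdot>\<^bsub>C\<^esub> \<pi>\<^sub>2"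
    using p unfolding is_product_def by blast
  then show ?thesis using assms by (metis hom_iff)
qed

text \<open>Splits unique existence into existence of pairings and joint cancellability of the
  projections; the test object is read off as the common domain of the arrows.\<close>

lemma productI:
  assumes "x \<in> Ob C" "y \<in> Ob C" "p \<in> Ob C" "\<pi>\<^sub>1 \<in> hom C p x" "\<pi>\<^sub>2 \<in> hom C p y"
    and "\<And>f g. \<lbrakk>f \<in> Ar C; g \<in> Ar C; Dom C f = Dom C g; Cod C f = x; Cod C g = y\<rbrakk> \<Longrightarrow>
      \<exists>h. h \<in> Ar C \<and> Dom C h = Dom C f \<and> Cod C h = p \<and> h \<cdot>\<^bsub>C\<^esub> \<pi>\<^sub>1 = f \<and> h \<cdot>\<^bsub>C\<^esub> \<pi>\<^sub>2 = g"
    and "\<And>h k. \<lbrakk>h \<in> Ar C; k \<in> Ar C; Dom C h = Dom C k; Cod C h = p; Cod C k = p;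
      h \<cdot>\<^bsub>C\<^esub> \<pi>\<^sub>1 = k \<cdot>\<^bsub>C\<^esub> \<pi>\<^sub>1; h \<cdot>\<^bsub>C\<^esub> \<pi>\<^sub>2 = k \<cdot>\<^bsub>C\<^esub> \<pi>\<^sub>2\<rbrakk> \<Longrightarrow> h = k"
  shows "is_product C x y p \<pi>\<^sub>1 \<pi>\<^sub>2"
  unfolding is_product_def
proof (intro conjI ballI ex_ex1I)
  fix w f g assume "w \<in> Ob C" "f \<in> hom C w x" "g \<in> hom C w y"
  then show "\<exists>h. h \<in> hom C w p \<and> h \<cdot>\<^bsub>C\<^esub> \<pi>\<^sub>1 = f \<and> h \<cdot>\<^bsub>C\<^esub> \<pi>\<^sub>2 = g"
    using assms(6)[of f g] by (auto simp: hom_iff)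
next
  fix w f g h k assume "h \<in> hom C w p \<and> h \<cdot>\<^bsub>C\<^esub> \<pi>\<^sub>1 = f \<and> h \<cdot>\<^bsub>C\<^esub> \<pi>\<^sub>2 = g"
    "k \<in> hom C w p \<and> k \<cdot>\<^bsub>C\<^esub> \<pi>\<^sub>1 = f \<and> k \<cdot>\<^bsub>C\<^esub> \<pi>\<^sub>2 = g"
  then show "h = k" using assms(7)[of h k] by (auto simp: hom_iff)
qed (use assms in auto)

text \<open>Pairings into the new vertex are the old pairings followed by the inverse
  \<open>j\<close>; two arrows with equal projections agree after \<open>i\<close>, which can be
  cancelled.\<close>

lemma product_cmp_iso:
  assumes p: "is_product C x y p \<pi>\<^sub>1 \<pi>\<^sub>2" and i: "inverse_arrows C i j" "Cod C i = p"
  shows "is_product C x y (Dom C i) (i \<cdot>\<^bsub>C\<^esub> \<pi>\<^sub>1) (i \<cdot>\<^bsub>C\<^esub> \<pi>\<^sub>2)"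
proof -
  note [simp] = productD[OF p]
  have [simp]: "i \<in> Ar C" "Cod C i = p" "j \<in> Ar C" "Dom C j = p" "Cod C j = Dom C i"
    and ij: "i \<cdot>\<^bsub>C\<^esub> j = Ide C (Dom C i)" "j \<cdot>\<^bsub>C\<^esub> i = Ide C p"
    using i by (auto simp: inverse_arrows_def hom_iff)
  show ?thesis
  proof (rule productI)
    fix f g assume a: "f \<in> Ar C" "g \<in> Ar C" "Dom C f = Dom C g" "Cod C f = x" "Cod C g = y"
    obtain h where h: "h \<in> Ar C" "Dom C h = Dom C f" "Cod C h = p"
      "h \<cdot>\<^bsub>C\<^esub> \<pi>\<^sub>1 = f" "h \<cdot>\<^bsub>C\<^esub> \<pi>\<^sub>2 = g"
      using product_pairing[OF p a] by blast
    have "j \<cdot>\<^bsub>C\<^esub> (i \<cdot>\<^bsub>C\<^esub> q) = q" if "q \<in> Ar C" "Dom C q = p" for q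
      using assoc_cmp[of j i q] that by (simp add: ij)
    with h have "h \<cdot>\<^bsub>C\<^esub> j \<in> Ar C \<and> Dom C (h \<cdot>\<^bsub>C\<^esub> j) = Dom C f \<and> Cod C (h \<cdot>\<^bsub>C\<^esub> j) = Dom C i \<and>
       (h \<cdot>\<^bsub>C\<^esub> j) \<cdot>\<^bsub>C\<^esub> (i \<cdot>\<^bsub>C\<^esub> \<pi>\<^sub>1) = f \<and> (h \<cdot>\<^bsub>C\<^esub> j) \<cdot>\<^bsub>C\<^esub> (i \<cdot>\<^bsub>C\<^esub> \<pi>\<^sub>2) = g" by simp
    then show "\<exists>h. h \<in> Ar C \<and> Dom C h = Dom C f \<and> Cod C h = Dom C i \<and>
      h \<cdot>\<^bsub>C\<^esub> (i \<cdot>\<^bsub>C\<^esub> \<pi>\<^sub>1) = f \<and> h \<cdot>\<^bsub>C\<^esub> (i \<cdot>\<^bsub>C\<^esub> \<pi>\<^sub>2) = g" by blast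
  next
    fix h k assume a: "h \<in> Ar C" "k \<in> Ar C" "Dom C h = Dom C k" "Cod C h = Dom C i"
      "Cod C k = Dom C i" "h \<cdot>\<^bsub>C\<^esub> (i \<cdot>\<^bsub>C\<^esub> \<pi>\<^sub>1) = k \<cdot>\<^bsub>C\<^esub> (i \<cdot>\<^bsub>C\<^esub> \<pi>\<^sub>1)"
      "h \<cdot>\<^bsub>C\<^esub> (i \<cdot>\<^bsub>C\<^esub> \<pi>\<^sub>2) = k \<cdot>\<^bsub>C\<^esub> (i \<cdot>\<^bsub>C\<^esub> \<pi>\<^sub>2)"
    have "h \<cdot>\<^bsub>C\<^esub> i = k \<cdot>\<^bsub>C\<^esub> i" by (rule product_eqI[OF p]) (use a in simp_all)
    then have "(h \<cdot>\<^bsub>C\<^esub> i) \<cdot>\<^bsub>C\<^esub> j = (k \<cdot>\<^bsub>C\<^esub> i) \<cdot>\<^bsub>C\<^esub> j" by simp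
    then show "h = k" using a by (simp add: ij)
  qed (auto simp: hom_iff)
qed

text \<open>Each cone factors through the other, and both composites fix the projections, so they
  are identities by uniqueness of pairings.\<close>

lemma product_comparison:
  assumes p: "is_product C x y p \<pi>\<^sub>1 \<pi>\<^sub>2" and q: "is_product C x y q \<rho>\<^sub>1 \<rho>\<^sub>2"
  obtains i j where "inverse_arrows C i j" "Dom C i = q" "Cod C i = p"
    "i \<cdot>\<^bsub>C\<^esub> \<pi>\<^sub>1 = \<rho>\<^sub>1" "i \<cdot>\<^bsub>C\<^esub> \<pi>\<^sub>2 = \<rho>\<^sub>2"
proof -
  note [simp] = productD[OF p] productD[OF q]
  obtain i where i: "i \<in> Ar C" "Dom C i = q" "Cod C i = p" "i \<cdot>\<^bsub>C\<^esub> \<pi>\<^sub>1 = \<rho>\<^sub>1" "i \<cdot>\<^bsub>C\<^esub> \<pi>\<^sub>2 = \<rho>\<^sub>2"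
    using product_pairing[OF p, of \<rho>\<^sub>1 \<rho>\<^sub>2] by auto
  obtain j where j: "j \<in> Ar C" "Dom C j = p" "Cod C j = q" "j \<cdot>\<^bsub>C\<^esub> \<rho>\<^sub>1 = \<pi>\<^sub>1" "j \<cdot>\<^bsub>C\<^esub> \<rho>\<^sub>2 = \<pi>\<^sub>2"
    using product_pairing[OF q, of \<pi>\<^sub>1 \<pi>\<^sub>2] by auto
  have "i \<cdot>\<^bsub>C\<^esub> j = Ide C q" by (rule product_eqI[OF q]) (use i j in simp_all)
  moreover have "j \<cdot>\<^bsub>C\<^esub> i = Ide C p" by (rule product_eqI[OF p]) (use i j in simp_all)
  ultimately show thesis using that[of i j] i j by (auto simp: inverse_arrows_def hom_iff)
qed

lemma terminal_comparison:
  assumes t: "is_terminal C t" and u: "is_terminal C u"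
  obtains i j where "inverse_arrows C i j" "Dom C i = t" "Cod C i = u"
proof -
  obtain i j where i: "i \<in> hom C t u" and j: "j \<in> hom C u t"
    using t u by (meson is_terminal_def)
  have "i \<cdot>\<^bsub>C\<^esub> j \<in> hom C t t" "Ide C t \<in> hom C t t" "j \<cdot>\<^bsub>C\<^esub> i \<in> hom C u u" "Ide C u \<in> hom C u u"
    "t \<in> Ob C" "u \<in> Ob C"
    using i j t u by (auto simp: hom_iff is_terminal_def)
  then have "i \<cdot>\<^bsub>C\<^esub> j = Ide C t" "j \<cdot>\<^bsub>C\<^esub> i = Ide C u" using t u by (metis is_terminal_def)+
  then show thesis using that[of i j] i j by (auto simp: inverse_arrows_def hom_iff)
qed

lemma terminal_iso:
  assumes u: "is_terminal C u" and i: "inverse_arrows C i j" "Cod C i = u"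
  shows "is_terminal C (Dom C i)"
  unfolding is_terminal_def
proof (intro conjI ballI ex_ex1I)
  have [simp]: "i \<in> Ar C" "Cod C i = u" "j \<in> Ar C" "Dom C j = u" "Cod C j = Dom C i"
    and ij: "i \<cdot>\<^bsub>C\<^esub> j = Ide C (Dom C i)"
    using i by (auto simp: inverse_arrows_def hom_iff)
  show "Dom C i \<in> Ob C" by simp
  fix w assume w: "w \<in> Ob C"
  obtain h where "h \<in> hom C w u" using u w by (meson is_terminal_def)
  then have "h \<cdot>\<^bsub>C\<^esub> j \<in> hom C w (Dom C i)" by (simp add: hom_iff)
  then show "\<exists>h. h \<in> hom C w (Dom C i)" by blast
  fix h k assume hk: "h \<in> hom C w (Dom C i)" "k \<in> hom C w (Dom C i)"
  have "h \<cdot>\<^bsub>C\<^esub> i \<in> hom C w u" "k \<cdot>\<^bsub>C\<^esub> i \<in> hom C w u" using hk by (auto simp: hom_iff)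
  then have "h \<cdot>\<^bsub>C\<^esub> i = k \<cdot>\<^bsub>C\<^esub> i" using u w by (metis is_terminal_def)
  then have "(h \<cdot>\<^bsub>C\<^esub> i) \<cdot>\<^bsub>C\<^esub> j = (k \<cdot>\<^bsub>C\<^esub> i) \<cdot>\<^bsub>C\<^esub> j" by simp
  then show "h = k" using hk by (simp add: ij hom_iff)
qed

end

section \<open>Functors and preservation of products\<close>

context cat_functor
begin

lemma ar_simps [simp]:
  assumes "f \<in> Ar C"
  shows "onAr F f \<in> Ar D" "Dom D (onAr F f) = onOb F (Dom C f)" "Cod D (onAr F f) = onOb F (Cod C f)"
  using ar_in[of f "Dom C f" "Cod C f"] assms by (auto simp: hom_iff)

lemma cmp_image:
  "f \<in> Ar C \<Longrightarrow> g \<in> Ar C \<Longrightarrow> Cod C f = Dom C g \<Longrightarrow>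
    onAr F (f \<cdot>\<^bsub>C\<^esub> g) = onAr F f \<cdot>\<^bsub>D\<^esub> onAr F g"
  using pres_cmp[of f "Dom C f" "Dom C g" g "Cod C g"] by (simp add: hom_iff)

lemma inverse_image:
  assumes "category C" "inverse_arrows C i j" shows "inverse_arrows D (onAr F i) (onAr F j)"
proof -
  interpret category C by fact
  have [simp]: "i \<in> Ar C" "j \<in> Ar C" "Dom C j = Cod C i" "Cod C j = Dom C i"
    and ij: "i \<cdot>\<^bsub>C\<^esub> j = Ide C (Dom C i)" "j \<cdot>\<^bsub>C\<^esub> i = Ide C (Cod C i)"
    using assms by (auto simp: inverse_arrows_def hom_iff)
  show ?thesis
    unfolding inverse_arrows_def by (simp add: hom_iff cmp_image[symmetric] ij pres_ide)
qed

text \<open>All product cones on a pair of objects are isomorphic, so it suffices to look at one of them.\<close>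

lemma preserves_productsI:
  assumes C: "category C" and D: "category D" and P: "chosen_products C P"
    and prod: "\<And>x y. x \<in> Ob C \<Longrightarrow> y \<in> Ob C \<Longrightarrow> is_product D (onOb F x) (onOb F y)
      (onOb F (Prod P x y)) (onAr F (Proj1 P x y)) (onAr F (Proj2 P x y))"
    and terminal: "is_terminal D (onOb F (One P))"
  shows "preserves_products C D F"
proof -
  interpret C: category C by fact
  interpret D: category D by fact
  show ?thesis
    unfolding preserves_products_def
  proof (intro conjI allI impI)
    fix x y p \<pi>\<^sub>1 \<pi>\<^sub>2 assume p: "is_product C x y p \<pi>\<^sub>1 \<pi>\<^sub>2"
    note [simp] = C.productD[OF p]
    have q: "is_product C x y (Prod P x y) (Proj1 P x y) (Proj2 P x y)"
      using P by (simp add: chosen_products_def)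
    note [simp] = C.productD[OF q]
    obtain i j where i: "inverse_arrows C i j" "Dom C i = p" "Cod C i = Prod P x y"
      "i \<cdot>\<^bsub>C\<^esub> Proj1 P x y = \<pi>\<^sub>1" "i \<cdot>\<^bsub>C\<^esub> Proj2 P x y = \<pi>\<^sub>2"
      using C.product_comparison[OF q p] by blast
    have [simp]: "i \<in> Ar C" using i by (simp add: inverse_arrows_def)
    have "is_product D (onOb F x) (onOb F y) (Dom D (onAr F i))
      (onAr F i \<cdot>\<^bsub>D\<^esub> onAr F (Proj1 P x y)) (onAr F i \<cdot>\<^bsub>D\<^esub> onAr F (Proj2 P x y))"
      by (rule D.product_cmp_iso[OF prod inverse_image[OF C i(1)]]) (simp_all add: i)
    then show "is_product D (onOb F x) (onOb F y) (onOb F p) (onAr F \<pi>\<^sub>1) (onAr F \<pi>\<^sub>2)"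
      by (simp add: i cmp_image[symmetric])
  next
    fix t assume t: "is_terminal C t"
    have "is_terminal C (One P)" using P by (simp add: chosen_products_def)
    then obtain i j where i: "inverse_arrows C i j" "Dom C i = t" "Cod C i = One P"
      using C.terminal_comparison[OF t] by blast
    then have "i \<in> Ar C" by (simp add: inverse_arrows_def)
    then show "is_terminal D (onOb F t)"
      using D.terminal_iso[OF terminal inverse_image[OF C i(1)]] i by simp
  qed
qed

end

section \<open>Rewriting rules for 2-cells\<close>

context two_category
begin

sublocale c1: category "C1 A" by (rule cat1)
sublocale c2: category "C2 A" by (rule cat2)

lemma arrow_simps [simp]:
  assumes "s \<in> Ar (C2 A)"
  shows "Dom (C2 A) s \<in> Ar (C1 A)" "Cod (C2 A) s \<in> Ar (C1 A)"
    "Dom (C1 A) (Cod (C2 A) s) = Dom (C1 A) (Dom (C2 A) s)"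
    "Cod (C1 A) (Cod (C2 A) s) = Cod (C1 A) (Dom (C2 A) s)"
  using c2.dom_cod_Ob[OF assms] parallel_dom[of s] parallel_cod[of s] assms
  by (auto simp: ob2 hom_iff)

lemma ide2_simps [simp]:
  assumes "f \<in> Ar (C1 A)"
  shows "Ide (C2 A) f \<in> Ar (C2 A)" "Dom (C2 A) (Ide (C2 A) f) = f" "Cod (C2 A) (Ide (C2 A) f) = f"
  using c2.ide_simps[of f] assms by (simp_all add: ob2)

lemma two_hom_iff:
  "s \<in> two_hom A x y \<longleftrightarrow> s \<in> Ar (C2 A) \<and> Dom (C1 A) (Dom (C2 A) s) = x \<and> Cod (C1 A) (Dom (C2 A) s) = y"
  by (auto simp: two_hom_def hom_iff)

lemma hcmp_simps [simp]:
  assumes "s \<in> Ar (C2 A)" "t \<in> Ar (C2 A)" "Cod (C1 A) (Dom (C2 A) s) = Dom (C1 A) (Dom (C2 A) t)"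
  shows "s *\<^bsub>A\<^esub> t \<in> Ar (C2 A)"
    "Dom (C2 A) (s *\<^bsub>A\<^esub> t) = Dom (C2 A) s \<cdot>\<^bsub>C1 A\<^esub> Dom (C2 A) t"
    "Cod (C2 A) (s *\<^bsub>A\<^esub> t) = Cod (C2 A) s \<cdot>\<^bsub>C1 A\<^esub> Cod (C2 A) t"
  using hcmp_hom[of "Dom (C2 A) s" "Dom (C1 A) (Dom (C2 A) s)" "Dom (C1 A) (Dom (C2 A) t)"
    "Dom (C2 A) t" "Cod (C1 A) (Dom (C2 A) t)" s "Cod (C2 A) s" t "Cod (C2 A) t"] assms
  by (auto simp: hom_iff)

lemma ide_hcmp_ide [simp]:
  "f \<in> Ar (C1 A) \<Longrightarrow> g \<in> Ar (C1 A) \<Longrightarrow> Cod (C1 A) f = Dom (C1 A) g \<Longrightarrow>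
    Ide (C2 A) f *\<^bsub>A\<^esub> Ide (C2 A) g = Ide (C2 A) (f \<cdot>\<^bsub>C1 A\<^esub> g)"
  using hcmp_ide[of f "Dom (C1 A) f" "Dom (C1 A) g" g "Cod (C1 A) g"] by (simp add: hom_iff)

lemma ide_hcmp [simp]:
  "s \<in> Ar (C2 A) \<Longrightarrow> Dom (C1 A) (Dom (C2 A) s) = x \<Longrightarrow> Ide (C2 A) (Ide (C1 A) x) *\<^bsub>A\<^esub> s = s"
  using hcmp_left[of s x] by (simp add: two_hom_iff)

lemma hcmp_ide_right [simp]:
  "s \<in> Ar (C2 A) \<Longrightarrow> Cod (C1 A) (Dom (C2 A) s) = x \<Longrightarrow> s *\<^bsub>A\<^esub> Ide (C2 A) (Ide (C1 A) x) = s"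
  using hcmp_right[of s _ x] by (simp add: two_hom_iff)

lemma assoc_hcmp:
  "\<lbrakk>s \<in> Ar (C2 A); t \<in> Ar (C2 A); u \<in> Ar (C2 A); Cod (C1 A) (Dom (C2 A) s) = Dom (C1 A) (Dom (C2 A) t);
    Cod (C1 A) (Dom (C2 A) t) = Dom (C1 A) (Dom (C2 A) u)\<rbrakk> \<Longrightarrow>
    s *\<^bsub>A\<^esub> t *\<^bsub>A\<^esub> u = s *\<^bsub>A\<^esub> (t *\<^bsub>A\<^esub> u)"
  using hcmp_assoc by (simp add: two_hom_iff)

text \<open>Oriented opposite to \<open>interchange\<close>: vertical composites are gathered inside
  a single horizontal one, where identities can then be removed.\<close>

lemma hcmp_cmp:
  "\<lbrakk>s \<in> Ar (C2 A); t \<in> Ar (C2 A); s' \<in> Ar (C2 A); t' \<in> Ar (C2 A);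
    Cod (C2 A) s = Dom (C2 A) t; Cod (C2 A) s' = Dom (C2 A) t';
    Cod (C1 A) (Dom (C2 A) s) = Dom (C1 A) (Dom (C2 A) s')\<rbrakk> \<Longrightarrow>
    (s *\<^bsub>A\<^esub> s') \<cdot>\<^bsub>C2 A\<^esub> (t *\<^bsub>A\<^esub> t') = (s \<cdot>\<^bsub>C2 A\<^esub> t) *\<^bsub>A\<^esub> (s' \<cdot>\<^bsub>C2 A\<^esub> t')"
  by (subst interchange[of "Dom (C2 A) s" "Dom (C1 A) (Dom (C2 A) s)" "Dom (C1 A) (Dom (C2 A) s')"
    "Dom (C2 A) s'" "Cod (C1 A) (Dom (C2 A) s')" s _ t "Cod (C2 A) t" s' _ t' "Cod (C2 A) t'"])
    (auto simp: hom_iff)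

end

text \<open>Transport of structure. Only \<open>B\<close> is assumed to be a 2-category; the
  hypotheses say that every operation of \<open>A\<close> is the conjugate of the one of
  \<open>B\<close> under the bijections, so the laws of \<open>A\<close> are those of
  \<open>B\<close> read through them. This spares a direct verification for \<open>CartLax\<close>
  and for \<open>CAT\<close>.\<close>

lemma isomorphic_two_categoriesI:
  assumes B: "two_category B" and ob2: "Ob (C2 A) = Ar (C1 A)"
    and T0: "\<And>x. x \<in> Ob (C1 A) \<Longrightarrow> T0 x \<in> Ob (C1 B) \<and> S0 (T0 x) = x"
    and S0: "\<And>x. x \<in> Ob (C1 B) \<Longrightarrow> S0 x \<in> Ob (C1 A) \<and> T0 (S0 x) = x"
    and T1: "\<And>f. f \<in> Ar (C1 A) \<Longrightarrow> T1 f \<in> Ar (C1 B) \<and> S1 (T1 f) = f"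
    and S1: "\<And>f. f \<in> Ar (C1 B) \<Longrightarrow> S1 f \<in> Ar (C1 A) \<and> T1 (S1 f) = f"
    and T2: "\<And>s. s \<in> Ar (C2 A) \<Longrightarrow> T2 s \<in> Ar (C2 B) \<and> S2 (T2 s) = s"
    and S2: "\<And>s. s \<in> Ar (C2 B) \<Longrightarrow> S2 s \<in> Ar (C2 A) \<and> T2 (S2 s) = s"
    and dc1: "\<And>f. f \<in> Ar (C1 A) \<Longrightarrow> Dom (C1 A) f \<in> Ob (C1 A) \<and> Cod (C1 A) f \<in> Ob (C1 A) \<and>
      Dom (C1 B) (T1 f) = T0 (Dom (C1 A) f) \<and> Cod (C1 B) (T1 f) = T0 (Cod (C1 A) f)"
    and dc2: "\<And>s. s \<in> Ar (C2 A) \<Longrightarrow> Dom (C2 A) s \<in> Ar (C1 A) \<and> Cod (C2 A) s \<in> Ar (C1 A) \<and>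
      Dom (C2 B) (T2 s) = T1 (Dom (C2 A) s) \<and> Cod (C2 B) (T2 s) = T1 (Cod (C2 A) s)"
    and ide1: "\<And>x. x \<in> Ob (C1 A) \<Longrightarrow> Ide (C1 A) x = S1 (Ide (C1 B) (T0 x))"
    and ide2: "\<And>f. f \<in> Ar (C1 A) \<Longrightarrow> Ide (C2 A) f = S2 (Ide (C2 B) (T1 f))"
    and cmp1: "\<And>f g. f \<in> Ar (C1 A) \<Longrightarrow> g \<in> Ar (C1 A) \<Longrightarrow> Cod (C1 A) f = Dom (C1 A) g \<Longrightarrow>
      f \<cdot>\<^bsub>C1 A\<^esub> g = S1 (T1 f \<cdot>\<^bsub>C1 B\<^esub> T1 g)"
    and cmp2: "\<And>s t. s \<in> Ar (C2 A) \<Longrightarrow> t \<in> Ar (C2 A) \<Longrightarrow> Cod (C2 A) s = Dom (C2 A) t \<Longrightarrow>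
      s \<cdot>\<^bsub>C2 A\<^esub> t = S2 (T2 s \<cdot>\<^bsub>C2 B\<^esub> T2 t)"
    and hcmp: "\<And>s t. s \<in> Ar (C2 A) \<Longrightarrow> t \<in> Ar (C2 A) \<Longrightarrow>
      Cod (C1 A) (Dom (C2 A) s) = Dom (C1 A) (Dom (C2 A) t) \<Longrightarrow> s *\<^bsub>A\<^esub> t = S2 (T2 s *\<^bsub>B\<^esub> T2 t)"
  shows "isomorphic_two_categories A B"
proof -
  interpret B: two_category B by fact
  note [simp] = T0 S0 T1 S1 T2 S2 dc1 dc2 ide1 ide2 cmp1 cmp2 hcmp ob2 B.ob2
  have T0i: "x = y" if "T0 x = T0 y" "x \<in> Ob (C1 A)" "y \<in> Ob (C1 A)" for x y
    using that T0 by metis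
  have T1i: "x = y" if "T1 x = T1 y" "x \<in> Ar (C1 A)" "y \<in> Ar (C1 A)" for x y
    using that T1 by metis
  have S1dc: "Dom (C1 A) (S1 f) = S0 (Dom (C1 B) f)" "Cod (C1 A) (S1 f) = S0 (Cod (C1 B) f)"
    if "f \<in> Ar (C1 B)" for f using that by (metis S1 T0 dc1)+
  have S2dc: "Dom (C2 A) (S2 f) = S1 (Dom (C2 B) f)" "Cod (C2 A) (S2 f) = S1 (Cod (C2 B) f)"
    if "f \<in> Ar (C2 B)" for f using that by (metis S2 T1 dc2)+
  note [simp] = S1dc S2dc
  \<comment> \<open>That the two ends of a 2-cell are parallel is an equation between objects of
    \<open>A\<close>, so it can be tested after the injective map \<open>T0\<close>.\<close>
  have par: "Dom (C1 A) (Cod (C2 A) s) = Dom (C1 A) (Dom (C2 A) s)"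
    "Cod (C1 A) (Cod (C2 A) s) = Cod (C1 A) (Dom (C2 A) s)" if s: "s \<in> Ar (C2 A)" for s
  proof -
    show "Dom (C1 A) (Cod (C2 A) s) = Dom (C1 A) (Dom (C2 A) s)"
      by (rule T0i) (use B.arrow_simps(3)[of "T2 s"] s in simp_all)
    show "Cod (C1 A) (Cod (C2 A) s) = Cod (C1 A) (Dom (C2 A) s)"
      by (rule T0i) (use B.arrow_simps(4)[of "T2 s"] s in simp_all)
  qed
  note [simp] = par
  have c1: "category (C1 A)"
    by unfold_locales (auto simp: hom_iff)
  have c2: "category (C2 A)"
    by unfold_locales (auto simp: hom_iff)
  \<comment> \<open>The operations of \<open>A\<close> unfold to an inverse map applied to an
    operation of \<open>B\<close>, inner round trips cancel, and the corresponding law of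
    \<open>B\<close> remains.\<close>
  have A: "two_category A"
    by (rule two_category.intro) (use c1 c2 in \<open>auto simp: hom_iff two_hom_def B.assoc_hcmp B.hcmp_cmp\<close>)
  \<comment> \<open>The bijections may take any values off the carriers; restricting makes them
    extensional, as functors have to be.\<close>
  let ?F = "\<lparr>on0 = restrict T0 (Ob (C1 A)), on1 = restrict T1 (Ar (C1 A)), on2 = restrict T2 (Ar (C2 A))\<rparr>"
  let ?G = "\<lparr>on0 = restrict S0 (Ob (C1 B)), on1 = restrict S1 (Ar (C1 B)), on2 = restrict S2 (Ar (C2 B))\<rparr>"
  interpret A: two_category A by (rule A)
  have "two_functor A B ?F"
    by unfold_locales (auto simp: hom_iff two_hom_def)
  moreover have "two_functor B A ?G"
    by unfold_locales (auto simp: hom_iff two_hom_def)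
  ultimately show ?thesis
    unfolding isomorphic_two_categories_def using A B
    by (intro conjI exI[of _ ?F] exI[of _ ?G]) auto
qed

text \<open>Composites are normalised to the right, so an equation between two-fold composites does
  not match inside a longer one. This form applies it in front of a further factor
  \<open>z\<close>.\<close>

lemma (in category) cmp_extend:
  "\<lbrakk>f \<cdot>\<^bsub>C\<^esub> g = h \<cdot>\<^bsub>C\<^esub> k; f \<in> Ar C; g \<in> Ar C; h \<in> Ar C; k \<in> Ar C; z \<in> Ar C; Cod C f = Dom C g;
    Cod C h = Dom C k; Cod C g = Dom C z; Cod C k = Dom C z\<rbrakk> \<Longrightarrow>
    f \<cdot>\<^bsub>C\<^esub> (g \<cdot>\<^bsub>C\<^esub> z) = h \<cdot>\<^bsub>C\<^esub> (k \<cdot>\<^bsub>C\<^esub> z)"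
  by (simp flip: assoc_cmp)

context two_category
begin

lemma whisker_left:
  "\<lbrakk>u \<in> Ar (C1 A); s \<in> Ar (C2 A); t \<in> Ar (C2 A); Cod (C2 A) s = Dom (C2 A) t;
    Cod (C1 A) u = Dom (C1 A) (Dom (C2 A) s)\<rbrakk> \<Longrightarrow>
    Ide (C2 A) u *\<^bsub>A\<^esub> (s \<cdot>\<^bsub>C2 A\<^esub> t) = (Ide (C2 A) u *\<^bsub>A\<^esub> s) \<cdot>\<^bsub>C2 A\<^esub> (Ide (C2 A) u *\<^bsub>A\<^esub> t)"
  by (simp add: hcmp_cmp)

lemma whisker_right:
  "\<lbrakk>u \<in> Ar (C1 A); s \<in> Ar (C2 A); t \<in> Ar (C2 A); Cod (C2 A) s = Dom (C2 A) t;
    Cod (C1 A) (Dom (C2 A) s) = Dom (C1 A) u\<rbrakk> \<Longrightarrow>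
    (s \<cdot>\<^bsub>C2 A\<^esub> t) *\<^bsub>A\<^esub> Ide (C2 A) u = (s *\<^bsub>A\<^esub> Ide (C2 A) u) \<cdot>\<^bsub>C2 A\<^esub> (t *\<^bsub>A\<^esub> Ide (C2 A) u)"
  by (simp add: hcmp_cmp)

lemma whisker_left_cmp:
  "\<lbrakk>u \<in> Ar (C1 A); v \<in> Ar (C1 A); s \<in> Ar (C2 A); Cod (C1 A) u = Dom (C1 A) v;
    Cod (C1 A) v = Dom (C1 A) (Dom (C2 A) s)\<rbrakk> \<Longrightarrow>
    Ide (C2 A) (u \<cdot>\<^bsub>C1 A\<^esub> v) *\<^bsub>A\<^esub> s = Ide (C2 A) u *\<^bsub>A\<^esub> (Ide (C2 A) v *\<^bsub>A\<^esub> s)"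
  by (subst assoc_hcmp[symmetric]) simp_all

lemma whisker_right_cmp:
  "\<lbrakk>u \<in> Ar (C1 A); v \<in> Ar (C1 A); s \<in> Ar (C2 A); Cod (C1 A) u = Dom (C1 A) v;
    Cod (C1 A) (Dom (C2 A) s) = Dom (C1 A) u\<rbrakk> \<Longrightarrow>
    s *\<^bsub>A\<^esub> Ide (C2 A) (u \<cdot>\<^bsub>C1 A\<^esub> v) = s *\<^bsub>A\<^esub> Ide (C2 A) u *\<^bsub>A\<^esub> Ide (C2 A) v"
  by (subst assoc_hcmp) simp_all

lemma whisker_both:
  "\<lbrakk>u \<in> Ar (C1 A); v \<in> Ar (C1 A); s \<in> Ar (C2 A); Cod (C1 A) u = Dom (C1 A) (Dom (C2 A) s);
    Cod (C1 A) (Dom (C2 A) s) = Dom (C1 A) v\<rbrakk> \<Longrightarrow>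
    Ide (C2 A) u *\<^bsub>A\<^esub> s *\<^bsub>A\<^esub> Ide (C2 A) v = Ide (C2 A) u *\<^bsub>A\<^esub> (s *\<^bsub>A\<^esub> Ide (C2 A) v)"
  by (simp add: assoc_hcmp)

text \<open>As rewrite rules these bring 2-cell expressions to vertical composites of 2-cells
  whiskered by one 1-cell at a time, after which naturality facts match syntactically.\<close>

lemmas whisker = whisker_left whisker_right whisker_left_cmp whisker_right_cmp whisker_both

lemma hcmp_eq_whisker:
  assumes "s \<in> Ar (C2 A)" "t \<in> Ar (C2 A)" "Cod (C1 A) (Dom (C2 A) s) = Dom (C1 A) (Dom (C2 A) t)"
  shows "s *\<^bsub>A\<^esub> t = (Ide (C2 A) (Dom (C2 A) s) *\<^bsub>A\<^esub> t) \<cdot>\<^bsub>C2 A\<^esub> (s *\<^bsub>A\<^esub> Ide (C2 A) (Cod (C2 A) t))"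
    and "s *\<^bsub>A\<^esub> t = (s *\<^bsub>A\<^esub> Ide (C2 A) (Dom (C2 A) t)) \<cdot>\<^bsub>C2 A\<^esub> (Ide (C2 A) (Cod (C2 A) s) *\<^bsub>A\<^esub> t)"
  using assms by (simp_all add: hcmp_cmp)

text \<open>Two 2-cells acting on adjacent 1-cells slide past each other, since both sides are
  factorisations of the horizontal composite of \<open>s\<close> and \<open>t\<close>.\<close>

lemma whisker_swap:
  assumes "s \<in> Ar (C2 A)" "t \<in> Ar (C2 A)" "Cod (C1 A) (Dom (C2 A) s) = Dom (C1 A) (Dom (C2 A) t)"
    "Dom (C2 A) s = a" "Cod (C2 A) s = b" "Dom (C2 A) t = c" "Cod (C2 A) t = d"
  shows "(Ide (C2 A) a *\<^bsub>A\<^esub> t) \<cdot>\<^bsub>C2 A\<^esub> (s *\<^bsub>A\<^esub> Ide (C2 A) d) =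
    (s *\<^bsub>A\<^esub> Ide (C2 A) c) \<cdot>\<^bsub>C2 A\<^esub> (Ide (C2 A) b *\<^bsub>A\<^esub> t)"
  using hcmp_eq_whisker[of s t] assms by metis

end

section \<open>2-functors\<close>

context two_functor
begin

lemma on0_in [simp]: "x \<in> Ob (C1 A) \<Longrightarrow> on0 F x \<in> Ob (C1 B)"
  using cat_functor.ob_in[OF functor1] by simp

lemma on1_simps [simp]:
  assumes "f \<in> Ar (C1 A)"
  shows "on1 F f \<in> Ar (C1 B)" "Dom (C1 B) (on1 F f) = on0 F (Dom (C1 A) f)"
    "Cod (C1 B) (on1 F f) = on0 F (Cod (C1 A) f)"
  using cat_functor.ar_simps[OF functor1, of f] assms by simp_all

lemma on2_simps [simp]:
  assumes "s \<in> Ar (C2 A)"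
  shows "on2 F s \<in> Ar (C2 B)" "Dom (C2 B) (on2 F s) = on1 F (Dom (C2 A) s)"
    "Cod (C2 B) (on2 F s) = on1 F (Cod (C2 A) s)"
  using cat_functor.ar_simps[OF functor2, of s] assms by simp_all

lemma on1_cmp [simp]:
  "f \<in> Ar (C1 A) \<Longrightarrow> g \<in> Ar (C1 A) \<Longrightarrow> Cod (C1 A) f = Dom (C1 A) g \<Longrightarrow>
    on1 F (f \<cdot>\<^bsub>C1 A\<^esub> g) = on1 F f \<cdot>\<^bsub>C1 B\<^esub> on1 F g"
  using cat_functor.cmp_image[OF functor1, of f g] by simp

lemma on2_cmp [simp]:
  "s \<in> Ar (C2 A) \<Longrightarrow> t \<in> Ar (C2 A) \<Longrightarrow> Cod (C2 A) s = Dom (C2 A) t \<Longrightarrow>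
    on2 F (s \<cdot>\<^bsub>C2 A\<^esub> t) = on2 F s \<cdot>\<^bsub>C2 B\<^esub> on2 F t"
  using cat_functor.cmp_image[OF functor2, of s t] by simp

lemma on1_ide [simp]: "x \<in> Ob (C1 A) \<Longrightarrow> on1 F (Ide (C1 A) x) = Ide (C1 B) (on0 F x)"
  using cat_functor.pres_ide[OF functor1, of x] by simp

lemma on2_ide [simp]: "two_category A \<Longrightarrow> f \<in> Ar (C1 A) \<Longrightarrow> on2 F (Ide (C2 A) f) = Ide (C2 B) (on1 F f)"
  using cat_functor.pres_ide[OF functor2, of f] by (simp add: two_category.ob2)

lemma on2_hcmp [simp]:
  "two_category A \<Longrightarrow> s \<in> Ar (C2 A) \<Longrightarrow> t \<in> Ar (C2 A) \<Longrightarrow>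
    Cod (C1 A) (Dom (C2 A) s) = Dom (C1 A) (Dom (C2 A) t) \<Longrightarrow> on2 F (s *\<^bsub>A\<^esub> t) = on2 F s *\<^bsub>B\<^esub> on2 F t"
  using pres_hcmp by (simp add: two_category.two_hom_iff)

lemma on_extensional:
  "on0 F \<in> extensional (Ob (C1 A))" "on1 F \<in> extensional (Ar (C1 A))"
  "on2 F \<in> extensional (Ar (C2 A))"
  using cat_functor.ob_ext[OF functor1] cat_functor.ar_ext[OF functor1]
    cat_functor.ar_ext[OF functor2] by simp_all

end

section \<open>The 2-category of product preserving 2-functors\<close>

locale two_categories = A: two_category A + B: two_category B
  for A :: "('o, 'a, 't) two_cat" and B :: "('p, 'b, 'u) two_cat"
begin

abbreviation cmp1 (infixl "\<cdot>" 70) where "f \<cdot> g \<equiv> Cmp (C1 B) f g"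
abbreviation cmp2 (infixl "\<bullet>" 65) where "s \<bullet> t \<equiv> Cmp (C2 B) s t"
abbreviation hcmp (infixl "\<star>" 70) where "s \<star> t \<equiv> HCmp B s t"
abbreviation ide2 ("\<iota>") where "\<iota> f \<equiv> Ide (C2 B) f"

end

locale transformation = two_categories A B + two_lax_transformation A B \<alpha> +
    S: two_functor A B "nsrc \<alpha>" + T: two_functor A B "ntgt \<alpha>"
  for A :: "('o, 'a, 't) two_cat" and B :: "('p, 'b, 'u) two_cat"
    and \<alpha> :: "('o, 'a, 't, 'p, 'b, 'u) lax_nat"
begin

lemma nob_simps [simp]:
  assumes "x \<in> Ob (C1 A)"
  shows "nob \<alpha> x \<in> Ar (C1 B)" "Dom (C1 B) (nob \<alpha> x) = on0 (nsrc \<alpha>) x"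
    "Cod (C1 B) (nob \<alpha> x) = on0 (ntgt \<alpha>) x"
  using ob_hom[OF assms] by (auto simp: hom_iff)

lemma nar_simps [simp]:
  assumes "f \<in> Ar (C1 A)"
  shows "nar \<alpha> f \<in> Ar (C2 B)"
    "Dom (C2 B) (nar \<alpha> f) = nob \<alpha> (Dom (C1 A) f) \<cdot> on1 (ntgt \<alpha>) f"
    "Cod (C2 B) (nar \<alpha> f) = on1 (nsrc \<alpha>) f \<cdot> nob \<alpha> (Cod (C1 A) f)"
  using ar_hom[of f "Dom (C1 A) f" "Cod (C1 A) f"] assms by (auto simp: hom_iff)

lemma nar_natural:
  assumes "s \<in> Ar (C2 A)" "Dom (C2 A) s = f" "Cod (C2 A) s = g" "Dom (C1 A) f = x" "Cod (C1 A) f = y"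
  shows "nar \<alpha> f \<bullet> (on2 (nsrc \<alpha>) s \<star> \<iota> (nob \<alpha> y)) = (\<iota> (nob \<alpha> x) \<star> on2 (ntgt \<alpha>) s) \<bullet> nar \<alpha> g"
  using natural[of f x y g s] A.arrow_simps[OF assms(1)] assms by (auto simp: hom_iff)

lemma nar_cmp:
  "f \<in> Ar (C1 A) \<Longrightarrow> g \<in> Ar (C1 A) \<Longrightarrow> Cod (C1 A) f = Dom (C1 A) g \<Longrightarrow>
    nar \<alpha> (f \<cdot>\<^bsub>C1 A\<^esub> g) = (nar \<alpha> f \<star> \<iota> (on1 (ntgt \<alpha>) g)) \<bullet> (\<iota> (on1 (nsrc \<alpha>) f) \<star> nar \<alpha> g)"
  using ar_cmp[of f _ _ g] by (simp add: hom_iff)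

end

lemma transformationI:
  assumes "two_category A" "two_category B" "two_lax_transformation A B \<alpha>"
    "two_functor A B (nsrc \<alpha>)" "two_functor A B (ntgt \<alpha>)"
  shows "transformation A B \<alpha>"
  using assms by (simp add: transformation_def two_categories_def)

locale composable_transformations = \<alpha>: transformation A B \<alpha> + \<beta>: transformation A B \<beta>
  for A :: "('o, 'a, 't) two_cat" and B :: "('p, 'b, 'u) two_cat"
    and \<alpha> \<beta> :: "('o, 'a, 't, 'p, 'b, 'u) lax_nat" +
  assumes meet [simp]: "nsrc \<beta> = ntgt \<alpha>"
begin

sublocale two_categories A B ..

text \<open>Pasting: the structure 2-cell of the composite is that of \<open>\<beta>\<close>
  whiskered by \<open>\<alpha>\<close> followed by that of \<open>\<alpha>\<close> whiskered by
  \<open>\<beta>\<close>, and naturality follows by whiskering the two naturality squares.\<close>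

lemma lax_transformation_cmp: "two_lax_transformation A B (lax_nat_cmp A B \<alpha> \<beta>)"
proof (unfold_locales, unfold hom_iff)
  fix f g x y s
  assume "f \<in> Ar (C1 A) \<and> Dom (C1 A) f = x \<and> Cod (C1 A) f = y"
    "g \<in> Ar (C1 A) \<and> Dom (C1 A) g = x \<and> Cod (C1 A) g = y"
    "s \<in> Ar (C2 A) \<and> Dom (C2 A) s = f \<and> Cod (C2 A) s = g"
  then have [simp]: "f \<in> Ar (C1 A)" "Dom (C1 A) f = x" "Cod (C1 A) f = y"
    "g \<in> Ar (C1 A)" "Dom (C1 A) g = x" "Cod (C1 A) g = y" and
    s [simp]: "s \<in> Ar (C2 A)" "Dom (C2 A) s = f" "Cod (C2 A) s = g" by auto
  have [simp]: "x \<in> Ob (C1 A)" "y \<in> Ob (C1 A)"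
    using \<alpha>.A.c1.dom_cod_Ob[of f] by simp_all
  let ?F = "nsrc \<alpha>" and ?G = "ntgt \<alpha>" and ?H = "ntgt \<beta>"
  have 1: "(nar \<alpha> f \<star> \<iota> (nob \<beta> y)) \<bullet> (on2 ?F s \<star> \<iota> (nob \<alpha> y) \<star> \<iota> (nob \<beta> y)) =
    (\<iota> (nob \<alpha> x) \<star> (on2 ?G s \<star> \<iota> (nob \<beta> y))) \<bullet> (nar \<alpha> g \<star> \<iota> (nob \<beta> y))"
    using arg_cong[OF \<alpha>.nar_natural[of s f g x y], of "\<lambda>u. u \<star> \<iota> (nob \<beta> y)"]
    by (simp add: \<alpha>.B.whisker)
  have 2: "(\<iota> (nob \<alpha> x) \<star> nar \<beta> f) \<bullet> (\<iota> (nob \<alpha> x) \<star> (on2 ?G s \<star> \<iota> (nob \<beta> y))) =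
    (\<iota> (nob \<alpha> x) \<star> (\<iota> (nob \<beta> x) \<star> on2 ?H s)) \<bullet> (\<iota> (nob \<alpha> x) \<star> nar \<beta> g)"
    using arg_cong[OF \<beta>.nar_natural[of s f g x y], of "\<lambda>u. \<iota> (nob \<alpha> x) \<star> u"]
    by (simp add: \<alpha>.B.whisker)
  show "nar (lax_nat_cmp A B \<alpha> \<beta>) f \<bullet>
      (on2 (nsrc (lax_nat_cmp A B \<alpha> \<beta>)) s \<star> \<iota> (nob (lax_nat_cmp A B \<alpha> \<beta>) y)) =
    (\<iota> (nob (lax_nat_cmp A B \<alpha> \<beta>) x) \<star> on2 (ntgt (lax_nat_cmp A B \<alpha> \<beta>)) s) \<bullet>
      nar (lax_nat_cmp A B \<alpha> \<beta>) g"
    by (simp add: lax_nat_cmp_def \<alpha>.B.whisker 1 \<alpha>.B.c2.cmp_extend[OF 2])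
next
  fix f g x y z
  assume "f \<in> Ar (C1 A) \<and> Dom (C1 A) f = x \<and> Cod (C1 A) f = y"
    "g \<in> Ar (C1 A) \<and> Dom (C1 A) g = y \<and> Cod (C1 A) g = z"
  then have [simp]: "f \<in> Ar (C1 A)" "Dom (C1 A) f = x" "Cod (C1 A) f = y"
    "g \<in> Ar (C1 A)" "Dom (C1 A) g = y" "Cod (C1 A) g = z" by auto
  have [simp]: "x \<in> Ob (C1 A)" "y \<in> Ob (C1 A)" "z \<in> Ob (C1 A)"
    using \<alpha>.A.c1.dom_cod_Ob[of f] \<alpha>.A.c1.dom_cod_Ob[of g] by simp_all
  \<comment> \<open>The two ways of pasting meet \<open>nar \<alpha> f\<close> and
    \<open>nar \<beta> g\<close> in opposite orders. They act on disjoint stretches of 1-cells, so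
    interchange lets them slide past each other.\<close>
  have 1: "(\<iota> (nob \<alpha> x) \<star> (\<iota> (on1 (ntgt \<alpha>) f) \<star> nar \<beta> g)) \<bullet>
      (nar \<alpha> f \<star> \<iota> (on1 (ntgt \<alpha>) g) \<star> \<iota> (nob \<beta> z)) =
    (nar \<alpha> f \<star> \<iota> (nob \<beta> y) \<star> \<iota> (on1 (ntgt \<beta>) g)) \<bullet>
      (\<iota> (on1 (nsrc \<alpha>) f) \<star> (\<iota> (nob \<alpha> y) \<star> nar \<beta> g))"
    using \<alpha>.B.whisker_swap[OF _ _ _ refl refl refl refl, of "nar \<alpha> f" "nar \<beta> g"] by (simp add: \<alpha>.B.whisker)
  show "nar (lax_nat_cmp A B \<alpha> \<beta>) (f \<cdot>\<^bsub>C1 A\<^esub> g) =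
    (nar (lax_nat_cmp A B \<alpha> \<beta>) f \<star> \<iota> (on1 (ntgt (lax_nat_cmp A B \<alpha> \<beta>)) g)) \<bullet>
      (\<iota> (on1 (nsrc (lax_nat_cmp A B \<alpha> \<beta>)) f) \<star> nar (lax_nat_cmp A B \<alpha> \<beta>) g)"
    by (simp add: lax_nat_cmp_def \<alpha>.B.whisker \<alpha>.nar_cmp \<beta>.nar_cmp \<alpha>.B.c2.cmp_extend[OF 1])
qed (auto simp: lax_nat_cmp_def \<alpha>.ar_ide \<beta>.ar_ide)

text \<open>Both whiskered structure 2-cells are identities, so what remains is to paste the two
  boundary equations.\<close>

lemma two_strict_at_cmp:
  assumes "two_strict_at B \<alpha> x y f" "two_strict_at B \<beta> x y f" "f \<in> hom (C1 A) x y"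
  shows "two_strict_at B (lax_nat_cmp A B \<alpha> \<beta>) x y f"
proof -
  have [simp]: "f \<in> Ar (C1 A)" "Dom (C1 A) f = x" "Cod (C1 A) f = y"
    using assms by (auto simp: hom_iff)
  have [simp]: "x \<in> Ob (C1 A)" "y \<in> Ob (C1 A)" using \<alpha>.A.c1.dom_cod_Ob[of f] by simp_all
  have a: "nob \<alpha> x \<cdot> on1 (ntgt \<alpha>) f = on1 (nsrc \<alpha>) f \<cdot> nob \<alpha> y"
    and b: "nob \<beta> x \<cdot> on1 (ntgt \<beta>) f = on1 (ntgt \<alpha>) f \<cdot> nob \<beta> y"
    and [simp]: "nar \<alpha> f = \<iota> (on1 (nsrc \<alpha>) f \<cdot> nob \<alpha> y)" "nar \<beta> f = \<iota> (on1 (ntgt \<alpha>) f \<cdot> nob \<beta> y)"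
    using assms(1,2) by (auto simp: two_strict_at_def)
  show ?thesis
    unfolding two_strict_at_def lax_nat_cmp_def
    by (simp add: b) (simp add: \<alpha>.B.c1.cmp_extend[OF a])
qed

end

text \<open>Component maps of identities and composites are built by \<open>restrict\<close>;
  against an extensional map they have to be compared on the carrier only.\<close>

lemma restrict_eqI: "f \<in> extensional S \<Longrightarrow> (\<And>x. x \<in> S \<Longrightarrow> g x = f x) \<Longrightarrow> restrict g S = f"
  by (auto simp: extensional_def restrict_def fun_eq_iff)


section \<open>Modifications\<close>

locale modification_of = two_categories A B + modification A B \<mu> +
    S: transformation A B "msrc \<mu>" + T: transformation A B "mtgt \<mu>"
  for A :: "('o, 'a, 't) two_cat" and B :: "('p, 'b, 'u) two_cat"
    and \<mu> :: "('o, 'a, 't, 'p, 'b, 'u) modif"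
begin

lemma ends [simp]: "nsrc (mtgt \<mu>) = nsrc (msrc \<mu>)" "ntgt (mtgt \<mu>) = ntgt (msrc \<mu>)"
  using same_src same_tgt by simp_all

lemma mob_simps [simp]:
  assumes "x \<in> Ob (C1 A)"
  shows "mob \<mu> x \<in> Ar (C2 B)" "Dom (C2 B) (mob \<mu> x) = nob (msrc \<mu>) x"
    "Cod (C2 B) (mob \<mu> x) = nob (mtgt \<mu>) x"
  using ob_hom[OF assms] by (auto simp: hom_iff)

lemma mob_natural:
  "f \<in> Ar (C1 A) \<Longrightarrow> Dom (C1 A) f = x \<Longrightarrow> Cod (C1 A) f = y \<Longrightarrow>
    nar (msrc \<mu>) f \<bullet> (\<iota> (on1 (nsrc (msrc \<mu>)) f) \<star> mob \<mu> y) =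
      (mob \<mu> x \<star> \<iota> (on1 (ntgt (msrc \<mu>)) f)) \<bullet> nar (mtgt \<mu>) f"
  using natural[of f x y] by (simp add: hom_iff)

text \<open>The modification axiom speaks of 1-cells, while the axiom of a modulation ranges over
  all cells. Naturality of the source transformation in \<open>s\<close> supplies the
  difference.\<close>

lemma mob_natural2:
  assumes "s \<in> Ar (C2 A)" "Dom (C2 A) s = f" "Cod (C2 A) s = g" "Dom (C1 A) f = x" "Cod (C1 A) f = y"
  shows "nar (msrc \<mu>) f \<bullet> (on2 (nsrc (msrc \<mu>)) s \<star> mob \<mu> y) =
      (mob \<mu> x \<star> on2 (ntgt (msrc \<mu>)) s) \<bullet> nar (mtgt \<mu>) g"
proof -
  let ?F = "nsrc (msrc \<mu>)" and ?G = "ntgt (msrc \<mu>)"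
  have [simp]: "f \<in> Ar (C1 A)" "g \<in> Ar (C1 A)" "Dom (C1 A) g = x" "Cod (C1 A) g = y"
    "x \<in> Ob (C1 A)" "y \<in> Ob (C1 A)"
    using A.arrow_simps[OF assms(1)] A.c1.dom_cod_Ob[of f] by (auto simp: assms)
  note [simp] = assms
  have 1: "on2 ?F s \<star> mob \<mu> y = (on2 ?F s \<star> \<iota> (nob (msrc \<mu>) y)) \<bullet> (\<iota> (on1 ?F g) \<star> mob \<mu> y)"
    and 2: "mob \<mu> x \<star> on2 ?G s = (\<iota> (nob (msrc \<mu>) x) \<star> on2 ?G s) \<bullet> (mob \<mu> x \<star> \<iota> (on1 ?G g))"
    by (simp_all add: B.hcmp_cmp)
  show ?thesis
    by (simp add: 1 2 B.c2.cmp_extend[OF S.nar_natural[OF assms]])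
      (simp add: mob_natural B.hcmp_cmp)
qed

end

lemma (in two_categories) modification_ofI:
  assumes "transformation A B (msrc \<mu>)" "transformation A B (mtgt \<mu>)" "modification A B \<mu>"
  shows "modification_of A B \<mu>"
  using assms two_categories_axioms by (simp add: modification_of_def)

section \<open>Identities and composites of cartesian transformations and modifications\<close>

locale cartesian_target = two_categories A B
  for A :: "('o, 'a, 't) two_cat" and B :: "('p, 'b, 'u) two_cat" +
  fixes P :: "('o, 'a) prods"
  assumes P: "chosen_products (C1 A) P"
begin

definition cart_functor :: "('o, 'a, 't, 'p, 'b, 'u) two_fctr \<Rightarrow> bool"
  where "cart_functor F \<longleftrightarrow> two_functor A B F \<and> preserves_2products A B F"

definition cart_transf :: "('o, 'a, 't, 'p, 'b, 'u) lax_nat \<Rightarrow> bool"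
  where "cart_transf \<alpha> \<longleftrightarrow> cart_functor (nsrc \<alpha>) \<and> cart_functor (ntgt \<alpha>) \<and>
    two_lax_transformation A B \<alpha> \<and> two_cartesian_transformation A P B \<alpha>"

definition cart_modif :: "('o, 'a, 't, 'p, 'b, 'u) modif \<Rightarrow> bool"
  where "cart_modif \<mu> \<longleftrightarrow> cart_transf (msrc \<mu>) \<and> cart_transf (mtgt \<mu>) \<and> modification A B \<mu>"

lemma Cart2Cat_simps:
  "Ob (C1 (Cart2Cat A P B)) = {F. cart_functor F}"
  "Ar (C1 (Cart2Cat A P B)) = {\<alpha>. cart_transf \<alpha>}"
  "Dom (C1 (Cart2Cat A P B)) = nsrc" "Cod (C1 (Cart2Cat A P B)) = ntgt"
  "Ide (C1 (Cart2Cat A P B)) = lax_nat_ide A B" "Cmp (C1 (Cart2Cat A P B)) = lax_nat_cmp A B"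
  "Ob (C2 (Cart2Cat A P B)) = {\<alpha>. cart_transf \<alpha>}"
  "Ar (C2 (Cart2Cat A P B)) = {\<mu>. cart_modif \<mu>}"
  "Dom (C2 (Cart2Cat A P B)) = msrc" "Cod (C2 (Cart2Cat A P B)) = mtgt"
  "Ide (C2 (Cart2Cat A P B)) = (\<lambda>\<alpha>. \<lparr>msrc = \<alpha>, mtgt = \<alpha>, mob = (\<lambda>x \<in> Ob (C1 A). \<iota> (nob \<alpha> x))\<rparr>)"
  "Cmp (C2 (Cart2Cat A P B)) = (\<lambda>\<mu> \<nu>. \<lparr>msrc = msrc \<mu>, mtgt = mtgt \<nu>,
    mob = (\<lambda>x \<in> Ob (C1 A). mob \<mu> x \<bullet> mob \<nu> x)\<rparr>)"
  "HCmp (Cart2Cat A P B) = (\<lambda>\<mu> \<nu>. \<lparr>msrc = lax_nat_cmp A B (msrc \<mu>) (msrc \<nu>),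
    mtgt = lax_nat_cmp A B (mtgt \<mu>) (mtgt \<nu>), mob = (\<lambda>x \<in> Ob (C1 A). mob \<mu> x \<star> mob \<nu> x)\<rparr>)"
  by (simp_all add: Cart2Cat_def Let_def cart_functor_def cart_transf_def cart_modif_def)

lemma cart_transfD: "cart_transf \<alpha> \<Longrightarrow> transformation A B \<alpha>"
  using A.two_category_axioms B.two_category_axioms
  by (intro transformationI) (auto simp: cart_transf_def cart_functor_def)

lemma cart_modifD: "cart_modif \<mu> \<Longrightarrow> modification_of A B \<mu>"
  by (intro modification_ofI cart_transfD) (auto simp: cart_modif_def)

lemma proj_simps [simp]:
  assumes "x \<in> Ob (C1 A)" "y \<in> Ob (C1 A)"
  shows "Prod P x y \<in> Ob (C1 A)"
    "Proj1 P x y \<in> Ar (C1 A)" "Dom (C1 A) (Proj1 P x y) = Prod P x y" "Cod (C1 A) (Proj1 P x y) = x"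
    "Proj2 P x y \<in> Ar (C1 A)" "Dom (C1 A) (Proj2 P x y) = Prod P x y" "Cod (C1 A) (Proj2 P x y) = y"
  using P assms by (auto simp: chosen_products_def dest: A.c1.productD)

lemma cart_transf_ide:
  assumes F: "cart_functor F" shows "cart_transf (lax_nat_ide A B F)"
proof -
  interpret F: two_functor A B F using F by (simp add: cart_functor_def)
  have "two_lax_transformation A B (lax_nat_ide A B F)"
    by unfold_locales
      (auto simp: lax_nat_ide_def hom_iff A.two_category_axioms)
  moreover have "two_cartesian_transformation A P B (lax_nat_ide A B F)"
    by (simp add: two_cartesian_transformation_def two_strict_at_def lax_nat_ide_def)
  ultimately show ?thesis using F by (simp add: cart_transf_def lax_nat_ide_def)
qed

lemma cart_transf_cmp:
  assumes "cart_transf \<alpha>" "cart_transf \<beta>" "ntgt \<alpha> = nsrc \<beta>"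
  shows "cart_transf (lax_nat_cmp A B \<alpha> \<beta>)"
proof -
  interpret composable_transformations A B \<alpha> \<beta>
    using assms by (simp add: composable_transformations_def cart_transfD
      composable_transformations_axioms_def)
  show ?thesis
    using assms(1,2) lax_transformation_cmp
    by (auto simp: cart_transf_def two_cartesian_transformation_def hom_iff
        intro!: two_strict_at_cmp) (auto simp: lax_nat_cmp_def)
qed

lemma cart_modif_ide:
  assumes "cart_transf \<alpha>"
  shows "cart_modif \<lparr>msrc = \<alpha>, mtgt = \<alpha>, mob = (\<lambda>x \<in> Ob (C1 A). \<iota> (nob \<alpha> x))\<rparr>"
proof -
  interpret transformation A B \<alpha> using assms by (rule cart_transfD)
  show ?thesis
    unfolding cart_modif_def using assms
    by (auto simp: hom_iff intro!: modification.intro)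
qed

lemma cart_modif_cmp:
  assumes \<mu>: "cart_modif \<mu>" and \<nu>: "cart_modif \<nu>" and m: "mtgt \<mu> = msrc \<nu>"
  shows "cart_modif \<lparr>msrc = msrc \<mu>, mtgt = mtgt \<nu>, mob = (\<lambda>x \<in> Ob (C1 A). mob \<mu> x \<bullet> mob \<nu> x)\<rparr>"
proof -
  interpret \<mu>: modification_of A B \<mu> using \<mu> by (rule cart_modifD)
  interpret \<nu>: modification_of A B \<nu> using \<nu> by (rule cart_modifD)
  note [simp] = m[symmetric]
  have e [simp]: "nsrc (mtgt \<nu>) = nsrc (msrc \<mu>)" "ntgt (mtgt \<nu>) = ntgt (msrc \<mu>)"
    using \<nu>.ends by simp_all
  have "modification A B \<lparr>msrc = msrc \<mu>, mtgt = mtgt \<nu>,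
    mob = (\<lambda>x \<in> Ob (C1 A). mob \<mu> x \<bullet> mob \<nu> x)\<rparr>"
  proof (rule modification.intro, unfold hom_iff)
    fix f x y assume f: "f \<in> Ar (C1 A) \<and> Dom (C1 A) f = x \<and> Cod (C1 A) f = y"
    then have [simp]: "f \<in> Ar (C1 A)" "Dom (C1 A) f = x" "Cod (C1 A) f = y"
      "x \<in> Ob (C1 A)" "y \<in> Ob (C1 A)" by auto
    note 1 = \<mu>.mob_natural[of f x y, simplified] and 2 = \<nu>.mob_natural[of f x y, simplified]
    show "nar (msrc \<lparr>msrc = msrc \<mu>, mtgt = mtgt \<nu>, mob = (\<lambda>x \<in> Ob (C1 A). mob \<mu> x \<bullet> mob \<nu> x)\<rparr>) f \<bullet>
      (\<iota> (on1 (nsrc (msrc \<lparr>msrc = msrc \<mu>, mtgt = mtgt \<nu>, mob = (\<lambda>x \<in> Ob (C1 A). mob \<mu> x \<bullet> mob \<nu> x)\<rparr>)) f) \<star>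
        mob \<lparr>msrc = msrc \<mu>, mtgt = mtgt \<nu>, mob = (\<lambda>x \<in> Ob (C1 A). mob \<mu> x \<bullet> mob \<nu> x)\<rparr> y) =
      (mob \<lparr>msrc = msrc \<mu>, mtgt = mtgt \<nu>, mob = (\<lambda>x \<in> Ob (C1 A). mob \<mu> x \<bullet> mob \<nu> x)\<rparr> x \<star>
        \<iota> (on1 (ntgt (msrc \<lparr>msrc = msrc \<mu>, mtgt = mtgt \<nu>, mob = (\<lambda>x \<in> Ob (C1 A). mob \<mu> x \<bullet> mob \<nu> x)\<rparr>)) f)) \<bullet>
      nar (mtgt \<lparr>msrc = msrc \<mu>, mtgt = mtgt \<nu>, mob = (\<lambda>x \<in> Ob (C1 A). mob \<mu> x \<bullet> mob \<nu> x)\<rparr>) f"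
      by (simp add: B.whisker) (simp add: B.c2.cmp_extend[OF 1], simp add: 2)
  qed auto
  then show ?thesis using \<mu> \<nu> by (simp add: cart_modif_def)
qed

text \<open>Fact \<open>h\<close> splits the horizontal composite into two whiskerings. Facts 1 and
  4 are the axioms of \<open>\<mu>\<close> and \<open>\<nu>\<close> whiskered by a 1-cell; facts 2
  and 3 slide a component of a modification past a structure 2-cell acting on neighbouring
  1-cells.\<close>

lemma cart_modif_hcmp:
  assumes \<mu>: "cart_modif \<mu>" and \<nu>: "cart_modif \<nu>" and m: "ntgt (msrc \<mu>) = nsrc (msrc \<nu>)"
  shows "cart_modif \<lparr>msrc = lax_nat_cmp A B (msrc \<mu>) (msrc \<nu>),
    mtgt = lax_nat_cmp A B (mtgt \<mu>) (mtgt \<nu>), mob = (\<lambda>x \<in> Ob (C1 A). mob \<mu> x \<star> mob \<nu> x)\<rparr>"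
    (is "cart_modif ?\<rho>")
proof -
  interpret \<mu>: modification_of A B \<mu> using \<mu> by (rule cart_modifD)
  interpret \<nu>: modification_of A B \<nu> using \<nu> by (rule cart_modifD)
  note [simp] = m[symmetric]
  have e [simp]: "nsrc (mtgt \<nu>) = ntgt (msrc \<mu>)"
    using \<nu>.ends by simp
  have "modification A B ?\<rho>"
  proof (rule modification.intro, unfold hom_iff)
    fix f x y assume f: "f \<in> Ar (C1 A) \<and> Dom (C1 A) f = x \<and> Cod (C1 A) f = y"
    then have [simp]: "f \<in> Ar (C1 A)" "Dom (C1 A) f = x" "Cod (C1 A) f = y"
      "x \<in> Ob (C1 A)" "y \<in> Ob (C1 A)" by auto
    let ?F = "nsrc (msrc \<mu>)" and ?G = "ntgt (msrc \<mu>)" and ?H = "ntgt (msrc \<nu>)"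
      and ?\<alpha> = "msrc \<mu>" and ?\<alpha>' = "mtgt \<mu>" and ?\<beta> = "msrc \<nu>" and ?\<beta>' = "mtgt \<nu>"
    have h: "mob \<mu> z \<star> mob \<nu> z = (mob \<mu> z \<star> \<iota> (nob ?\<beta> z)) \<bullet> (\<iota> (nob ?\<alpha>' z) \<star> mob \<nu> z)"
      if "z \<in> Ob (C1 A)" for z using that by (simp add: B.hcmp_cmp)
    have 1: "(nar ?\<alpha> f \<star> \<iota> (nob ?\<beta> y)) \<bullet> (\<iota> (on1 ?F f) \<star> (mob \<mu> y \<star> \<iota> (nob ?\<beta> y))) =
      (mob \<mu> x \<star> \<iota> (on1 ?G f) \<star> \<iota> (nob ?\<beta> y)) \<bullet> (nar ?\<alpha>' f \<star> \<iota> (nob ?\<beta> y))"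
      using arg_cong[OF \<mu>.mob_natural[of f x y, simplified], of "\<lambda>u. u \<star> \<iota> (nob ?\<beta> y)"]
      by (simp add: B.whisker)
    have 2: "(nar ?\<alpha>' f \<star> \<iota> (nob ?\<beta> y)) \<bullet> (\<iota> (on1 ?F f) \<star> (\<iota> (nob ?\<alpha>' y) \<star> mob \<nu> y)) =
      (\<iota> (nob ?\<alpha>' x) \<star> (\<iota> (on1 ?G f) \<star> mob \<nu> y)) \<bullet> (nar ?\<alpha>' f \<star> \<iota> (nob ?\<beta>' y))"
      using B.whisker_swap[OF _ _ _ refl refl refl refl, of "nar ?\<alpha>' f" "mob \<nu> y"]
      by (simp add: B.whisker)
    have 3: "(\<iota> (nob ?\<alpha> x) \<star> nar ?\<beta> f) \<bullet> (mob \<mu> x \<star> \<iota> (on1 ?G f) \<star> \<iota> (nob ?\<beta> y)) =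
      (mob \<mu> x \<star> \<iota> (nob ?\<beta> x) \<star> \<iota> (on1 ?H f)) \<bullet> (\<iota> (nob ?\<alpha>' x) \<star> nar ?\<beta> f)"
      using B.whisker_swap[OF _ _ _ refl refl refl refl, of "mob \<mu> x" "nar ?\<beta> f"]
      by (simp add: B.whisker)
    have 4: "(\<iota> (nob ?\<alpha>' x) \<star> nar ?\<beta> f) \<bullet> (\<iota> (nob ?\<alpha>' x) \<star> (\<iota> (on1 ?G f) \<star> mob \<nu> y)) =
      (\<iota> (nob ?\<alpha>' x) \<star> (mob \<nu> x \<star> \<iota> (on1 ?H f))) \<bullet> (\<iota> (nob ?\<alpha>' x) \<star> nar ?\<beta>' f)"
      using arg_cong[OF \<nu>.mob_natural[of f x y, simplified], of "\<lambda>u. \<iota> (nob ?\<alpha>' x) \<star> u"]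
      by (simp add: B.whisker)
    show "nar (msrc ?\<rho>) f \<bullet> (\<iota> (on1 (nsrc (msrc ?\<rho>)) f) \<star> mob ?\<rho> y) =
      (mob ?\<rho> x \<star> \<iota> (on1 (ntgt (msrc ?\<rho>)) f)) \<bullet> nar (mtgt ?\<rho>) f"
      by (simp add: lax_nat_cmp_def h B.whisker B.c2.cmp_extend[OF 1])
        (simp add: 2 B.c2.cmp_extend[OF 3] B.c2.cmp_extend[OF 4])
  qed (auto simp: lax_nat_cmp_def)
  then show ?thesis using \<mu> \<nu> by (auto simp: cart_modif_def intro!: cart_transf_cmp)
qed

text \<open>All operations are componentwise, so by extensionality each law reduces, at every object
  or arrow of \<open>A\<close>, to the same law in \<open>B\<close> or to an identity between
  normalised whiskerings.\<close>

theorem two_category_Cart2Cat: "two_category (Cart2Cat A P B)"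
proof -
  note [simp] = Cart2Cat_simps
  have src: "cart_functor (nsrc \<alpha>)" "cart_functor (ntgt \<alpha>)" if "cart_transf \<alpha>" for \<alpha>
    using that by (auto simp: cart_transf_def)
  have msrc: "cart_transf (msrc \<mu>)" "cart_transf (mtgt \<mu>)" if "cart_modif \<mu>" for \<mu>
    using that by (auto simp: cart_modif_def)
  have ends: "nsrc (mtgt \<mu>) = nsrc (msrc \<mu>)" "ntgt (mtgt \<mu>) = ntgt (msrc \<mu>)" if "cart_modif \<mu>" for \<mu>
    using modification_of.ends[OF cart_modifD[OF that]] by simp_all
  have F: "two_functor A B F" if "cart_functor F" for F
    using that by (simp add: cart_functor_def)
  have cat1: "category (C1 (Cart2Cat A P B))"
  proof (rule category.intro, goal_cases)
    \<comment> \<open>Cases 5 to 7 are the unit laws and associativity; the remaining cases are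
      closure conditions.\<close>
    case (5 \<alpha> F G)
    then interpret transformation A B \<alpha> by (auto simp: hom_iff intro: cart_transfD)
    from 5 show ?case
      by (auto simp: hom_iff lax_nat_cmp_def lax_nat_ide_def B.whisker
          intro!: lax_nat.equality restrict_eqI ob_ext ar_ext)
  next
    case (6 \<alpha> F G)
    then interpret transformation A B \<alpha> by (auto simp: hom_iff intro: cart_transfD)
    from 6 show ?case
      by (auto simp: hom_iff lax_nat_cmp_def lax_nat_ide_def B.whisker
          intro!: lax_nat.equality restrict_eqI ob_ext ar_ext)
  next
    case (7 \<alpha> F G \<beta> H \<gamma> K)
    then interpret \<alpha>: transformation A B \<alpha> by (auto simp: hom_iff intro: cart_transfD)
    from 7 interpret \<beta>: transformation A B \<beta> by (auto simp: hom_iff intro: cart_transfD)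
    from 7 interpret \<gamma>: transformation A B \<gamma> by (auto simp: hom_iff intro: cart_transfD)
    from 7 have [simp]: "nsrc \<beta> = ntgt \<alpha>" "nsrc \<gamma> = ntgt \<beta>" by (auto simp: hom_iff)
    show ?case
      by (auto simp: lax_nat_cmp_def B.whisker intro!: restrict_ext)
  qed (auto simp: hom_iff src cart_transf_ide cart_transf_cmp, simp_all add: lax_nat_ide_def lax_nat_cmp_def)
  have cat2: "category (C2 (Cart2Cat A P B))"
  proof (rule category.intro, goal_cases)
    case (5 \<mu> \<alpha> \<beta>)
    then interpret modification_of A B \<mu> by (auto simp: hom_iff intro: cart_modifD)
    from 5 show ?case
      by (auto simp: hom_iff intro!: modif.equality restrict_eqI ob_ext)
  next
    case (6 \<mu> \<alpha> \<beta>)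
    then interpret modification_of A B \<mu> by (auto simp: hom_iff intro: cart_modifD)
    from 6 show ?case
      by (auto simp: hom_iff intro!: modif.equality restrict_eqI ob_ext)
  next
    case (7 \<mu> _ _ \<nu> _ \<rho> _)
    then interpret \<mu>: modification_of A B \<mu> by (auto simp: hom_iff intro: cart_modifD)
    from 7 interpret \<nu>: modification_of A B \<nu> by (auto simp: hom_iff intro: cart_modifD)
    from 7 interpret \<rho>: modification_of A B \<rho> by (auto simp: hom_iff intro: cart_modifD)
    from 7 have [simp]: "msrc \<nu> = mtgt \<mu>" "msrc \<rho> = mtgt \<nu>" by (auto simp: hom_iff)
    show ?case by (auto intro!: restrict_ext)
  qed (auto simp: hom_iff msrc cart_modif_ide cart_modif_cmp)
  show ?thesis
  proof (rule two_category.intro[OF cat1 cat2], goal_cases)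
    case (4 f x y h z s g t k)
    then show ?case by (auto simp: hom_iff intro!: cart_modif_hcmp)
  next
    case (5 \<alpha> _ _ \<beta> _)
    then interpret \<alpha>: transformation A B \<alpha> by (auto simp: hom_iff intro: cart_transfD)
    from 5 interpret \<beta>: transformation A B \<beta> by (auto simp: hom_iff intro: cart_transfD)
    from 5 have [simp]: "nsrc \<beta> = ntgt \<alpha>" by (auto simp: hom_iff)
    show ?case by (auto simp: lax_nat_cmp_def intro!: restrict_ext)
  next
    case (6 _ _ _ _ _ s _ t _ s' _ t' _)
    then interpret s: modification_of A B s by (auto simp: hom_iff intro: cart_modifD)
    from 6 interpret s': modification_of A B s' by (auto simp: hom_iff intro: cart_modifD)
    from 6 interpret t: modification_of A B t by (auto simp: hom_iff intro: cart_modifD)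
    from 6 interpret t': modification_of A B t' by (auto simp: hom_iff intro: cart_modifD)
    from 6 have [simp]: "msrc t = mtgt s" "msrc t' = mtgt s'" "nsrc (msrc s') = ntgt (msrc s)"
      by (auto simp: hom_iff)
    show ?case by (auto simp: B.hcmp_cmp intro!: restrict_ext)
  next
    case (7 \<mu> F G)
    then interpret modification_of A B \<mu> by (auto simp: two_hom_def hom_iff intro: cart_modifD)
    from 7 have "nsrc (msrc \<mu>) = F" "cart_functor F" by (auto simp: two_hom_def hom_iff src)
    then show ?case
      \<comment> \<open>A modification records its boundary, so the unit law for horizontal
        composition also needs the unit law for transformations at both ends.\<close>
      using category.ide_left[OF cat1, of "msrc \<mu>"] category.ide_left[OF cat1, of "mtgt \<mu>"] 7
      by (auto simp: two_hom_def hom_iff lax_nat_ide_def intro!: modif.equality restrict_eqI ob_ext)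
  next
    case (8 \<mu> F G)
    then interpret modification_of A B \<mu> by (auto simp: two_hom_def hom_iff intro: cart_modifD)
    from 8 have "ntgt (msrc \<mu>) = G" "cart_functor G" by (auto simp: two_hom_def hom_iff src)
    then show ?case
      using category.ide_right[OF cat1, of "msrc \<mu>"] category.ide_right[OF cat1, of "mtgt \<mu>"] 8
      by (auto simp: two_hom_def hom_iff lax_nat_ide_def intro!: modif.equality restrict_eqI ob_ext)
  next
    case (9 s _ _ t _ u _)
    then interpret s: modification_of A B s by (auto simp: two_hom_def hom_iff intro: cart_modifD)
    from 9 interpret t: modification_of A B t by (auto simp: two_hom_def hom_iff intro: cart_modifD)
    from 9 interpret u: modification_of A B u by (auto simp: two_hom_def hom_iff intro: cart_modifD)
    from 9 have "nsrc (msrc t) = ntgt (msrc s)" "nsrc (msrc u) = ntgt (msrc t)"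
      by (auto simp: two_hom_def hom_iff)
    with 9 show ?case
      using category.cmp_assoc[OF cat1, of "msrc s" _ _ "msrc t" _ "msrc u"]
        category.cmp_assoc[OF cat1, of "mtgt s" _ _ "mtgt t" _ "mtgt u"]
      by (auto simp: two_hom_def hom_iff B.assoc_hcmp intro!: restrict_ext)
  qed (auto simp: hom_iff ends)
qed

end

section \<open>Isomorphic targets\<close>

text \<open>Postcomposition with \<open>K\<close>, restricted so that the result is again
  extensional.\<close>

definition post0 ::
  "('o, 'a, 't) two_cat \<Rightarrow> ('p, 'b, 'u, 'p2, 'b2, 'u2) two_fctr \<Rightarrow>
    ('o, 'a, 't, 'p, 'b, 'u) two_fctr \<Rightarrow> ('o, 'a, 't, 'p2, 'b2, 'u2) two_fctr"
  where "post0 A K F =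
    \<lparr>on0 = (\<lambda>x \<in> Ob (C1 A). on0 K (on0 F x)), on1 = (\<lambda>f \<in> Ar (C1 A). on1 K (on1 F f)),
     on2 = (\<lambda>s \<in> Ar (C2 A). on2 K (on2 F s))\<rparr>"

definition post1 ::
  "('o, 'a, 't) two_cat \<Rightarrow> ('p, 'b, 'u, 'p2, 'b2, 'u2) two_fctr \<Rightarrow>
    ('o, 'a, 't, 'p, 'b, 'u) lax_nat \<Rightarrow> ('o, 'a, 't, 'p2, 'b2, 'u2) lax_nat"
  where "post1 A K \<alpha> =
    \<lparr>nsrc = post0 A K (nsrc \<alpha>), ntgt = post0 A K (ntgt \<alpha>),
     nob = (\<lambda>x \<in> Ob (C1 A). on1 K (nob \<alpha> x)), nar = (\<lambda>f \<in> Ar (C1 A). on2 K (nar \<alpha> f))\<rparr>"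

definition post2 ::
  "('o, 'a, 't) two_cat \<Rightarrow> ('p, 'b, 'u, 'p2, 'b2, 'u2) two_fctr \<Rightarrow>
    ('o, 'a, 't, 'p, 'b, 'u) modif \<Rightarrow> ('o, 'a, 't, 'p2, 'b2, 'u2) modif"
  where "post2 A K \<mu> =
    \<lparr>msrc = post1 A K (msrc \<mu>), mtgt = post1 A K (mtgt \<mu>),
     mob = (\<lambda>x \<in> Ob (C1 A). on2 K (mob \<mu> x))\<rparr>"

lemma post0_simps [simp]:
  "x \<in> Ob (C1 A) \<Longrightarrow> on0 (post0 A K F) x = on0 K (on0 F x)"
  "f \<in> Ar (C1 A) \<Longrightarrow> on1 (post0 A K F) f = on1 K (on1 F f)"
  "s \<in> Ar (C2 A) \<Longrightarrow> on2 (post0 A K F) s = on2 K (on2 F s)"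
  by (simp_all add: post0_def)

lemma post1_simps [simp]:
  "nsrc (post1 A K \<alpha>) = post0 A K (nsrc \<alpha>)" "ntgt (post1 A K \<alpha>) = post0 A K (ntgt \<alpha>)"
  "x \<in> Ob (C1 A) \<Longrightarrow> nob (post1 A K \<alpha>) x = on1 K (nob \<alpha> x)"
  "f \<in> Ar (C1 A) \<Longrightarrow> nar (post1 A K \<alpha>) f = on2 K (nar \<alpha> f)"
  by (simp_all add: post1_def)

lemma post2_simps [simp]:
  "msrc (post2 A K \<mu>) = post1 A K (msrc \<mu>)" "mtgt (post2 A K \<mu>) = post1 A K (mtgt \<mu>)"
  "x \<in> Ob (C1 A) \<Longrightarrow> mob (post2 A K \<mu>) x = on2 K (mob \<mu> x)"
  by (simp_all add: post2_def)

lemma (in two_category) product_2hom: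
  assumes "is_2product A x y p \<pi>\<^sub>1 \<pi>\<^sub>2" shows "x \<in> Ob (C1 A)" "y \<in> Ob (C1 A)" "p \<in> Ob (C1 A)"
    "\<pi>\<^sub>1 \<in> Ar (C1 A)" "Dom (C1 A) \<pi>\<^sub>1 = p" "Cod (C1 A) \<pi>\<^sub>1 = x"
    "\<pi>\<^sub>2 \<in> Ar (C1 A)" "Dom (C1 A) \<pi>\<^sub>2 = p" "Cod (C1 A) \<pi>\<^sub>2 = y"
  using assms by (auto simp: is_2product_def dest: c1.productD)

lemma is_2productI:
  assumes "is_product (C1 A) x y p \<pi>\<^sub>1 \<pi>\<^sub>2"
    and "\<And>w s t. \<lbrakk>w \<in> Ob (C1 A); s \<in> two_hom A w x; t \<in> two_hom A w y\<rbrakk> \<Longrightarrow>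
      \<exists>u. u \<in> two_hom A w p \<and> u *\<^bsub>A\<^esub> Ide (C2 A) \<pi>\<^sub>1 = s \<and> u *\<^bsub>A\<^esub> Ide (C2 A) \<pi>\<^sub>2 = t"
    and "\<And>w u v. \<lbrakk>w \<in> Ob (C1 A); u \<in> two_hom A w p; v \<in> two_hom A w p;
      u *\<^bsub>A\<^esub> Ide (C2 A) \<pi>\<^sub>1 = v *\<^bsub>A\<^esub> Ide (C2 A) \<pi>\<^sub>1; u *\<^bsub>A\<^esub> Ide (C2 A) \<pi>\<^sub>2 = v *\<^bsub>A\<^esub> Ide (C2 A) \<pi>\<^sub>2\<rbrakk> \<Longrightarrow>
      u = v"
  shows "is_2product A x y p \<pi>\<^sub>1 \<pi>\<^sub>2"
  unfolding is_2product_def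
proof (intro conjI ballI ex_ex1I)
  fix w s t assume "w \<in> Ob (C1 A)" "s \<in> two_hom A w x" "t \<in> two_hom A w y"
  then show "\<exists>u. u \<in> two_hom A w p \<and> u *\<^bsub>A\<^esub> Ide (C2 A) \<pi>\<^sub>1 = s \<and> u *\<^bsub>A\<^esub> Ide (C2 A) \<pi>\<^sub>2 = t"
    by (rule assms(2))
next
  fix w s t u v assume "w \<in> Ob (C1 A)"
    "u \<in> two_hom A w p \<and> u *\<^bsub>A\<^esub> Ide (C2 A) \<pi>\<^sub>1 = s \<and> u *\<^bsub>A\<^esub> Ide (C2 A) \<pi>\<^sub>2 = t"
    "v \<in> two_hom A w p \<and> v *\<^bsub>A\<^esub> Ide (C2 A) \<pi>\<^sub>1 = s \<and> v *\<^bsub>A\<^esub> Ide (C2 A) \<pi>\<^sub>2 = t"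
  then show "u = v" using assms(3)[of w u v] by simp
qed (rule assms(1))

context two_category
begin

lemma two_product_pairing:
  assumes "is_2product A x y p \<pi>\<^sub>1 \<pi>\<^sub>2" "w \<in> Ob (C1 A)" "s \<in> two_hom A w x" "t \<in> two_hom A w y"
  obtains u where "u \<in> two_hom A w p" "u *\<^bsub>A\<^esub> Ide (C2 A) \<pi>\<^sub>1 = s" "u *\<^bsub>A\<^esub> Ide (C2 A) \<pi>\<^sub>2 = t"
  using assms unfolding is_2product_def by blast

lemma two_product_eqI:
  assumes p: "is_2product A x y p \<pi>\<^sub>1 \<pi>\<^sub>2" and h: "u \<in> two_hom A w p" "v \<in> two_hom A w p"
    and e: "u *\<^bsub>A\<^esub> Ide (C2 A) \<pi>\<^sub>1 = v *\<^bsub>A\<^esub> Ide (C2 A) \<pi>\<^sub>1" "u *\<^bsub>A\<^esub> Ide (C2 A) \<pi>\<^sub>2 = v *\<^bsub>A\<^esub> Ide (C2 A) \<pi>\<^sub>2"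
  shows "u = v"
proof -
  have "w \<in> Ob (C1 A)" "v *\<^bsub>A\<^esub> Ide (C2 A) \<pi>\<^sub>1 \<in> two_hom A w x" "v *\<^bsub>A\<^esub> Ide (C2 A) \<pi>\<^sub>2 \<in> two_hom A w y"
    using h product_2hom[OF p] by (auto simp: two_hom_iff)
  then have "\<exists>!z. z \<in> two_hom A w p \<and> z *\<^bsub>A\<^esub> Ide (C2 A) \<pi>\<^sub>1 = v *\<^bsub>A\<^esub> Ide (C2 A) \<pi>\<^sub>1 \<and>
      z *\<^bsub>A\<^esub> Ide (C2 A) \<pi>\<^sub>2 = v *\<^bsub>A\<^esub> Ide (C2 A) \<pi>\<^sub>2"
    using p unfolding is_2product_def by blast
  then show ?thesis using h e by blast
qed

end

locale two_isomorphism = two_categories A B + K: two_functor A B K + L: two_functor B A L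
  for A :: "('o, 'a, 't) two_cat" and B :: "('p, 'b, 'u) two_cat"
    and K :: "('o, 'a, 't, 'p, 'b, 'u) two_fctr" and L :: "('p, 'b, 'u, 'o, 'a, 't) two_fctr" +
  assumes LK0 [simp]: "x \<in> Ob (C1 A) \<Longrightarrow> on0 L (on0 K x) = x"
    and KL0 [simp]: "y \<in> Ob (C1 B) \<Longrightarrow> on0 K (on0 L y) = y"
    and LK1 [simp]: "f \<in> Ar (C1 A) \<Longrightarrow> on1 L (on1 K f) = f"
    and KL1 [simp]: "g \<in> Ar (C1 B) \<Longrightarrow> on1 K (on1 L g) = g"
    and LK2 [simp]: "s \<in> Ar (C2 A) \<Longrightarrow> on2 L (on2 K s) = s"
    and KL2 [simp]: "t \<in> Ar (C2 B) \<Longrightarrow> on2 K (on2 L t) = t"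
begin

lemma inverse: "two_isomorphism B A L K"
  by unfold_locales auto

lemma isomorphic: "isomorphic_two_categories A B"
  unfolding isomorphic_two_categories_def
  using A.two_category_axioms B.two_category_axioms K.two_functor_axioms L.two_functor_axioms
  by (auto intro!: exI[of _ K] exI[of _ L])

text \<open>A pairing problem in \<open>B\<close> is carried to \<open>A\<close> by
  \<open>L\<close>, solved there, and the solution carried back by \<open>K\<close>; uniqueness is
  tested after applying \<open>L\<close>.\<close>

lemma two_product_image:
  assumes p: "is_2product A x y p \<pi>\<^sub>1 \<pi>\<^sub>2"
  shows "is_2product B (on0 K x) (on0 K y) (on0 K p) (on1 K \<pi>\<^sub>1) (on1 K \<pi>\<^sub>2)"
proof -
  note [simp] = A.product_2hom[OF p] A.two_hom_iff B.two_hom_iff A.two_category_axioms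
    B.two_category_axioms
  have p1: "is_product (C1 A) x y p \<pi>\<^sub>1 \<pi>\<^sub>2" using p by (simp add: is_2product_def)
  show ?thesis
  proof (rule is_2productI, rule B.c1.productI)
    fix f g assume a: "f \<in> Ar (C1 B)" "g \<in> Ar (C1 B)" "Dom (C1 B) f = Dom (C1 B) g"
      "Cod (C1 B) f = on0 K x" "Cod (C1 B) g = on0 K y"
    have "on1 L f \<in> Ar (C1 A)" "on1 L g \<in> Ar (C1 A)" "Dom (C1 A) (on1 L f) = Dom (C1 A) (on1 L g)"
      "Cod (C1 A) (on1 L f) = x" "Cod (C1 A) (on1 L g) = y"
      using a by simp_all
    from A.c1.product_pairing[OF p1 this]
    obtain h where h: "h \<in> Ar (C1 A)" "Dom (C1 A) h = Dom (C1 A) (on1 L f)" "Cod (C1 A) h = p"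
      "h \<cdot>\<^bsub>C1 A\<^esub> \<pi>\<^sub>1 = on1 L f" "h \<cdot>\<^bsub>C1 A\<^esub> \<pi>\<^sub>2 = on1 L g"
      by blast
    have "on1 K h \<cdot> on1 K \<pi>\<^sub>1 = f" "on1 K h \<cdot> on1 K \<pi>\<^sub>2 = g"
      using arg_cong[OF h(4), of "on1 K"] arg_cong[OF h(5), of "on1 K"] h(1-3) a(1,2) by simp_all
    with h(1-3) a(1-3) show "\<exists>h. h \<in> Ar (C1 B) \<and> Dom (C1 B) h = Dom (C1 B) f \<and> Cod (C1 B) h = on0 K p \<and>
      h \<cdot> on1 K \<pi>\<^sub>1 = f \<and> h \<cdot> on1 K \<pi>\<^sub>2 = g"
      by (intro exI[of _ "on1 K h"]) simp
  next
    fix h k assume a: "h \<in> Ar (C1 B)" "k \<in> Ar (C1 B)" "Dom (C1 B) h = Dom (C1 B) k"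
      "Cod (C1 B) h = on0 K p" "Cod (C1 B) k = on0 K p"
      "h \<cdot> on1 K \<pi>\<^sub>1 = k \<cdot> on1 K \<pi>\<^sub>1" "h \<cdot> on1 K \<pi>\<^sub>2 = k \<cdot> on1 K \<pi>\<^sub>2"
    have "on1 L h \<cdot>\<^bsub>C1 A\<^esub> \<pi>\<^sub>1 = on1 L k \<cdot>\<^bsub>C1 A\<^esub> \<pi>\<^sub>1" "on1 L h \<cdot>\<^bsub>C1 A\<^esub> \<pi>\<^sub>2 = on1 L k \<cdot>\<^bsub>C1 A\<^esub> \<pi>\<^sub>2"
      using arg_cong[OF a(6), of "on1 L"] arg_cong[OF a(7), of "on1 L"] a(1-5) by simp_all
    then have "on1 L h = on1 L k"
      by (rule A.c1.product_eqI[OF p1, rotated 5]) (use a(1-5) in simp_all)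
    then have "on1 K (on1 L h) = on1 K (on1 L k)" by simp
    then show "h = k" using a(1,2) by simp
  next
    fix w s t assume a: "w \<in> Ob (C1 B)" "s \<in> two_hom B w (on0 K x)" "t \<in> two_hom B w (on0 K y)"
    have "on0 L w \<in> Ob (C1 A)" "on2 L s \<in> two_hom A (on0 L w) x" "on2 L t \<in> two_hom A (on0 L w) y"
      using a by auto
    from A.two_product_pairing[OF p this]
    obtain u where u: "u \<in> two_hom A (on0 L w) p" "u *\<^bsub>A\<^esub> Ide (C2 A) \<pi>\<^sub>1 = on2 L s"
      "u *\<^bsub>A\<^esub> Ide (C2 A) \<pi>\<^sub>2 = on2 L t" by blast
    have "on2 K u \<star> \<iota> (on1 K \<pi>\<^sub>1) = s" "on2 K u \<star> \<iota> (on1 K \<pi>\<^sub>2) = t"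
      using arg_cong[OF u(2), of "on2 K"] arg_cong[OF u(3), of "on2 K"] u(1) a by simp_all
    moreover have "on2 K u \<in> two_hom B w (on0 K p)" using u(1) a(1) by auto
    ultimately show "\<exists>u. u \<in> two_hom B w (on0 K p) \<and> u \<star> \<iota> (on1 K \<pi>\<^sub>1) = s \<and> u \<star> \<iota> (on1 K \<pi>\<^sub>2) = t"
      by blast
  next
    fix w u v assume a: "w \<in> Ob (C1 B)" "u \<in> two_hom B w (on0 K p)" "v \<in> two_hom B w (on0 K p)"
      "u \<star> \<iota> (on1 K \<pi>\<^sub>1) = v \<star> \<iota> (on1 K \<pi>\<^sub>1)" "u \<star> \<iota> (on1 K \<pi>\<^sub>2) = v \<star> \<iota> (on1 K \<pi>\<^sub>2)"
    have "on2 L u *\<^bsub>A\<^esub> Ide (C2 A) \<pi>\<^sub>1 = on2 L v *\<^bsub>A\<^esub> Ide (C2 A) \<pi>\<^sub>1"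
      "on2 L u *\<^bsub>A\<^esub> Ide (C2 A) \<pi>\<^sub>2 = on2 L v *\<^bsub>A\<^esub> Ide (C2 A) \<pi>\<^sub>2"
      using arg_cong[OF a(4), of "on2 L"] arg_cong[OF a(5), of "on2 L"] a(1-3) by simp_all
    moreover have "on2 L u \<in> two_hom A (on0 L w) p" "on2 L v \<in> two_hom A (on0 L w) p"
      using a(1-3) by auto
    ultimately have "on2 L u = on2 L v" by (rule A.two_product_eqI[OF p, rotated 2])
    then have "on2 K (on2 L u) = on2 K (on2 L v)" by simp
    then show "u = v" using a(2,3) by simp
  qed (auto simp: hom_iff)
qed

lemma two_terminal_image:
  assumes t: "is_2terminal A t" shows "is_2terminal B (on0 K t)"
proof -
  note [simp] = A.two_hom_iff B.two_hom_iff A.two_category_axioms B.two_category_axioms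
  have [simp]: "t \<in> Ob (C1 A)" using t by (simp add: is_2terminal_def is_terminal_def)
  show ?thesis
    unfolding is_2terminal_def is_terminal_def
  proof (intro conjI ballI ex_ex1I)
    fix w assume w: "w \<in> Ob (C1 B)"
    then have w': "on0 L w \<in> Ob (C1 A)" by simp
    obtain h where "h \<in> hom (C1 A) (on0 L w) t"
      using t w' by (metis is_2terminal_def is_terminal_def)
    then have "on1 K h \<in> hom (C1 B) w (on0 K t)" using w by (auto simp: hom_iff)
    then show "\<exists>h. h \<in> hom (C1 B) w (on0 K t)" ..
    obtain u where "u \<in> two_hom A (on0 L w) t" using t w' by (metis is_2terminal_def)
    then have "on2 K u \<in> two_hom B w (on0 K t)" using w by auto
    then show "\<exists>u. u \<in> two_hom B w (on0 K t)" ..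
    fix h k assume h: "h \<in> hom (C1 B) w (on0 K t)" "k \<in> hom (C1 B) w (on0 K t)"
    then have "on1 L h \<in> hom (C1 A) (on0 L w) t" "on1 L k \<in> hom (C1 A) (on0 L w) t"
      by (auto simp: hom_iff)
    then have "on1 L h = on1 L k" using t w' by (metis is_2terminal_def is_terminal_def)
    then have "on1 K (on1 L h) = on1 K (on1 L k)" by simp
    then show "h = k" using h by (simp add: hom_iff)
  next
    fix w u v assume w: "w \<in> Ob (C1 B)" and h: "u \<in> two_hom B w (on0 K t)" "v \<in> two_hom B w (on0 K t)"
    then have w': "on0 L w \<in> Ob (C1 A)" by simp
    have "on2 L u \<in> two_hom A (on0 L w) t" "on2 L v \<in> two_hom A (on0 L w) t" using h by auto
    then have "on2 L u = on2 L v" using t w' by (metis is_2terminal_def)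
    then have "on2 K (on2 L u) = on2 K (on2 L v)" by simp
    then show "u = v" using h by simp
  qed simp
qed

end

lemma isomorphic_two_categoriesE:
  assumes "isomorphic_two_categories A B"
  obtains K L where "two_isomorphism A B K L"
  using assms unfolding isomorphic_two_categories_def two_isomorphism_def two_categories_def
    two_isomorphism_axioms_def by blast

lemma isomorphic_two_categories_sym:
  "isomorphic_two_categories A B \<Longrightarrow> isomorphic_two_categories B A"
  by (metis isomorphic_two_categoriesE two_isomorphism.inverse two_isomorphism.isomorphic)

lemma two_functor_post0:
  assumes "two_category A" "two_category B" "two_functor A B F" "two_functor B B' K"
  shows "two_functor A B' (post0 A K F)"
proof -
  interpret A: two_category A by fact
  interpret B: two_category B by fact
  interpret F: two_functor A B F by fact
  interpret K: two_functor B B' K by fact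
  have [simp]: "on1 K f \<in> Ob (C2 B')" if "f \<in> Ar (C1 B)" for f
    using cat_functor.ob_in[OF K.functor2, of f] that by (simp add: B.ob2)
  show ?thesis
    by unfold_locales
      (auto simp: hom_iff A.two_hom_iff A.two_category_axioms B.two_category_axioms A.ob2 post0_def)
qed

lemma isomorphic_two_categories_trans:
  assumes "isomorphic_two_categories A B" "isomorphic_two_categories B C"
  shows "isomorphic_two_categories A C"
proof -
  obtain K L where "two_isomorphism A B K L" using assms(1) by (rule isomorphic_two_categoriesE)
  then interpret K: two_isomorphism A B K L .
  obtain M N where "two_isomorphism B C M N" using assms(2) by (rule isomorphic_two_categoriesE)
  then interpret M: two_isomorphism B C M N .
  note cats = K.A.two_category_axioms K.B.two_category_axioms M.B.two_category_axioms
  interpret F: two_functor A C "post0 A M K"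
    by (rule two_functor_post0) (use cats in \<open>auto intro: K.K.two_functor_axioms M.K.two_functor_axioms\<close>)
  interpret G: two_functor C A "post0 C L N"
    by (rule two_functor_post0) (use cats in \<open>auto intro: K.L.two_functor_axioms M.L.two_functor_axioms\<close>)
  have "two_isomorphism A C (post0 A M K) (post0 C L N)"
    by unfold_locales auto
  then show ?thesis by (rule two_isomorphism.isomorphic)
qed

section \<open>Postcomposition with an isomorphism of 2-categories\<close>

locale cartesian_targets = two_isomorphism B B' K L + D: cartesian_target A B P + E: cartesian_target A B' P
  for A :: "('o, 'a, 't) two_cat" and P and B :: "('p, 'b, 'u) two_cat"
    and B' :: "('p2, 'b2, 'u2) two_cat" and K L
begin

lemma cart_functor_post0:
  assumes F: "D.cart_functor F" shows "E.cart_functor (post0 A K F)"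
proof -
  have "two_functor A B' (post0 A K F)"
    using F two_functor_post0[OF D.A.two_category_axioms A.two_category_axioms _ K.two_functor_axioms]
    by (simp add: D.cart_functor_def)
  moreover have "preserves_2products A B' (post0 A K F)"
    unfolding preserves_2products_def
  proof (intro conjI allI impI)
    fix x y p \<pi>\<^sub>1 \<pi>\<^sub>2 assume p: "is_2product A x y p \<pi>\<^sub>1 \<pi>\<^sub>2"
    then have "is_2product B (on0 F x) (on0 F y) (on0 F p) (on1 F \<pi>\<^sub>1) (on1 F \<pi>\<^sub>2)"
      using F by (simp add: D.cart_functor_def preserves_2products_def)
    from two_product_image[OF this]
    show "is_2product B' (on0 (post0 A K F) x) (on0 (post0 A K F) y) (on0 (post0 A K F) p)
      (on1 (post0 A K F) \<pi>\<^sub>1) (on1 (post0 A K F) \<pi>\<^sub>2)"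
      by (simp add: D.A.product_2hom[OF p])
  next
    fix t assume t: "is_2terminal A t"
    then have "is_2terminal B (on0 F t)" "t \<in> Ob (C1 A)"
      using F by (simp_all add: D.cart_functor_def preserves_2products_def is_2terminal_def is_terminal_def)
    with two_terminal_image show "is_2terminal B' (on0 (post0 A K F) t)" by simp
  qed
  ultimately show ?thesis by (simp add: E.cart_functor_def)
qed

text \<open>Every axiom is an equation between composites and whiskerings, so applying
  \<open>on2 K\<close> to it yields the axiom of the image. Strictness at a projection survives
  because \<open>K\<close> preserves composites and identities.\<close>

lemma cart_transf_post1:
  assumes a: "D.cart_transf \<alpha>" shows "E.cart_transf (post1 A K \<alpha>)"
proof -
  interpret \<alpha>: transformation A B \<alpha> using a by (rule D.cart_transfD)
  note [simp] = A.two_category_axioms B.two_category_axioms D.A.two_category_axioms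
  have "two_lax_transformation A B' (post1 A K \<alpha>)"
  proof (rule two_lax_transformation.intro, unfold hom_iff)
    fix f g x y s
    assume "f \<in> Ar (C1 A) \<and> Dom (C1 A) f = x \<and> Cod (C1 A) f = y"
      "g \<in> Ar (C1 A) \<and> Dom (C1 A) g = x \<and> Cod (C1 A) g = y"
      "s \<in> Ar (C2 A) \<and> Dom (C2 A) s = f \<and> Cod (C2 A) s = g"
    then have [simp]: "f \<in> Ar (C1 A)" "Dom (C1 A) f = x" "Cod (C1 A) f = y"
      "g \<in> Ar (C1 A)" "Dom (C1 A) g = x" "Cod (C1 A) g = y"
      "s \<in> Ar (C2 A)" "Dom (C2 A) s = f" "Cod (C2 A) s = g" by auto
    have [simp]: "x \<in> Ob (C1 A)" "y \<in> Ob (C1 A)"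
      using D.A.c1.dom_cod_Ob[of f] by simp_all
    show "nar (post1 A K \<alpha>) f \<cdot>\<^bsub>C2 B'\<^esub> (on2 (nsrc (post1 A K \<alpha>)) s *\<^bsub>B'\<^esub> Ide (C2 B') (nob (post1 A K \<alpha>) y)) =
      (Ide (C2 B') (nob (post1 A K \<alpha>) x) *\<^bsub>B'\<^esub> on2 (ntgt (post1 A K \<alpha>)) s) \<cdot>\<^bsub>C2 B'\<^esub> nar (post1 A K \<alpha>) g"
      using arg_cong[OF \<alpha>.nar_natural[of s f g x y], of "on2 K"] by simp
  qed (auto simp: post1_def \<alpha>.ar_ide \<alpha>.nar_cmp)
  moreover have "two_strict_at B' (post1 A K \<alpha>) x y f"
    if s: "two_strict_at B \<alpha> x y f" and f [simp]: "f \<in> Ar (C1 A)" "Dom (C1 A) f = x" "Cod (C1 A) f = y" for x y f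
  proof -
    have [simp]: "x \<in> Ob (C1 A)" "y \<in> Ob (C1 A)"
      using D.A.c1.dom_cod_Ob[of f] by simp_all
    have "on1 K (nob \<alpha> x \<cdot>\<^bsub>C1 B\<^esub> on1 (ntgt \<alpha>) f) = on1 K (on1 (nsrc \<alpha>) f \<cdot>\<^bsub>C1 B\<^esub> nob \<alpha> y)"
      using s by (simp add: two_strict_at_def del: K.on1_cmp)
    then show ?thesis using s by (simp add: two_strict_at_def)
  qed
  ultimately show ?thesis using a
    by (simp add: E.cart_transf_def D.cart_transf_def cart_functor_post0 two_cartesian_transformation_def)
qed

lemma cart_modif_post2:
  assumes a: "D.cart_modif \<mu>" shows "E.cart_modif (post2 A K \<mu>)"
proof -
  interpret \<mu>: modification_of A B \<mu> using a by (rule D.cart_modifD)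
  note [simp] = A.two_category_axioms B.two_category_axioms D.A.two_category_axioms
  have "modification A B' (post2 A K \<mu>)"
  proof (rule modification.intro, unfold hom_iff)
    fix f x y assume f: "f \<in> Ar (C1 A) \<and> Dom (C1 A) f = x \<and> Cod (C1 A) f = y"
    then have [simp]: "f \<in> Ar (C1 A)" "Dom (C1 A) f = x" "Cod (C1 A) f = y"
      "x \<in> Ob (C1 A)" "y \<in> Ob (C1 A)" by auto
    show "nar (msrc (post2 A K \<mu>)) f \<cdot>\<^bsub>C2 B'\<^esub>
        (Ide (C2 B') (on1 (nsrc (msrc (post2 A K \<mu>))) f) *\<^bsub>B'\<^esub> mob (post2 A K \<mu>) y) =
      (mob (post2 A K \<mu>) x *\<^bsub>B'\<^esub> Ide (C2 B') (on1 (ntgt (msrc (post2 A K \<mu>))) f)) \<cdot>\<^bsub>C2 B'\<^esub>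
        nar (mtgt (post2 A K \<mu>)) f"
      using arg_cong[OF \<mu>.mob_natural[of f x y], of "on2 K"] by simp
  qed (auto simp: post2_def)
  then show ?thesis using a by (simp add: E.cart_modif_def D.cart_modif_def cart_transf_post1)
qed

lemma post0_inverse:
  assumes "D.cart_functor F" shows "post0 A L (post0 A K F) = F"
proof -
  interpret F: two_functor A B F using assms by (simp add: D.cart_functor_def)
  show ?thesis
    by (rule two_fctr.equality) (auto simp: post0_def intro!: restrict_eqI F.on_extensional)
qed

lemma post1_inverse:
  assumes "D.cart_transf \<alpha>" shows "post1 A L (post1 A K \<alpha>) = \<alpha>"
proof -
  interpret \<alpha>: transformation A B \<alpha> using assms by (rule D.cart_transfD)
  show ?thesis using assms
    by (intro lax_nat.equality)
      (auto simp: post1_def post0_inverse D.cart_transf_def intro!: restrict_eqI \<alpha>.ob_ext \<alpha>.ar_ext)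
qed

lemma post2_inverse:
  assumes "D.cart_modif \<mu>" shows "post2 A L (post2 A K \<mu>) = \<mu>"
proof -
  interpret \<mu>: modification_of A B \<mu> using assms by (rule D.cart_modifD)
  show ?thesis using assms
    by (intro modif.equality)
      (auto simp: post2_def post1_inverse D.cart_modif_def intro!: restrict_eqI \<mu>.ob_ext)
qed

end

text \<open>Postcomposition with \<open>K\<close> and with \<open>L\<close> are mutually inverse
  because all component maps are extensional. The transport criterion then asks that each operation
  be recovered by conjugation, which holds since \<open>K\<close> and \<open>L\<close> preserve all
  operations.\<close>

theorem Cart2Cat_isomorphic_targets:
  assumes A: "two_category A" and P: "chosen_products (C1 A) P" and B: "isomorphic_two_categories B B'"
  shows "isomorphic_two_categories (Cart2Cat A P B) (Cart2Cat A P B')"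
proof -
  obtain K L where "two_isomorphism B B' K L" using B by (rule isomorphic_two_categoriesE)
  then interpret I: two_isomorphism B B' K L .
  interpret A: two_category A by fact
  interpret S: cartesian_targets A P B B' K L
    by unfold_locales (rule P)
  interpret J: two_isomorphism B' B L K by (rule I.inverse)
  interpret R: cartesian_targets A P B' B L K ..
  note [simp] = I.A.two_category_axioms I.B.two_category_axioms A.two_category_axioms
  note [simp] = S.D.Cart2Cat_simps S.E.Cart2Cat_simps
  have src: "S.D.cart_functor (nsrc \<alpha>)" "S.D.cart_functor (ntgt \<alpha>)" if "S.D.cart_transf \<alpha>" for \<alpha>
    using that by (auto simp: S.D.cart_transf_def)
  have msrc: "S.D.cart_transf (msrc \<mu>)" "S.D.cart_transf (mtgt \<mu>)" if "S.D.cart_modif \<mu>" for \<mu>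
    using that by (auto simp: S.D.cart_modif_def)
  \<comment> \<open>Isolated because the boundary of a horizontal composite of modifications
    consists of two such composites.\<close>
  have cmp: "lax_nat_cmp A B \<alpha> \<beta> = post1 A L (lax_nat_cmp A B' (post1 A K \<alpha>) (post1 A K \<beta>))"
    if t: "S.D.cart_transf \<alpha>" "S.D.cart_transf \<beta>" "ntgt \<alpha> = nsrc \<beta>" for \<alpha> \<beta>
  proof -
    interpret \<alpha>: transformation A B \<alpha> using t(1) by (rule S.D.cart_transfD)
    interpret \<beta>: transformation A B \<beta> using t(2) by (rule S.D.cart_transfD)
    note [simp] = t(3)[symmetric]
    have "post0 A L (post0 A K (nsrc \<alpha>)) = nsrc \<alpha>" "post0 A L (post0 A K (ntgt \<beta>)) = ntgt \<beta>"
      using t(1,2) by (auto intro: S.post0_inverse src)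
    then show ?thesis
      by (auto simp: post1_def lax_nat_cmp_def intro!: restrict_ext)
  qed
  show ?thesis
  proof (rule isomorphic_two_categoriesI[where ?T0.0 = "post0 A K" and ?T1.0 = "post1 A K" and ?T2.0 = "post2 A K"
        and ?S0.0 = "post0 A L" and ?S1.0 = "post1 A L" and ?S2.0 = "post2 A L"])
    show "two_category (Cart2Cat A P B')" by (rule S.E.two_category_Cart2Cat)
  next
    fix F assume F: "F \<in> Ob (C1 (Cart2Cat A P B))"
    then interpret F: two_functor A B F by (simp add: S.D.cart_functor_def)
    show "Ide (C1 (Cart2Cat A P B)) F = post1 A L (Ide (C1 (Cart2Cat A P B')) (post0 A K F))"
      using F by (auto simp: post1_def lax_nat_ide_def S.post0_inverse intro!: restrict_ext)
  next
    fix \<alpha> assume \<alpha>: "\<alpha> \<in> Ar (C1 (Cart2Cat A P B))"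
    then interpret transformation A B \<alpha> by (auto intro: S.D.cart_transfD)
    show "Ide (C2 (Cart2Cat A P B)) \<alpha> = post2 A L (Ide (C2 (Cart2Cat A P B')) (post1 A K \<alpha>))"
      using \<alpha> by (auto simp: post2_def S.post1_inverse intro!: restrict_ext)
  next
    fix \<mu> \<nu> assume m: "\<mu> \<in> Ar (C2 (Cart2Cat A P B))" "\<nu> \<in> Ar (C2 (Cart2Cat A P B))"
      "Cod (C2 (Cart2Cat A P B)) \<mu> = Dom (C2 (Cart2Cat A P B)) \<nu>"
    then interpret \<mu>: modification_of A B \<mu> by (auto intro: S.D.cart_modifD)
    from m interpret \<nu>: modification_of A B \<nu> by (auto intro: S.D.cart_modifD)
    show "\<mu> \<cdot>\<^bsub>C2 (Cart2Cat A P B)\<^esub> \<nu> =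
      post2 A L (post2 A K \<mu> \<cdot>\<^bsub>C2 (Cart2Cat A P B')\<^esub> post2 A K \<nu>)"
      using m by (auto simp: post2_def S.post1_inverse msrc intro!: restrict_ext)
  next
    fix \<mu> \<nu> assume m: "\<mu> \<in> Ar (C2 (Cart2Cat A P B))" "\<nu> \<in> Ar (C2 (Cart2Cat A P B))"
      "Cod (C1 (Cart2Cat A P B)) (Dom (C2 (Cart2Cat A P B)) \<mu>) =
        Dom (C1 (Cart2Cat A P B)) (Dom (C2 (Cart2Cat A P B)) \<nu>)"
    then interpret \<mu>: modification_of A B \<mu> by (auto intro: S.D.cart_modifD)
    from m interpret \<nu>: modification_of A B \<nu> by (auto intro: S.D.cart_modifD)
    have t: "ntgt (msrc \<mu>) = nsrc (msrc \<nu>)" using m by simp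
    then show "\<mu> *\<^bsub>Cart2Cat A P B\<^esub> \<nu> =
      post2 A L (post2 A K \<mu> *\<^bsub>Cart2Cat A P B'\<^esub> post2 A K \<nu>)"
      using m \<mu>.ends \<nu>.ends by (auto simp: post2_def cmp[symmetric] msrc intro!: restrict_ext)
  qed (auto simp: S.cart_functor_post0 S.post0_inverse R.cart_functor_post0 R.post0_inverse
      S.cart_transf_post1 S.post1_inverse R.cart_transf_post1 R.post1_inverse
      S.cart_modif_post2 S.post2_inverse R.cart_modif_post2 R.post2_inverse
      src msrc cmp)
qed

section \<open>Coherence in a double category\<close>

context category
begin

lemma iso_cancel_left:
  assumes f: "iso_arrow C f" and g: "g \<in> Ar C" "h \<in> Ar C" "Cod C f = Dom C g" "Cod C f = Dom C h"
    and e: "f \<cdot>\<^bsub>C\<^esub> g = f \<cdot>\<^bsub>C\<^esub> h"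
  shows "g = h"
proof -
  note i = inv_arrow[OF f]
  have "(inv_arrow C f \<cdot>\<^bsub>C\<^esub> f) \<cdot>\<^bsub>C\<^esub> g = (inv_arrow C f \<cdot>\<^bsub>C\<^esub> f) \<cdot>\<^bsub>C\<^esub> h"
    using g i(1-4) by (simp add: e)
  then show ?thesis unfolding i(6) using g by simp
qed

lemma iso_cancel_right:
  assumes f: "iso_arrow C f" and g: "g \<in> Ar C" "h \<in> Ar C" "Cod C g = Dom C f" "Cod C h = Dom C f"
    and e: "g \<cdot>\<^bsub>C\<^esub> f = h \<cdot>\<^bsub>C\<^esub> f"
  shows "g = h"
proof -
  note i = inv_arrow[OF f]
  have "(g \<cdot>\<^bsub>C\<^esub> f) \<cdot>\<^bsub>C\<^esub> inv_arrow C f = (h \<cdot>\<^bsub>C\<^esub> f) \<cdot>\<^bsub>C\<^esub> inv_arrow C f" by (simp only: e)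
  then show ?thesis using i(5) g by (simp add: i)
qed

lemma inv_cmp_cancel:
  assumes "iso_arrow C f" "g \<in> Ar C"
  shows "Dom C g = Dom C f \<Longrightarrow> f \<cdot>\<^bsub>C\<^esub> (inv_arrow C f \<cdot>\<^bsub>C\<^esub> g) = g"
    and "Dom C g = Cod C f \<Longrightarrow> inv_arrow C f \<cdot>\<^bsub>C\<^esub> (f \<cdot>\<^bsub>C\<^esub> g) = g"
  using inv_arrow[OF assms(1)] assms by (simp_all flip: assoc_cmp)

end

lemma pro_iff: "m \<in> pro D x y \<longleftrightarrow> m \<in> Ob (D1 D) \<and> psrc D m = x \<and> ptgt D m = y"
  by (auto simp: pro_def)

lemma cells_iff: "\<alpha> \<in> cells D m n f g \<longleftrightarrow>
    \<alpha> \<in> Ar (D1 D) \<and> Dom (D1 D) \<alpha> = m \<and> Cod (D1 D) \<alpha> = n \<and> csrc D \<alpha> = f \<and> ctgt D \<alpha> = g"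
  by (auto simp: cells_def hom_iff)

section \<open>Simplification rules for double categories\<close>

context double_category
begin

sublocale c0: category "D0 D" by (rule cat0)
sublocale c1: category "D1 D" by (rule cat1)

abbreviation cmp0 (infixl "\<cdot>" 70) where "f \<cdot> g \<equiv> Cmp (D0 D) f g"
abbreviation cmp1 (infixl "\<bullet>" 65) where "\<alpha> \<bullet> \<beta> \<equiv> Cmp (D1 D) \<alpha> \<beta>"
abbreviation pro_cmp (infixl "\<otimes>" 75) where "m \<otimes> n \<equiv> pcmp D m n"
abbreviation cell_cmp (infixl "\<parallel>" 70) where "\<alpha> \<parallel> \<beta> \<equiv> ccmp D \<alpha> \<beta>"
abbreviation cell_ide ("\<I>") where "\<I> m \<equiv> Ide (D1 D) m"

lemma pro_ends [simp]:
  "m \<in> Ob (D1 D) \<Longrightarrow> psrc D m \<in> Ob (D0 D)" "m \<in> Ob (D1 D) \<Longrightarrow> ptgt D m \<in> Ob (D0 D)"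
  by (rule psrc_in, assumption) (rule ptgt_in)

lemma cell_ends [simp]:
  assumes "\<alpha> \<in> Ar (D1 D)"
  shows "csrc D \<alpha> \<in> Ar (D0 D)" "ctgt D \<alpha> \<in> Ar (D0 D)"
    "Dom (D0 D) (csrc D \<alpha>) = psrc D (Dom (D1 D) \<alpha>)" "Cod (D0 D) (csrc D \<alpha>) = psrc D (Cod (D1 D) \<alpha>)"
    "Dom (D0 D) (ctgt D \<alpha>) = ptgt D (Dom (D1 D) \<alpha>)" "Cod (D0 D) (ctgt D \<alpha>) = ptgt D (Cod (D1 D) \<alpha>)"
  using csrc_hom[of \<alpha>] ctgt_hom[of \<alpha>] assms by (auto simp: hom_iff)

declare csrc_ide [simp] ctgt_ide [simp]

lemma ends_cmp [simp]:
  assumes "\<alpha> \<in> Ar (D1 D)" "\<beta> \<in> Ar (D1 D)" "Cod (D1 D) \<alpha> = Dom (D1 D) \<beta>"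
  shows "csrc D (\<alpha> \<bullet> \<beta>) = csrc D \<alpha> \<cdot> csrc D \<beta>" "ctgt D (\<alpha> \<bullet> \<beta>) = ctgt D \<alpha> \<cdot> ctgt D \<beta>"
  using csrc_cmp[of \<alpha> _ _ \<beta>] ctgt_cmp[of \<alpha> _ _ \<beta>] assms by (auto simp: hom_iff)

lemma pid_simps [simp]:
  assumes "x \<in> Ob (D0 D)"
  shows "pid D x \<in> Ob (D1 D)" "psrc D (pid D x) = x" "ptgt D (pid D x) = x"
  using pid_in[OF assms] by (auto simp: pro_iff)

lemma cid_simps [simp]:
  assumes "f \<in> Ar (D0 D)"
  shows "cid D f \<in> Ar (D1 D)" "Dom (D1 D) (cid D f) = pid D (Dom (D0 D) f)"
    "Cod (D1 D) (cid D f) = pid D (Cod (D0 D) f)" "csrc D (cid D f) = f" "ctgt D (cid D f) = f"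
  using cid_in[of f "Dom (D0 D) f" "Cod (D0 D) f"] assms by (auto simp: hom_iff cells_iff)

declare cid_ide [simp]

lemma cid_of_cmp [simp]:
  "f \<in> Ar (D0 D) \<Longrightarrow> g \<in> Ar (D0 D) \<Longrightarrow> Cod (D0 D) f = Dom (D0 D) g \<Longrightarrow>
    cid D (f \<cdot> g) = cid D f \<bullet> cid D g"
  using cid_cmp[of f _ _ g] by (simp add: hom_iff)

lemma pcmp_simps [simp]:
  assumes "m \<in> Ob (D1 D)" "n \<in> Ob (D1 D)" "ptgt D m = psrc D n"
  shows "m \<otimes> n \<in> Ob (D1 D)" "psrc D (m \<otimes> n) = psrc D m" "ptgt D (m \<otimes> n) = ptgt D n"
  using pcmp_in[of m _ _ n] assms by (auto simp: pro_iff)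

lemma meeting:
  assumes "\<alpha> \<in> Ar (D1 D)" "\<beta> \<in> Ar (D1 D)" "ctgt D \<alpha> = csrc D \<beta>"
  shows "ptgt D (Dom (D1 D) \<alpha>) = psrc D (Dom (D1 D) \<beta>)" "ptgt D (Cod (D1 D) \<alpha>) = psrc D (Cod (D1 D) \<beta>)"
  using cell_ends[OF assms(1)] cell_ends[OF assms(2)] assms(3) by auto

lemma ccmp_simps [simp]:
  assumes "\<alpha> \<in> Ar (D1 D)" "\<beta> \<in> Ar (D1 D)" "ctgt D \<alpha> = csrc D \<beta>"
  shows "\<alpha> \<parallel> \<beta> \<in> Ar (D1 D)" "Dom (D1 D) (\<alpha> \<parallel> \<beta>) = Dom (D1 D) \<alpha> \<otimes> Dom (D1 D) \<beta>"
    "Cod (D1 D) (\<alpha> \<parallel> \<beta>) = Cod (D1 D) \<alpha> \<otimes> Cod (D1 D) \<beta>"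
    "csrc D (\<alpha> \<parallel> \<beta>) = csrc D \<alpha>" "ctgt D (\<alpha> \<parallel> \<beta>) = ctgt D \<beta>"
  using ccmp_in[of "Dom (D1 D) \<alpha>" "psrc D (Dom (D1 D) \<alpha>)" "psrc D (Dom (D1 D) \<beta>)" "Dom (D1 D) \<beta>"
      "ptgt D (Dom (D1 D) \<beta>)" \<alpha> "Cod (D1 D) \<alpha>" "csrc D \<alpha>" "csrc D \<beta>" \<beta> "Cod (D1 D) \<beta>" "ctgt D \<beta>"]
    meeting[OF assms] assms by (auto simp: pro_iff cells_iff)

lemma ide_ccmp_ide [simp]:
  "m \<in> Ob (D1 D) \<Longrightarrow> n \<in> Ob (D1 D) \<Longrightarrow> ptgt D m = psrc D n \<Longrightarrow> \<I> m \<parallel> \<I> n = \<I> (m \<otimes> n)"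
  using ccmp_ide[of m _ _ n] by (simp add: pro_iff)

text \<open>Interchange, oriented so that vertical composites are gathered inside one external
  composite. Composability is expressed through \<open>csrc\<close> and \<open>ctgt\<close>;
  \<open>meeting\<close> recovers from it that the proarrows fit.\<close>

lemma merge:
  assumes "\<alpha> \<in> Ar (D1 D)" "\<beta> \<in> Ar (D1 D)" "ctgt D \<alpha> = csrc D \<beta>"
    "\<alpha>' \<in> Ar (D1 D)" "\<beta>' \<in> Ar (D1 D)" "ctgt D \<alpha>' = csrc D \<beta>'"
    "Cod (D1 D) \<alpha> = Dom (D1 D) \<alpha>'" "Cod (D1 D) \<beta> = Dom (D1 D) \<beta>'"
  shows "(\<alpha> \<parallel> \<beta>) \<bullet> (\<alpha>' \<parallel> \<beta>') = (\<alpha> \<bullet> \<alpha>') \<parallel> (\<beta> \<bullet> \<beta>')"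
  using interchange[of "Dom (D1 D) \<alpha>" "psrc D (Dom (D1 D) \<alpha>)" "psrc D (Dom (D1 D) \<beta>)" "Dom (D1 D) \<beta>"
      "ptgt D (Dom (D1 D) \<beta>)" \<alpha> "Cod (D1 D) \<alpha>" "csrc D \<alpha>" "csrc D \<beta>" \<alpha>' "Cod (D1 D) \<alpha>'"
      "csrc D \<alpha>'" "csrc D \<beta>'" \<beta> "Cod (D1 D) \<beta>" "ctgt D \<beta>" \<beta>' "Cod (D1 D) \<beta>'" "ctgt D \<beta>'"]
    meeting[OF assms(1-3)] assms by (auto simp: pro_iff cells_iff)

lemma merge_extend:
  assumes "\<alpha> \<in> Ar (D1 D)" "\<beta> \<in> Ar (D1 D)" "ctgt D \<alpha> = csrc D \<beta>"
    "\<alpha>' \<in> Ar (D1 D)" "\<beta>' \<in> Ar (D1 D)" "ctgt D \<alpha>' = csrc D \<beta>'"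
    "Cod (D1 D) \<alpha> = Dom (D1 D) \<alpha>'" "Cod (D1 D) \<beta> = Dom (D1 D) \<beta>'"
    "\<gamma> \<in> Ar (D1 D)" "Dom (D1 D) \<gamma> = Cod (D1 D) \<alpha>' \<otimes> Cod (D1 D) \<beta>'"
  shows "(\<alpha> \<parallel> \<beta>) \<bullet> ((\<alpha>' \<parallel> \<beta>') \<bullet> \<gamma>) = ((\<alpha> \<bullet> \<alpha>') \<parallel> (\<beta> \<bullet> \<beta>')) \<bullet> \<gamma>"
  using assms merge[OF assms(1-8)] by (simp flip: c1.assoc_cmp)

lemma assoc_simps [simp]:
  assumes "m \<in> Ob (D1 D)" "n \<in> Ob (D1 D)" "p \<in> Ob (D1 D)" "ptgt D m = psrc D n" "ptgt D n = psrc D p"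
  shows "assoc D m n p \<in> Ar (D1 D)" "Dom (D1 D) (assoc D m n p) = m \<otimes> n \<otimes> p"
    "Cod (D1 D) (assoc D m n p) = m \<otimes> (n \<otimes> p)" "csrc D (assoc D m n p) = Ide (D0 D) (psrc D m)"
    "ctgt D (assoc D m n p) = Ide (D0 D) (ptgt D p)" "iso_arrow (D1 D) (assoc D m n p)"
  using assoc_in[of m _ _ n _ p] assms by (auto simp: pro_iff globular_def cells_iff)

lemma unit_simps [simp]:
  assumes "m \<in> Ob (D1 D)"
  shows "lunit D m \<in> Ar (D1 D)" "Dom (D1 D) (lunit D m) = pid D (psrc D m) \<otimes> m" "Cod (D1 D) (lunit D m) = m"
    "csrc D (lunit D m) = Ide (D0 D) (psrc D m)" "ctgt D (lunit D m) = Ide (D0 D) (ptgt D m)"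
    "iso_arrow (D1 D) (lunit D m)"
    "runit D m \<in> Ar (D1 D)" "Dom (D1 D) (runit D m) = m \<otimes> pid D (ptgt D m)" "Cod (D1 D) (runit D m) = m"
    "csrc D (runit D m) = Ide (D0 D) (psrc D m)" "ctgt D (runit D m) = Ide (D0 D) (ptgt D m)"
    "iso_arrow (D1 D) (runit D m)"
  using lunit_in[of m] runit_in[of m] assms by (auto simp: pro_iff globular_def cells_iff)

text \<open>\<open>iso_arrow\<close> says nothing about the source and target of the inverse; they
  are found by applying \<open>csrc\<close> and \<open>ctgt\<close> to the equation that makes it a
  right inverse.\<close>

lemma inverse_globular:
  assumes f: "iso_arrow (D1 D) f" and "csrc D f = Ide (D0 D) x" "ctgt D f = Ide (D0 D) y"
    "psrc D (Dom (D1 D) f) = x" "ptgt D (Dom (D1 D) f) = y"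
  shows "csrc D (inv_arrow (D1 D) f) = Ide (D0 D) x" "ctgt D (inv_arrow (D1 D) f) = Ide (D0 D) y"
proof -
  note i = c1.inv_arrow[OF f]
  have x: "x \<in> Ob (D0 D)" "y \<in> Ob (D0 D)" using i(1) assms by auto
  have "psrc D (Cod (D1 D) f) = x" "ptgt D (Cod (D1 D) f) = y"
    using cell_ends[OF i(1)] assms x by auto
  then show "csrc D (inv_arrow (D1 D) f) = Ide (D0 D) x" "ctgt D (inv_arrow (D1 D) f) = Ide (D0 D) y"
    using arg_cong[OF i(5), of "csrc D"] arg_cong[OF i(5), of "ctgt D"] i(1-4) assms by auto
qed

lemma inv_unit_simps [simp]:
  assumes "m \<in> Ob (D1 D)"
  shows "linv D m \<in> Ar (D1 D)" "Dom (D1 D) (linv D m) = m" "Cod (D1 D) (linv D m) = pid D (psrc D m) \<otimes> m"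
    "csrc D (linv D m) = Ide (D0 D) (psrc D m)" "ctgt D (linv D m) = Ide (D0 D) (ptgt D m)"
    "rinv D m \<in> Ar (D1 D)" "Dom (D1 D) (rinv D m) = m" "Cod (D1 D) (rinv D m) = m \<otimes> pid D (ptgt D m)"
    "csrc D (rinv D m) = Ide (D0 D) (psrc D m)" "ctgt D (rinv D m) = Ide (D0 D) (ptgt D m)"
  using c1.inv_arrow[OF unit_simps(6)[OF assms]] c1.inv_arrow[OF unit_simps(12)[OF assms]]
    inverse_globular[OF unit_simps(6)[OF assms]] inverse_globular[OF unit_simps(12)[OF assms]] assms
  by auto

lemma assoc_nat:
  assumes "\<alpha> \<in> Ar (D1 D)" "\<beta> \<in> Ar (D1 D)" "\<gamma> \<in> Ar (D1 D)" "ctgt D \<alpha> = csrc D \<beta>" "ctgt D \<beta> = csrc D \<gamma>"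
    "Dom (D1 D) \<alpha> = m" "Dom (D1 D) \<beta> = n" "Dom (D1 D) \<gamma> = p"
    "Cod (D1 D) \<alpha> = m'" "Cod (D1 D) \<beta> = n'" "Cod (D1 D) \<gamma> = p'"
  shows "((\<alpha> \<parallel> \<beta>) \<parallel> \<gamma>) \<bullet> assoc D m' n' p' = assoc D m n p \<bullet> (\<alpha> \<parallel> (\<beta> \<parallel> \<gamma>))"
  by (rule assoc_natural[of m "psrc D m" "psrc D n" n "psrc D p" p "ptgt D p" \<alpha> m' "csrc D \<alpha>" "csrc D \<beta>"
        \<beta> n' "csrc D \<gamma>" \<gamma> p' "ctgt D \<gamma>"])
    (use meeting[of \<alpha> \<beta>] meeting[of \<beta> \<gamma>] assms in \<open>auto simp: pro_iff cells_iff\<close>)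

lemma lunit_nat:
  "\<alpha> \<in> Ar (D1 D) \<Longrightarrow> (cid D (csrc D \<alpha>) \<parallel> \<alpha>) \<bullet> lunit D (Cod (D1 D) \<alpha>) = lunit D (Dom (D1 D) \<alpha>) \<bullet> \<alpha>"
  using lunit_natural[of "Dom (D1 D) \<alpha>" _ _ \<alpha>] by (simp add: pro_iff cells_iff)

lemma runit_nat:
  "\<alpha> \<in> Ar (D1 D) \<Longrightarrow> (\<alpha> \<parallel> cid D (ctgt D \<alpha>)) \<bullet> runit D (Cod (D1 D) \<alpha>) = runit D (Dom (D1 D) \<alpha>) \<bullet> \<alpha>"
  using runit_natural[of "Dom (D1 D) \<alpha>" _ _ \<alpha>] by (simp add: pro_iff cells_iff)

lemma linv_nat:
  assumes a: "\<alpha> \<in> Ar (D1 D)"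
  shows "\<alpha> \<bullet> linv D (Cod (D1 D) \<alpha>) = linv D (Dom (D1 D) \<alpha>) \<bullet> (cid D (csrc D \<alpha>) \<parallel> \<alpha>)"
proof (rule c1.iso_cancel_right[where f="lunit D (Cod (D1 D) \<alpha>)"])
  show "(\<alpha> \<bullet> linv D (Cod (D1 D) \<alpha>)) \<bullet> lunit D (Cod (D1 D) \<alpha>) =
    (linv D (Dom (D1 D) \<alpha>) \<bullet> (cid D (csrc D \<alpha>) \<parallel> \<alpha>)) \<bullet> lunit D (Cod (D1 D) \<alpha>)"
    using a by (simp add: c1.inv_arrow lunit_nat c1.inv_cmp_cancel)
qed (use a in simp_all)

lemma rinv_nat:
  assumes a: "\<alpha> \<in> Ar (D1 D)"
  shows "\<alpha> \<bullet> rinv D (Cod (D1 D) \<alpha>) = rinv D (Dom (D1 D) \<alpha>) \<bullet> (\<alpha> \<parallel> cid D (ctgt D \<alpha>))"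
proof (rule c1.iso_cancel_right[where f="runit D (Cod (D1 D) \<alpha>)"])
  show "(\<alpha> \<bullet> rinv D (Cod (D1 D) \<alpha>)) \<bullet> runit D (Cod (D1 D) \<alpha>) =
    (rinv D (Dom (D1 D) \<alpha>) \<bullet> (\<alpha> \<parallel> cid D (ctgt D \<alpha>))) \<bullet> runit D (Cod (D1 D) \<alpha>)"
    using a by (simp add: c1.inv_arrow runit_nat c1.inv_cmp_cancel)
qed (use a in simp_all)

text \<open>Naturality of the left unitor expresses \<open>\<alpha>\<close> preceded by the unitor
  through its external composite with an identity, and the unitor cancels.\<close>

lemma left_unit_faithful:
  assumes "\<alpha> \<in> Ar (D1 D)" "\<beta> \<in> Ar (D1 D)" "csrc D \<alpha> = csrc D \<beta>"
    "Dom (D1 D) \<alpha> = Dom (D1 D) \<beta>" "Cod (D1 D) \<alpha> = Cod (D1 D) \<beta>"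
    and "cid D (csrc D \<alpha>) \<parallel> \<alpha> = cid D (csrc D \<beta>) \<parallel> \<beta>"
  shows "\<alpha> = \<beta>"
  by (rule c1.iso_cancel_left[of "lunit D (Dom (D1 D) \<beta>)"])
    (use assms lunit_nat[of \<alpha>] lunit_nat[of \<beta>] in simp_all)

lemma right_unit_faithful:
  assumes "\<alpha> \<in> Ar (D1 D)" "\<beta> \<in> Ar (D1 D)" "ctgt D \<alpha> = ctgt D \<beta>"
    "Dom (D1 D) \<alpha> = Dom (D1 D) \<beta>" "Cod (D1 D) \<alpha> = Cod (D1 D) \<beta>"
    and "\<alpha> \<parallel> cid D (ctgt D \<alpha>) = \<beta> \<parallel> cid D (ctgt D \<beta>)"
  shows "\<alpha> = \<beta>"
  by (rule c1.iso_cancel_left[of "runit D (Dom (D1 D) \<beta>)"])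
    (use assms runit_nat[of \<alpha>] runit_nat[of \<beta>] in simp_all)

lemma triangle_law:
  "\<lbrakk>m \<in> Ob (D1 D); n \<in> Ob (D1 D); ptgt D m = y; psrc D n = y\<rbrakk> \<Longrightarrow>
    assoc D m (pid D y) n \<bullet> (\<I> m \<parallel> lunit D n) = runit D m \<parallel> \<I> n"
  using triangle[of m _ y n] by (simp add: pro_iff)

lemma pentagon_law:
  "\<lbrakk>m \<in> Ob (D1 D); n \<in> Ob (D1 D); p \<in> Ob (D1 D); q \<in> Ob (D1 D); ptgt D m = psrc D n;
    ptgt D n = psrc D p; ptgt D p = psrc D q\<rbrakk> \<Longrightarrow>
    (assoc D m n p \<parallel> \<I> q) \<bullet> (assoc D m (n \<otimes> p) q \<bullet> (\<I> m \<parallel> assoc D n p q)) =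
      assoc D (m \<otimes> n) p q \<bullet> assoc D m n (p \<otimes> q)"
  using pentagon[of m _ _ n _ p _ q] by (simp add: pro_iff)

lemma iso_ccmp_ide:
  assumes f: "iso_arrow (D1 D) f" and "csrc D f = Ide (D0 D) x" "ctgt D f = Ide (D0 D) y"
    "psrc D (Dom (D1 D) f) = x" "ptgt D (Dom (D1 D) f) = y" and n: "n \<in> Ob (D1 D)" "psrc D n = y"
  shows "iso_arrow (D1 D) (f \<parallel> \<I> n)"
proof -
  note [simp] = c1.inv_arrow[OF f] inverse_globular[OF assms(1-5)]
  have y: "ptgt D (Cod (D1 D) f) = y"
    using cell_ends(6)[of f] assms(3) n pro_ends(1)[OF n(1)] by simp
  have "inverse_arrows (D1 D) (f \<parallel> \<I> n) (inv_arrow (D1 D) f \<parallel> \<I> n)"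
    unfolding inverse_arrows_def using assms y by (auto simp: hom_iff merge)
  then show ?thesis by (auto simp: iso_arrow_def)
qed

text \<open>Kelly's argument: both sides of the next two lemmas agree after composing externally with an
  identity proarrow, which is a faithful operation.\<close>

lemma lunit_pcmp:
  assumes [simp]: "m \<in> Ob (D1 D)" "n \<in> Ob (D1 D)" "ptgt D m = psrc D n"
  shows "assoc D (pid D (psrc D m)) m n \<bullet> lunit D (m \<otimes> n) = lunit D m \<parallel> \<I> n"
proof (rule left_unit_faithful)
  let ?x = "psrc D m" let ?I = "pid D ?x"
  \<comment> \<open>The pentagon for \<open>I\<close>, \<open>I\<close>, \<open>m\<close>,
    \<open>n\<close> and two uses of the triangle compare both candidates after external composition
    with \<open>I\<close> on the left; the two associators in front are then cancelled.\<close>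
  have P: "(assoc D ?I ?I m \<parallel> \<I> n) \<bullet> (assoc D ?I (?I \<otimes> m) n \<bullet> (\<I> ?I \<parallel> assoc D ?I m n)) =
      assoc D (?I \<otimes> ?I) m n \<bullet> assoc D ?I ?I (m \<otimes> n)"
    by (rule pentagon_law) simp_all
  have "(assoc D ?I ?I m \<parallel> \<I> n) \<bullet> (assoc D ?I (?I \<otimes> m) n \<bullet> (\<I> ?I \<parallel> (assoc D ?I m n \<bullet> lunit D (m \<otimes> n)))) =
    ((assoc D ?I ?I m \<parallel> \<I> n) \<bullet> (assoc D ?I (?I \<otimes> m) n \<bullet> (\<I> ?I \<parallel> assoc D ?I m n))) \<bullet> (\<I> ?I \<parallel> lunit D (m \<otimes> n))"
    by (simp add: merge)
  also have "\<dots> = assoc D (?I \<otimes> ?I) m n \<bullet> (runit D ?I \<parallel> \<I> (m \<otimes> n))"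
    unfolding P by (simp add: triangle_law)
  also have "\<dots> = ((runit D ?I \<parallel> \<I> m) \<parallel> \<I> n) \<bullet> assoc D ?I m n"
    by (subst assoc_nat) simp_all
  also have "\<dots> = ((assoc D ?I ?I m \<bullet> (\<I> ?I \<parallel> lunit D m)) \<parallel> \<I> n) \<bullet> assoc D ?I m n"
    by (simp add: triangle_law)
  also have "\<dots> = (assoc D ?I ?I m \<parallel> \<I> n) \<bullet> (((\<I> ?I \<parallel> lunit D m) \<parallel> \<I> n) \<bullet> assoc D ?I m n)"
    by (simp add: merge_extend)
  also have "\<dots> = (assoc D ?I ?I m \<parallel> \<I> n) \<bullet> (assoc D ?I (?I \<otimes> m) n \<bullet> (\<I> ?I \<parallel> (lunit D m \<parallel> \<I> n)))"
    by (subst assoc_nat) simp_all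
  finally have e: "(assoc D ?I ?I m \<parallel> \<I> n) \<bullet> (assoc D ?I (?I \<otimes> m) n \<bullet> (\<I> ?I \<parallel> (assoc D ?I m n \<bullet> lunit D (m \<otimes> n)))) =
    (assoc D ?I ?I m \<parallel> \<I> n) \<bullet> (assoc D ?I (?I \<otimes> m) n \<bullet> (\<I> ?I \<parallel> (lunit D m \<parallel> \<I> n)))" .
  have i: "iso_arrow (D1 D) (assoc D ?I ?I m \<parallel> \<I> n)"
    by (rule iso_ccmp_ide) simp_all
  show "cid D (csrc D (assoc D (pid D (psrc D m)) m n \<bullet> lunit D (m \<otimes> n))) \<parallel>
      (assoc D (pid D (psrc D m)) m n \<bullet> lunit D (m \<otimes> n)) =
    cid D (csrc D (lunit D m \<parallel> \<I> n)) \<parallel> (lunit D m \<parallel> \<I> n)"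
    using c1.iso_cancel_left[OF _ _ _ _ _ c1.iso_cancel_left[OF i _ _ _ _ e]] by simp
qed simp_all

lemma runit_pcmp:
  assumes [simp]: "m \<in> Ob (D1 D)" "n \<in> Ob (D1 D)" "ptgt D m = psrc D n"
  shows "assoc D m n (pid D (ptgt D n)) \<bullet> (\<I> m \<parallel> runit D n) = runit D (m \<otimes> n)"
proof (rule right_unit_faithful)
  let ?I = "pid D (ptgt D n)"
  \<comment> \<open>The mirror image: here the pentagon is taken for \<open>m\<close>,
    \<open>n\<close>, \<open>I\<close>, \<open>I\<close>, and an associator is cancelled at the
    end.\<close>
  have P: "(assoc D m n ?I \<parallel> \<I> ?I) \<bullet> (assoc D m (n \<otimes> ?I) ?I \<bullet> (\<I> m \<parallel> assoc D n ?I ?I)) =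
      assoc D (m \<otimes> n) ?I ?I \<bullet> assoc D m n (?I \<otimes> ?I)"
    by (rule pentagon_law) simp_all
  have "((assoc D m n ?I \<bullet> (\<I> m \<parallel> runit D n)) \<parallel> \<I> ?I) \<bullet> assoc D m n ?I =
    (assoc D m n ?I \<parallel> \<I> ?I) \<bullet> (((\<I> m \<parallel> runit D n) \<parallel> \<I> ?I) \<bullet> assoc D m n ?I)"
    by (simp add: merge_extend)
  also have "\<dots> = (assoc D m n ?I \<parallel> \<I> ?I) \<bullet> (assoc D m (n \<otimes> ?I) ?I \<bullet> (\<I> m \<parallel> (runit D n \<parallel> \<I> ?I)))"
    by (subst assoc_nat) simp_all
  also have "\<dots> = ((assoc D m n ?I \<parallel> \<I> ?I) \<bullet> (assoc D m (n \<otimes> ?I) ?I \<bullet> (\<I> m \<parallel> assoc D n ?I ?I))) \<bullet>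
      (\<I> m \<parallel> (\<I> n \<parallel> lunit D ?I))"
    by (simp add: merge triangle_law)
  also have "\<dots> = assoc D (m \<otimes> n) ?I ?I \<bullet> (assoc D m n (?I \<otimes> ?I) \<bullet> (\<I> m \<parallel> (\<I> n \<parallel> lunit D ?I)))"
    unfolding P by simp
  also have "\<dots> = assoc D (m \<otimes> n) ?I ?I \<bullet> (((\<I> m \<parallel> \<I> n) \<parallel> lunit D ?I) \<bullet> assoc D m n ?I)"
    by (subst assoc_nat) (simp_all del: ide_ccmp_ide)
  also have "\<dots> = (assoc D (m \<otimes> n) ?I ?I \<bullet> (\<I> (m \<otimes> n) \<parallel> lunit D ?I)) \<bullet> assoc D m n ?I"
    by simp
  also have "\<dots> = (runit D (m \<otimes> n) \<parallel> \<I> ?I) \<bullet> assoc D m n ?I"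
    by (subst triangle_law) simp_all
  finally have e: "((assoc D m n ?I \<bullet> (\<I> m \<parallel> runit D n)) \<parallel> \<I> ?I) \<bullet> assoc D m n ?I =
    (runit D (m \<otimes> n) \<parallel> \<I> ?I) \<bullet> assoc D m n ?I" .
  show "(assoc D m n (pid D (ptgt D n)) \<bullet> (\<I> m \<parallel> runit D n)) \<parallel>
      cid D (ctgt D (assoc D m n (pid D (ptgt D n)) \<bullet> (\<I> m \<parallel> runit D n))) =
    runit D (m \<otimes> n) \<parallel> cid D (ctgt D (runit D (m \<otimes> n)))"
    using c1.iso_cancel_right[OF _ _ _ _ _ e] by simp
qed simp_all

text \<open>Naturality of the left unitor at itself identifies
  \<open>\<I> I \<parallel> lunit I\<close> with the unitor of \<open>I \<otimes> I\<close>; with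
  \<open>lunit_pcmp\<close> and the triangle, both unitors agree after external composition with
  \<open>I\<close>. This is what identifies the left and the right action on cells whose domain is
  an identity proarrow.\<close>

lemma lunit_pid_eq_runit:
  assumes [simp]: "x \<in> Ob (D0 D)"
  shows "lunit D (pid D x) = runit D (pid D x)"
proof (rule right_unit_faithful)
  let ?I = "pid D x"
  have e: "\<I> ?I \<parallel> lunit D ?I = lunit D (?I \<otimes> ?I)"
    by (rule c1.iso_cancel_right[of "lunit D ?I"]) (use lunit_nat[of "lunit D ?I"] in simp_all)
  have "lunit D ?I \<parallel> \<I> ?I = runit D ?I \<parallel> \<I> ?I"
    using lunit_pcmp[of ?I ?I] triangle_law[of ?I ?I x] by (simp add: e)
  then show "lunit D ?I \<parallel> cid D (ctgt D (lunit D ?I)) = runit D ?I \<parallel> cid D (ctgt D (runit D ?I))"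
    by simp
qed simp_all

end

section \<open>Category objects\<close>

text \<open>Cells into \<open>loop Y\<close> are generalized arrows of the category object, and this
  is their composition; for spans it composes arrows pointwise.\<close>

definition join :: "('o, 'a, 'p, 'c) dbl \<Rightarrow> ('o, 'p, 'c) cat_ob \<Rightarrow> 'c \<Rightarrow> 'c \<Rightarrow> 'c"
  where "join D Y a b = (a \<circledcirc>\<^bsub>D\<^esub> b) \<cdot>\<^bsub>D1 D\<^esub> mult Y"

text \<open>The actions of a cell \<open>\<sigma> : id \<rightarrow> s\<close> on cells into the category object \<open>s\<close>.\<close>

definition lact :: "('o, 'a, 'p, 'c) dbl \<Rightarrow> ('o, 'p, 'c) cat_ob \<Rightarrow> 'c \<Rightarrow> 'c \<Rightarrow> 'c"
  where "lact D Y \<sigma> a = linv D (Dom (D1 D) a) \<cdot>\<^bsub>D1 D\<^esub> join D Y \<sigma> a"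

definition ract :: "('o, 'a, 'p, 'c) dbl \<Rightarrow> ('o, 'p, 'c) cat_ob \<Rightarrow> 'c \<Rightarrow> 'c \<Rightarrow> 'c"
  where "ract D Y a \<sigma> = rinv D (Dom (D1 D) a) \<cdot>\<^bsub>D1 D\<^esub> join D Y a \<sigma>"

section \<open>Calculus of actions\<close>

context double_category
begin

abbreviation "cobj \<equiv> category_object D"
abbreviation "cfun \<equiv> category_object_functor D"
abbreviation "ctrans \<equiv> category_object_transformation D"

lemma cobj_simps [simp]:
  assumes "cobj Y"
  shows "base Y \<in> Ob (D0 D)" "loop Y \<in> Ob (D1 D)" "psrc D (loop Y) = base Y" "ptgt D (loop Y) = base Y"
    "mult Y \<in> Ar (D1 D)" "Dom (D1 D) (mult Y) = loop Y \<otimes> loop Y" "Cod (D1 D) (mult Y) = loop Y"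
    "csrc D (mult Y) = Ide (D0 D) (base Y)" "ctgt D (mult Y) = Ide (D0 D) (base Y)"
    "unit Y \<in> Ar (D1 D)" "Dom (D1 D) (unit Y) = pid D (base Y)" "Cod (D1 D) (unit Y) = loop Y"
    "csrc D (unit Y) = Ide (D0 D) (base Y)" "ctgt D (unit Y) = Ide (D0 D) (base Y)"
  using category_object.base_in[OF assms] category_object.loop_in[OF assms]
    category_object.mult_in[OF assms] category_object.unit_in[OF assms]
  by (auto simp: pro_iff globular_def cells_iff)

lemma into_loop:
  assumes "cobj Y" "a \<in> Ar (D1 D)" "Cod (D1 D) a = loop Y"
  shows "Cod (D0 D) (csrc D a) = base Y" "Cod (D0 D) (ctgt D a) = base Y"
  using assms by simp_all

lemma join_simps [simp]:
  assumes "cobj Y" "a \<in> Ar (D1 D)" "b \<in> Ar (D1 D)" "Cod (D1 D) a = loop Y" "Cod (D1 D) b = loop Y"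
    "ctgt D a = csrc D b"
  shows "join D Y a b \<in> Ar (D1 D)" "Dom (D1 D) (join D Y a b) = Dom (D1 D) a \<otimes> Dom (D1 D) b"
    "Cod (D1 D) (join D Y a b) = loop Y" "csrc D (join D Y a b) = csrc D a" "ctgt D (join D Y a b) = ctgt D b"
  using assms by (simp_all add: join_def)

lemma lact_simps [simp]:
  assumes "cobj Y" "\<sigma> \<in> Ar (D1 D)" "a \<in> Ar (D1 D)" "Cod (D1 D) \<sigma> = loop Y" "Cod (D1 D) a = loop Y"
    "ctgt D \<sigma> = csrc D a" "Dom (D1 D) \<sigma> = pid D (psrc D (Dom (D1 D) a))"
  shows "lact D Y \<sigma> a \<in> Ar (D1 D)" "Dom (D1 D) (lact D Y \<sigma> a) = Dom (D1 D) a"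
    "Cod (D1 D) (lact D Y \<sigma> a) = loop Y" "csrc D (lact D Y \<sigma> a) = csrc D \<sigma>" "ctgt D (lact D Y \<sigma> a) = ctgt D a"
  using assms by (simp_all add: lact_def)

lemma ract_simps [simp]:
  assumes "cobj Y" "\<sigma> \<in> Ar (D1 D)" "a \<in> Ar (D1 D)" "Cod (D1 D) \<sigma> = loop Y" "Cod (D1 D) a = loop Y"
    "ctgt D a = csrc D \<sigma>" "Dom (D1 D) \<sigma> = pid D (ptgt D (Dom (D1 D) a))"
  shows "ract D Y a \<sigma> \<in> Ar (D1 D)" "Dom (D1 D) (ract D Y a \<sigma>) = Dom (D1 D) a"
    "Cod (D1 D) (ract D Y a \<sigma>) = loop Y" "csrc D (ract D Y a \<sigma>) = csrc D a" "ctgt D (ract D Y a \<sigma>) = ctgt D \<sigma>"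
  using assms by (simp_all add: ract_def)

lemma ccmp_join:
  assumes "cobj Y" "a \<in> Ar (D1 D)" "b \<in> Ar (D1 D)" "Cod (D1 D) a = loop Y" "Cod (D1 D) b = loop Y"
    "ctgt D a = csrc D b" "c \<in> Ar (D1 D)" "d \<in> Ar (D1 D)" "ctgt D c = csrc D d"
    "Cod (D1 D) c = Dom (D1 D) a" "Cod (D1 D) d = Dom (D1 D) b"
  shows "(c \<parallel> d) \<bullet> join D Y a b = join D Y (c \<bullet> a) (d \<bullet> b)"
  using assms by (simp add: join_def merge_extend)

text \<open>Associativity of \<open>mult\<close>, carried over to generalized arrows by naturality
  of the associator, which is left over on the domain side.\<close>

lemma join_join:
  assumes [simp]: "cobj Y" "a \<in> Ar (D1 D)" "b \<in> Ar (D1 D)" "c \<in> Ar (D1 D)" "Cod (D1 D) a = loop Y"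
    "Cod (D1 D) b = loop Y" "Cod (D1 D) c = loop Y" "ctgt D a = csrc D b" "ctgt D b = csrc D c"
  shows "join D Y (join D Y a b) c =
    assoc D (Dom (D1 D) a) (Dom (D1 D) b) (Dom (D1 D) c) \<bullet> join D Y a (join D Y b c)"
proof -
  note [simp] = meeting[of a b] meeting[of b c]
  have "join D Y (join D Y a b) c = ((a \<parallel> b) \<parallel> c) \<bullet> ((mult Y \<parallel> \<I> (loop Y)) \<bullet> mult Y)"
    by (simp add: join_def merge_extend)
  also have "\<dots> = ((a \<parallel> b) \<parallel> c) \<bullet> (assoc D (loop Y) (loop Y) (loop Y) \<bullet> ((\<I> (loop Y) \<parallel> mult Y) \<bullet> mult Y))"
    by (subst category_object.mult_assoc) simp_all
  also have "\<dots> = assoc D (Dom (D1 D) a) (Dom (D1 D) b) (Dom (D1 D) c) \<bullet>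
      ((a \<parallel> (b \<parallel> c)) \<bullet> ((\<I> (loop Y) \<parallel> mult Y) \<bullet> mult Y))"
    by (rule c1.cmp_extend[OF assoc_nat]) simp_all
  finally show ?thesis by (simp add: join_def merge_extend)
qed

text \<open>Inverse form of \<open>lunit_pcmp\<close>: the inverse unitor hidden in
  \<open>lact\<close> meets the associator of \<open>join_join\<close> in exactly this
  shape.\<close>

lemma linv_pcmp:
  assumes [simp]: "m \<in> Ob (D1 D)" "n \<in> Ob (D1 D)" "ptgt D m = psrc D n" "psrc D m = x"
  shows "(linv D m \<parallel> \<I> n) \<bullet> assoc D (pid D x) m n = linv D (m \<otimes> n)"
proof -
  have x [simp]: "x \<in> Ob (D0 D)" using pro_ends(1)[of m] by simp
  show ?thesis
  by (rule c1.iso_cancel_right[of "lunit D (m \<otimes> n)"])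
    (use lunit_pcmp[of m n] in \<open>simp_all add: merge c1.inv_arrow\<close>)
qed

lemma rinv_pcmp:
  assumes [simp]: "m \<in> Ob (D1 D)" "n \<in> Ob (D1 D)" "ptgt D m = psrc D n" "ptgt D n = y"
  shows "rinv D (m \<otimes> n) \<bullet> assoc D m n (pid D y) = \<I> m \<parallel> rinv D n"
proof -
  have y [simp]: "y \<in> Ob (D0 D)" using pro_ends(2)[of n] by simp
  have "rinv D (m \<otimes> n) \<bullet> assoc D m n (pid D y) =
    rinv D (m \<otimes> n) \<bullet> (assoc D m n (pid D y) \<bullet> ((\<I> m \<parallel> runit D n) \<bullet> (\<I> m \<parallel> rinv D n)))"
    by (simp add: merge c1.inv_arrow)
  also have "\<dots> = rinv D (m \<otimes> n) \<bullet> ((assoc D m n (pid D y) \<bullet> (\<I> m \<parallel> runit D n)) \<bullet> (\<I> m \<parallel> rinv D n))"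
    by simp
  also have "\<dots> = \<I> m \<parallel> rinv D n"
    using runit_pcmp[of m n] by (simp del: c1.assoc_cmp add: c1.inv_cmp_cancel)
  finally show ?thesis .
qed

text \<open>The triangle identity with both unitors inverted: insert the left unitor followed by its
  inverse, apply the triangle, and cancel the right unitor.\<close>

lemma inv_triangle:
  assumes [simp]: "m \<in> Ob (D1 D)" "n \<in> Ob (D1 D)" "ptgt D m = y" "psrc D n = y"
  shows "(rinv D m \<parallel> \<I> n) \<bullet> assoc D m (pid D y) n = \<I> m \<parallel> linv D n"
proof -
  have y [simp]: "y \<in> Ob (D0 D)" using pro_ends(2)[of m] by simp
  have "(rinv D m \<parallel> \<I> n) \<bullet> assoc D m (pid D y) n =
    (rinv D m \<parallel> \<I> n) \<bullet> ((assoc D m (pid D y) n \<bullet> (\<I> m \<parallel> lunit D n)) \<bullet> (\<I> m \<parallel> linv D n))"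
    by (simp add: merge c1.inv_arrow)
  also have "\<dots> = \<I> m \<parallel> linv D n"
    by (subst triangle_law) (simp_all add: merge c1.inv_arrow)
  finally show ?thesis .
qed

text \<open>Here and in the next two lemmas a cell with an identity proarrow as domain acts on the
  left, on the right or in the middle of a \<open>join\<close>. In each case the associator of
  \<open>join_join\<close> is absorbed by an inverse unitor, through \<open>linv_pcmp\<close>,
  \<open>rinv_pcmp\<close> and \<open>inv_triangle\<close> respectively.\<close>

lemma join_lact:
  assumes [simp]: "cobj Y" "\<sigma> \<in> Ar (D1 D)" "a \<in> Ar (D1 D)" "b \<in> Ar (D1 D)" "Cod (D1 D) \<sigma> = loop Y"
    "Cod (D1 D) a = loop Y" "Cod (D1 D) b = loop Y" "ctgt D \<sigma> = csrc D a" "ctgt D a = csrc D b"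
    "Dom (D1 D) \<sigma> = pid D (psrc D (Dom (D1 D) a))"
  shows "join D Y (lact D Y \<sigma> a) b = lact D Y \<sigma> (join D Y a b)"
proof -
  note [simp] = meeting[of a b]
  let ?m = "Dom (D1 D) a" and ?n = "Dom (D1 D) b"
  have "join D Y (lact D Y \<sigma> a) b = (linv D ?m \<parallel> \<I> ?n) \<bullet> join D Y (join D Y \<sigma> a) b"
    by (simp add: ccmp_join lact_def)
  also have "\<dots> = ((linv D ?m \<parallel> \<I> ?n) \<bullet> assoc D (pid D (psrc D ?m)) ?m ?n) \<bullet> join D Y \<sigma> (join D Y a b)"
    by (simp add: join_join)
  also have "\<dots> = lact D Y \<sigma> (join D Y a b)"
    by (subst linv_pcmp) (simp_all add: lact_def)
  finally show ?thesis .
qed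

lemma join_ract:
  assumes [simp]: "cobj Y" "\<tau> \<in> Ar (D1 D)" "a \<in> Ar (D1 D)" "b \<in> Ar (D1 D)" "Cod (D1 D) \<tau> = loop Y"
    "Cod (D1 D) a = loop Y" "Cod (D1 D) b = loop Y" "ctgt D b = csrc D \<tau>" "ctgt D a = csrc D b"
    "Dom (D1 D) \<tau> = pid D (ptgt D (Dom (D1 D) b))"
  shows "join D Y a (ract D Y b \<tau>) = ract D Y (join D Y a b) \<tau>"
proof -
  note [simp] = meeting[of a b]
  let ?m = "Dom (D1 D) a" and ?n = "Dom (D1 D) b"
  have "join D Y a (ract D Y b \<tau>) = (\<I> ?m \<parallel> rinv D ?n) \<bullet> join D Y a (join D Y b \<tau>)"
    by (simp add: ccmp_join ract_def)
  also have "\<dots> = (rinv D (?m \<otimes> ?n) \<bullet> assoc D ?m ?n (pid D (ptgt D ?n))) \<bullet> join D Y a (join D Y b \<tau>)"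
    by (subst rinv_pcmp) simp_all
  also have "\<dots> = ract D Y (join D Y a b) \<tau>"
    by (simp add: join_join ract_def)
  finally show ?thesis .
qed

lemma join_ract_lact:
  assumes [simp]: "cobj Y" "\<sigma> \<in> Ar (D1 D)" "a \<in> Ar (D1 D)" "b \<in> Ar (D1 D)" "Cod (D1 D) \<sigma> = loop Y"
    "Cod (D1 D) a = loop Y" "Cod (D1 D) b = loop Y" "ctgt D a = csrc D \<sigma>" "ctgt D \<sigma> = csrc D b"
    "Dom (D1 D) \<sigma> = pid D (ptgt D (Dom (D1 D) a))"
  shows "join D Y (ract D Y a \<sigma>) b = join D Y a (lact D Y \<sigma> b)"
proof -
  let ?m = "Dom (D1 D) a" and ?n = "Dom (D1 D) b"
  have [simp]: "psrc D ?n = ptgt D ?m" using meeting[of \<sigma> b] by simp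
  have "join D Y (ract D Y a \<sigma>) b = (rinv D ?m \<parallel> \<I> ?n) \<bullet> join D Y (join D Y a \<sigma>) b"
    by (simp add: ccmp_join ract_def)
  also have "\<dots> = ((rinv D ?m \<parallel> \<I> ?n) \<bullet> assoc D ?m (pid D (ptgt D ?m)) ?n) \<bullet> join D Y a (join D Y \<sigma> b)"
    by (simp add: join_join)
  also have "\<dots> = join D Y a (lact D Y \<sigma> b)"
    by (subst inv_triangle) (simp_all add: ccmp_join lact_def)
  finally show ?thesis .
qed

lemma cmp_lact:
  assumes [simp]: "cobj Y" "\<sigma> \<in> Ar (D1 D)" "a \<in> Ar (D1 D)" "c \<in> Ar (D1 D)" "Cod (D1 D) \<sigma> = loop Y"
    "Cod (D1 D) a = loop Y" "ctgt D \<sigma> = csrc D a" "Dom (D1 D) \<sigma> = pid D (psrc D (Dom (D1 D) a))"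
    "Cod (D1 D) c = Dom (D1 D) a"
  shows "c \<bullet> lact D Y \<sigma> a = lact D Y (cid D (csrc D c) \<bullet> \<sigma>) (c \<bullet> a)"
  by (simp add: lact_def c1.cmp_extend[OF linv_nat[of c, simplified]] ccmp_join)

lemma cmp_ract:
  assumes [simp]: "cobj Y" "\<sigma> \<in> Ar (D1 D)" "a \<in> Ar (D1 D)" "c \<in> Ar (D1 D)" "Cod (D1 D) \<sigma> = loop Y"
    "Cod (D1 D) a = loop Y" "ctgt D a = csrc D \<sigma>" "Dom (D1 D) \<sigma> = pid D (ptgt D (Dom (D1 D) a))"
    "Cod (D1 D) c = Dom (D1 D) a"
  shows "c \<bullet> ract D Y a \<sigma> = ract D Y (c \<bullet> a) (cid D (ctgt D c) \<bullet> \<sigma>)"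
  by (simp add: ract_def c1.cmp_extend[OF rinv_nat[of c, simplified]] ccmp_join)

text \<open>After pulling \<open>unit\<close> out of the join, \<open>unit_left\<close> turns it
  into a unitor, and naturality cancels this unitor against the inverse one hidden in the
  action.\<close>

lemma lact_unit:
  assumes [simp]: "cobj Y" "a \<in> Ar (D1 D)" "Cod (D1 D) a = loop Y" "csrc D a = f"
  shows "lact D Y (cid D f \<bullet> unit Y) a = a"
proof -
  have [simp]: "f \<in> Ar (D0 D)" "Dom (D0 D) f = psrc D (Dom (D1 D) a)" "Cod (D0 D) f = base Y"
    using cell_ends[of a] by simp_all
  have "lact D Y (cid D f \<bullet> unit Y) a = linv D (Dom (D1 D) a) \<bullet> ((cid D f \<parallel> a) \<bullet> join D Y (unit Y) (\<I> (loop Y)))"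
    by (simp add: lact_def ccmp_join)
  also have "\<dots> = a"
    using lunit_nat[of a] by (simp add: join_def category_object.unit_left c1.inv_cmp_cancel)
  finally show ?thesis .
qed

lemma ract_unit:
  assumes [simp]: "cobj Y" "a \<in> Ar (D1 D)" "Cod (D1 D) a = loop Y" "ctgt D a = f"
  shows "ract D Y a (cid D f \<bullet> unit Y) = a"
proof -
  have [simp]: "f \<in> Ar (D0 D)" "Dom (D0 D) f = ptgt D (Dom (D1 D) a)" "Cod (D0 D) f = base Y"
    using cell_ends[of a] by simp_all
  have "ract D Y a (cid D f \<bullet> unit Y) = rinv D (Dom (D1 D) a) \<bullet> ((a \<parallel> cid D f) \<bullet> join D Y (\<I> (loop Y)) (unit Y))"
    by (simp add: ract_def ccmp_join)
  also have "\<dots> = a"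
    using runit_nat[of a] by (simp add: join_def category_object.unit_right c1.inv_cmp_cancel)
  finally show ?thesis .
qed

lemma lact_eq_ract:
  assumes "Dom (D1 D) \<sigma> = pid D x" "Dom (D1 D) \<tau> = pid D x" "x \<in> Ob (D0 D)"
  shows "ract D Y \<sigma> \<tau> = lact D Y \<sigma> \<tau>"
  using assms by (simp add: lact_def ract_def lunit_pid_eq_runit)

text \<open>In this lemma, \<open>ract_lact\<close> and \<open>ract_ract\<close>, the outer action
  is unfolded to a \<open>join\<close>, the inner one is moved across it by the lemmas above, and
  the result is folded back, so that no associator survives.\<close>

lemma lact_lact:
  assumes [simp]: "cobj Y" "\<sigma> \<in> Ar (D1 D)" "\<tau> \<in> Ar (D1 D)" "a \<in> Ar (D1 D)" "Cod (D1 D) \<sigma> = loop Y"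
    "Cod (D1 D) \<tau> = loop Y" "Cod (D1 D) a = loop Y" "ctgt D \<sigma> = csrc D \<tau>" "ctgt D \<tau> = csrc D a"
    "Dom (D1 D) \<sigma> = pid D (psrc D (Dom (D1 D) a))" "Dom (D1 D) \<tau> = pid D (psrc D (Dom (D1 D) a))"
  shows "lact D Y (lact D Y \<sigma> \<tau>) a = lact D Y \<sigma> (lact D Y \<tau> a)"
proof -
  have "lact D Y (lact D Y \<sigma> \<tau>) a = linv D (Dom (D1 D) a) \<bullet> lact D Y \<sigma> (join D Y \<tau> a)"
    by (simp add: lact_def[of _ _ "lact D Y \<sigma> \<tau>"] join_lact)
  then show ?thesis by (simp add: cmp_lact) (simp add: lact_def[of _ _ \<tau>])
qed

lemma ract_lact:
  assumes [simp]: "cobj Y" "\<sigma> \<in> Ar (D1 D)" "\<tau> \<in> Ar (D1 D)" "a \<in> Ar (D1 D)" "Cod (D1 D) \<sigma> = loop Y"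
    "Cod (D1 D) \<tau> = loop Y" "Cod (D1 D) a = loop Y" "ctgt D \<sigma> = csrc D a" "ctgt D a = csrc D \<tau>"
    "Dom (D1 D) \<sigma> = pid D (psrc D (Dom (D1 D) a))" "Dom (D1 D) \<tau> = pid D (ptgt D (Dom (D1 D) a))"
  shows "ract D Y (lact D Y \<sigma> a) \<tau> = lact D Y \<sigma> (ract D Y a \<tau>)"
proof -
  have "ract D Y (lact D Y \<sigma> a) \<tau> = rinv D (Dom (D1 D) a) \<bullet> lact D Y \<sigma> (join D Y a \<tau>)"
    by (simp add: ract_def join_lact)
  then show ?thesis by (simp add: cmp_lact) (simp add: ract_def)
qed

lemma ract_ract:
  assumes [simp]: "cobj Y" "\<sigma> \<in> Ar (D1 D)" "\<tau> \<in> Ar (D1 D)" "a \<in> Ar (D1 D)" "Cod (D1 D) \<sigma> = loop Y"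
    "Cod (D1 D) \<tau> = loop Y" "Cod (D1 D) a = loop Y" "ctgt D a = csrc D \<sigma>" "ctgt D \<sigma> = csrc D \<tau>"
    "Dom (D1 D) \<sigma> = pid D (ptgt D (Dom (D1 D) a))" "Dom (D1 D) \<tau> = pid D (ptgt D (Dom (D1 D) a))"
  shows "ract D Y (ract D Y a \<sigma>) \<tau> = ract D Y a (lact D Y \<sigma> \<tau>)"
  by (simp add: ract_def[of _ _ _ \<tau>] join_ract_lact) (simp add: ract_def)

section \<open>Functors and 2-morphisms of category objects\<close>

lemma cfun_simps [simp]:
  assumes "cfun H"
  shows "cobj (fsrc H)" "cobj (ftgt H)" "farr H \<in> Ar (D0 D)" "Dom (D0 D) (farr H) = base (fsrc H)"
    "Cod (D0 D) (farr H) = base (ftgt H)" "fcell H \<in> Ar (D1 D)" "Dom (D1 D) (fcell H) = loop (fsrc H)"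
    "Cod (D1 D) (fcell H) = loop (ftgt H)" "csrc D (fcell H) = farr H" "ctgt D (fcell H) = farr H"
  using assms by (auto simp: category_object_functor_def hom_iff cells_iff)

lemma cfun_mult:
  "cfun H \<Longrightarrow> (fcell H \<parallel> fcell H) \<bullet> mult (ftgt H) = mult (fsrc H) \<bullet> fcell H"
  unfolding category_object_functor_def by blast

lemma cfun_unit: "cfun H \<Longrightarrow> cid D (farr H) \<bullet> unit (ftgt H) = unit (fsrc H) \<bullet> fcell H"
  unfolding category_object_functor_def by blast

lemma cfunI:
  assumes "cobj (fsrc H)" "cobj (ftgt H)" "farr H \<in> Ar (D0 D)" "Dom (D0 D) (farr H) = base (fsrc H)"
    "Cod (D0 D) (farr H) = base (ftgt H)" "fcell H \<in> Ar (D1 D)" "Dom (D1 D) (fcell H) = loop (fsrc H)"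
    "Cod (D1 D) (fcell H) = loop (ftgt H)" "csrc D (fcell H) = farr H" "ctgt D (fcell H) = farr H"
    "(fcell H \<parallel> fcell H) \<bullet> mult (ftgt H) = mult (fsrc H) \<bullet> fcell H"
    "cid D (farr H) \<bullet> unit (ftgt H) = unit (fsrc H) \<bullet> fcell H"
  shows "cfun H"
  unfolding category_object_functor_def hom_iff cells_iff using assms by blast

lemma join_cfun:
  assumes "cfun H" "a \<in> Ar (D1 D)" "b \<in> Ar (D1 D)" "Cod (D1 D) a = loop (fsrc H)"
    "Cod (D1 D) b = loop (fsrc H)" "ctgt D a = csrc D b"
  shows "join D (fsrc H) a b \<bullet> fcell H = join D (ftgt H) (a \<bullet> fcell H) (b \<bullet> fcell H)"
  using assms cfun_mult[OF assms(1)] into_loop[of "fsrc H" b]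
  by (simp add: join_def merge_extend flip: cfun_mult)

lemma lact_cfun:
  assumes "cfun H" "\<sigma> \<in> Ar (D1 D)" "a \<in> Ar (D1 D)" "Cod (D1 D) \<sigma> = loop (fsrc H)" "Cod (D1 D) a = loop (fsrc H)"
    "ctgt D \<sigma> = csrc D a" "Dom (D1 D) \<sigma> = pid D (psrc D (Dom (D1 D) a))"
  shows "lact D (fsrc H) \<sigma> a \<bullet> fcell H = lact D (ftgt H) (\<sigma> \<bullet> fcell H) (a \<bullet> fcell H)"
  using assms by (simp add: lact_def join_cfun)

lemma loop_eq_lact:
  assumes "cfun (xtgt s)" "cobj (ftgt (xsrc s))" "xcell s \<in> Ar (D1 D)" "fsrc (xtgt s) = fsrc (xsrc s)"
    "ftgt (xtgt s) = ftgt (xsrc s)" "Dom (D1 D) (xcell s) = pid D (base (fsrc (xsrc s)))"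
    "Cod (D1 D) (xcell s) = loop (ftgt (xsrc s))" "ctgt D (xcell s) = farr (xtgt s)"
  shows "cat_ob_trans_loop D s = lact D (ftgt (xsrc s)) (xcell s) (fcell (xtgt s))"
  using assms cfun_simps(1)[OF assms(1)] by (simp add: lact_def cat_ob_trans_loop_def join_def)

lemma ctransD:
  assumes "ctrans s"
  shows "cfun (xsrc s)" "cfun (xtgt s)" "fsrc (xtgt s) = fsrc (xsrc s)" "ftgt (xtgt s) = ftgt (xsrc s)"
    "xcell s \<in> Ar (D1 D)" "Dom (D1 D) (xcell s) = pid D (base (fsrc (xsrc s)))"
    "Cod (D1 D) (xcell s) = loop (ftgt (xsrc s))" "csrc D (xcell s) = farr (xsrc s)" "ctgt D (xcell s) = farr (xtgt s)"
  using assms by (auto simp: category_object_transformation_def cells_iff)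

lemma ctrans_simps [simp]:
  assumes "ctrans s"
  shows "cfun (xsrc s)" "cfun (xtgt s)" "fsrc (xtgt s) = fsrc (xsrc s)" "ftgt (xtgt s) = ftgt (xsrc s)"
    "cobj (fsrc (xsrc s))" "cobj (ftgt (xsrc s))"
    "xcell s \<in> Ar (D1 D)" "Dom (D1 D) (xcell s) = pid D (base (fsrc (xsrc s)))"
    "Cod (D1 D) (xcell s) = loop (ftgt (xsrc s))" "csrc D (xcell s) = farr (xsrc s)" "ctgt D (xcell s) = farr (xtgt s)"
    "Dom (D0 D) (farr (xtgt s)) = base (fsrc (xsrc s))" "Cod (D0 D) (farr (xtgt s)) = base (ftgt (xsrc s))"
    "Dom (D1 D) (fcell (xtgt s)) = loop (fsrc (xsrc s))" "Cod (D1 D) (fcell (xtgt s)) = loop (ftgt (xsrc s))"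
  using ctransD[OF assms] cfun_simps[OF ctransD(1)[OF assms]] cfun_simps[OF ctransD(2)[OF assms]] by auto

text \<open>The condition on a 2-morphism is that both actions induce the same cell; later arguments
  choose whichever side is convenient.\<close>

lemma ctrans_loop:
  assumes "ctrans s"
  shows "cat_ob_trans_loop D s = lact D (ftgt (xsrc s)) (xcell s) (fcell (xtgt s))"
    "cat_ob_trans_loop D s = ract D (ftgt (xsrc s)) (fcell (xsrc s)) (xcell s)"
proof -
  show "cat_ob_trans_loop D s = lact D (ftgt (xsrc s)) (xcell s) (fcell (xtgt s))"
    using assms by (simp add: loop_eq_lact)
  have "cat_ob_trans_loop D s = rinv D (loop (fsrc (xsrc s))) \<bullet> (fcell (xsrc s) \<parallel> xcell s) \<bullet> mult (ftgt (xsrc s))"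
    using assms unfolding category_object_transformation_def by blast
  then show "cat_ob_trans_loop D s = ract D (ftgt (xsrc s)) (fcell (xsrc s)) (xcell s)"
    using assms by (simp add: ract_def join_def)
qed

lemma ctransI:
  assumes "cfun (xsrc s)" "cfun (xtgt s)" "fsrc (xtgt s) = fsrc (xsrc s)" "ftgt (xtgt s) = ftgt (xsrc s)"
    "xcell s \<in> Ar (D1 D)" "Dom (D1 D) (xcell s) = pid D (base (fsrc (xsrc s)))"
    "Cod (D1 D) (xcell s) = loop (ftgt (xsrc s))" "csrc D (xcell s) = farr (xsrc s)" "ctgt D (xcell s) = farr (xtgt s)"
    and "lact D (ftgt (xsrc s)) (xcell s) (fcell (xtgt s)) = ract D (ftgt (xsrc s)) (fcell (xsrc s)) (xcell s)"
  shows "ctrans s"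
  using assms loop_eq_lact[of s] unfolding category_object_transformation_def
  by (simp add: ract_def join_def cells_iff)

lemma loop_simps [simp]:
  assumes "ctrans s"
  shows "cat_ob_trans_loop D s \<in> Ar (D1 D)" "Dom (D1 D) (cat_ob_trans_loop D s) = loop (fsrc (xsrc s))"
    "Cod (D1 D) (cat_ob_trans_loop D s) = loop (ftgt (xsrc s))"
    "csrc D (cat_ob_trans_loop D s) = farr (xsrc s)" "ctgt D (cat_ob_trans_loop D s) = farr (xtgt s)"
  using assms by (simp_all add: ctrans_loop(1))

text \<open>The functor \<open>xtgt s\<close> carries the unit of its domain to the unit of its
  codomain, on which \<open>xcell s\<close> acts without change. Hence the induced cell determines
  the 2-morphism.\<close>

lemma unit_loop:
  assumes [simp]: "ctrans s" shows "unit (fsrc (xsrc s)) \<bullet> cat_ob_trans_loop D s = xcell s"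
proof -
  have "unit (fsrc (xsrc s)) \<bullet> cat_ob_trans_loop D s =
      lact D (ftgt (xsrc s)) (xcell s) (cid D (farr (xtgt s)) \<bullet> unit (ftgt (xsrc s)))"
    using cfun_unit[of "xtgt s"] by (simp add: ctrans_loop(1) cmp_lact)
  \<comment> \<open>Both cells start at an identity proarrow, so the left action of
    \<open>xcell s\<close> may be read as the right action of a unit.\<close>
  also have "\<dots> = ract D (ftgt (xsrc s)) (xcell s) (cid D (farr (xtgt s)) \<bullet> unit (ftgt (xsrc s)))"
    by (rule lact_eq_ract[symmetric, where x="base (fsrc (xsrc s))"]) simp_all
  also have "\<dots> = xcell s" by (simp add: ract_unit)
  finally show ?thesis .
qed

lemma ctrans_eqI:
  assumes "ctrans s" "ctrans t" "xsrc s = xsrc t" "xtgt s = xtgt t"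
    "cat_ob_trans_loop D s = cat_ob_trans_loop D t"
  shows "s = t"
  using assms unit_loop[of s] unit_loop[of t] by (auto intro!: cat_ob_trans.equality)

text \<open>Functoriality of the middle functor \<open>xsrc t\<close> carries the multiplication
  past both actions. The identity serves twice: it yields the interchange law for category objects,
  and it is naturality of the laxator of \<open>S0\<close>.\<close>

lemma mult_loop:
  assumes s [simp]: "ctrans s" and t [simp]: "ctrans t" and m [simp]: "xtgt s = xsrc t"
  shows "mult (fsrc (xsrc s)) \<bullet> lact D (ftgt (xsrc s)) (xcell s) (cat_ob_trans_loop D t) =
    join D (ftgt (xsrc s)) (cat_ob_trans_loop D s) (cat_ob_trans_loop D t)"
proof -
  let ?Y = "ftgt (xsrc s)"
  have [simp]: "fsrc (xsrc t) = fsrc (xsrc s)" "ftgt (xsrc t) = ?Y"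
    using ctrans_simps(3,4)[OF s] unfolding m by simp_all
  have [simp]: "cobj ?Y" by simp
  have [simp]: "Dom (D0 D) (farr (xsrc t)) = base (fsrc (xsrc s))" "Cod (D0 D) (farr (xsrc t)) = base ?Y"
    "Dom (D1 D) (fcell (xsrc t)) = loop (fsrc (xsrc s))" "Cod (D1 D) (fcell (xsrc t)) = loop ?Y"
    by simp_all
  have e: "mult (fsrc (xsrc s)) \<bullet> fcell (xsrc t) = join D ?Y (fcell (xsrc t)) (fcell (xsrc t))"
    using cfun_mult[of "xsrc t"] by (simp add: join_def)
  have "mult (fsrc (xsrc s)) \<bullet> lact D ?Y (xcell s) (cat_ob_trans_loop D t) =
    lact D ?Y (xcell s) (ract D ?Y (mult (fsrc (xsrc s)) \<bullet> fcell (xsrc t)) (xcell t))"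
    by (simp add: ctrans_loop(2)[of t] cmp_lact cmp_ract)
  also have "\<dots> = lact D ?Y (xcell s) (join D ?Y (fcell (xsrc t)) (cat_ob_trans_loop D t))"
    by (simp add: e join_ract ctrans_loop(2)[of t])
  also have "\<dots> = join D ?Y (lact D ?Y (xcell s) (fcell (xsrc t))) (cat_ob_trans_loop D t)"
    by (simp add: join_lact)
  finally show ?thesis by (simp add: ctrans_loop(1)[of s])
qed

end

section \<open>The 2-category of category objects\<close>

context double_category
begin

definition ide_trans :: "('o, 'a, 'p, 'c) cat_ob_fun \<Rightarrow> ('o, 'a, 'p, 'c) cat_ob_trans"
  where "ide_trans H = \<lparr>xsrc = H, xtgt = H, xcell = cid D (farr H) \<bullet> unit (ftgt H)\<rparr>"

definition vcmp :: "('o, 'a, 'p, 'c) cat_ob_trans \<Rightarrow> ('o, 'a, 'p, 'c) cat_ob_trans \<Rightarrow> ('o, 'a, 'p, 'c) cat_ob_trans"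
  where "vcmp s t = \<lparr>xsrc = xsrc s, xtgt = xtgt t, xcell = lact D (ftgt (xsrc s)) (xcell s) (xcell t)\<rparr>"

definition tcmp :: "('o, 'a, 'p, 'c) cat_ob_trans \<Rightarrow> ('o, 'a, 'p, 'c) cat_ob_trans \<Rightarrow> ('o, 'a, 'p, 'c) cat_ob_trans"
  where "tcmp s t = \<lparr>xsrc = cat_ob_fun_cmp D (xsrc s) (xsrc t), xtgt = cat_ob_fun_cmp D (xtgt s) (xtgt t),
    xcell = xcell s \<bullet> cat_ob_trans_loop D t\<rparr>"

lemma trans_ops_simps [simp]:
  "xsrc (ide_trans H) = H" "xtgt (ide_trans H) = H" "xcell (ide_trans H) = cid D (farr H) \<bullet> unit (ftgt H)"
  "xsrc (vcmp s t) = xsrc s" "xtgt (vcmp s t) = xtgt t"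
  "xcell (vcmp s t) = lact D (ftgt (xsrc s)) (xcell s) (xcell t)"
  "xsrc (tcmp s t) = cat_ob_fun_cmp D (xsrc s) (xsrc t)" "xtgt (tcmp s t) = cat_ob_fun_cmp D (xtgt s) (xtgt t)"
  "xcell (tcmp s t) = xcell s \<bullet> cat_ob_trans_loop D t"
  by (simp_all add: ide_trans_def vcmp_def tcmp_def)

lemma CatObjects_simps:
  "Ob (C1 (CatObjects D)) = {X. cobj X}" "Ar (C1 (CatObjects D)) = {H. cfun H}"
  "Dom (C1 (CatObjects D)) = fsrc" "Cod (C1 (CatObjects D)) = ftgt"
  "Ide (C1 (CatObjects D)) = (\<lambda>X. \<lparr>fsrc = X, ftgt = X, farr = Ide (D0 D) (base X), fcell = \<I> (loop X)\<rparr>)"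
  "Cmp (C1 (CatObjects D)) = cat_ob_fun_cmp D"
  "Ob (C2 (CatObjects D)) = {H. cfun H}" "Ar (C2 (CatObjects D)) = {s. ctrans s}"
  "Dom (C2 (CatObjects D)) = xsrc" "Cod (C2 (CatObjects D)) = xtgt"
  "Ide (C2 (CatObjects D)) = ide_trans"
  "HCmp (CatObjects D) = tcmp"
  by (simp_all add: CatObjects_def ide_trans_def[abs_def] tcmp_def[abs_def])

lemma cfun_cmp_simps [simp]:
  "fsrc (cat_ob_fun_cmp D H K) = fsrc H" "ftgt (cat_ob_fun_cmp D H K) = ftgt K"
  "farr (cat_ob_fun_cmp D H K) = farr H \<cdot> farr K" "fcell (cat_ob_fun_cmp D H K) = fcell H \<bullet> fcell K"
  by (simp_all add: cat_ob_fun_cmp_def)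

lemma cfun_ide:
  assumes "cobj X" shows "cfun \<lparr>fsrc = X, ftgt = X, farr = Ide (D0 D) (base X), fcell = \<I> (loop X)\<rparr>"
  by (rule cfunI) (use assms in simp_all)

lemma cfun_cmp:
  assumes [simp]: "cfun H" "cfun K" "ftgt H = fsrc K" shows "cfun (cat_ob_fun_cmp D H K)"
proof (rule cfunI)
  let ?X = "fsrc K"
  have [simp]: "Cod (D0 D) (farr H) = base ?X" "Cod (D1 D) (fcell H) = loop ?X"
    using cfun_simps[of H] by simp_all
  have "((fcell H \<bullet> fcell K) \<parallel> (fcell H \<bullet> fcell K)) \<bullet> mult (ftgt K) =
    (fcell H \<parallel> fcell H) \<bullet> ((fcell K \<parallel> fcell K) \<bullet> mult (ftgt K))"
    by (simp add: merge_extend)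
  also have "\<dots> = (fcell H \<parallel> fcell H) \<bullet> (mult ?X \<bullet> fcell K)"
    by (simp only: cfun_mult[of K, simplified])
  also have "\<dots> = mult (fsrc H) \<bullet> (fcell H \<bullet> fcell K)"
    by (rule trans[OF c1.cmp_extend[where h="mult (fsrc H)" and k="fcell H"]])
      (use cfun_mult[of H] in simp_all)
  finally show "(fcell (cat_ob_fun_cmp D H K) \<parallel> fcell (cat_ob_fun_cmp D H K)) \<bullet>
      mult (ftgt (cat_ob_fun_cmp D H K)) = mult (fsrc (cat_ob_fun_cmp D H K)) \<bullet> fcell (cat_ob_fun_cmp D H K)"
    by simp
  have "cid D (farr H) \<bullet> (cid D (farr K) \<bullet> unit (ftgt K)) = cid D (farr H) \<bullet> (unit ?X \<bullet> fcell K)"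
    by (simp only: cfun_unit[of K, simplified])
  also have "\<dots> = unit (fsrc H) \<bullet> (fcell H \<bullet> fcell K)"
    by (rule trans[OF c1.cmp_extend[where h="unit (fsrc H)" and k="fcell H"]])
      (use cfun_unit[of H] in simp_all)
  finally show "cid D (farr (cat_ob_fun_cmp D H K)) \<bullet> unit (ftgt (cat_ob_fun_cmp D H K)) =
    unit (fsrc (cat_ob_fun_cmp D H K)) \<bullet> fcell (cat_ob_fun_cmp D H K)"
    by simp
qed simp_all

lemma ctrans_ide:
  assumes "cfun H" shows "ctrans (ide_trans H)"
  by (rule ctransI) (use assms in \<open>simp_all add: lact_unit ract_unit\<close>)

lemma loop_ide [simp]: "cfun H \<Longrightarrow> cat_ob_trans_loop D (ide_trans H) = fcell H"
  using ctrans_loop(1)[OF ctrans_ide, of H] by (simp add: lact_unit)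

text \<open>The record composes by a formula with explicit coherence cells. For composable
  2-morphisms that formula is a left action, so the calculus of actions becomes available.\<close>

lemma Cmp_CatObjects:
  assumes [simp]: "ctrans s" "ctrans t" and m: "xtgt s = xsrc t"
  shows "s \<cdot>\<^bsub>C2 (CatObjects D)\<^esub> t = vcmp s t"
proof -
  have [simp]: "fsrc (xsrc t) = fsrc (xsrc s)" "ftgt (xsrc t) = ftgt (xsrc s)" "farr (xtgt s) = farr (xsrc t)"
    using ctrans_simps(3,4)[of s] m by simp_all
  show ?thesis by (simp add: CatObjects_def vcmp_def lact_def join_def)
qed

text \<open>Either \<open>s\<close> acts on the induced cell of \<open>t\<close>, or
  \<open>t\<close> acts on that of \<open>s\<close>. The laws \<open>lact_lact\<close>,
  \<open>ract_lact\<close> and \<open>ract_ract\<close> connect these expressions, and the same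
  chain proves that the composite is a 2-morphism.\<close>

lemma ctrans_vcmp:
  assumes s [simp]: "ctrans s" and t [simp]: "ctrans t" and m: "xtgt s = xsrc t"
  shows "ctrans (vcmp s t)"
    "cat_ob_trans_loop D (vcmp s t) = lact D (ftgt (xsrc s)) (xcell s) (cat_ob_trans_loop D t)"
    "cat_ob_trans_loop D (vcmp s t) = ract D (ftgt (xsrc s)) (cat_ob_trans_loop D s) (xcell t)"
proof -
  let ?Y = "ftgt (xsrc s)" and ?X = "fsrc (xsrc s)"
  have [simp]: "fsrc (xsrc t) = ?X" "ftgt (xsrc t) = ?Y"
    using ctrans_simps(3,4)[OF s] unfolding m by simp_all
  have [simp]: "farr (xtgt s) = farr (xsrc t)" "fcell (xtgt s) = fcell (xsrc t)" by (simp_all add: m)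
  have [simp]: "Dom (D0 D) (farr (xsrc t)) = base ?X" "Cod (D0 D) (farr (xsrc t)) = base ?Y"
    "Dom (D1 D) (fcell (xsrc t)) = loop ?X" "Cod (D1 D) (fcell (xsrc t)) = loop ?Y"
    "fsrc (xtgt t) = ?X" "ftgt (xtgt t) = ?Y"
    by simp_all
  have l: "lact D ?Y (lact D ?Y (xcell s) (xcell t)) (fcell (xtgt t)) =
      lact D ?Y (xcell s) (cat_ob_trans_loop D t)"
    by (simp add: lact_lact ctrans_loop(1)[OF t])
  also have "\<dots> = ract D ?Y (cat_ob_trans_loop D s) (xcell t)"
    by (simp add: ctrans_loop(2)[OF t] ctrans_loop(1)[OF s] ract_lact)
  finally have lr: "lact D ?Y (lact D ?Y (xcell s) (xcell t)) (fcell (xtgt t)) =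
    ract D ?Y (cat_ob_trans_loop D s) (xcell t)" .
  also have "\<dots> = ract D ?Y (fcell (xsrc s)) (lact D ?Y (xcell s) (xcell t))"
    by (simp add: ctrans_loop(2)[OF s] ract_ract)
  finally have e: "lact D ?Y (lact D ?Y (xcell s) (xcell t)) (fcell (xtgt t)) =
    ract D ?Y (fcell (xsrc s)) (lact D ?Y (xcell s) (xcell t))" .
  show c: "ctrans (vcmp s t)" by (rule ctransI) (simp_all add: e)
  show "cat_ob_trans_loop D (vcmp s t) = lact D ?Y (xcell s) (cat_ob_trans_loop D t)"
    "cat_ob_trans_loop D (vcmp s t) = ract D ?Y (cat_ob_trans_loop D s) (xcell t)"
    using ctrans_loop(1)[OF c] l lr by simp_all
qed

text \<open>Writing the induced cell as a left action exposes the multiplicativity of the target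
  functor; the companion below uses a right action and the source functor. Horizontal composition
  needs both.\<close>

lemma mult_loop_tgt:
  assumes [simp]: "ctrans t"
  shows "mult (fsrc (xsrc t)) \<bullet> cat_ob_trans_loop D t = join D (ftgt (xsrc t)) (cat_ob_trans_loop D t) (fcell (xtgt t))"
  using cfun_mult[of "xtgt t"] by (simp add: ctrans_loop(1) cmp_lact join_lact) (simp add: join_def)

lemma mult_loop_src:
  assumes [simp]: "ctrans t"
  shows "mult (fsrc (xsrc t)) \<bullet> cat_ob_trans_loop D t = join D (ftgt (xsrc t)) (fcell (xsrc t)) (cat_ob_trans_loop D t)"
  using cfun_mult[of "xsrc t"] by (simp add: ctrans_loop(2) cmp_ract join_ract) (simp add: join_def)

text \<open>Facts 1 and 2 present the composite of the induced cells as a left and as a right action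
  of the same cell, so that cell is a 2-morphism. Strict composition of induced cells is the reason
  why a 2-functor into category objects gives a functor into \<open>D1\<close>.\<close>

lemma ctrans_hcmp:
  assumes s [simp]: "ctrans s" and t [simp]: "ctrans t" and m [simp]: "ftgt (xsrc s) = fsrc (xsrc t)"
  shows "ctrans (tcmp s t)"
    "cat_ob_trans_loop D (tcmp s t) = cat_ob_trans_loop D s \<bullet> cat_ob_trans_loop D t"
proof -
  let ?X = "fsrc (xsrc s)" and ?Y = "fsrc (xsrc t)" and ?Z = "ftgt (xsrc t)"
  have [simp]: "cfun (cat_ob_fun_cmp D (xsrc s) (xsrc t))" "cfun (cat_ob_fun_cmp D (xtgt s) (xtgt t))"
    by (auto intro: cfun_cmp)
  have [simp]: "Cod (D0 D) (farr (xsrc s)) = base ?Y" "Cod (D1 D) (fcell (xsrc s)) = loop ?Y"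
    using cfun_simps[of "xsrc s"] by simp_all
  have 1: "cat_ob_trans_loop D s \<bullet> cat_ob_trans_loop D t =
    lact D ?Z (xcell s \<bullet> cat_ob_trans_loop D t) (fcell (xtgt s) \<bullet> fcell (xtgt t))"
    using mult_loop_tgt[of t] by (simp add: ctrans_loop(1)[OF s] lact_def join_def merge_extend)
  have 2: "cat_ob_trans_loop D s \<bullet> cat_ob_trans_loop D t =
    ract D ?Z (fcell (xsrc s) \<bullet> fcell (xsrc t)) (xcell s \<bullet> cat_ob_trans_loop D t)"
    using mult_loop_src[of t] by (simp add: ctrans_loop(2)[OF s] ract_def join_def merge_extend)
  show c: "ctrans (tcmp s t)"
    by (rule ctransI) (simp_all add: 1[symmetric] 2[symmetric])
  show "cat_ob_trans_loop D (tcmp s t) = cat_ob_trans_loop D s \<bullet> cat_ob_trans_loop D t"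
    using ctrans_loop(1)[OF c] by (simp add: 1)
qed

theorem two_category_CatObjects: "two_category (CatObjects D)"
proof -
  note [simp] = CatObjects_simps Cmp_CatObjects
  have cat1: "category (C1 (CatObjects D))"
  proof (rule category.intro, goal_cases)
    case (7 F _ _ G _ H _)
    then have "cfun F" "cfun G" "cfun H" "ftgt F = fsrc G" "ftgt G = fsrc H" by (auto simp: hom_iff)
    then show ?case
      using cfun_simps(5,8)[of F] cfun_simps(5,8)[of G] by (simp add: cat_ob_fun_cmp_def)
  qed (auto simp: hom_iff cfun_ide cfun_cmp intro!: cat_ob_fun.equality)
  have cat2: "category (C2 (CatObjects D))"
  proof (rule category.intro, goal_cases)
    case (5 s H K)
    then have s: "ctrans s" "H = xsrc s" by (auto simp: hom_iff)
    then show ?case by (auto simp: ctrans_ide lact_unit intro!: cat_ob_trans.equality)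
  next
    case (6 s H K)
    then have s: "ctrans s" "K = xtgt s" by (auto simp: hom_iff)
    \<comment> \<open>\<open>vcmp\<close> is defined by the left action, whereas the unit acts
      trivially from the right; on an identity proarrow the two actions coincide.\<close>
    then have "lact D (ftgt (xsrc s)) (xcell s) (cid D (farr (xtgt s)) \<bullet> unit (ftgt (xsrc s))) = xcell s"
      using lact_eq_ract[of "xcell s" "base (fsrc (xsrc s))" "cid D (farr (xtgt s)) \<bullet> unit (ftgt (xsrc s))" "ftgt (xsrc s)"]
      by (simp add: ract_unit)
    then show ?case using s by (auto simp: ctrans_ide intro!: cat_ob_trans.equality)
  next
    case (7 s _ _ t _ u _)
    then have c: "ctrans s" "ctrans t" "ctrans u" "xtgt s = xsrc t" "xtgt t = xsrc u" by (auto simp: hom_iff)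
    then have e: "fsrc (xsrc t) = fsrc (xsrc s)" "ftgt (xsrc t) = ftgt (xsrc s)"
      "fsrc (xsrc u) = fsrc (xsrc s)" "ftgt (xsrc u) = ftgt (xsrc s)"
      using ctrans_simps(3,4)[of s] ctrans_simps(3,4)[of t] by auto
    from c e show ?case by (simp add: ctrans_vcmp(1)) (simp add: vcmp_def lact_lact)
  qed (auto simp: hom_iff ctrans_ide ctrans_vcmp(1))
  show ?thesis
  proof (rule two_category.intro[OF cat1 cat2], goal_cases)
    case (4 f x y h z s g t k)
    then show ?case by (auto simp: hom_iff ctrans_hcmp)
  next
    case (5 H _ _ K _)
    then have c [simp]: "cfun H" "cfun K" "ftgt H = fsrc K" by (auto simp: hom_iff)
    have "cid D (farr H) \<bullet> (unit (fsrc K) \<bullet> fcell K) = cid D (farr H) \<bullet> (cid D (farr K) \<bullet> unit (ftgt K))"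
      by (simp add: cfun_unit)
    then show ?case using cfun_simps(5,8)[of H] by (auto intro!: cat_ob_trans.equality)
  next
    case (6 _ _ _ _ _ s _ t _ s' _ t' _)
    then have c [simp]: "ctrans s" "ctrans t" "ctrans s'" "ctrans t'" and m: "xtgt s = xsrc t" "xtgt s' = xsrc t'"
      and n: "ftgt (xsrc s) = fsrc (xsrc s')" by (auto simp: hom_iff)
    let ?X = "fsrc (xsrc s)" and ?Y = "fsrc (xsrc s')" and ?Z = "ftgt (xsrc s')"
    have e: "fsrc (xsrc t) = ?X" "ftgt (xsrc t) = ?Y" "fsrc (xsrc t') = ?Y" "ftgt (xsrc t') = ?Z"
      "farr (xtgt s) = farr (xsrc t)" "farr (xtgt s') = farr (xsrc t')"
      using ctrans_simps(3,4)[of s] ctrans_simps(3,4)[of s'] n unfolding m by auto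
    note [simp] = ctrans_vcmp(1) ctrans_hcmp(1) e n m
    \<comment> \<open>Interchange: \<open>mult_loop\<close> moves the multiplication of the middle
      object through the vertical composite of \<open>s'\<close> and \<open>t'\<close>.\<close>
    have "lact D ?Y (xcell s) (xcell t) \<bullet> cat_ob_trans_loop D (vcmp s' t') =
      lact D ?Z (xcell s \<bullet> cat_ob_trans_loop D s') (xcell t \<bullet> cat_ob_trans_loop D t')"
      using mult_loop[of s' t'] by (simp add: ctrans_vcmp(2)) (simp add: lact_def join_def merge_extend)
    then show ?case by (auto intro!: cat_ob_trans.equality)
  next
    case (7 s X _)
    then have s [simp]: "ctrans s" "X = fsrc (xsrc s)" by (auto simp: two_hom_def hom_iff)
    then show ?case
      by (auto simp: unit_loop intro!: cat_ob_trans.equality cat_ob_fun.equality)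
  next
    case (8 s _ X)
    then have s: "ctrans s" "ftgt (xsrc s) = X" "cobj X" by (auto simp: two_hom_def hom_iff)
    then have "cat_ob_trans_loop D (ide_trans \<lparr>fsrc = X, ftgt = X, farr = Ide (D0 D) (base X), fcell = \<I> (loop X)\<rparr>) = \<I> (loop X)"
      by (simp add: cfun_ide)
    with s show ?case
      using cfun_simps(5,8)[of "xsrc s"]
      by (auto intro!: cat_ob_trans.equality cat_ob_fun.equality)
  next
    case (9 s _ _ t _ u _)
    then have "ctrans s" "ctrans t" "ctrans u" "ftgt (xsrc s) = fsrc (xsrc t)" "ftgt (xsrc t) = fsrc (xsrc u)"
      by (auto simp: two_hom_def hom_iff)
    then show ?case
      using cfun_simps(5,8)[of "xsrc s"] cfun_simps(5,8)[of "xsrc t"]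
      by (auto simp: ctrans_hcmp(2) intro!: cat_ob_trans.equality cat_ob_fun.equality)
  qed (auto simp: hom_iff)
qed

end

section \<open>Products of category objects\<close>

context category
begin

lemma terminal_Ob: "is_terminal C t \<Longrightarrow> t \<in> Ob C"
  by (simp add: is_terminal_def)

lemma terminal_arrow:
  assumes "is_terminal C t" "w \<in> Ob C"
  obtains h where "h \<in> Ar C" "Dom C h = w" "Cod C h = t"
  using assms unfolding is_terminal_def hom_iff by blast

lemma terminal_eqI:
  assumes "is_terminal C t" "h \<in> Ar C" "k \<in> Ar C" "Dom C h = Dom C k" "Cod C h = t" "Cod C k = t"
  shows "h = k"
proof -
  have "Dom C k \<in> Ob C" using assms by simp
  then have "\<exists>!h. h \<in> hom C (Dom C k) t" using assms(1) by (simp add: is_terminal_def)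
  then show ?thesis using assms by (auto simp: hom_iff)
qed

lemma is_terminalI:
  assumes "t \<in> Ob C" "\<And>w. w \<in> Ob C \<Longrightarrow> \<exists>h. h \<in> Ar C \<and> Dom C h = w \<and> Cod C h = t"
    "\<And>h k. h \<in> Ar C \<Longrightarrow> k \<in> Ar C \<Longrightarrow> Dom C h = Dom C k \<Longrightarrow> Cod C h = t \<Longrightarrow> Cod C k = t \<Longrightarrow> h = k"
  shows "is_terminal C t"
  unfolding is_terminal_def hom_iff using assms by metis

end

context double_category
begin

lemma ract_cfun:
  assumes "cfun H" "\<sigma> \<in> Ar (D1 D)" "a \<in> Ar (D1 D)" "Cod (D1 D) \<sigma> = loop (fsrc H)" "Cod (D1 D) a = loop (fsrc H)"
    "ctgt D a = csrc D \<sigma>" "Dom (D1 D) \<sigma> = pid D (ptgt D (Dom (D1 D) a))"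
  shows "ract D (fsrc H) a \<sigma> \<bullet> fcell H = ract D (ftgt H) (a \<bullet> fcell H) (\<sigma> \<bullet> fcell H)"
  using assms by (simp add: ract_def join_cfun)

end

text \<open>The componentwise notion of product: the underlying arrows and the underlying cells of
  the two functors form product cones. Given parallel products it is shown to agree with 2-products
  of category objects.\<close>

locale cat_ob_product = double_category D for D :: "('o, 'a, 'p, 'c) dbl" +
  fixes X Y Z :: "('o, 'p, 'c) cat_ob" and H\<^sub>1 H\<^sub>2
  assumes H [simp]: "cfun H\<^sub>1" "cfun H\<^sub>2" and ends [simp]: "fsrc H\<^sub>1 = Z" "fsrc H\<^sub>2 = Z" "ftgt H\<^sub>1 = X" "ftgt H\<^sub>2 = Y"
    and prod0: "is_product (D0 D) (base X) (base Y) (base Z) (farr H\<^sub>1) (farr H\<^sub>2)"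
    and prod1: "is_product (D1 D) (loop X) (loop Y) (loop Z) (fcell H\<^sub>1) (fcell H\<^sub>2)"
begin

lemma parts [simp]: "cobj X" "cobj Y" "cobj Z"
  "Dom (D0 D) (farr H\<^sub>1) = base Z" "Cod (D0 D) (farr H\<^sub>1) = base X"
  "Dom (D0 D) (farr H\<^sub>2) = base Z" "Cod (D0 D) (farr H\<^sub>2) = base Y"
  "Dom (D1 D) (fcell H\<^sub>1) = loop Z" "Cod (D1 D) (fcell H\<^sub>1) = loop X"
  "Dom (D1 D) (fcell H\<^sub>2) = loop Z" "Cod (D1 D) (fcell H\<^sub>2) = loop Y"
  using cfun_simps[OF H(1)] cfun_simps[OF H(2)] by simp_all

text \<open>A pairing in \<open>D1\<close> comes without control over its source and target; these
  are forced by uniqueness of pairings in \<open>D0\<close>.\<close>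

lemma cell_pairing:
  assumes "a \<in> Ar (D1 D)" "b \<in> Ar (D1 D)" "Dom (D1 D) a = Dom (D1 D) b"
    "Cod (D1 D) a = loop X" "Cod (D1 D) b = loop Y"
    and f: "f \<in> Ar (D0 D)" "Cod (D0 D) f = base Z" "csrc D a = f \<cdot> farr H\<^sub>1" "csrc D b = f \<cdot> farr H\<^sub>2"
    and g: "g \<in> Ar (D0 D)" "Cod (D0 D) g = base Z" "ctgt D a = g \<cdot> farr H\<^sub>1" "ctgt D b = g \<cdot> farr H\<^sub>2"
  obtains c where "c \<in> Ar (D1 D)" "Dom (D1 D) c = Dom (D1 D) a" "Cod (D1 D) c = loop Z"
    "c \<bullet> fcell H\<^sub>1 = a" "c \<bullet> fcell H\<^sub>2 = b" "csrc D c = f" "ctgt D c = g"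
proof -
  obtain c where c: "c \<in> Ar (D1 D)" "Dom (D1 D) c = Dom (D1 D) a" "Cod (D1 D) c = loop Z"
    "c \<bullet> fcell H\<^sub>1 = a" "c \<bullet> fcell H\<^sub>2 = b"
    using c1.product_pairing[OF prod1 assms(1-5)] by blast
  have 1: "csrc D c \<cdot> farr H\<^sub>1 = csrc D a" "csrc D c \<cdot> farr H\<^sub>2 = csrc D b"
    "ctgt D c \<cdot> farr H\<^sub>1 = ctgt D a" "ctgt D c \<cdot> farr H\<^sub>2 = ctgt D b"
    using c ends_cmp[of c "fcell H\<^sub>1"] ends_cmp[of c "fcell H\<^sub>2"] by auto
  have d: "Dom (D0 D) f = psrc D (Dom (D1 D) a)" "Dom (D0 D) g = ptgt D (Dom (D1 D) a)"
    using cell_ends(3)[OF assms(1)] cell_ends(5)[OF assms(1)] f g by simp_all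
  have "csrc D c = f" by (rule c0.product_eqI[OF prod0]) (use 1 c f d in simp_all)
  moreover have "ctgt D c = g" by (rule c0.product_eqI[OF prod0]) (use 1 c g d in simp_all)
  ultimately show thesis using that c by blast
qed

lemma cell_eqI:
  assumes "a \<in> Ar (D1 D)" "b \<in> Ar (D1 D)" "Dom (D1 D) a = Dom (D1 D) b"
    "Cod (D1 D) a = loop Z" "Cod (D1 D) b = loop Z"
    "a \<bullet> fcell H\<^sub>1 = b \<bullet> fcell H\<^sub>1" "a \<bullet> fcell H\<^sub>2 = b \<bullet> fcell H\<^sub>2"
  shows "a = b"
  by (rule c1.product_eqI[OF prod1 assms(1,4,2,5,3,6,7)])

lemma fun_eqI:
  assumes [simp]: "cfun K" "cfun K'" "fsrc K = fsrc K'" and e [simp]: "ftgt K = Z" "ftgt K' = Z"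
    and "cat_ob_fun_cmp D K H\<^sub>1 = cat_ob_fun_cmp D K' H\<^sub>1" "cat_ob_fun_cmp D K H\<^sub>2 = cat_ob_fun_cmp D K' H\<^sub>2"
  shows "K = K'"
proof -
  have 1: "farr K \<cdot> farr H\<^sub>1 = farr K' \<cdot> farr H\<^sub>1" "fcell K \<bullet> fcell H\<^sub>1 = fcell K' \<bullet> fcell H\<^sub>1"
    "farr K \<cdot> farr H\<^sub>2 = farr K' \<cdot> farr H\<^sub>2" "fcell K \<bullet> fcell H\<^sub>2 = fcell K' \<bullet> fcell H\<^sub>2"
    using assms(6,7) by (simp_all add: cat_ob_fun_cmp_def)
  note [simp] = cfun_simps(5,8)[of K, simplified] cfun_simps(5,8)[of K', simplified]
  have "farr K = farr K'" by (rule c0.product_eqI[OF prod0]) (use 1 in simp_all)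
  moreover have "fcell K = fcell K'" by (rule cell_eqI) (use 1 in simp_all)
  ultimately show ?thesis by (auto intro: cat_ob_fun.equality)
qed

text \<open>The paired cell preserves multiplication and unit because both sides of each equation
  agree after composing with the two projections.\<close>

lemma fun_pairing:
  assumes [simp]: "cfun F" "cfun G" and e [simp]: "fsrc F = fsrc G" "ftgt F = X" "ftgt G = Y"
  obtains K where "cfun K" "fsrc K = fsrc G" "ftgt K = Z" "cat_ob_fun_cmp D K H\<^sub>1 = F" "cat_ob_fun_cmp D K H\<^sub>2 = G"
proof -
  note [simp] = cfun_simps(4,5,7,8)[of F, simplified] cfun_simps(5,8)[of G, simplified]
  obtain f where f [simp]: "f \<in> Ar (D0 D)" "Dom (D0 D) f = base (fsrc G)" "Cod (D0 D) f = base Z"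
    and f': "f \<cdot> farr H\<^sub>1 = farr F" "f \<cdot> farr H\<^sub>2 = farr G"
    using c0.product_pairing[OF prod0, of "farr F" "farr G"] by auto
  obtain c where c [simp]: "c \<in> Ar (D1 D)" "Dom (D1 D) c = loop (fsrc G)" "Cod (D1 D) c = loop Z"
    "csrc D c = f" "ctgt D c = f" and c': "c \<bullet> fcell H\<^sub>1 = fcell F" "c \<bullet> fcell H\<^sub>2 = fcell G"
    by (rule cell_pairing[of "fcell F" "fcell G" f f]) (simp_all add: f')
  let ?K = "\<lparr>fsrc = fsrc G, ftgt = Z, farr = f, fcell = c\<rparr>"
  \<comment> \<open>Formulated for an arbitrary leg \<open>H\<close> so that it serves both
    projections; likewise for the unit below.\<close>
  have m: "(c \<parallel> c) \<bullet> mult Z \<bullet> fcell H = (mult (fsrc G) \<bullet> c) \<bullet> fcell H"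
    if h: "cfun H" "fsrc H = Z" "cfun F" "fsrc F = fsrc G" "ftgt F = ftgt H" "c \<bullet> fcell H = fcell F"
      "f \<cdot> farr H = farr F" for H F
  proof -
    have e [simp]: "Dom (D0 D) (farr H) = base Z" "Dom (D1 D) (fcell H) = loop Z"
      "Dom (D1 D) (fcell F) = loop (fsrc G)" "Cod (D1 D) (fcell F) = loop (ftgt H)"
      using h cfun_simps[of H] cfun_simps[of F] by simp_all
    have "(c \<parallel> c) \<bullet> mult Z \<bullet> fcell H = (c \<parallel> c) \<bullet> ((fcell H \<parallel> fcell H) \<bullet> mult (ftgt H))"
      using h cfun_mult[of H] by simp
    also have "\<dots> = (fcell F \<parallel> fcell F) \<bullet> mult (ftgt F)" using h by (simp add: merge_extend)
    also have "\<dots> = (mult (fsrc G) \<bullet> c) \<bullet> fcell H" using h cfun_mult[of F] by simp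
    finally show ?thesis .
  qed
  have u: "(cid D f \<bullet> unit Z) \<bullet> fcell H = (unit (fsrc G) \<bullet> c) \<bullet> fcell H"
    if h: "cfun H" "fsrc H = Z" "cfun F" "fsrc F = fsrc G" "ftgt F = ftgt H" "c \<bullet> fcell H = fcell F"
      "f \<cdot> farr H = farr F" for H F
  proof -
    have e [simp]: "Dom (D0 D) (farr H) = base Z" "Dom (D1 D) (fcell H) = loop Z"
      using h cfun_simps[of H] by simp_all
    have "(cid D f \<bullet> unit Z) \<bullet> fcell H = cid D f \<bullet> (cid D (farr H) \<bullet> unit (ftgt H))"
      using h cfun_unit[of H] by simp
    also have "\<dots> = cid D (f \<cdot> farr H) \<bullet> unit (ftgt H)" using h(1,2) by simp
    also have "\<dots> = (unit (fsrc G) \<bullet> c) \<bullet> fcell H" using h cfun_unit[of F] by simp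
    finally show ?thesis .
  qed
  have "(c \<parallel> c) \<bullet> mult Z = mult (fsrc G) \<bullet> c"
    by (rule cell_eqI) (use m[of H\<^sub>1 F] m[of H\<^sub>2 G] f' c' in simp_all)
  moreover have "cid D f \<bullet> unit Z = unit (fsrc G) \<bullet> c"
    by (rule cell_eqI) (use u[of H\<^sub>1 F] u[of H\<^sub>2 G] f' c' in simp_all)
  ultimately have "cfun ?K" by (intro cfunI) simp_all
  then show thesis
    by (rule that) (auto simp: f' c' intro!: cat_ob_fun.equality)
qed

lemma trans_eqI:
  assumes [simp]: "ctrans u" "ctrans v" "fsrc (xsrc u) = fsrc (xsrc v)" and e [simp]: "ftgt (xsrc u) = Z" "ftgt (xsrc v) = Z"
    and e1: "tcmp u (ide_trans H\<^sub>1) = tcmp v (ide_trans H\<^sub>1)" and e2: "tcmp u (ide_trans H\<^sub>2) = tcmp v (ide_trans H\<^sub>2)"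
  shows "u = v"
proof -
  have [simp]: "Cod (D1 D) (xcell u) = loop Z" "Cod (D1 D) (xcell v) = loop Z"
    using ctrans_simps[of u] ctrans_simps[of v] by simp_all
  have "xsrc u = xsrc v" by (rule fun_eqI) (use e1 e2 in \<open>simp_all add: tcmp_def\<close>)
  moreover have "xtgt u = xtgt v" by (rule fun_eqI) (use e1 e2 in \<open>simp_all add: tcmp_def\<close>)
  moreover have "xcell u = xcell v" by (rule cell_eqI) (use e1 e2 in \<open>simp_all add: tcmp_def\<close>)
  ultimately show ?thesis by (auto intro: cat_ob_trans.equality)
qed

text \<open>Equality of the two actions of the paired cell is tested after each projection, where
  \<open>lact_cfun\<close> and \<open>ract_cfun\<close> reduce it to the same condition on
  \<open>s\<close> and on \<open>t\<close>.\<close>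

lemma trans_pairing:
  assumes [simp]: "ctrans s" "ctrans t" and e [simp]: "fsrc (xsrc s) = fsrc (xsrc t)" "ftgt (xsrc s) = X" "ftgt (xsrc t) = Y"
  obtains u where "ctrans u" "fsrc (xsrc u) = fsrc (xsrc t)" "ftgt (xsrc u) = Z"
    "tcmp u (ide_trans H\<^sub>1) = s" "tcmp u (ide_trans H\<^sub>2) = t"
proof -
  note [simp] = ctrans_simps(3,4,8,9,12-)[of s, simplified] ctrans_simps(3,4,8,9,12-)[of t, simplified]
  obtain K where K [simp]: "cfun K" "fsrc K = fsrc (xsrc t)" "ftgt K = Z"
    and K': "cat_ob_fun_cmp D K H\<^sub>1 = xsrc s" "cat_ob_fun_cmp D K H\<^sub>2 = xsrc t"
    using fun_pairing[of "xsrc s" "xsrc t"] by auto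
  obtain L where L [simp]: "cfun L" "fsrc L = fsrc (xsrc t)" "ftgt L = Z"
    and L': "cat_ob_fun_cmp D L H\<^sub>1 = xtgt s" "cat_ob_fun_cmp D L H\<^sub>2 = xtgt t"
    using fun_pairing[of "xtgt s" "xtgt t"] by auto
  note [simp] = cfun_simps(4,5,7,8)[of K, simplified] cfun_simps(4,5,7,8)[of L, simplified]
  have Kp: "farr K \<cdot> farr H\<^sub>1 = farr (xsrc s)" "farr K \<cdot> farr H\<^sub>2 = farr (xsrc t)"
    "fcell K \<bullet> fcell H\<^sub>1 = fcell (xsrc s)" "fcell K \<bullet> fcell H\<^sub>2 = fcell (xsrc t)"
    by (simp_all flip: K')
  have Lp: "farr L \<cdot> farr H\<^sub>1 = farr (xtgt s)" "farr L \<cdot> farr H\<^sub>2 = farr (xtgt t)"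
    "fcell L \<bullet> fcell H\<^sub>1 = fcell (xtgt s)" "fcell L \<bullet> fcell H\<^sub>2 = fcell (xtgt t)"
    by (simp_all flip: L')
  obtain c where c [simp]: "c \<in> Ar (D1 D)" "Dom (D1 D) c = pid D (base (fsrc (xsrc t)))" "Cod (D1 D) c = loop Z"
    "csrc D c = farr K" "ctgt D c = farr L" and c': "c \<bullet> fcell H\<^sub>1 = xcell s" "c \<bullet> fcell H\<^sub>2 = xcell t"
    by (rule cell_pairing[of "xcell s" "xcell t" "farr K" "farr L"]) (simp_all add: Kp Lp)
  have "lact D Z c (fcell L) = ract D Z (fcell K) c"
  proof (rule cell_eqI)
    show "lact D Z c (fcell L) \<bullet> fcell H\<^sub>1 = ract D Z (fcell K) c \<bullet> fcell H\<^sub>1"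
      using lact_cfun[of H\<^sub>1 c "fcell L"] ract_cfun[of H\<^sub>1 c "fcell K"] ctrans_loop[of s]
      by (simp add: c' Kp Lp)
    show "lact D Z c (fcell L) \<bullet> fcell H\<^sub>2 = ract D Z (fcell K) c \<bullet> fcell H\<^sub>2"
      using lact_cfun[of H\<^sub>2 c "fcell L"] ract_cfun[of H\<^sub>2 c "fcell K"] ctrans_loop[of t]
      by (simp add: c' Kp Lp)
  qed simp_all
  then have "ctrans \<lparr>xsrc = K, xtgt = L, xcell = c\<rparr>" by (intro ctransI) simp_all
  then show thesis
    by (rule that) (auto simp: K' L' c' intro!: cat_ob_trans.equality)
qed

theorem is_2product: "is_2product (CatObjects D) X Y Z H\<^sub>1 H\<^sub>2"
proof -
  interpret CO: two_category "CatObjects D" by (rule two_category_CatObjects)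
  note [simp] = CatObjects_simps
  have hom: "u \<in> two_hom (CatObjects D) W V \<longleftrightarrow> ctrans u \<and> fsrc (xsrc u) = W \<and> ftgt (xsrc u) = V" for u W V
    by (simp add: CO.two_hom_iff)
  show ?thesis
  proof (rule is_2productI, rule CO.c1.productI, goal_cases)
    case (6 F G)
    then show ?case using fun_pairing[of F G] by simp metis
  next
    case (7 F G)
    then show ?case using fun_eqI[of F G] by simp
  next
    case (8 W s t)
    then show ?case unfolding hom using trans_pairing[of s t] by simp metis
  next
    case (9 W u v)
    then show ?case unfolding hom using trans_eqI[of u v] by simp
  qed (simp_all add: hom_iff)
qed

end

context double_category
begin

text \<open>The common interface through which a general cartesian equipment and the double category
  of spans enter the proof.\<close>

definition parallel_products :: "('o, 'a) prods \<Rightarrow> ('p, 'c) prods \<Rightarrow> bool"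
  where "parallel_products P Q \<longleftrightarrow>
    chosen_products (D0 D) P \<and> chosen_products (D1 D) Q \<and>
    (\<forall>m \<in> Ob (D1 D). \<forall>n \<in> Ob (D1 D).
      psrc D (Prod Q m n) = Prod P (psrc D m) (psrc D n) \<and>
      ptgt D (Prod Q m n) = Prod P (ptgt D m) (ptgt D n) \<and>
      csrc D (Proj1 Q m n) = Proj1 P (psrc D m) (psrc D n) \<and>
      ctgt D (Proj1 Q m n) = Proj1 P (ptgt D m) (ptgt D n) \<and>
      csrc D (Proj2 Q m n) = Proj2 P (psrc D m) (psrc D n) \<and>
      ctgt D (Proj2 Q m n) = Proj2 P (ptgt D m) (ptgt D n)) \<and>
    psrc D (One Q) = One P \<and> ptgt D (One Q) = One P"

text \<open>As for monoids in a monoidal category, products of category objects are created by the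
  underlying proarrows; compatibility of products with external composition is not involved.\<close>

lemma product_cat_ob:
  assumes PQ: "parallel_products P Q" and X [simp]: "cobj X" and Y [simp]: "cobj Y"
  obtains Z H\<^sub>1 H\<^sub>2 where "cat_ob_product D X Y Z H\<^sub>1 H\<^sub>2"
proof -
  let ?z = "Prod P (base X) (base Y)" and ?r = "Prod Q (loop X) (loop Y)"
  let ?f1 = "Proj1 P (base X) (base Y)" and ?f2 = "Proj2 P (base X) (base Y)"
  let ?p1 = "Proj1 Q (loop X) (loop Y)" and ?p2 = "Proj2 Q (loop X) (loop Y)"
  have prod0: "is_product (D0 D) (base X) (base Y) ?z ?f1 ?f2"
    and prod1: "is_product (D1 D) (loop X) (loop Y) ?r ?p1 ?p2"
    using PQ by (auto simp: parallel_products_def chosen_products_def)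
  note [simp] = c0.productD[OF prod0] c1.productD[OF prod1]
  have [simp]: "psrc D ?r = ?z" "ptgt D ?r = ?z" "csrc D ?p1 = ?f1" "ctgt D ?p1 = ?f1"
    "csrc D ?p2 = ?f2" "ctgt D ?p2 = ?f2"
    using PQ by (auto simp: parallel_products_def)
  \<comment> \<open>The multiplication is paired from those of \<open>X\<close> and \<open>Y\<close>
    applied to two copies of a projection; the unit is obtained likewise.\<close>
  obtain \<mu> where \<mu> [simp]: "\<mu> \<in> Ar (D1 D)" "Dom (D1 D) \<mu> = ?r \<otimes> ?r" "Cod (D1 D) \<mu> = ?r"
    and \<mu>': "\<mu> \<bullet> ?p1 = join D X ?p1 ?p1" "\<mu> \<bullet> ?p2 = join D Y ?p2 ?p2"
    using c1.product_pairing[OF prod1, of "join D X ?p1 ?p1" "join D Y ?p2 ?p2"] by auto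
  obtain \<upsilon> where \<upsilon> [simp]: "\<upsilon> \<in> Ar (D1 D)" "Dom (D1 D) \<upsilon> = pid D ?z" "Cod (D1 D) \<upsilon> = ?r"
    and \<upsilon>': "\<upsilon> \<bullet> ?p1 = cid D ?f1 \<bullet> unit X" "\<upsilon> \<bullet> ?p2 = cid D ?f2 \<bullet> unit Y"
    using c1.product_pairing[OF prod1, of "cid D ?f1 \<bullet> unit X" "cid D ?f2 \<bullet> unit Y"] by auto
  \<comment> \<open>Nothing in the pairing says that it is globular; its source and target are
    identities because they fix both projections in \<open>D0\<close>.\<close>
  have glob: "csrc D c = Ide (D0 D) ?z" "ctgt D c = Ide (D0 D) ?z"
    if c: "c \<in> Ar (D1 D)" "Cod (D1 D) c = ?r" "csrc D (c \<bullet> ?p1) = ?f1" "csrc D (c \<bullet> ?p2) = ?f2"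
      "ctgt D (c \<bullet> ?p1) = ?f1" "ctgt D (c \<bullet> ?p2) = ?f2" "psrc D (Dom (D1 D) c) = ?z" "ptgt D (Dom (D1 D) c) = ?z" for c
  proof -
    show "csrc D c = Ide (D0 D) ?z" by (rule c0.product_eqI[OF prod0]) (use c in simp_all)
    show "ctgt D c = Ide (D0 D) ?z" by (rule c0.product_eqI[OF prod0]) (use c in simp_all)
  qed
  have g\<mu> [simp]: "csrc D \<mu> = Ide (D0 D) ?z" "ctgt D \<mu> = Ide (D0 D) ?z"
    by (rule glob; simp add: \<mu>')+
  have g\<upsilon> [simp]: "csrc D \<upsilon> = Ide (D0 D) ?z" "ctgt D \<upsilon> = Ide (D0 D) ?z"
    by (rule glob; simp add: \<upsilon>')+
  let ?Z = "\<lparr>base = ?z, loop = ?r, mult = \<mu>, unit = \<upsilon>\<rparr>"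
  have "cobj ?Z"
  proof (rule category_object.intro)
    \<comment> \<open>Each law holds after composing with any cell \<open>p\<close> that respects
      multiplication and, for the unit laws, the unit; applied to both projections, which are
      jointly cancellable, this gives the laws of the product.\<close>
    have a: "((\<mu> \<parallel> \<I> ?r) \<bullet> \<mu>) \<bullet> p = (assoc D ?r ?r ?r \<bullet> (\<I> ?r \<parallel> \<mu>) \<bullet> \<mu>) \<bullet> p"
      if [simp]: "cobj W" "p \<in> Ar (D1 D)" "Dom (D1 D) p = ?r" "Cod (D1 D) p = loop W" "csrc D p = f" "ctgt D p = f"
        and e: "\<mu> \<bullet> p = join D W p p" for p W f
    proof -
      have "((\<mu> \<parallel> \<I> ?r) \<bullet> \<mu>) \<bullet> p = join D W (\<mu> \<bullet> p) p"
        by (simp add: e ccmp_join)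
      moreover have "(assoc D ?r ?r ?r \<bullet> (\<I> ?r \<parallel> \<mu>) \<bullet> \<mu>) \<bullet> p = assoc D ?r ?r ?r \<bullet> join D W p (\<mu> \<bullet> p)"
        by (simp add: e ccmp_join)
      ultimately show ?thesis using join_join[of W p p p] by (simp add: e)
    qed
    have b: "((\<upsilon> \<parallel> \<I> ?r) \<bullet> \<mu>) \<bullet> p = lunit D ?r \<bullet> p" "((\<I> ?r \<parallel> \<upsilon>) \<bullet> \<mu>) \<bullet> p = runit D ?r \<bullet> p"
      if [simp]: "cobj W" "p \<in> Ar (D1 D)" "Dom (D1 D) p = ?r" "Cod (D1 D) p = loop W" "csrc D p = f" "ctgt D p = f"
        and e: "\<mu> \<bullet> p = join D W p p" "\<upsilon> \<bullet> p = cid D f \<bullet> unit W" for p W f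
    proof -
      have [simp]: "f \<in> Ar (D0 D)" "Dom (D0 D) f = ?z" "Cod (D0 D) f = base W"
        using cell_ends[of p] by simp_all
      have "join D W (cid D f \<bullet> unit W) p = lunit D ?r \<bullet> lact D W (cid D f \<bullet> unit W) p"
        "join D W p (cid D f \<bullet> unit W) = runit D ?r \<bullet> ract D W p (cid D f \<bullet> unit W)"
        by (simp_all add: lact_def ract_def c1.inv_cmp_cancel)
      then show "((\<upsilon> \<parallel> \<I> ?r) \<bullet> \<mu>) \<bullet> p = lunit D ?r \<bullet> p" "((\<I> ?r \<parallel> \<upsilon>) \<bullet> \<mu>) \<bullet> p = runit D ?r \<bullet> p"
        by (simp_all add: e ccmp_join lact_unit ract_unit)
    qed
    show "(mult ?Z \<parallel> \<I> (loop ?Z)) \<bullet> mult ?Z =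
      assoc D (loop ?Z) (loop ?Z) (loop ?Z) \<bullet> (\<I> (loop ?Z) \<parallel> mult ?Z) \<bullet> mult ?Z"
      by (rule c1.product_eqI[OF prod1]) (use a[of X ?p1] a[of Y ?p2] \<mu>' in simp_all)
    show "(unit ?Z \<parallel> \<I> (loop ?Z)) \<bullet> mult ?Z = lunit D (loop ?Z)"
      by (rule c1.product_eqI[OF prod1]) (use b(1)[of X ?p1] b(1)[of Y ?p2] \<mu>' \<upsilon>' in simp_all)
    show "(\<I> (loop ?Z) \<parallel> unit ?Z) \<bullet> mult ?Z = runit D (loop ?Z)"
      by (rule c1.product_eqI[OF prod1]) (use b(2)[of X ?p1] b(2)[of Y ?p2] \<mu>' \<upsilon>' in simp_all)
  qed (simp_all add: pro_iff globular_def cells_iff)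
  then have "cat_ob_product D X Y ?Z \<lparr>fsrc = ?Z, ftgt = X, farr = ?f1, fcell = ?p1\<rparr>
    \<lparr>fsrc = ?Z, ftgt = Y, farr = ?f2, fcell = ?p2\<rparr>"
    using \<mu>' \<upsilon>' by unfold_locales (auto intro!: cfunI prod0 prod1 simp: join_def)
  then show thesis by (rule that)
qed

text \<open>Compare with the product created by the underlying proarrows: the comparison is an
  isomorphism of category objects, its components are isomorphisms in \<open>D0\<close> and
  \<open>D1\<close>, and product cones are stable under these.\<close>

theorem is_2product_components:
  assumes PQ: "parallel_products P Q" and p: "is_2product (CatObjects D) X Y Z H\<^sub>1 H\<^sub>2"
  shows "cat_ob_product D X Y Z H\<^sub>1 H\<^sub>2"
proof -
  interpret CO: two_category "CatObjects D" by (rule two_category_CatObjects)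
  note [simp] = CatObjects_simps
  have [simp]: "cobj X" "cobj Y" "cobj Z" "cfun H\<^sub>1" "cfun H\<^sub>2" "fsrc H\<^sub>1 = Z" "fsrc H\<^sub>2 = Z" "ftgt H\<^sub>1 = X" "ftgt H\<^sub>2 = Y"
    using CO.product_2hom[OF p] by simp_all
  obtain W K\<^sub>1 K\<^sub>2 where "cat_ob_product D X Y W K\<^sub>1 K\<^sub>2" using product_cat_ob[OF PQ, of X Y] by auto
  then interpret W: cat_ob_product D X Y W K\<^sub>1 K\<^sub>2 .
  have "is_product (C1 (CatObjects D)) X Y W K\<^sub>1 K\<^sub>2" "is_product (C1 (CatObjects D)) X Y Z H\<^sub>1 H\<^sub>2"
    using W.is_2product p by (auto simp: is_2product_def)
  from CO.c1.product_comparison[OF this]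
  obtain I J where I: "inverse_arrows (C1 (CatObjects D)) I J" "fsrc I = Z" "ftgt I = W"
    "cat_ob_fun_cmp D I K\<^sub>1 = H\<^sub>1" "cat_ob_fun_cmp D I K\<^sub>2 = H\<^sub>2" by auto
  have J: "cfun I" "cfun J" "fsrc J = W" "ftgt J = Z"
    "cat_ob_fun_cmp D I J = \<lparr>fsrc = Z, ftgt = Z, farr = Ide (D0 D) (base Z), fcell = \<I> (loop Z)\<rparr>"
    "cat_ob_fun_cmp D J I = \<lparr>fsrc = W, ftgt = W, farr = Ide (D0 D) (base W), fcell = \<I> (loop W)\<rparr>"
    using I(1) unfolding inverse_arrows_def hom_iff by (simp_all add: I)
  have ij: "farr I \<cdot> farr J = Ide (D0 D) (base Z)" "fcell I \<bullet> fcell J = \<I> (loop Z)"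
    "farr J \<cdot> farr I = Ide (D0 D) (base W)" "fcell J \<bullet> fcell I = \<I> (loop W)"
    using arg_cong[OF J(5), of farr] arg_cong[OF J(6), of farr] arg_cong[OF J(5), of fcell] arg_cong[OF J(6), of fcell]
    by simp_all
  have i: "farr H\<^sub>1 = farr I \<cdot> farr K\<^sub>1" "farr H\<^sub>2 = farr I \<cdot> farr K\<^sub>2"
    "fcell H\<^sub>1 = fcell I \<bullet> fcell K\<^sub>1" "fcell H\<^sub>2 = fcell I \<bullet> fcell K\<^sub>2" by (simp_all flip: I(4,5))
  note [simp] = cfun_simps[OF J(1)] cfun_simps[OF J(2)] I(2,3) J(3,4)
  have "inverse_arrows (D0 D) (farr I) (farr J)" "inverse_arrows (D1 D) (fcell I) (fcell J)"
    unfolding inverse_arrows_def by (simp_all add: hom_iff ij)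
  from c0.product_cmp_iso[OF W.prod0 this(1)] c1.product_cmp_iso[OF W.prod1 this(2)]
  show ?thesis
    by unfold_locales (simp_all add: i)
qed

definition cat_ob_terminal :: "('o, 'p, 'c) cat_ob \<Rightarrow> bool"
  where "cat_ob_terminal T \<longleftrightarrow> cobj T \<and> is_terminal (D0 D) (base T) \<and> is_terminal (D1 D) (loop T)"

theorem is_2terminal:
  assumes "cat_ob_terminal T" shows "is_2terminal (CatObjects D) T"
proof -
  interpret CO: two_category "CatObjects D" by (rule two_category_CatObjects)
  have T [simp]: "cobj T" and t0: "is_terminal (D0 D) (base T)" and t1: "is_terminal (D1 D) (loop T)"
    using assms by (auto simp: cat_ob_terminal_def)
  note [simp] = CatObjects_simps
  have hom: "u \<in> two_hom (CatObjects D) W V \<longleftrightarrow> ctrans u \<and> fsrc (xsrc u) = W \<and> ftgt (xsrc u) = V" for u W V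
    by (simp add: CO.two_hom_iff)
  have ex: "\<exists>K. cfun K \<and> fsrc K = W \<and> ftgt K = T" if [simp]: "cobj W" for W
  proof -
    obtain f where f [simp]: "f \<in> Ar (D0 D)" "Dom (D0 D) f = base W" "Cod (D0 D) f = base T"
      using c0.terminal_arrow[OF t0, of "base W"] by auto
    obtain c where c [simp]: "c \<in> Ar (D1 D)" "Dom (D1 D) c = loop W" "Cod (D1 D) c = loop T"
      using c1.terminal_arrow[OF t1, of "loop W"] by auto
    have [simp]: "csrc D c = f" "ctgt D c = f"
      by (rule c0.terminal_eqI[OF t0]; simp)+
    have "cfun \<lparr>fsrc = W, ftgt = T, farr = f, fcell = c\<rparr>"
      by (rule cfunI) (simp_all add: c1.terminal_eqI[OF t1])
    then show ?thesis by (intro exI[of _ "\<lparr>fsrc = W, ftgt = T, farr = f, fcell = c\<rparr>"]) simp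
  qed
  have un: "K = L" if [simp]: "cfun K" "cfun L" "fsrc K = fsrc L" "ftgt K = T" "ftgt L = T" for K L
  proof -
    note [simp] = cfun_simps(5,8)[of K, simplified] cfun_simps(5,8)[of L, simplified]
    have "farr K = farr L" "fcell K = fcell L"
      by (rule c0.terminal_eqI[OF t0] c1.terminal_eqI[OF t1]; simp)+
    then show ?thesis by (auto intro: cat_ob_fun.equality)
  qed
  show ?thesis
    unfolding is_2terminal_def
  proof (intro conjI ballI ex_ex1I)
    show "is_terminal (C1 (CatObjects D)) T"
      by (rule CO.c1.is_terminalI) (use ex un in auto)
    fix W assume "W \<in> Ob (C1 (CatObjects D))"
    then obtain K where K: "cfun K" "fsrc K = W" "ftgt K = T" using ex by auto
    then show "\<exists>u. u \<in> two_hom (CatObjects D) W T"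
      unfolding hom by (intro exI[of _ "ide_trans K"]) (simp add: ctrans_ide)
    fix u v assume "u \<in> two_hom (CatObjects D) W T" "v \<in> two_hom (CatObjects D) W T"
    then have uv [simp]: "ctrans u" "ctrans v" "fsrc (xsrc u) = W" "fsrc (xsrc v) = W"
      "ftgt (xsrc u) = T" "ftgt (xsrc v) = T" unfolding hom by auto
    note [simp] = ctrans_simps(9)[of u, simplified] ctrans_simps(9)[of v, simplified]
    have "xsrc u = xsrc v" "xtgt u = xtgt v" "xcell u = xcell v"
      by (rule un c1.terminal_eqI[OF t1]; simp)+
    then show "u = v" by (auto intro: cat_ob_trans.equality)
  qed
qed

text \<open>The terminal objects of \<open>D0\<close> and \<open>D1\<close> carry a category object,
  whose equations hold because parallel cells into a terminal object agree; any 2-terminal object is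
  isomorphic to it.\<close>

theorem is_2terminal_components:
  assumes PQ: "parallel_products P Q" and p: "is_2terminal (CatObjects D) T"
  shows "cat_ob_terminal T"
proof -
  interpret CO: two_category "CatObjects D" by (rule two_category_CatObjects)
  note [simp] = CatObjects_simps
  have t0: "is_terminal (D0 D) (One P)" and t1: "is_terminal (D1 D) (One Q)"
    and [simp]: "psrc D (One Q) = One P" "ptgt D (One Q) = One P"
    using PQ by (auto simp: parallel_products_def chosen_products_def)
  note [simp] = c0.terminal_Ob[OF t0] c1.terminal_Ob[OF t1]
  obtain \<mu> where \<mu> [simp]: "\<mu> \<in> Ar (D1 D)" "Dom (D1 D) \<mu> = One Q \<otimes> One Q" "Cod (D1 D) \<mu> = One Q"
    using c1.terminal_arrow[OF t1, of "One Q \<otimes> One Q"] by auto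
  obtain \<upsilon> where \<upsilon> [simp]: "\<upsilon> \<in> Ar (D1 D)" "Dom (D1 D) \<upsilon> = pid D (One P)" "Cod (D1 D) \<upsilon> = One Q"
    using c1.terminal_arrow[OF t1, of "pid D (One P)"] by auto
  have [simp]: "csrc D \<mu> = Ide (D0 D) (One P)" "ctgt D \<mu> = Ide (D0 D) (One P)"
    "csrc D \<upsilon> = Ide (D0 D) (One P)" "ctgt D \<upsilon> = Ide (D0 D) (One P)"
    by (rule c0.terminal_eqI[OF t0]; simp)+
  let ?W = "\<lparr>base = One P, loop = One Q, mult = \<mu>, unit = \<upsilon>\<rparr>"
  have "cobj ?W"
    by (rule category_object.intro)
      (auto simp: pro_iff globular_def cells_iff intro!: c1.terminal_eqI[OF t1])
  then have "cat_ob_terminal ?W" by (simp add: cat_ob_terminal_def t0 t1)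
  from is_2terminal[OF this] have "is_terminal (C1 (CatObjects D)) ?W" "is_terminal (C1 (CatObjects D)) T"
    using p by (auto simp: is_2terminal_def)
  from CO.c1.terminal_comparison[OF this(2,1)]
  obtain I J where I: "inverse_arrows (C1 (CatObjects D)) I J" "fsrc I = T" "ftgt I = ?W" by auto
  have J: "cfun I" "cfun J" "fsrc J = ?W" "ftgt J = T"
    "cat_ob_fun_cmp D I J = \<lparr>fsrc = T, ftgt = T, farr = Ide (D0 D) (base T), fcell = \<I> (loop T)\<rparr>"
    "cat_ob_fun_cmp D J I = \<lparr>fsrc = ?W, ftgt = ?W, farr = Ide (D0 D) (base ?W), fcell = \<I> (loop ?W)\<rparr>"
    using I(1) unfolding inverse_arrows_def hom_iff by (simp_all add: I)
  have ij: "farr I \<cdot> farr J = Ide (D0 D) (base T)" "fcell I \<bullet> fcell J = \<I> (loop T)"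
    "farr J \<cdot> farr I = Ide (D0 D) (One P)" "fcell J \<bullet> fcell I = \<I> (One Q)"
    using arg_cong[OF J(5), of farr] arg_cong[OF J(6), of farr] arg_cong[OF J(5), of fcell] arg_cong[OF J(6), of fcell]
    by simp_all
  note [simp] = cfun_simps[OF J(1)] cfun_simps[OF J(2)] I(2,3) J(3,4)
  have "inverse_arrows (D0 D) (farr I) (farr J)" "inverse_arrows (D1 D) (fcell I) (fcell J)"
    unfolding inverse_arrows_def by (simp_all add: hom_iff ij)
  from c0.terminal_iso[OF t0 this(1)] c1.terminal_iso[OF t1 this(2)] cfun_simps(1)[OF J(1)]
  show ?thesis by (simp add: cat_ob_terminal_def)
qed

end

section \<open>Lax functors out of \<open>VerDbl A\<close>\<close>

lemma VerDbl_simps [simp]: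
  "D0 (VerDbl A) = C1 A" "Ob (D1 (VerDbl A)) = Ob (C1 A)" "Ar (D1 (VerDbl A)) = Ar (C2 A)"
  "Dom (D1 (VerDbl A)) s = Dom (C1 A) (Dom (C2 A) s)" "Cod (D1 (VerDbl A)) s = Cod (C1 A) (Dom (C2 A) s)"
  "Ide (D1 (VerDbl A)) x = Ide (C2 A) (Ide (C1 A) x)" "Cmp (D1 (VerDbl A)) s t = s *\<^bsub>A\<^esub> t"
  "psrc (VerDbl A) x = x" "ptgt (VerDbl A) x = x" "csrc (VerDbl A) = Dom (C2 A)" "ctgt (VerDbl A) = Cod (C2 A)"
  "pid (VerDbl A) x = x" "cid (VerDbl A) = Ide (C2 A)" "x \<odot>\<^bsub>VerDbl A\<^esub> y = x"
  "ccmp (VerDbl A) s t = s \<cdot>\<^bsub>C2 A\<^esub> t" "assoc (VerDbl A) x y z = Ide (C2 A) (Ide (C1 A) x)"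
  "lunit (VerDbl A) x = Ide (C2 A) (Ide (C1 A) x)" "runit (VerDbl A) x = Ide (C2 A) (Ide (C1 A) x)"
  by (simp_all add: VerDbl_def)

section \<open>Products in \<open>VerDbl A\<close>\<close>

context two_category
begin

lemma category_VerDbl: "category (D1 (VerDbl A))"
  by unfold_locales (auto simp: hom_iff assoc_hcmp)

text \<open>Arrows of \<open>D1 (VerDbl A)\<close> are 2-cells under horizontal composition, so the
  half of a 2-product that concerns 2-cells is a product cone there, with identity 2-cells as
  projections.\<close>

lemma product_VerDbl:
  assumes p: "is_2product A x y p \<pi>\<^sub>1 \<pi>\<^sub>2"
  shows "is_product (D1 (VerDbl A)) x y p (Ide (C2 A) \<pi>\<^sub>1) (Ide (C2 A) \<pi>\<^sub>2)"
proof -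
  interpret V: category "D1 (VerDbl A)" by (rule category_VerDbl)
  note [simp] = product_2hom[OF p]
  show ?thesis
  proof (rule V.productI, goal_cases)
    case (6 s t)
    then show ?case using two_product_pairing[OF p, of "Dom (C1 A) (Dom (C2 A) s)" s t]
      by (simp add: two_hom_iff) metis
  next
    case (7 s t)
    then show ?case using two_product_eqI[OF p, of s _ t] by (simp add: two_hom_iff)
  qed (simp_all add: hom_iff)
qed

lemma terminal_VerDbl:
  assumes "is_2terminal A t" shows "is_terminal (D1 (VerDbl A)) t"
  using assms unfolding is_2terminal_def is_terminal_def two_hom_iff
  by (simp add: hom_iff)

end

locale cell_valued = A: two_category A + double_category D
  for A :: "('o, 'a, 't) two_cat" and D :: "('eo, 'ea, 'ep, 'ec) dbl"
begin

text \<open>\<open>T0\<close>, \<open>T1\<close>, \<open>T2\<close> turn lax functors, lax transformations and modulations into 2-functors, lax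
  transformations and modifications; \<open>S0\<close>, \<open>S1\<close>, \<open>S2\<close> are their inverses.\<close>

definition T0 :: "('o, 'a, 'o, 't, 'eo, 'ea, 'ep, 'ec) lax_fctr \<Rightarrow>
    ('o, 'a, 't, ('eo, 'ep, 'ec) cat_ob, ('eo, 'ea, 'ep, 'ec) cat_ob_fun, ('eo, 'ea, 'ep, 'ec) cat_ob_trans) two_fctr"
  where "T0 F =
    (let on0 = (\<lambda>x. \<lparr>base = onOb (F0 F) x, loop = onOb (F1 F) x, mult = laxator F x x, unit = unitor F x\<rparr>);
       on1 = (\<lambda>f. \<lparr>fsrc = on0 (Dom (C1 A) f), ftgt = on0 (Cod (C1 A) f), farr = onAr (F0 F) f,
         fcell = onAr (F1 F) (Ide (C2 A) f)\<rparr>)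
     in \<lparr>on0 = restrict on0 (Ob (C1 A)), on1 = restrict on1 (Ar (C1 A)),
       on2 = (\<lambda>s \<in> Ar (C2 A). \<lparr>xsrc = on1 (Dom (C2 A) s), xtgt = on1 (Cod (C2 A) s),
         xcell = unitor F (Dom (C1 A) (Dom (C2 A) s)) \<bullet> onAr (F1 F) s\<rparr>)\<rparr>)"

text \<open>A 2-cell goes to the cell of proarrows induced by its image. Composable proarrows of
  \<open>VerDbl A\<close> are equal, so the laxator lives on the diagonal and is
  \<open>undefined\<close> elsewhere, as \<open>laxator_ext\<close> demands.\<close>

definition S0 :: "('o, 'a, 't, ('eo, 'ep, 'ec) cat_ob, ('eo, 'ea, 'ep, 'ec) cat_ob_fun, ('eo, 'ea, 'ep, 'ec) cat_ob_trans) two_fctr \<Rightarrow>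
    ('o, 'a, 'o, 't, 'eo, 'ea, 'ep, 'ec) lax_fctr"
  where "S0 G =
    \<lparr>F0 = \<lparr>onOb = (\<lambda>x \<in> Ob (C1 A). base (on0 G x)), onAr = (\<lambda>f \<in> Ar (C1 A). farr (on1 G f))\<rparr>,
     F1 = \<lparr>onOb = (\<lambda>x \<in> Ob (C1 A). loop (on0 G x)), onAr = (\<lambda>s \<in> Ar (C2 A). cat_ob_trans_loop D (on2 G s))\<rparr>,
     laxator = (\<lambda>x y. if x \<in> Ob (C1 A) \<and> x = y then mult (on0 G x) else undefined),
     unitor = (\<lambda>x \<in> Ob (C1 A). unit (on0 G x))\<rparr>"

lemma T0_simps [simp]:
  "x \<in> Ob (C1 A) \<Longrightarrow> on0 (T0 F) x =
    \<lparr>base = onOb (F0 F) x, loop = onOb (F1 F) x, mult = laxator F x x, unit = unitor F x\<rparr>"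
  "f \<in> Ar (C1 A) \<Longrightarrow> on1 (T0 F) f = \<lparr>fsrc = on0 (T0 F) (Dom (C1 A) f), ftgt = on0 (T0 F) (Cod (C1 A) f),
    farr = onAr (F0 F) f, fcell = onAr (F1 F) (Ide (C2 A) f)\<rparr>"
  "s \<in> Ar (C2 A) \<Longrightarrow> on2 (T0 F) s = \<lparr>xsrc = on1 (T0 F) (Dom (C2 A) s), xtgt = on1 (T0 F) (Cod (C2 A) s),
    xcell = unitor F (Dom (C1 A) (Dom (C2 A) s)) \<bullet> onAr (F1 F) s\<rparr>"
  by (simp_all add: T0_def Let_def)

lemma S0_simps [simp]:
  "x \<in> Ob (C1 A) \<Longrightarrow> onOb (F0 (S0 G)) x = base (on0 G x)"
  "f \<in> Ar (C1 A) \<Longrightarrow> onAr (F0 (S0 G)) f = farr (on1 G f)"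
  "x \<in> Ob (C1 A) \<Longrightarrow> onOb (F1 (S0 G)) x = loop (on0 G x)"
  "s \<in> Ar (C2 A) \<Longrightarrow> onAr (F1 (S0 G)) s = cat_ob_trans_loop D (on2 G s)"
  "x \<in> Ob (C1 A) \<Longrightarrow> laxator (S0 G) x x = mult (on0 G x)"
  "x \<in> Ob (C1 A) \<Longrightarrow> unitor (S0 G) x = unit (on0 G x)"
  by (simp_all add: S0_def)

end

section \<open>From lax functors to 2-functors\<close>

locale ver_functor = cell_valued A D + lax_double_functor "VerDbl A" D F
  for A :: "('o, 'a, 't) two_cat" and D :: "('eo, 'ea, 'ep, 'ec) dbl" and F
begin

lemma ob_simps [simp]:
  assumes "x \<in> Ob (C1 A)"
  shows "onOb (F0 F) x \<in> Ob (D0 D)" "onOb (F1 F) x \<in> Ob (D1 D)"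
    "psrc D (onOb (F1 F) x) = onOb (F0 F) x" "ptgt D (onOb (F1 F) x) = onOb (F0 F) x"
  using cat_functor.ob_in[OF functor0, of x] cat_functor.ob_in[OF functor1, of x] assms
    psrc_compat[of x] ptgt_compat[of x] by simp_all

lemma ar_simps [simp]:
  assumes "f \<in> Ar (C1 A)"
  shows "onAr (F0 F) f \<in> Ar (D0 D)" "Dom (D0 D) (onAr (F0 F) f) = onOb (F0 F) (Dom (C1 A) f)"
    "Cod (D0 D) (onAr (F0 F) f) = onOb (F0 F) (Cod (C1 A) f)"
  using cat_functor.ar_simps[OF functor0, of f] assms by simp_all

lemma cell_simps [simp]:
  assumes "s \<in> Ar (C2 A)"
  shows "onAr (F1 F) s \<in> Ar (D1 D)" "Dom (D1 D) (onAr (F1 F) s) = onOb (F1 F) (Dom (C1 A) (Dom (C2 A) s))"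
    "Cod (D1 D) (onAr (F1 F) s) = onOb (F1 F) (Cod (C1 A) (Dom (C2 A) s))"
    "csrc D (onAr (F1 F) s) = onAr (F0 F) (Dom (C2 A) s)" "ctgt D (onAr (F1 F) s) = onAr (F0 F) (Cod (C2 A) s)"
  using cat_functor.ar_simps[OF functor1, of s] csrc_compat[of s] ctgt_compat[of s] assms by simp_all

lemma lax_simps [simp]:
  assumes "x \<in> Ob (C1 A)"
  shows "laxator F x x \<in> Ar (D1 D)" "Dom (D1 D) (laxator F x x) = onOb (F1 F) x \<otimes> onOb (F1 F) x"
    "Cod (D1 D) (laxator F x x) = onOb (F1 F) x"
    "csrc D (laxator F x x) = Ide (D0 D) (onOb (F0 F) x)" "ctgt D (laxator F x x) = Ide (D0 D) (onOb (F0 F) x)"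
    "unitor F x \<in> Ar (D1 D)" "Dom (D1 D) (unitor F x) = pid D (onOb (F0 F) x)"
    "Cod (D1 D) (unitor F x) = onOb (F1 F) x"
    "csrc D (unitor F x) = Ide (D0 D) (onOb (F0 F) x)" "ctgt D (unitor F x) = Ide (D0 D) (onOb (F0 F) x)"
  using laxator_in[of x x x x x] unitor_in[of x] assms by (simp_all add: pro_iff globular_def cells_iff)

lemma ide_image [simp]:
  assumes "x \<in> Ob (C1 A)"
  shows "onAr (F0 F) (Ide (C1 A) x) = Ide (D0 D) (onOb (F0 F) x)"
    "onAr (F1 F) (Ide (C2 A) (Ide (C1 A) x)) = \<I> (onOb (F1 F) x)"
  using cat_functor.pres_ide[OF functor0, of x] cat_functor.pres_ide[OF functor1, of x] assms by simp_all

lemma cmp_image: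
  "f \<in> Ar (C1 A) \<Longrightarrow> g \<in> Ar (C1 A) \<Longrightarrow> Cod (C1 A) f = Dom (C1 A) g \<Longrightarrow>
    onAr (F0 F) (f \<cdot>\<^bsub>C1 A\<^esub> g) = onAr (F0 F) f \<cdot> onAr (F0 F) g"
  "s \<in> Ar (C2 A) \<Longrightarrow> t \<in> Ar (C2 A) \<Longrightarrow> Cod (C1 A) (Dom (C2 A) s) = Dom (C1 A) (Dom (C2 A) t) \<Longrightarrow>
    onAr (F1 F) (s *\<^bsub>A\<^esub> t) = onAr (F1 F) s \<bullet> onAr (F1 F) t"
  using cat_functor.cmp_image[OF functor0, of f g] cat_functor.cmp_image[OF functor1, of s t] by simp_all

lemma lax_natural:
  assumes "s \<in> Ar (C2 A)" "t \<in> Ar (C2 A)" "Cod (C2 A) s = Dom (C2 A) t" "Dom (C1 A) (Dom (C2 A) s) = x"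
    "Cod (C1 A) (Dom (C2 A) s) = y"
  shows "(onAr (F1 F) s \<parallel> onAr (F1 F) t) \<bullet> laxator F y y = laxator F x x \<bullet> onAr (F1 F) (s \<cdot>\<^bsub>C2 A\<^esub> t)"
proof -
  have "x \<in> Ob (C1 A)" using A.c1.dom_cod_Ob[of "Dom (C2 A) s"] assms by auto
  moreover have "Dom (C1 A) (Dom (C2 A) t) = x" "Cod (C1 A) (Dom (C2 A) t) = y"
    using A.arrow_simps(3,4)[OF assms(1)] assms by auto
  ultimately show ?thesis
    using laxator_natural[of x x x x x s y "Dom (C2 A) s" "Cod (C2 A) s" t y "Cod (C2 A) t"] assms
    by (simp add: pro_iff cells_iff)
qed

lemma unit_natural:
  assumes "f \<in> Ar (C1 A)" "Dom (C1 A) f = x" "Cod (C1 A) f = y"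
  shows "cid D (onAr (F0 F) f) \<bullet> unitor F y = unitor F x \<bullet> onAr (F1 F) (Ide (C2 A) f)"
  using unitor_natural[of f x y] assms by (simp add: hom_iff)

text \<open>The coherence cells of \<open>VerDbl A\<close> are identities, so the associativity and
  unit axioms of \<open>F\<close> at a single object become the laws of a category object.\<close>

lemma cobj_image:
  assumes x [simp]: "x \<in> Ob (C1 A)" shows "cobj (on0 (T0 F) x)"
proof (rule category_object.intro)
  have e: "onAr (F1 F) (assoc (VerDbl A) x x x) = \<I> (onOb (F1 F) x)"
    "onAr (F1 F) (lunit (VerDbl A) x) = \<I> (onOb (F1 F) x)" "onAr (F1 F) (runit (VerDbl A) x) = \<I> (onOb (F1 F) x)"
    by simp_all
  show "(mult (on0 (T0 F) x) \<parallel> \<I> (loop (on0 (T0 F) x))) \<bullet> mult (on0 (T0 F) x) =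
    assoc D (loop (on0 (T0 F) x)) (loop (on0 (T0 F) x)) (loop (on0 (T0 F) x)) \<bullet>
    (\<I> (loop (on0 (T0 F) x)) \<parallel> mult (on0 (T0 F) x)) \<bullet> mult (on0 (T0 F) x)"
    using lax_assoc[of x x x x x x x, unfolded e] by (simp add: pro_iff)
  show "(unit (on0 (T0 F) x) \<parallel> \<I> (loop (on0 (T0 F) x))) \<bullet> mult (on0 (T0 F) x) = lunit D (loop (on0 (T0 F) x))"
    using lax_unit_left[of x x x, unfolded e] by (simp add: pro_iff)
  show "(\<I> (loop (on0 (T0 F) x)) \<parallel> unit (on0 (T0 F) x)) \<bullet> mult (on0 (T0 F) x) = runit D (loop (on0 (T0 F) x))"
    using lax_unit_right[of x x x, unfolded e] by (simp add: pro_iff)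
qed (simp_all add: pro_iff globular_def cells_iff)

lemma cfun_image:
  assumes f [simp]: "f \<in> Ar (C1 A)" shows "cfun (on1 (T0 F) f)"
  by (rule cfunI) (use cobj_image[of "Dom (C1 A) f"] cobj_image[of "Cod (C1 A) f"] unit_natural[of f]
      lax_natural[of "Ide (C2 A) f" "Ide (C2 A) f"] in simp_all)

text \<open>Naturality of the laxator turns the external composite into the image of the vertical
  composite; the unitor in front then cancels the laxator against the inverse unitor of the
  action.\<close>

lemma lact_image:
  assumes [simp]: "s \<in> Ar (C2 A)" "t \<in> Ar (C2 A)" "Cod (C2 A) s = Dom (C2 A) t"
    "Dom (C1 A) (Dom (C2 A) t) = x" "Cod (C1 A) (Dom (C2 A) t) = y"
  shows "lact D (on0 (T0 F) y) (unitor F x \<bullet> onAr (F1 F) s) (onAr (F1 F) t) = onAr (F1 F) (s \<cdot>\<^bsub>C2 A\<^esub> t)"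
    "ract D (on0 (T0 F) y) (onAr (F1 F) s) (unitor F x \<bullet> onAr (F1 F) t) = onAr (F1 F) (s \<cdot>\<^bsub>C2 A\<^esub> t)"
proof -
  have [simp]: "Dom (C1 A) (Dom (C2 A) s) = x" "Cod (C1 A) (Dom (C2 A) s) = y" "x \<in> Ob (C1 A)" "y \<in> Ob (C1 A)"
    using A.arrow_simps(3,4)[of s] A.c1.dom_cod_Ob[of "Dom (C2 A) t"] by simp_all
  note n = lax_natural[of s t x y, simplified]
  have u: "(unitor F x \<parallel> \<I> (onOb (F1 F) x)) \<bullet> laxator F x x = lunit D (onOb (F1 F) x)"
    "(\<I> (onOb (F1 F) x) \<parallel> unitor F x) \<bullet> laxator F x x = runit D (onOb (F1 F) x)"
    using category_object.unit_left[OF cobj_image[of x]] category_object.unit_right[OF cobj_image[of x]] by simp_all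
  have "((unitor F x \<bullet> onAr (F1 F) s) \<parallel> onAr (F1 F) t) \<bullet> laxator F y y =
    (unitor F x \<parallel> \<I> (onOb (F1 F) x)) \<bullet> ((onAr (F1 F) s \<parallel> onAr (F1 F) t) \<bullet> laxator F y y)"
    by (simp add: merge_extend)
  also have "\<dots> = ((unitor F x \<parallel> \<I> (onOb (F1 F) x)) \<bullet> laxator F x x) \<bullet> onAr (F1 F) (s \<cdot>\<^bsub>C2 A\<^esub> t)"
    by (simp add: n)
  finally show "lact D (on0 (T0 F) y) (unitor F x \<bullet> onAr (F1 F) s) (onAr (F1 F) t) = onAr (F1 F) (s \<cdot>\<^bsub>C2 A\<^esub> t)"
    by (simp add: lact_def join_def u c1.inv_cmp_cancel)
  have "(onAr (F1 F) s \<parallel> (unitor F x \<bullet> onAr (F1 F) t)) \<bullet> laxator F y y =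
    (\<I> (onOb (F1 F) x) \<parallel> unitor F x) \<bullet> ((onAr (F1 F) s \<parallel> onAr (F1 F) t) \<bullet> laxator F y y)"
    by (simp add: merge_extend)
  also have "\<dots> = ((\<I> (onOb (F1 F) x) \<parallel> unitor F x) \<bullet> laxator F x x) \<bullet> onAr (F1 F) (s \<cdot>\<^bsub>C2 A\<^esub> t)"
    by (simp add: n)
  finally show "ract D (on0 (T0 F) y) (onAr (F1 F) s) (unitor F x \<bullet> onAr (F1 F) t) = onAr (F1 F) (s \<cdot>\<^bsub>C2 A\<^esub> t)"
    by (simp add: ract_def join_def u c1.inv_cmp_cancel)
qed

text \<open>Take one factor of \<open>lact_image\<close> to be an identity 2-cell. The second part
  is what lets \<open>S0\<close> recover the values of \<open>F\<close> on cells.\<close>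

lemma ctrans_image:
  assumes s [simp]: "s \<in> Ar (C2 A)"
  shows "ctrans (on2 (T0 F) s)" "cat_ob_trans_loop D (on2 (T0 F) s) = onAr (F1 F) s"
proof -
  let ?x = "Dom (C1 A) (Dom (C2 A) s)" and ?y = "Cod (C1 A) (Dom (C2 A) s)"
  have l: "lact D (on0 (T0 F) ?y) (unitor F ?x \<bullet> onAr (F1 F) s) (onAr (F1 F) (Ide (C2 A) (Cod (C2 A) s))) = onAr (F1 F) s"
    by (subst lact_image) simp_all
  have r: "ract D (on0 (T0 F) ?y) (onAr (F1 F) (Ide (C2 A) (Dom (C2 A) s))) (unitor F ?x \<bullet> onAr (F1 F) s) = onAr (F1 F) s"
    by (subst lact_image) simp_all
  show c: "ctrans (on2 (T0 F) s)"
    by (rule ctransI) (use cfun_image[of "Dom (C2 A) s"] cfun_image[of "Cod (C2 A) s"] l r in simp_all)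
  show "cat_ob_trans_loop D (on2 (T0 F) s) = onAr (F1 F) s"
    using ctrans_loop(1)[OF c] l by simp
qed

lemma two_functor_T0: "two_functor A (CatObjects D) (T0 F)"
proof -
  interpret CO: two_category "CatObjects D" by (rule two_category_CatObjects)
  note [simp] = CatObjects_simps
  show ?thesis
  proof (rule two_functor.intro)
    show "cat_functor (C1 A) (C1 (CatObjects D)) \<lparr>onOb = on0 (T0 F), onAr = on1 (T0 F)\<rparr>"
      \<comment> \<open>\<open>F\<close> preserves horizontal composites of 2-cells, so the identity
        on a composite arrow is first split into a horizontal composite of identities.\<close>
      by unfold_locales (auto simp del: T0_simps simp: hom_iff cobj_image cfun_image,
        auto simp: T0_def Let_def cmp_image cat_ob_fun_cmp_def A.ide_hcmp_ide[symmetric] simp del: A.ide_hcmp_ide)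
    show "cat_functor (C2 A) (C2 (CatObjects D)) \<lparr>onOb = on1 (T0 F), onAr = on2 (T0 F)\<rparr>"
    proof (rule cat_functor.intro, goal_cases)
      case (5 f)
      then show ?case using unit_natural[of f] by (simp add: A.ob2 ide_trans_def)
    next
      case (6 s f g t h)
      then have [simp]: "s \<in> Ar (C2 A)" "Dom (C2 A) s = f" "t \<in> Ar (C2 A)" "Dom (C2 A) t = g"
        "Cod (C2 A) s = g" "Cod (C2 A) t = h" by (auto simp: hom_iff)
      have [simp]: "f \<in> Ar (C1 A)" "g \<in> Ar (C1 A)" "Dom (C1 A) g = Dom (C1 A) f" "Cod (C1 A) g = Cod (C1 A) f"
        using A.arrow_simps[of s] by simp_all
      have [simp]: "h \<in> Ar (C1 A)" "Dom (C1 A) h = Dom (C1 A) f" "Cod (C1 A) h = Cod (C1 A) f"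
        using A.arrow_simps[of t] by simp_all
      have "on2 (T0 F) s \<cdot>\<^bsub>C2 (CatObjects D)\<^esub> on2 (T0 F) t = vcmp (on2 (T0 F) s) (on2 (T0 F) t)"
        by (rule Cmp_CatObjects) (rule ctrans_image ctrans_image, simp, rule ctrans_image, simp, simp)
      \<comment> \<open>The unitor in front of the second cell can be pulled out of the action,
        which leaves an instance of \<open>lact_image\<close>.\<close>
      moreover have "lact D (on0 (T0 F) (Cod (C1 A) f)) (unitor F (Dom (C1 A) f) \<bullet> onAr (F1 F) s)
          (unitor F (Dom (C1 A) f) \<bullet> onAr (F1 F) t) = unitor F (Dom (C1 A) f) \<bullet> onAr (F1 F) (s \<cdot>\<^bsub>C2 A\<^esub> t)"
        using cmp_lact[of "on0 (T0 F) (Cod (C1 A) f)" "unitor F (Dom (C1 A) f) \<bullet> onAr (F1 F) s" "onAr (F1 F) t" "unitor F (Dom (C1 A) f)"]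
          lact_image(1)[of s t "Dom (C1 A) f" "Cod (C1 A) f"] cobj_image[of "Cod (C1 A) f"] by simp
      ultimately show ?case by (auto intro!: cat_ob_trans.equality)
    qed (auto simp del: T0_simps simp: hom_iff cfun_image ctrans_image A.ob2,
        auto simp: T0_def Let_def A.ob2)
    fix s t x y z assume "s \<in> two_hom A x y" "t \<in> two_hom A y z"
    then have [simp]: "s \<in> Ar (C2 A)" "t \<in> Ar (C2 A)" "Dom (C1 A) (Dom (C2 A) s) = x"
      "Cod (C1 A) (Dom (C2 A) s) = y" "Dom (C1 A) (Dom (C2 A) t) = y" "Cod (C1 A) (Dom (C2 A) t) = z"
      by (auto simp: A.two_hom_iff)
    have [simp]: "x \<in> Ob (C1 A)" "y \<in> Ob (C1 A)"
      using A.c1.dom_cod_Ob[of "Dom (C2 A) s"] by simp_all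
    show "on2 (T0 F) (s *\<^bsub>A\<^esub> t) = on2 (T0 F) s *\<^bsub>CatObjects D\<^esub> on2 (T0 F) t"
      using ctrans_image(2)[of t]
      by (auto simp: tcmp_def cmp_image cat_ob_fun_cmp_def A.ide_hcmp_ide[symmetric] simp del: A.ide_hcmp_ide)
  qed
qed

lemma S0_T0: "S0 (T0 F) = F"
proof (rule lax_fctr.equality)
  show "F0 (S0 (T0 F)) = F0 F"
    by (rule fctr.equality) (auto simp: S0_def intro!: restrict_eqI cat_functor.ob_ext[OF functor0, simplified]
        cat_functor.ar_ext[OF functor0, simplified])
  show "F1 (S0 (T0 F)) = F1 F"
    by (rule fctr.equality) (auto simp: S0_def ctrans_image(2) simp del: T0_simps(3)
        intro!: restrict_eqI cat_functor.ob_ext[OF functor1, simplified] cat_functor.ar_ext[OF functor1, simplified])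
  \<comment> \<open>Off the diagonal both sides are \<open>undefined\<close>.\<close>
  show "laxator (S0 (T0 F)) = laxator F"
    using laxator_ext by (auto simp: S0_def fun_eq_iff)
  show "unitor (S0 (T0 F)) = unitor F"
    using unitor_ext by (auto simp: S0_def intro!: restrict_eqI)
qed simp

end

context cell_valued
begin

lemma T0_extensional [simp]:
  "on0 (T0 F) \<in> extensional (Ob (C1 A))" "on1 (T0 F) \<in> extensional (Ar (C1 A))"
  "on2 (T0 F) \<in> extensional (Ar (C2 A))"
  by (simp_all add: T0_def Let_def)

end

section \<open>From 2-functors to lax functors\<close>

locale cat_valued = cell_valued A D + G: two_functor A "CatObjects D" G
  for A :: "('o, 'a, 't) two_cat" and D :: "('eo, 'ea, 'ep, 'ec) dbl" and G
begin

text \<open>The generic rules produce terms such as \<open>Dom (C1 (CatObjects D))\<close>; they are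
  replaced below by rules about the record fields of category objects.\<close>

declare G.on0_in [simp del] G.on1_simps [simp del] G.on2_simps [simp del] G.on1_ide [simp del]
  G.on2_ide [simp del] G.on1_cmp [simp del] G.on2_cmp [simp del] G.on2_hcmp [simp del]

lemma G_simps [simp]:
  "x \<in> Ob (C1 A) \<Longrightarrow> cobj (on0 G x)"
  "f \<in> Ar (C1 A) \<Longrightarrow> cfun (on1 G f)"
  "f \<in> Ar (C1 A) \<Longrightarrow> fsrc (on1 G f) = on0 G (Dom (C1 A) f)"
  "f \<in> Ar (C1 A) \<Longrightarrow> ftgt (on1 G f) = on0 G (Cod (C1 A) f)"
  "s \<in> Ar (C2 A) \<Longrightarrow> ctrans (on2 G s)"
  "s \<in> Ar (C2 A) \<Longrightarrow> xsrc (on2 G s) = on1 G (Dom (C2 A) s)"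
  "s \<in> Ar (C2 A) \<Longrightarrow> xtgt (on2 G s) = on1 G (Cod (C2 A) s)"
  using G.on0_in[of x] G.on1_simps[of f] G.on2_simps[of s] by (simp_all add: CatObjects_simps)

lemma G_cells [simp]:
  assumes "f \<in> Ar (C1 A)"
  shows "Dom (D0 D) (farr (on1 G f)) = base (on0 G (Dom (C1 A) f))"
    "Cod (D0 D) (farr (on1 G f)) = base (on0 G (Cod (C1 A) f))"
    "Dom (D1 D) (fcell (on1 G f)) = loop (on0 G (Dom (C1 A) f))"
    "Cod (D1 D) (fcell (on1 G f)) = loop (on0 G (Cod (C1 A) f))"
  using cfun_simps[OF G_simps(2)[OF assms]] assms by simp_all

lemma G_ide [simp]:
  "x \<in> Ob (C1 A) \<Longrightarrow> on1 G (Ide (C1 A) x) =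
    \<lparr>fsrc = on0 G x, ftgt = on0 G x, farr = Ide (D0 D) (base (on0 G x)), fcell = \<I> (loop (on0 G x))\<rparr>"
  "f \<in> Ar (C1 A) \<Longrightarrow> on2 G (Ide (C2 A) f) = ide_trans (on1 G f)"
  using G.on1_ide[of x] G.on2_ide[OF A.two_category_axioms, of f] by (simp_all add: CatObjects_simps)

lemma G_cmp:
  "f \<in> Ar (C1 A) \<Longrightarrow> g \<in> Ar (C1 A) \<Longrightarrow> Cod (C1 A) f = Dom (C1 A) g \<Longrightarrow>
    on1 G (f \<cdot>\<^bsub>C1 A\<^esub> g) = cat_ob_fun_cmp D (on1 G f) (on1 G g)"
  "s \<in> Ar (C2 A) \<Longrightarrow> t \<in> Ar (C2 A) \<Longrightarrow> Cod (C2 A) s = Dom (C2 A) t \<Longrightarrow>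
    on2 G (s \<cdot>\<^bsub>C2 A\<^esub> t) = vcmp (on2 G s) (on2 G t)"
  "s \<in> Ar (C2 A) \<Longrightarrow> t \<in> Ar (C2 A) \<Longrightarrow> Cod (C1 A) (Dom (C2 A) s) = Dom (C1 A) (Dom (C2 A) t) \<Longrightarrow>
    on2 G (s *\<^bsub>A\<^esub> t) = tcmp (on2 G s) (on2 G t)"
  using G.on1_cmp[of f g] G.on2_cmp[of s t] G.on2_hcmp[OF A.two_category_axioms, of s t]
  by (simp_all add: CatObjects_simps Cmp_CatObjects)

text \<open>Functoriality on cells is \<open>ctrans_hcmp\<close>, naturality of the laxator is
  \<open>mult_loop\<close>, naturality of the unitor is preservation of units by functors, and the
  remaining equations are the laws of the category objects.\<close>

lemma lax_double_functor_S0: "lax_double_functor (VerDbl A) D (S0 G)"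
proof (rule lax_double_functor.intro)
  show "cat_functor (D0 (VerDbl A)) (D0 D) (F0 (S0 G))"
    by (rule cat_functor.intro) (auto simp: hom_iff G_cmp, auto simp: S0_def)
  show "cat_functor (D1 (VerDbl A)) (D1 D) (F1 (S0 G))"
    by (rule cat_functor.intro) (auto simp: hom_iff G_cmp ctrans_hcmp(2) cfun_ide, auto simp: S0_def)
  fix x y z s t m m' n n' f g h
  assume "m \<in> pro (VerDbl A) x y" "n \<in> pro (VerDbl A) y z"
    "s \<in> cells (VerDbl A) m m' f g" "t \<in> cells (VerDbl A) n n' g h"
  then have [simp]: "s \<in> Ar (C2 A)" "t \<in> Ar (C2 A)" "Dom (C2 A) t = Cod (C2 A) s" "m = x" "n = x"
    "m' = Cod (C1 A) (Dom (C2 A) s)" "n' = Cod (C1 A) (Dom (C2 A) t)" "Dom (C1 A) (Dom (C2 A) s) = x"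
    by (auto simp: pro_iff cells_iff)
  have [simp]: "x \<in> Ob (C1 A)" using A.c1.dom_cod_Ob[of "Dom (C2 A) s"] by simp
  show "(onAr (F1 (S0 G)) s \<parallel> onAr (F1 (S0 G)) t) \<bullet> laxator (S0 G) m' n' =
    laxator (S0 G) m n \<bullet> onAr (F1 (S0 G)) (s \<circledcirc>\<^bsub>VerDbl A\<^esub> t)"
    using mult_loop[of "on2 G s" "on2 G t"]
    by (simp add: G_cmp ctrans_vcmp(2)) (simp add: join_def)
next
  fix f x y assume "f \<in> hom (D0 (VerDbl A)) x y"
  then show "cid D (onAr (F0 (S0 G)) f) \<bullet> unitor (S0 G) y = unitor (S0 G) x \<bullet> onAr (F1 (S0 G)) (cid (VerDbl A) f)"
    using cfun_unit[of "on1 G f"] by (auto simp: hom_iff)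
next
  fix m n p w x y z
  assume "m \<in> pro (VerDbl A) w x" "n \<in> pro (VerDbl A) x y" "p \<in> pro (VerDbl A) y z"
  then show "(laxator (S0 G) m n \<parallel> \<I> (onOb (F1 (S0 G)) p)) \<bullet> laxator (S0 G) (m \<odot>\<^bsub>VerDbl A\<^esub> n) p \<bullet>
      onAr (F1 (S0 G)) (assoc (VerDbl A) m n p) =
    assoc D (onOb (F1 (S0 G)) m) (onOb (F1 (S0 G)) n) (onOb (F1 (S0 G)) p) \<bullet>
      (\<I> (onOb (F1 (S0 G)) m) \<parallel> laxator (S0 G) n p) \<bullet> laxator (S0 G) m (n \<odot>\<^bsub>VerDbl A\<^esub> p)"
    using category_object.mult_assoc[of D "on0 G x"] by (auto simp: pro_iff cfun_ide)
qed (auto simp: pro_iff globular_def cells_iff cfun_ide category_object.unit_left category_object.unit_right,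
    auto simp: S0_def)

text \<open>By \<open>unit_loop\<close> a 2-morphism is recovered from its induced cell by
  precomposing with the unit; the rest is extensionality.\<close>

lemma T0_S0: "T0 (S0 G) = G"
proof (rule two_fctr.equality)
  show e0: "on0 (T0 (S0 G)) = on0 G"
    by (rule extensionalityI[OF _ G.on_extensional(1)]) auto
  show e1: "on1 (T0 (S0 G)) = on1 G"
    by (rule extensionalityI[OF _ G.on_extensional(2)]) (auto simp: e0 simp del: T0_simps(1))
  show "on2 (T0 (S0 G)) = on2 G"
  proof (rule extensionalityI[OF _ G.on_extensional(3)])
    fix s assume s: "s \<in> Ar (C2 A)"
    then show "on2 (T0 (S0 G)) s = on2 G s"
      using unit_loop[of "on2 G s"] by (auto simp: e1 simp del: T0_simps(2) intro!: cat_ob_trans.equality)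
  qed simp
qed simp

end

section \<open>Preservation of products in both directions\<close>

context ver_functor
begin

text \<open>A 2-product of \<open>A\<close> is a product both in \<open>C1 A\<close> and in
  \<open>D1 (VerDbl A)\<close>. Its image is thus a componentwise product of category objects, hence
  a 2-product.\<close>

lemma preserves_2products_T0:
  assumes "preserves_products (C1 A) (D0 D) (F0 F)" "preserves_products (D1 (VerDbl A)) (D1 D) (F1 F)"
  shows "preserves_2products A (CatObjects D) (T0 F)"
  unfolding preserves_2products_def
proof (intro conjI allI impI)
  interpret T: two_functor A "CatObjects D" "T0 F" by (rule two_functor_T0)
  interpret T: cat_valued A D "T0 F" ..
  fix x y p \<pi>\<^sub>1 \<pi>\<^sub>2 assume p: "is_2product A x y p \<pi>\<^sub>1 \<pi>\<^sub>2"
  note [simp] = A.product_2hom[OF p]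
  have "is_product (C1 A) x y p \<pi>\<^sub>1 \<pi>\<^sub>2" using p by (simp add: is_2product_def)
  then have "is_product (D0 D) (onOb (F0 F) x) (onOb (F0 F) y) (onOb (F0 F) p) (onAr (F0 F) \<pi>\<^sub>1) (onAr (F0 F) \<pi>\<^sub>2)"
    using assms(1) by (simp add: preserves_products_def)
  moreover have "is_product (D1 D) (onOb (F1 F) x) (onOb (F1 F) y) (onOb (F1 F) p)
    (onAr (F1 F) (Ide (C2 A) \<pi>\<^sub>1)) (onAr (F1 F) (Ide (C2 A) \<pi>\<^sub>2))"
    using assms(2) A.product_VerDbl[OF p] by (simp add: preserves_products_def)
  ultimately interpret cat_ob_product D "on0 (T0 F) x" "on0 (T0 F) y" "on0 (T0 F) p" "on1 (T0 F) \<pi>\<^sub>1" "on1 (T0 F) \<pi>\<^sub>2"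
    using cfun_image[of \<pi>\<^sub>1] cfun_image[of \<pi>\<^sub>2] by unfold_locales simp_all
  show "is_2product (CatObjects D) (on0 (T0 F) x) (on0 (T0 F) y) (on0 (T0 F) p) (on1 (T0 F) \<pi>\<^sub>1) (on1 (T0 F) \<pi>\<^sub>2)"
    by (rule is_2product)
next
  fix t assume t: "is_2terminal A t"
  then have "is_terminal (C1 A) t" "t \<in> Ob (C1 A)" by (auto simp: is_2terminal_def is_terminal_def)
  then show "is_2terminal (CatObjects D) (on0 (T0 F) t)"
    using assms A.terminal_VerDbl[OF t] cobj_image[of t]
    by (intro is_2terminal) (simp add: cat_ob_terminal_def preserves_products_def)
qed

end

context cat_valued
begin

text \<open>A product cone in \<open>C1 A\<close> or \<open>D1 (VerDbl A)\<close> is not given as a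
  2-product, so preservation is checked on the chosen 2-products, where
  \<open>is_2product_components\<close> yields both product cones, and extended by uniqueness of
  products up to isomorphism.\<close>

lemma preserves_products_S0:
  assumes P: "cartesian_two_category A P" and Q: "parallel_products P' Q'"
    and G: "preserves_2products A (CatObjects D) G"
  shows "preserves_products (C1 A) (D0 D) (F0 (S0 G))" "preserves_products (D1 (VerDbl A)) (D1 D) (F1 (S0 G))"
proof -
  have p: "is_2product A x y (Prod P x y) (Proj1 P x y) (Proj2 P x y)" if "x \<in> Ob (C1 A)" "y \<in> Ob (C1 A)" for x y
    using P that by (simp add: cartesian_two_category_def)
  have t: "is_2terminal A (One P)" using P by (simp add: cartesian_two_category_def)
  then have [simp]: "One P \<in> Ob (C1 A)" by (simp add: is_2terminal_def is_terminal_def)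
  \<comment> \<open>The chosen products of \<open>A\<close>, with identity 2-cells as projections,
    serve as a choice of products in \<open>D1 (VerDbl A)\<close>.\<close>
  let ?P = "\<lparr>Prod = Prod P, Proj1 = (\<lambda>x y. Ide (C2 A) (Proj1 P x y)), Proj2 = (\<lambda>x y. Ide (C2 A) (Proj2 P x y)), One = One P\<rparr>"
  have c0: "chosen_products (C1 A) P"
    using p t by (auto simp: chosen_products_def is_2product_def is_2terminal_def)
  have c1: "chosen_products (D1 (VerDbl A)) ?P"
    using A.product_VerDbl[OF p] A.terminal_VerDbl[OF t] by (auto simp: chosen_products_def)
  have im: "cat_ob_product D (on0 G x) (on0 G y) (on0 G (Prod P x y)) (on1 G (Proj1 P x y)) (on1 G (Proj2 P x y))"
    if "x \<in> Ob (C1 A)" "y \<in> Ob (C1 A)" for x y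
    using is_2product_components[OF Q] G p[OF that] by (simp add: preserves_2products_def)
  have it: "cat_ob_terminal (on0 G (One P))"
    using is_2terminal_components[OF Q] G t by (simp add: preserves_2products_def)
  interpret F: lax_double_functor "VerDbl A" D "S0 G" by (rule lax_double_functor_S0)
  show "preserves_products (C1 A) (D0 D) (F0 (S0 G))"
  proof (rule cat_functor.preserves_productsI[OF _ A.cat1 cat0 c0])
    fix x y assume xy [simp]: "x \<in> Ob (C1 A)" "y \<in> Ob (C1 A)"
    note [simp] = A.product_2hom[OF p[OF xy]]
    show "is_product (D0 D) (onOb (F0 (S0 G)) x) (onOb (F0 (S0 G)) y) (onOb (F0 (S0 G)) (Prod P x y))
      (onAr (F0 (S0 G)) (Proj1 P x y)) (onAr (F0 (S0 G)) (Proj2 P x y))"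
      using cat_ob_product.prod0[OF im[OF xy]] by simp
  qed (use F.functor0 it in \<open>simp_all add: cat_ob_terminal_def\<close>)
  show "preserves_products (D1 (VerDbl A)) (D1 D) (F1 (S0 G))"
  proof (rule cat_functor.preserves_productsI[OF _ A.category_VerDbl cat1 c1])
    fix x y assume "x \<in> Ob (D1 (VerDbl A))" "y \<in> Ob (D1 (VerDbl A))"
    then have xy [simp]: "x \<in> Ob (C1 A)" "y \<in> Ob (C1 A)" by simp_all
    note [simp] = A.product_2hom[OF p[OF xy]]
    show "is_product (D1 D) (onOb (F1 (S0 G)) x) (onOb (F1 (S0 G)) y) (onOb (F1 (S0 G)) (Prod ?P x y))
      (onAr (F1 (S0 G)) (Proj1 ?P x y)) (onAr (F1 (S0 G)) (Proj2 ?P x y))"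
      using cat_ob_product.prod1[OF im[OF xy]] by simp
  qed (use F.functor1 it in \<open>simp_all add: cat_ob_terminal_def\<close>)
qed

end

section \<open>The correspondence on transformations and modulations\<close>

context cell_valued
begin

definition T1 :: "('o, 'a, 'o, 't, 'eo, 'ea, 'ep, 'ec) lax_transf \<Rightarrow>
    ('o, 'a, 't, ('eo, 'ep, 'ec) cat_ob, ('eo, 'ea, 'ep, 'ec) cat_ob_fun, ('eo, 'ea, 'ep, 'ec) cat_ob_trans) lax_nat"
  where "T1 \<alpha> =
    (let F = T0 (tsrc \<alpha>); G = T0 (ttgt \<alpha>);
       n = (\<lambda>x. \<lparr>fsrc = on0 F x, ftgt = on0 G x, farr = tob \<alpha> x, fcell = tpro \<alpha> x\<rparr>)
     in \<lparr>nsrc = F, ntgt = G, nob = restrict n (Ob (C1 A)),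
       nar = (\<lambda>f \<in> Ar (C1 A). \<lparr>xsrc = cat_ob_fun_cmp D (n (Dom (C1 A) f)) (on1 G f),
         xtgt = cat_ob_fun_cmp D (on1 F f) (n (Cod (C1 A) f)), xcell = tar \<alpha> f\<rparr>)\<rparr>)"

definition S1 :: "('o, 'a, 't, ('eo, 'ep, 'ec) cat_ob, ('eo, 'ea, 'ep, 'ec) cat_ob_fun, ('eo, 'ea, 'ep, 'ec) cat_ob_trans) lax_nat \<Rightarrow>
    ('o, 'a, 'o, 't, 'eo, 'ea, 'ep, 'ec) lax_transf"
  where "S1 \<beta> =
    \<lparr>tsrc = S0 (nsrc \<beta>), ttgt = S0 (ntgt \<beta>), tob = (\<lambda>x \<in> Ob (C1 A). farr (nob \<beta> x)),
     tpro = (\<lambda>x \<in> Ob (C1 A). fcell (nob \<beta> x)), tar = (\<lambda>f \<in> Ar (C1 A). xcell (nar \<beta> f))\<rparr>"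

definition T2 :: "('o, 'a, 'o, 't, 'eo, 'ea, 'ep, 'ec) modul \<Rightarrow>
    ('o, 'a, 't, ('eo, 'ep, 'ec) cat_ob, ('eo, 'ea, 'ep, 'ec) cat_ob_fun, ('eo, 'ea, 'ep, 'ec) cat_ob_trans) modif"
  where "T2 \<mu> = \<lparr>msrc = T1 (usrc \<mu>), mtgt = T1 (utgt \<mu>),
    mob = (\<lambda>x \<in> Ob (C1 A). \<lparr>xsrc = nob (T1 (usrc \<mu>)) x, xtgt = nob (T1 (utgt \<mu>)) x, xcell = uob \<mu> x\<rparr>)\<rparr>"

definition S2 :: "('o, 'a, 't, ('eo, 'ep, 'ec) cat_ob, ('eo, 'ea, 'ep, 'ec) cat_ob_fun, ('eo, 'ea, 'ep, 'ec) cat_ob_trans) modif \<Rightarrow>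
    ('o, 'a, 'o, 't, 'eo, 'ea, 'ep, 'ec) modul"
  where "S2 \<nu> = \<lparr>usrc = S1 (msrc \<nu>), utgt = S1 (mtgt \<nu>), uob = (\<lambda>x \<in> Ob (C1 A). xcell (mob \<nu> x))\<rparr>"

lemma T1_simps [simp]:
  "nsrc (T1 \<alpha>) = T0 (tsrc \<alpha>)" "ntgt (T1 \<alpha>) = T0 (ttgt \<alpha>)"
  "x \<in> Ob (C1 A) \<Longrightarrow> nob (T1 \<alpha>) x =
    \<lparr>fsrc = on0 (T0 (tsrc \<alpha>)) x, ftgt = on0 (T0 (ttgt \<alpha>)) x, farr = tob \<alpha> x, fcell = tpro \<alpha> x\<rparr>"
  "f \<in> Ar (C1 A) \<Longrightarrow> nar (T1 \<alpha>) f =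
    \<lparr>xsrc = cat_ob_fun_cmp D (nob (T1 \<alpha>) (Dom (C1 A) f)) (on1 (T0 (ttgt \<alpha>)) f),
     xtgt = cat_ob_fun_cmp D (on1 (T0 (tsrc \<alpha>)) f) (nob (T1 \<alpha>) (Cod (C1 A) f)), xcell = tar \<alpha> f\<rparr>"
  "nob (T1 \<alpha>) \<in> extensional (Ob (C1 A))" "nar (T1 \<alpha>) \<in> extensional (Ar (C1 A))"
  by (simp_all add: T1_def Let_def)

lemma S1_simps [simp]:
  "tsrc (S1 \<beta>) = S0 (nsrc \<beta>)" "ttgt (S1 \<beta>) = S0 (ntgt \<beta>)"
  "x \<in> Ob (C1 A) \<Longrightarrow> tob (S1 \<beta>) x = farr (nob \<beta> x)" "x \<in> Ob (C1 A) \<Longrightarrow> tpro (S1 \<beta>) x = fcell (nob \<beta> x)"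
  "f \<in> Ar (C1 A) \<Longrightarrow> tar (S1 \<beta>) f = xcell (nar \<beta> f)"
  "tob (S1 \<beta>) \<in> extensional (Ob (C1 A))" "tpro (S1 \<beta>) \<in> extensional (Ob (C1 A))"
  "tar (S1 \<beta>) \<in> extensional (Ar (C1 A))"
  by (simp_all add: S1_def)

lemma T2_simps [simp]:
  "msrc (T2 \<mu>) = T1 (usrc \<mu>)" "mtgt (T2 \<mu>) = T1 (utgt \<mu>)"
  "x \<in> Ob (C1 A) \<Longrightarrow> mob (T2 \<mu>) x = \<lparr>xsrc = nob (T1 (usrc \<mu>)) x, xtgt = nob (T1 (utgt \<mu>)) x, xcell = uob \<mu> x\<rparr>"
  "mob (T2 \<mu>) \<in> extensional (Ob (C1 A))"
  by (simp_all add: T2_def)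

lemma S2_simps [simp]:
  "usrc (S2 \<nu>) = S1 (msrc \<nu>)" "utgt (S2 \<nu>) = S1 (mtgt \<nu>)"
  "x \<in> Ob (C1 A) \<Longrightarrow> uob (S2 \<nu>) x = xcell (mob \<nu> x)" "uob (S2 \<nu>) \<in> extensional (Ob (C1 A))"
  by (simp_all add: S2_def)

end

context cat_valued
begin

text \<open>The unitors of \<open>VerDbl A\<close> are identities, so following the laxator by their
  image changes nothing; the suppressed coherence in the axioms thereby disappears.\<close>

lemma laxL_S0 [simp]: "x \<in> Ob (C1 A) \<Longrightarrow> laxL (VerDbl A) D (S0 G) x = mult (on0 G x)"
  and laxR_S0 [simp]: "x \<in> Ob (C1 A) \<Longrightarrow> laxR (VerDbl A) D (S0 G) x = mult (on0 G x)"
  by (simp_all add: laxL_def laxR_def cfun_ide)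

end

locale cat_valued_pair = cell_valued A D + G: cat_valued A D G + H: cat_valued A D H
  for A :: "('o, 'a, 't) two_cat" and D :: "('eo, 'ea, 'ep, 'ec) dbl" and G H
begin

text \<open>A square of 2-morphisms of category objects commutes if and only if the induced cells between
  the underlying proarrows agree.\<close>

lemma square_iff:
  assumes s: "s \<in> Ar (C2 A)" "Dom (C2 A) s = f" "Cod (C2 A) s = g" "Dom (C1 A) f = x" "Cod (C1 A) f = y"
    and c: "ctrans mx" "ctrans my" "ctrans Mf" "ctrans Mg"
    and e: "fsrc (xsrc mx) = on0 G x" "ftgt (xsrc mx) = on0 H x" "fsrc (xsrc my) = on0 G y" "ftgt (xsrc my) = on0 H y"
      "xsrc Mf = cat_ob_fun_cmp D (xsrc mx) (on1 H f)" "xtgt Mf = cat_ob_fun_cmp D (on1 G f) (xsrc my)"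
      "xsrc Mg = cat_ob_fun_cmp D (xtgt mx) (on1 H g)" "xtgt Mg = cat_ob_fun_cmp D (on1 G g) (xtgt my)"
  shows "Mf \<cdot>\<^bsub>C2 (CatObjects D)\<^esub> tcmp (on2 G s) my = tcmp mx (on2 H s) \<cdot>\<^bsub>C2 (CatObjects D)\<^esub> Mg \<longleftrightarrow>
    lact D (on0 H y) (xcell Mf) (cat_ob_trans_loop D (on2 G s) \<bullet> cat_ob_trans_loop D my) =
    ract D (on0 H y) (cat_ob_trans_loop D mx \<bullet> cat_ob_trans_loop D (on2 H s)) (xcell Mg)" (is "?l = ?r \<longleftrightarrow> _")
proof -
  have [simp]: "f \<in> Ar (C1 A)" "g \<in> Ar (C1 A)" "Dom (C1 A) g = x" "Cod (C1 A) g = y"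
    using A.arrow_simps[OF s(1)] s by simp_all
  note [simp] = s c e
  have t: "ctrans (tcmp (on2 G s) my)" "ctrans (tcmp mx (on2 H s))"
    by (rule ctrans_hcmp; simp)+
  have l: "?l = vcmp Mf (tcmp (on2 G s) my)" and r: "?r = vcmp (tcmp mx (on2 H s)) Mg"
    by (rule Cmp_CatObjects; simp add: t)+
  have "ctrans ?l" unfolding l by (rule ctrans_vcmp) (simp_all add: t)
  moreover have "ctrans ?r" unfolding r by (rule ctrans_vcmp) (simp_all add: t)
  \<comment> \<open>The induced cell of a vertical composite can be written as a left or as a right
    action; the choices made here match the two sides of the transformation axiom.\<close>
  moreover have "cat_ob_trans_loop D ?l =
    lact D (on0 H y) (xcell Mf) (cat_ob_trans_loop D (on2 G s) \<bullet> cat_ob_trans_loop D my)"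
    unfolding l by (subst ctrans_vcmp(2)) (simp_all add: t ctrans_hcmp(2))
  moreover have "cat_ob_trans_loop D ?r =
    ract D (on0 H y) (cat_ob_trans_loop D mx \<bullet> cat_ob_trans_loop D (on2 H s)) (xcell Mg)"
    unfolding r by (subst ctrans_vcmp(3)) (simp_all add: t ctrans_hcmp(2))
  moreover have "xsrc ?l = xsrc ?r" "xtgt ?l = xtgt ?r" unfolding l r by simp_all
  ultimately show ?thesis using ctrans_eqI[of ?l ?r] by metis
qed

end

text \<open>The boundary is presented as \<open>S0 G\<close> and \<open>S0 H\<close>, so that the
  rules for 2-functors into category objects apply. Boundaries of cartesian transformations have
  this form because \<open>S0 (T0 F) = F\<close>.\<close>

locale ver_transf = cat_valued_pair A D G H
  for A :: "('o, 'a, 't) two_cat" and D :: "('eo, 'ea, 'ep, 'ec) dbl" and G H +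
  fixes \<alpha> :: "('o, 'a, 'o, 't, 'eo, 'ea, 'ep, 'ec) lax_transf"
  assumes ends [simp]: "tsrc \<alpha> = S0 G" "ttgt \<alpha> = S0 H"
    and lax: "lax_transformation (VerDbl A) D \<alpha>"
begin

lemmas [simp] = G.T0_S0 H.T0_S0

lemma tob_simps [simp]:
  assumes "x \<in> Ob (C1 A)"
  shows "tob \<alpha> x \<in> Ar (D0 D)" "Dom (D0 D) (tob \<alpha> x) = base (on0 G x)" "Cod (D0 D) (tob \<alpha> x) = base (on0 H x)"
    "tpro \<alpha> x \<in> Ar (D1 D)" "Dom (D1 D) (tpro \<alpha> x) = loop (on0 G x)" "Cod (D1 D) (tpro \<alpha> x) = loop (on0 H x)"
    "csrc D (tpro \<alpha> x) = tob \<alpha> x" "ctgt D (tpro \<alpha> x) = tob \<alpha> x"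
  using lax_transformation.ob_in[OF lax, of x] lax_transformation.pro_in[OF lax, of x x x] assms
  by (auto simp: hom_iff pro_iff cells_iff)

lemma tar_simps [simp]:
  assumes "f \<in> Ar (C1 A)"
  shows "tar \<alpha> f \<in> Ar (D1 D)" "Dom (D1 D) (tar \<alpha> f) = pid D (base (on0 G (Dom (C1 A) f)))"
    "Cod (D1 D) (tar \<alpha> f) = loop (on0 H (Cod (C1 A) f))"
    "csrc D (tar \<alpha> f) = tob \<alpha> (Dom (C1 A) f) \<cdot> farr (on1 H f)"
    "ctgt D (tar \<alpha> f) = farr (on1 G f) \<cdot> tob \<alpha> (Cod (C1 A) f)"
  using lax_transformation.ar_in[OF lax, of f "Dom (C1 A) f" "Cod (C1 A) f"] assms
  by (auto simp: hom_iff cells_iff)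

text \<open>The transformation axiom for cells in terms of actions: its inverse unitors are those
  inside \<open>lact\<close> and \<open>ract\<close>, and \<open>laxL\<close> and
  \<open>laxR\<close> are the multiplication of \<open>on0 H y\<close>.\<close>

lemma tar_natural:
  assumes "s \<in> Ar (C2 A)" "Dom (C2 A) s = f" "Cod (C2 A) s = g" "Dom (C1 A) f = x" "Cod (C1 A) f = y"
  shows "lact D (on0 H y) (tar \<alpha> f) (cat_ob_trans_loop D (on2 G s) \<bullet> tpro \<alpha> y) =
    ract D (on0 H y) (tpro \<alpha> x \<bullet> cat_ob_trans_loop D (on2 H s)) (tar \<alpha> g)"
proof -
  have [simp]: "f \<in> Ar (C1 A)" "g \<in> Ar (C1 A)" "Dom (C1 A) g = x" "Cod (C1 A) g = y"
    using A.arrow_simps[OF assms(1)] assms by simp_all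
  have [simp]: "x \<in> Ob (C1 A)" "y \<in> Ob (C1 A)" using A.c1.dom_cod_Ob[of f] assms by simp_all
  show ?thesis
    using lax_transformation.natural[OF lax, of x x x y y y s f g] assms
    by (simp add: pro_iff cells_iff lact_def ract_def join_def)
qed

lemma cfun_nob:
  assumes [simp]: "x \<in> Ob (C1 A)" shows "cfun (nob (T1 \<alpha>) x)"
  using lax_transformation.pro_cmp[OF lax, of x x x x x] lax_transformation.pro_unit[OF lax, of x]
  by (intro cfunI) (simp_all add: pro_iff)

text \<open>The instance of \<open>tar_natural\<close> at the identity 2-cell on \<open>f\<close> is
  exactly the equality of actions demanded of a 2-morphism.\<close>

lemma ctrans_nar:
  assumes f [simp]: "f \<in> Ar (C1 A)" shows "ctrans (nar (T1 \<alpha>) f)"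
proof (rule ctransI)
  have n: "cfun (nob (T1 \<alpha>) (Dom (C1 A) f))" "cfun (nob (T1 \<alpha>) (Cod (C1 A) f))"
    by (rule cfun_nob; simp)+
  show "cfun (xsrc (nar (T1 \<alpha>) f))" "cfun (xtgt (nar (T1 \<alpha>) f))"
    using n by (simp_all del: T1_simps(3) add: cfun_cmp) (rule cfun_cmp; simp)+
qed (use tar_natural[of "Ide (C2 A) f" f f "Dom (C1 A) f" "Cod (C1 A) f"] in simp_all)

lemma two_lax_transformation_T1: "two_lax_transformation A (CatObjects D) (T1 \<alpha>)"
proof -
  note [simp] = CatObjects_simps
  show ?thesis
  proof (rule two_lax_transformation.intro, goal_cases)
    case (3 x)
    then show ?case using cfun_nob[of x] by (simp add: hom_iff)
  next
    case (4 f x y)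
    then show ?case using ctrans_nar[of f] by (auto simp: hom_iff)
  next
    case (5 f x y g s)
    then have s: "s \<in> Ar (C2 A)" "Dom (C2 A) s = f" "Cod (C2 A) s = g" "Dom (C1 A) f = x" "Cod (C1 A) f = y"
      and [simp]: "f \<in> Ar (C1 A)" "g \<in> Ar (C1 A)" "Dom (C1 A) f = x" "Cod (C1 A) f = y"
        "Dom (C1 A) g = x" "Cod (C1 A) g = y" by (auto simp: hom_iff)
    have [simp]: "x \<in> Ob (C1 A)" "y \<in> Ob (C1 A)" using A.c1.dom_cod_Ob[of f] by simp_all
    have c: "ctrans (ide_trans (nob (T1 \<alpha>) x))" "ctrans (ide_trans (nob (T1 \<alpha>) y))"
      "ctrans (nar (T1 \<alpha>) f)" "ctrans (nar (T1 \<alpha>) g)"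
      by (simp_all del: T1_simps add: ctrans_ide cfun_nob ctrans_nar)
    show ?case
      using square_iff[OF s c] tar_natural[OF s] cfun_nob[of x] cfun_nob[of y] by simp
  next
    case (6 f x y g z)
    then have [simp]: "f \<in> Ar (C1 A)" "Dom (C1 A) f = x" "Cod (C1 A) f = y"
      "g \<in> Ar (C1 A)" "Dom (C1 A) g = y" "Cod (C1 A) g = z" by (auto simp: hom_iff)
    have [simp]: "x \<in> Ob (C1 A)" "y \<in> Ob (C1 A)" "z \<in> Ob (C1 A)"
      using A.c1.dom_cod_Ob[of f] A.c1.dom_cod_Ob[of g] by simp_all
    have c: "ctrans (nar (T1 \<alpha>) f)" "ctrans (nar (T1 \<alpha>) g)" by (rule ctrans_nar; simp)+
    have t: "ctrans (tcmp (nar (T1 \<alpha>) f) (ide_trans (on1 H g)))" "ctrans (tcmp (ide_trans (on1 G f)) (nar (T1 \<alpha>) g))"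
      by (rule ctrans_hcmp; use c in \<open>simp add: ctrans_ide\<close>)+
    \<comment> \<open>Whiskering on the left uses the induced cell of
      \<open>nar (T1 \<alpha>) g\<close>, whereas \<open>ar_cmp\<close> is stated with
      \<open>tar \<alpha> g\<close> itself; the unit mediates between them.\<close>
    have u: "unit (on0 G y) \<bullet> cat_ob_trans_loop D (nar (T1 \<alpha>) g) = tar \<alpha> g"
      using unit_loop[OF c(2)] by simp
    have "tar \<alpha> (f \<cdot>\<^bsub>C1 A\<^esub> g) = lact D (on0 H z) (tar \<alpha> f \<bullet> fcell (on1 H g)) (cid D (farr (on1 G f)) \<bullet> tar \<alpha> g)"
      using lax_transformation.ar_cmp[OF lax, of f x y g z]
      by (simp add: hom_iff lact_def join_def)
    also have "\<dots> = xcell (vcmp (tcmp (nar (T1 \<alpha>) f) (ide_trans (on1 H g))) (tcmp (ide_trans (on1 G f)) (nar (T1 \<alpha>) g)))"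
      using u loop_simps[OF c(2)] by simp
    finally have "nar (T1 \<alpha>) (f \<cdot>\<^bsub>C1 A\<^esub> g) =
      vcmp (tcmp (nar (T1 \<alpha>) f) (ide_trans (on1 H g))) (tcmp (ide_trans (on1 G f)) (nar (T1 \<alpha>) g))"
      by (intro cat_ob_trans.equality) (simp_all add: G.G_cmp H.G_cmp cat_ob_fun_cmp_def)
    also have "\<dots> = tcmp (nar (T1 \<alpha>) f) (ide_trans (on1 H g)) \<cdot>\<^bsub>C2 (CatObjects D)\<^esub> tcmp (ide_trans (on1 G f)) (nar (T1 \<alpha>) g)"
      by (rule Cmp_CatObjects[symmetric, OF t]) (simp add: cat_ob_fun_cmp_def)
    finally show ?case by simp
  next
    case (7 x)
    then show ?case
      using lax_transformation.ar_ide[OF lax, of x] by (simp add: ide_trans_def cat_ob_fun_cmp_def)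
  qed simp_all
qed

text \<open>Strictness between category objects also asks for an equation of proarrow components,
  which \<open>strict_at\<close> does not mention. It follows: \<open>tar \<alpha> f\<close> is then
  a unit, acts trivially on either side, and naturality at the identity 2-cell collapses to that
  equation.\<close>

lemma strict_at_iff:
  assumes "f \<in> hom (C1 A) x y"
  shows "two_strict_at (CatObjects D) (T1 \<alpha>) x y f \<longleftrightarrow> strict_at D \<alpha> x y f"
proof -
  have [simp]: "f \<in> Ar (C1 A)" "Dom (C1 A) f = x" "Cod (C1 A) f = y" using assms by (auto simp: hom_iff)
  have [simp]: "x \<in> Ob (C1 A)" "y \<in> Ob (C1 A)" using A.c1.dom_cod_Ob[of f] by simp_all
  have "tpro \<alpha> x \<bullet> fcell (on1 H f) = fcell (on1 G f) \<bullet> tpro \<alpha> y"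
    if e: "tob \<alpha> x \<cdot> farr (on1 H f) = farr (on1 G f) \<cdot> tob \<alpha> y"
      and t: "tar \<alpha> f = cid D (farr (on1 G f) \<cdot> tob \<alpha> y) \<bullet> unit (on0 H y)"
  proof -
    have "lact D (on0 H y) (tar \<alpha> f) (fcell (on1 G f) \<bullet> tpro \<alpha> y) = fcell (on1 G f) \<bullet> tpro \<alpha> y"
      unfolding t by (rule lact_unit) simp_all
    moreover have "ract D (on0 H y) (tpro \<alpha> x \<bullet> fcell (on1 H f)) (tar \<alpha> f) = tpro \<alpha> x \<bullet> fcell (on1 H f)"
      unfolding t by (rule ract_unit) (simp_all add: e)
    ultimately show ?thesis using tar_natural[of "Ide (C2 A) f" f f x y] by simp
  qed
  then show ?thesis
    by (auto simp: two_strict_at_def strict_at_def CatObjects_simps ide_trans_def cat_ob_fun_cmp_def)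
qed

lemma S1_T1: "S1 (T1 \<alpha>) = \<alpha>"
  using lax_transformation.ob_ext[OF lax] lax_transformation.pro_ext[OF lax] lax_transformation.ar_ext[OF lax]
  by (intro lax_transf.equality) (auto simp: S1_def intro!: restrict_eqI)

end

section \<open>From transformations of 2-functors to lax transformations\<close>

locale ver_nat = cat_valued_pair A D G H
  for A :: "('o, 'a, 't) two_cat" and D :: "('eo, 'ea, 'ep, 'ec) dbl" and G H +
  fixes \<beta>
  assumes ends [simp]: "nsrc \<beta> = G" "ntgt \<beta> = H" and transf: "transformation A (CatObjects D) \<beta>"
begin

lemma lax: "two_lax_transformation A (CatObjects D) \<beta>"
  using transf by (simp add: transformation_def)

lemma nob_cells [simp]:
  assumes "x \<in> Ob (C1 A)"
  shows "cfun (nob \<beta> x)" "fsrc (nob \<beta> x) = on0 G x" "ftgt (nob \<beta> x) = on0 H x"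
    "Dom (D0 D) (farr (nob \<beta> x)) = base (on0 G x)" "Cod (D0 D) (farr (nob \<beta> x)) = base (on0 H x)"
    "Dom (D1 D) (fcell (nob \<beta> x)) = loop (on0 G x)" "Cod (D1 D) (fcell (nob \<beta> x)) = loop (on0 H x)"
proof -
  show "cfun (nob \<beta> x)" "fsrc (nob \<beta> x) = on0 G x" "ftgt (nob \<beta> x) = on0 H x"
    using transformation.nob_simps[OF transf assms] by (simp_all add: CatObjects_simps)
  then show "Dom (D0 D) (farr (nob \<beta> x)) = base (on0 G x)" "Cod (D0 D) (farr (nob \<beta> x)) = base (on0 H x)"
    "Dom (D1 D) (fcell (nob \<beta> x)) = loop (on0 G x)" "Cod (D1 D) (fcell (nob \<beta> x)) = loop (on0 H x)"
    by simp_all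
qed

lemma nar_cells [simp]:
  assumes "f \<in> Ar (C1 A)"
  shows "ctrans (nar \<beta> f)" "xsrc (nar \<beta> f) = cat_ob_fun_cmp D (nob \<beta> (Dom (C1 A) f)) (on1 H f)"
    "xtgt (nar \<beta> f) = cat_ob_fun_cmp D (on1 G f) (nob \<beta> (Cod (C1 A) f))"
  using transformation.nar_simps[OF transf assms] by (simp_all add: CatObjects_simps)

text \<open>Naturality as an equation between 2-morphisms, converted by \<open>square_iff\<close>
  into the form of the double-categorical axiom.\<close>

lemma nar_natural_loop:
  assumes s: "s \<in> Ar (C2 A)" "Dom (C2 A) s = f" "Cod (C2 A) s = g" "Dom (C1 A) f = x" "Cod (C1 A) f = y"
  shows "lact D (on0 H y) (xcell (nar \<beta> f)) (cat_ob_trans_loop D (on2 G s) \<bullet> fcell (nob \<beta> y)) =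
    ract D (on0 H y) (fcell (nob \<beta> x) \<bullet> cat_ob_trans_loop D (on2 H s)) (xcell (nar \<beta> g))"
proof -
  have [simp]: "f \<in> Ar (C1 A)" "g \<in> Ar (C1 A)" "Dom (C1 A) g = x" "Cod (C1 A) g = y"
    using A.arrow_simps[OF assms(1)] assms by simp_all
  have [simp]: "x \<in> Ob (C1 A)" "y \<in> Ob (C1 A)" using A.c1.dom_cod_Ob[of f] assms by simp_all
  have "ctrans (ide_trans (nob \<beta> x))" "ctrans (ide_trans (nob \<beta> y))" "ctrans (nar \<beta> f)" "ctrans (nar \<beta> g)"
    by (simp_all add: ctrans_ide)
  from square_iff[OF s this] show ?thesis
    using transformation.nar_natural[OF transf s] s by (simp add: CatObjects_simps)
qed

text \<open>The axiom for general cells is \<open>nar_natural_loop\<close>; compatibility with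
  laxators and unitors is functoriality of the components, and the composition law is the one of the
  2-categorical transformation with \<open>unit_loop\<close> applied.\<close>

lemma lax_transformation_S1: "lax_transformation (VerDbl A) D (S1 \<beta>)"
  unfolding lax_transformation_def VerDbl_simps S1_simps ends
proof (intro conjI allI impI, goal_cases)
  case (6 f x y)
  then have [simp]: "f \<in> Ar (C1 A)" "Dom (C1 A) f = x" "Cod (C1 A) f = y" by (auto simp: hom_iff)
  have [simp]: "x \<in> Ob (C1 A)" "y \<in> Ob (C1 A)" using A.c1.dom_cod_Ob[of f] by simp_all
  show ?case using ctrans_simps[of "nar \<beta> f"] by (simp add: cells_iff)
next
  case (7 m x y n w z s f g)
  then have s: "s \<in> Ar (C2 A)" "Dom (C2 A) s = f" "Cod (C2 A) s = g" "Dom (C1 A) f = m" "Cod (C1 A) f = n"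
    and [simp]: "m \<in> Ob (C1 A)" "n \<in> Ob (C1 A)" by (auto simp: pro_iff cells_iff)
  have [simp]: "f \<in> Ar (C1 A)" "g \<in> Ar (C1 A)" "Dom (C1 A) g = m" "Cod (C1 A) g = n"
    using A.arrow_simps[OF s(1)] s by simp_all
  show ?case
    using nar_natural_loop[OF s] s by (simp add: lact_def ract_def join_def)
next
  case (8 m x y n z)
  then have [simp]: "m \<in> Ob (C1 A)" "n = m" by (auto simp: pro_iff)
  show ?case using cfun_mult[of "nob \<beta> m"] by simp
next
  case (9 x)
  then show ?case using cfun_unit[of "nob \<beta> x"] by simp
next
  case (10 f x y g z)
  then have [simp]: "f \<in> Ar (C1 A)" "Dom (C1 A) f = x" "Cod (C1 A) f = y"
    "g \<in> Ar (C1 A)" "Dom (C1 A) g = y" "Cod (C1 A) g = z" by (auto simp: hom_iff)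
  have [simp]: "x \<in> Ob (C1 A)" "y \<in> Ob (C1 A)" "z \<in> Ob (C1 A)"
    using A.c1.dom_cod_Ob[of f] A.c1.dom_cod_Ob[of g] by simp_all
  have t: "ctrans (tcmp (nar \<beta> f) (ide_trans (on1 H g)))" "ctrans (tcmp (ide_trans (on1 G f)) (nar \<beta> g))"
    by (rule ctrans_hcmp; simp add: ctrans_ide)+
  have u: "unit (on0 G y) \<bullet> cat_ob_trans_loop D (nar \<beta> g) = xcell (nar \<beta> g)"
    using unit_loop[of "nar \<beta> g"] by simp
  have "nar \<beta> (f \<cdot>\<^bsub>C1 A\<^esub> g) = vcmp (tcmp (nar \<beta> f) (ide_trans (on1 H g))) (tcmp (ide_trans (on1 G f)) (nar \<beta> g))"
    using transformation.nar_cmp[OF transf, of f g] Cmp_CatObjects[OF t] by (simp add: CatObjects_simps cat_ob_fun_cmp_def)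
  then have "xcell (nar \<beta> (f \<cdot>\<^bsub>C1 A\<^esub> g)) =
    lact D (on0 H z) (xcell (nar \<beta> f) \<bullet> fcell (on1 H g)) (cid D (farr (on1 G f)) \<bullet> xcell (nar \<beta> g))"
    using u loop_simps[of "nar \<beta> g"] by simp
  then show ?case
    using ctrans_simps[of "nar \<beta> f"] ctrans_simps[of "nar \<beta> g"] by (simp add: lact_def join_def)
next
  case (11 x)
  then show ?case using two_lax_transformation.ar_ide[OF lax, of x] by (simp add: CatObjects_simps del: H.G_ide G.G_ide)
qed (auto simp: hom_iff pro_iff cells_iff)

lemma T1_S1: "T1 (S1 \<beta>) = \<beta>"
proof (rule lax_nat.equality)
  \<comment> \<open>Compared first because the boundaries of the 2-morphisms in \<open>nar\<close>
    are built from \<open>nob\<close>.\<close>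
  show e: "nob (T1 (S1 \<beta>)) = nob \<beta>"
    by (rule extensionalityI[OF _ two_lax_transformation.ob_ext[OF lax]]) (auto simp: G.T0_S0 H.T0_S0 intro!: cat_ob_fun.equality)
  show "nar (T1 (S1 \<beta>)) = nar \<beta>"
    by (rule extensionalityI[OF _ two_lax_transformation.ar_ext[OF lax]])
      (auto simp: G.T0_S0 H.T0_S0 e simp del: T1_simps(3) intro!: cat_ob_trans.equality)
qed (simp_all add: G.T0_S0 H.T0_S0)

end

section \<open>From modulations to modifications\<close>

locale ver_modul = cat_valued_pair A D G H + X: ver_transf A D G H \<alpha> + Y: ver_transf A D G H \<alpha>'
  for A :: "('o, 'a, 't) two_cat" and D :: "('eo, 'ea, 'ep, 'ec) dbl" and G H \<alpha> \<alpha>' +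
  fixes \<mu> :: "('o, 'a, 'o, 't, 'eo, 'ea, 'ep, 'ec) modul"
  assumes sides [simp]: "usrc \<mu> = \<alpha>" "utgt \<mu> = \<alpha>'" and modul: "modulation (VerDbl A) D \<mu>"
begin

lemma uob_simps [simp]:
  assumes "x \<in> Ob (C1 A)"
  shows "uob \<mu> x \<in> Ar (D1 D)" "Dom (D1 D) (uob \<mu> x) = pid D (base (on0 G x))"
    "Cod (D1 D) (uob \<mu> x) = loop (on0 H x)" "csrc D (uob \<mu> x) = tob \<alpha> x" "ctgt D (uob \<mu> x) = tob \<alpha>' x"
  using modulation.ob_in[OF modul, of x] assms by (simp_all add: cells_iff)

lemma modul_at_lact:
  "x \<in> Ob (C1 A) \<Longrightarrow> modul_at (VerDbl A) D \<mu> x = lact D (on0 H x) (uob \<mu> x) (tpro \<alpha>' x)"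
  by (simp add: modul_at_def lact_def join_def)

text \<open>Every proarrow of \<open>VerDbl A\<close> is an object \<open>x\<close>, and
  equivariance there says that the two actions of \<open>uob \<mu> x\<close> agree. So it is a
  2-morphism, and the common value \<open>modul_at\<close> is its induced cell.\<close>

lemma ctrans_mob:
  assumes [simp]: "x \<in> Ob (C1 A)"
  shows "ctrans (mob (T2 \<mu>) x)" "cat_ob_trans_loop D (mob (T2 \<mu>) x) = modul_at (VerDbl A) D \<mu> x"
proof -
  have e: "lact D (on0 H x) (uob \<mu> x) (tpro \<alpha>' x) = ract D (on0 H x) (tpro \<alpha> x) (uob \<mu> x)"
    using modulation.equivariant[OF modul, of x x x]
    by (simp add: pro_iff modul_at_lact) (simp add: ract_def join_def)
  show c: "ctrans (mob (T2 \<mu>) x)"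
    by (rule ctransI) (use e X.cfun_nob[of x] Y.cfun_nob[of x] in simp_all)
  show "cat_ob_trans_loop D (mob (T2 \<mu>) x) = modul_at (VerDbl A) D \<mu> x"
    using ctrans_loop(1)[OF c] by (simp add: modul_at_lact)
qed

lemma modification_T2: "modification A (CatObjects D) (T2 \<mu>)"
proof -
  note [simp] = CatObjects_simps
  show ?thesis
  proof (rule modification.intro, goal_cases)
    case (4 x)
    then show ?case using ctrans_mob(1)[of x] by (simp add: hom_iff)
  next
    case (5 f x y)
    then have f [simp]: "f \<in> Ar (C1 A)" "Dom (C1 A) f = x" "Cod (C1 A) f = y" by (auto simp: hom_iff)
    have [simp]: "x \<in> Ob (C1 A)" "y \<in> Ob (C1 A)" using A.c1.dom_cod_Ob[of f] by simp_all
    \<comment> \<open>The modulation axiom at the identity 2-cell of \<open>f\<close>, whose images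
      under \<open>S0 G\<close> and \<open>S0 H\<close> are the \<open>fcell\<close> of the functors
      at \<open>f\<close>.\<close>
    have n: "lact D (on0 H y) (tar \<alpha> f) (fcell (on1 G f) \<bullet> modul_at (VerDbl A) D \<mu> y) =
      ract D (on0 H y) (modul_at (VerDbl A) D \<mu> x \<bullet> fcell (on1 H f)) (tar \<alpha>' f)"
      using modulation.natural[OF modul, of x x x y y y "Ide (C2 A) f" f f] loop_simps[OF ctrans_mob(1), of x]
        loop_simps[OF ctrans_mob(1), of y] ctrans_mob(2)[of x] ctrans_mob(2)[of y]
      by (simp add: pro_iff cells_iff lact_def ract_def join_def)
    have i: "Ide (C2 A) f \<in> Ar (C2 A)" "Dom (C2 A) (Ide (C2 A) f) = f" "Cod (C2 A) (Ide (C2 A) f) = f" by simp_all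
    have "(nar (T1 \<alpha>) f \<cdot>\<^bsub>C2 (CatObjects D)\<^esub> tcmp (on2 G (Ide (C2 A) f)) (mob (T2 \<mu>) y) =
      tcmp (mob (T2 \<mu>) x) (on2 H (Ide (C2 A) f)) \<cdot>\<^bsub>C2 (CatObjects D)\<^esub> nar (T1 \<alpha>') f)"
      by (subst square_iff[OF i f(2,3) ctrans_mob(1) ctrans_mob(1) X.ctrans_nar Y.ctrans_nar])
        (simp_all del: T2_simps(3) add: ctrans_mob(2) n, simp_all)
    then show ?case by simp
  qed simp_all
qed

lemma S2_T2: "S2 (T2 \<mu>) = \<mu>"
  using modulation.ob_ext[OF modul] X.S1_T1 Y.S1_T1
  by (intro modul.equality) (auto simp: S2_def intro!: restrict_eqI)

end

section \<open>From modifications to modulations\<close>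

locale ver_modif = cat_valued_pair A D G H + X: ver_nat A D G H \<beta> + Y: ver_nat A D G H \<beta>'
  for A :: "('o, 'a, 't) two_cat" and D :: "('eo, 'ea, 'ep, 'ec) dbl" and G H \<beta> \<beta>' +
  fixes \<nu>
  assumes sides [simp]: "msrc \<nu> = \<beta>" "mtgt \<nu> = \<beta>'" and modif: "modification_of A (CatObjects D) \<nu>"
begin

lemma modification: "modification A (CatObjects D) \<nu>"
  using modif by (simp add: modification_of_def)

lemma mob_cells [simp]:
  assumes "x \<in> Ob (C1 A)"
  shows "ctrans (mob \<nu> x)" "xsrc (mob \<nu> x) = nob \<beta> x" "xtgt (mob \<nu> x) = nob \<beta>' x"
  using modification_of.mob_simps[OF modif assms] by (simp_all add: CatObjects_simps)

lemma mob_at: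
  assumes [simp]: "x \<in> Ob (C1 A)"
  shows "modul_at (VerDbl A) D (S2 \<nu>) x = cat_ob_trans_loop D (mob \<nu> x)"
  using ctrans_loop(1)[of "mob \<nu> x"] by (simp add: modul_at_def lact_def join_def)

text \<open>The axiom for an arbitrary cell comes from the modification axiom at arbitrary 2-cells,
  \<open>mob_natural2\<close>, which \<open>square_iff\<close> translates into actions.\<close>

lemma modulation_S2: "modulation (VerDbl A) D (S2 \<nu>)"
  unfolding modulation_def VerDbl_simps S2_simps S1_simps sides X.ends Y.ends
proof (intro conjI allI impI, goal_cases)
  case (4 x)
  then show ?case using ctrans_simps(7-11)[OF mob_cells(1)[of x]] by (simp add: cells_iff)
next
  case (5 m x y)
  then have [simp]: "m \<in> Ob (C1 A)" "x = m" "y = m" by (auto simp: pro_iff)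
  show ?case
    using ctrans_loop(2)[of "mob \<nu> m"] ctrans_simps(7-11)[OF mob_cells(1)[of m]]
    by (simp add: mob_at ract_def join_def)
next
  case (6 m x y n w z s f g)
  then have s [simp]: "s \<in> Ar (C2 A)" "Dom (C2 A) s = f" "Cod (C2 A) s = g" "Dom (C1 A) f = m" "Cod (C1 A) f = n"
    and [simp]: "m \<in> Ob (C1 A)" "n \<in> Ob (C1 A)" by (auto simp: pro_iff cells_iff)
  have [simp]: "f \<in> Ar (C1 A)" "g \<in> Ar (C1 A)" "Dom (C1 A) g = m" "Cod (C1 A) g = n"
    using A.arrow_simps[OF s(1)] by simp_all
  have "lact D (on0 H n) (xcell (nar \<beta> f)) (cat_ob_trans_loop D (on2 G s) \<bullet> cat_ob_trans_loop D (mob \<nu> n)) =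
    ract D (on0 H n) (cat_ob_trans_loop D (mob \<nu> m) \<bullet> cat_ob_trans_loop D (on2 H s)) (xcell (nar \<beta>' g))"
    by (subst square_iff[OF s, symmetric])
      (use modification_of.mob_natural2[OF modif s] in \<open>simp_all add: CatObjects_simps\<close>)
  moreover have "cat_ob_trans_loop D (mob \<nu> x) \<in> Ar (D1 D) \<and> Dom (D1 D) (cat_ob_trans_loop D (mob \<nu> x)) = loop (on0 G x) \<and>
    Cod (D1 D) (cat_ob_trans_loop D (mob \<nu> x)) = loop (on0 H x) \<and>
    csrc D (cat_ob_trans_loop D (mob \<nu> x)) = farr (nob \<beta> x) \<and> ctgt D (cat_ob_trans_loop D (mob \<nu> x)) = farr (nob \<beta>' x)"
    if "x \<in> Ob (C1 A)" for x using that by simp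
  moreover have "xcell (nar \<beta> f) \<in> Ar (D1 D)" "Cod (D1 D) (xcell (nar \<beta> f)) = loop (on0 H n)"
    "ctgt D (xcell (nar \<beta> f)) = farr (on1 G f) \<cdot> farr (nob \<beta> n)"
    "xcell (nar \<beta>' g) \<in> Ar (D1 D)" "Cod (D1 D) (xcell (nar \<beta>' g)) = loop (on0 H n)"
    "csrc D (xcell (nar \<beta>' g)) = farr (nob \<beta>' m) \<cdot> farr (on1 H g)"
    using ctrans_simps[OF X.nar_cells(1)[of f]] ctrans_simps[OF Y.nar_cells(1)[of g]] by simp_all
  ultimately show ?case
    by (simp add: mob_at lact_def ract_def join_def)
qed simp_all

lemma T2_S2: "T2 (S2 \<nu>) = \<nu>"
proof (rule modif.equality)
  show "mob (T2 (S2 \<nu>)) = mob \<nu>"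
    by (rule extensionalityI[OF _ modification.ob_ext[OF modification]])
      (auto simp: X.T1_S1 Y.T1_S1 simp del: T1_simps(3) intro!: cat_ob_trans.equality)
qed (simp_all add: X.T1_S1 Y.T1_S1)

end

section \<open>The isomorphism for cartesian functors and transformations\<close>

locale cartesian_valued = cell_valued A D
  for A :: "('o, 'a, 't) two_cat" and D :: "('eo, 'ea, 'ep, 'ec) dbl" +
  fixes P and P' and Q'
  assumes cart: "cartesian_two_category A P" and par: "parallel_products P' Q'"
begin

definition cl_functor :: "('o, 'a, 'o, 't, 'eo, 'ea, 'ep, 'ec) lax_fctr \<Rightarrow> bool"
  where "cl_functor F \<longleftrightarrow> cartesian_lax_functor (VerDbl A) D F"

definition cl_transf :: "('o, 'a, 'o, 't, 'eo, 'ea, 'ep, 'ec) lax_transf \<Rightarrow> bool"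
  where "cl_transf \<alpha> \<longleftrightarrow> cl_functor (tsrc \<alpha>) \<and> cl_functor (ttgt \<alpha>) \<and>
    lax_transformation (VerDbl A) D \<alpha> \<and> cartesian_transformation (VerDbl A) P D \<alpha>"

definition cl_modul :: "('o, 'a, 'o, 't, 'eo, 'ea, 'ep, 'ec) modul \<Rightarrow> bool"
  where "cl_modul \<mu> \<longleftrightarrow> cl_transf (usrc \<mu>) \<and> cl_transf (utgt \<mu>) \<and> modulation (VerDbl A) D \<mu>"

lemma CartLax_simps:
  "Ob (C1 (CartLax (VerDbl A) P D)) = {F. cl_functor F}"
  "Ar (C1 (CartLax (VerDbl A) P D)) = {\<alpha>. cl_transf \<alpha>}"
  "Dom (C1 (CartLax (VerDbl A) P D)) = tsrc" "Cod (C1 (CartLax (VerDbl A) P D)) = ttgt"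
  "Ide (C1 (CartLax (VerDbl A) P D)) = lax_transf_ide (VerDbl A) D"
  "Cmp (C1 (CartLax (VerDbl A) P D)) = lax_transf_cmp (VerDbl A) D"
  "Ob (C2 (CartLax (VerDbl A) P D)) = {\<alpha>. cl_transf \<alpha>}"
  "Ar (C2 (CartLax (VerDbl A) P D)) = {\<mu>. cl_modul \<mu>}"
  "Dom (C2 (CartLax (VerDbl A) P D)) = usrc" "Cod (C2 (CartLax (VerDbl A) P D)) = utgt"
  "Ide (C2 (CartLax (VerDbl A) P D)) \<alpha> = \<lparr>usrc = \<alpha>, utgt = \<alpha>,
    uob = (\<lambda>x \<in> Ob (C1 A). cid D (tob \<alpha> x) \<bullet> unitor (ttgt \<alpha>) x)\<rparr>"
  "Cmp (C2 (CartLax (VerDbl A) P D)) \<mu> \<nu> = \<lparr>usrc = usrc \<mu>, utgt = utgt \<nu>,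
    uob = (\<lambda>x \<in> Ob (C1 A). linv D (pid D (onOb (F0 (tsrc (usrc \<mu>))) x)) \<bullet>
      (uob \<mu> x \<parallel> uob \<nu> x) \<bullet> laxL (VerDbl A) D (ttgt (usrc \<mu>)) x)\<rparr>"
  "HCmp (CartLax (VerDbl A) P D) \<mu> \<nu> = \<lparr>usrc = lax_transf_cmp (VerDbl A) D (usrc \<mu>) (usrc \<nu>),
    utgt = lax_transf_cmp (VerDbl A) D (utgt \<mu>) (utgt \<nu>),
    uob = (\<lambda>x \<in> Ob (C1 A). uob \<mu> x \<bullet> modul_at (VerDbl A) D \<nu> x)\<rparr>"
  by (simp_all add: CartLax_def Let_def cl_functor_def cl_transf_def cl_modul_def)

abbreviation "cartF \<equiv> cartesian_target.cart_functor A (CatObjects D)"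
abbreviation "cartT \<equiv> cartesian_target.cart_transf A (CatObjects D) P"
abbreviation "cartM \<equiv> cartesian_target.cart_modif A (CatObjects D) P"

lemma P: "chosen_products (C1 A) P"
  using cart by (auto simp: cartesian_two_category_def chosen_products_def is_2product_def is_2terminal_def)

lemma target: "cartesian_target A (CatObjects D) P"
  using P A.two_category_axioms two_category_CatObjects
  by (simp add: cartesian_target_def cartesian_target_axioms_def two_categories_def)

lemmas cartF_def = cartesian_target.cart_functor_def[OF target]
lemmas cartT_def = cartesian_target.cart_transf_def[OF target]
lemmas cartM_def = cartesian_target.cart_modif_def[OF target]
lemmas Cart_simps = cartesian_target.Cart2Cat_simps[OF target]

lemma proj_hom:
  assumes "x \<in> Ob (C1 A)" "y \<in> Ob (C1 A)"
  shows "Proj1 P x y \<in> hom (C1 A) (Prod P x y) x" "Proj2 P x y \<in> hom (C1 A) (Prod P x y) y"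
  using cartesian_target.proj_simps[OF target assms] by (simp_all add: hom_iff)

lemma T0_cart:
  assumes "cl_functor F" shows "cartF (T0 F)" "S0 (T0 F) = F"
proof -
  interpret lax_double_functor "VerDbl A" D F using assms by (simp add: cl_functor_def cartesian_lax_functor_def)
  interpret ver_functor A D F ..
  show "cartF (T0 F)" "S0 (T0 F) = F"
    using assms two_functor_T0 preserves_2products_T0 S0_T0
    by (simp_all add: cartF_def cl_functor_def cartesian_lax_functor_def)
qed

lemma cat_valuedI: "cartF G \<Longrightarrow> cat_valued A D G"
  by (simp add: cat_valued_def cell_valued_axioms cartF_def)

lemma S0_cart:
  assumes "cartF G" shows "cl_functor (S0 G)" "T0 (S0 G) = G"
proof -
  interpret cat_valued A D G using assms by (rule cat_valuedI)
  show "cl_functor (S0 G)" "T0 (S0 G) = G"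
    using assms lax_double_functor_S0 preserves_products_S0[OF cart par] T0_S0
    by (simp_all add: cartF_def cl_functor_def cartesian_lax_functor_def)
qed

lemma ver_transfE:
  assumes a: "cl_transf \<alpha>"
  obtains G H where "ver_transf A D G H \<alpha>" "cartF G" "cartF H"
proof -
  obtain G H where G: "cartF G" "cartF H" "tsrc \<alpha> = S0 G" "ttgt \<alpha> = S0 H"
    using a T0_cart[of "tsrc \<alpha>"] T0_cart[of "ttgt \<alpha>"] unfolding cl_transf_def by metis
  then have "ver_transf A D G H \<alpha>"
    using a cell_valued_axioms cat_valuedI
    by (simp add: ver_transf_def ver_transf_axioms_def cat_valued_pair_def cl_transf_def)
  then show thesis using that G by blast
qed

text \<open>Cartesianness is strictness at the chosen projections of \<open>A\<close>, and there
  \<open>strict_at_iff\<close> matches the two notions of strictness.\<close>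

lemma T1_cart:
  assumes a: "cl_transf \<alpha>" shows "cartT (T1 \<alpha>)" "S1 (T1 \<alpha>) = \<alpha>"
proof -
  obtain G H where v: "ver_transf A D G H \<alpha>" and G: "cartF G" "cartF H" using a by (rule ver_transfE)
  interpret ver_transf A D G H \<alpha> by (rule v)
  show "S1 (T1 \<alpha>) = \<alpha>" by (rule S1_T1)
  show "cartT (T1 \<alpha>)"
    using a G two_lax_transformation_T1 strict_at_iff proj_hom
    by (simp add: cartT_def cl_transf_def two_cartesian_transformation_def cartesian_transformation_def)
qed

lemma ver_natI:
  assumes b: "cartT \<beta>" and e: "nsrc \<beta> = G" "ntgt \<beta> = H" shows "ver_nat A D G H \<beta>"
proof -
  have "cat_valued A D G" "cat_valued A D H"
    using b e by (auto simp: cartT_def intro: cat_valuedI)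
  then show ?thesis
    using cell_valued_axioms cartesian_target.cart_transfD[OF target b] e
    by (simp add: ver_nat_def ver_nat_axioms_def cat_valued_pair_def)
qed

lemma S1_cart:
  assumes b: "cartT \<beta>" shows "cl_transf (S1 \<beta>)" "T1 (S1 \<beta>) = \<beta>"
proof -
  obtain G H where GH: "nsrc \<beta> = G" "ntgt \<beta> = H" by blast
  interpret ver_nat A D G H \<beta> using b GH by (rule ver_natI)
  show e: "T1 (S1 \<beta>) = \<beta>" by (rule T1_S1)
  have F: "cl_functor (S0 G)" "cl_functor (S0 H)"
    using b unfolding cartT_def GH by (blast intro: S0_cart)+
  interpret S: ver_transf A D G H "S1 \<beta>"
    using cat_valued_pair_axioms lax_transformation_S1
    by (simp add: ver_transf_def ver_transf_axioms_def)
  have "strict_at D (S1 \<beta>) x y f" if "two_strict_at (CatObjects D) \<beta> x y f" "f \<in> hom (C1 A) x y" for x y f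
    using S.strict_at_iff[OF that(2)] that(1) by (simp add: e)
  then show "cl_transf (S1 \<beta>)"
    using b F lax_transformation_S1 proj_hom
    by (simp add: cartT_def cl_transf_def two_cartesian_transformation_def cartesian_transformation_def)
qed

lemma ver_modulE:
  assumes m: "cl_modul \<mu>"
  obtains G H \<alpha> \<alpha>' where "ver_modul A D G H \<alpha> \<alpha>' \<mu>"
proof -
  have a: "cl_transf (usrc \<mu>)" "cl_transf (utgt \<mu>)" and d: "modulation (VerDbl A) D \<mu>"
    using m by (auto simp: cl_modul_def)
  obtain G H where v: "ver_transf A D G H (usrc \<mu>)" using a(1) by (rule ver_transfE)
  have "ver_transf A D G H (utgt \<mu>)"
    using v a(2) modulation.same_src[OF d] modulation.same_tgt[OF d]
    by (simp add: ver_transf_def ver_transf_axioms_def cl_transf_def)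
  with v d have "ver_modul A D G H (usrc \<mu>) (utgt \<mu>) \<mu>"
    by (simp add: ver_modul_def ver_modul_axioms_def ver_transf_def)
  then show thesis by (rule that)
qed

lemma T2_cart:
  assumes m: "cl_modul \<mu>" shows "cartM (T2 \<mu>)" "S2 (T2 \<mu>) = \<mu>"
proof -
  obtain G H \<alpha> \<alpha>' where v: "ver_modul A D G H \<alpha> \<alpha>' \<mu>" using m by (rule ver_modulE)
  interpret ver_modul A D G H \<alpha> \<alpha>' \<mu> by (rule v)
  show "S2 (T2 \<mu>) = \<mu>" by (rule S2_T2)
  show "cartM (T2 \<mu>)"
    using m modification_T2 by (simp add: cartM_def cl_modul_def T1_cart)
qed

lemma S2_cart:
  assumes n: "cartM \<nu>" shows "cl_modul (S2 \<nu>)" "T2 (S2 \<nu>) = \<nu>"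
proof -
  obtain \<beta> \<beta>' where b: "msrc \<nu> = \<beta>" "mtgt \<nu> = \<beta>'" by blast
  obtain G H where G: "nsrc \<beta> = G" "ntgt \<beta> = H" by blast
  have a: "cartT \<beta>" "cartT \<beta>'" using n b by (auto simp: cartM_def)
  have d: "modification_of A (CatObjects D) \<nu>" by (rule cartesian_target.cart_modifD[OF target n])
  have "nsrc \<beta>' = G" "ntgt \<beta>' = H" using modification_of.ends[OF d] b G by simp_all
  with ver_natI[OF a(1) G] ver_natI[OF a(2)] b d have "ver_modif A D G H \<beta> \<beta>' \<nu>"
    by (simp add: ver_modif_def ver_modif_axioms_def ver_nat_def)
  then interpret ver_modif A D G H \<beta> \<beta>' \<nu> .
  show "T2 (S2 \<nu>) = \<nu>" by (rule T2_S2)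
  show "cl_modul (S2 \<nu>)"
    using n modulation_S2 S1_cart a by (simp add: cartM_def cl_modul_def)
qed

text \<open>In \<open>Cart2Cat\<close> the structure 2-cell of a composite is a vertical composite
  of two whiskerings, so its cell is a left action; unfolding that action gives the formula of
  \<open>lax_transf_cmp\<close>.\<close>

lemma cmp_transf:
  assumes a: "cl_transf \<alpha>" and b: "cl_transf \<beta>" and m: "ttgt \<alpha> = tsrc \<beta>"
  shows "lax_transf_cmp (VerDbl A) D \<alpha> \<beta> = S1 (lax_nat_cmp A (CatObjects D) (T1 \<alpha>) (T1 \<beta>))"
proof -
  obtain G H where v: "ver_transf A D G H \<alpha>" using a by (rule ver_transfE)
  obtain H' K where w: "ver_transf A D H' K \<beta>" using b by (rule ver_transfE)
  \<comment> \<open>The middle lax functor is presented twice; the two presentations agree because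
    \<open>T0\<close> inverts \<open>S0\<close>.\<close>
  have "S0 H = S0 H'" using m ver_transf.ends[OF v] ver_transf.ends[OF w] by simp
  moreover have "T0 (S0 H) = H" "T0 (S0 H') = H'"
    using v w by (auto simp: ver_transf_def cat_valued_pair_def intro: cat_valued.T0_S0)
  ultimately have "H' = H" by metis
  with w have w: "ver_transf A D H K \<beta>" by simp
  interpret \<alpha>: ver_transf A D G H \<alpha> by (rule v)
  interpret \<beta>: ver_transf A D H K \<beta> by (rule w)
  have t: "xcell (nar (lax_nat_cmp A (CatObjects D) (T1 \<alpha>) (T1 \<beta>)) f) =
    linv D (pid D (base (on0 G (Dom (C1 A) f)))) \<bullet> ((cid D (tob \<alpha> (Dom (C1 A) f)) \<bullet> tar \<beta> f) \<parallel>
      (tar \<alpha> f \<bullet> tpro \<beta> (Cod (C1 A) f))) \<bullet> mult (on0 K (Cod (C1 A) f))"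
    if f [simp]: "f \<in> Ar (C1 A)" for f
  proof -
    let ?x = "Dom (C1 A) f" and ?y = "Cod (C1 A) f"
    have c: "ctrans (nar (T1 \<alpha>) f)" "ctrans (nar (T1 \<beta>) f)" "cfun (nob (T1 \<alpha>) ?x)" "cfun (nob (T1 \<beta>) ?y)"
      by (rule \<alpha>.ctrans_nar \<beta>.ctrans_nar \<alpha>.cfun_nob \<beta>.cfun_nob; simp)+
    have t: "ctrans (tcmp (ide_trans (nob (T1 \<alpha>) ?x)) (nar (T1 \<beta>) f))"
      "ctrans (tcmp (nar (T1 \<alpha>) f) (ide_trans (nob (T1 \<beta>) ?y)))"
      by (rule ctrans_hcmp; use c in \<open>simp add: ctrans_ide\<close>)+
    \<comment> \<open>Whiskering by \<open>nob (T1 \<alpha>) ?x\<close> composes the unit with the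
      induced cell of \<open>nar (T1 \<beta>) f\<close>, and this is just
      \<open>tar \<beta> f\<close>.\<close>
    have u: "unit (on0 H ?x) \<bullet> cat_ob_trans_loop D (nar (T1 \<beta>) f) = tar \<beta> f"
      using unit_loop[OF c(2)] by simp
    have "nar (lax_nat_cmp A (CatObjects D) (T1 \<alpha>) (T1 \<beta>)) f =
      vcmp (tcmp (ide_trans (nob (T1 \<alpha>) ?x)) (nar (T1 \<beta>) f)) (tcmp (nar (T1 \<alpha>) f) (ide_trans (nob (T1 \<beta>) ?y)))"
      using Cmp_CatObjects[OF t] by (simp add: lax_nat_cmp_def CatObjects_simps cat_ob_fun_cmp_def)
    then show ?thesis
      using u c loop_simps[OF c(2)] by (simp add: lact_def join_def)
  qed
  have n: "nob (lax_nat_cmp A (CatObjects D) (T1 \<alpha>) (T1 \<beta>)) x = cat_ob_fun_cmp D (nob (T1 \<alpha>) x) (nob (T1 \<beta>) x)"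
    if "x \<in> Ob (C1 A)" for x using that by (simp add: lax_nat_cmp_def CatObjects_simps)
  have k: "nsrc (lax_nat_cmp A (CatObjects D) (T1 \<alpha>) (T1 \<beta>)) = G" "ntgt (lax_nat_cmp A (CatObjects D) (T1 \<alpha>) (T1 \<beta>)) = K"
    by (simp_all add: lax_nat_cmp_def)
  show ?thesis
    by (rule lax_transf.equality)
      (auto simp: lax_transf_cmp_def S1_def Let_def t n k intro!: restrict_ext)
qed

text \<open>The bijections on all three levels are available, so it remains to recognise each
  operation of \<open>CartLax\<close> as the conjugate of the one of
  \<open>Cart2Cat\<close>.\<close>

theorem CartLax_isomorphic:
  "isomorphic_two_categories (CartLax (VerDbl A) P D) (Cart2Cat A P (CatObjects D))"
proof (rule isomorphic_two_categoriesI[where ?T0.0 = T0 and ?S0.0 = S0 and ?T1.0 = T1 and ?S1.0 = S1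
      and ?T2.0 = T2 and ?S2.0 = S2])
  show "two_category (Cart2Cat A P (CatObjects D))"
    by (rule cartesian_target.two_category_Cart2Cat[OF target])
next
  fix F assume F: "F \<in> Ob (C1 (CartLax (VerDbl A) P D))"
  then interpret lax_double_functor "VerDbl A" D F by (simp add: cl_functor_def cartesian_lax_functor_def CartLax_simps)
  interpret ver_functor A D F ..
  show "Ide (C1 (CartLax (VerDbl A) P D)) F = S1 (Ide (C1 (Cart2Cat A P (CatObjects D))) (T0 F))"
    using F by (auto simp: CartLax_simps Cart_simps lax_transf_ide_def lax_nat_ide_def S1_def T0_cart CatObjects_simps
        intro!: restrict_ext)
next
  fix \<alpha> assume "\<alpha> \<in> Ar (C1 (CartLax (VerDbl A) P D))"
  then have a: "cl_transf \<alpha>" by (simp add: CartLax_simps)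
  obtain G H where v: "ver_transf A D G H \<alpha>" using a by (rule ver_transfE)
  interpret ver_transf A D G H \<alpha> by (rule v)
  show "Ide (C2 (CartLax (VerDbl A) P D)) \<alpha> = S2 (Ide (C2 (Cart2Cat A P (CatObjects D))) (T1 \<alpha>))"
    using a by (auto simp: CartLax_simps Cart_simps S2_def T1_cart CatObjects_simps intro!: restrict_ext)
next
  fix \<mu> \<nu> assume "\<mu> \<in> Ar (C2 (CartLax (VerDbl A) P D))" "\<nu> \<in> Ar (C2 (CartLax (VerDbl A) P D))"
    "Cod (C2 (CartLax (VerDbl A) P D)) \<mu> = Dom (C2 (CartLax (VerDbl A) P D)) \<nu>"
  then have m: "cl_modul \<mu>" "cl_modul \<nu>" "utgt \<mu> = usrc \<nu>" by (auto simp: CartLax_simps)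
  obtain G H \<alpha> \<alpha>' where v: "ver_modul A D G H \<alpha> \<alpha>' \<mu>" using m(1) by (rule ver_modulE)
  obtain G' H' \<beta> \<beta>' where w: "ver_modul A D G' H' \<beta> \<beta>' \<nu>" using m(2) by (rule ver_modulE)
  have "\<beta> = \<alpha>'" using ver_modul.sides[OF v] ver_modul.sides[OF w] m(3) by simp
  with w have w: "ver_modul A D G' H' \<alpha>' \<beta>' \<nu>" by simp
  have "S0 G = S0 G'" "S0 H = S0 H'"
    using v w ver_transf.ends[of A D G H \<alpha>'] ver_transf.ends[of A D G' H' \<alpha>'] by (simp_all add: ver_modul_def)
  moreover have "T0 (S0 G) = G" "T0 (S0 G') = G'" "T0 (S0 H) = H" "T0 (S0 H') = H'"
    using v w by (auto simp: ver_modul_def cat_valued_pair_def intro: cat_valued.T0_S0)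
  ultimately have "G' = G" "H' = H" by metis+
  with w have w: "ver_modul A D G H \<alpha>' \<beta>' \<nu>" by simp
  interpret \<mu>: ver_modul A D G H \<alpha> \<alpha>' \<mu> by (rule v)
  interpret \<nu>: ver_modul A D G H \<alpha>' \<beta>' \<nu> by (rule w)
  have c: "mob (T2 \<mu>) x \<cdot>\<^bsub>C2 (CatObjects D)\<^esub> mob (T2 \<nu>) x = vcmp (mob (T2 \<mu>) x) (mob (T2 \<nu>) x)"
    if "x \<in> Ob (C1 A)" for x
    using that by (intro Cmp_CatObjects \<mu>.ctrans_mob \<nu>.ctrans_mob) simp_all
  have a: "S1 (T1 \<alpha>) = \<alpha>" "S1 (T1 \<beta>') = \<beta>'"
    using m by (auto simp: cl_modul_def intro: T1_cart)
  show "\<mu> \<cdot>\<^bsub>C2 (CartLax (VerDbl A) P D)\<^esub> \<nu> = S2 (T2 \<mu> \<cdot>\<^bsub>C2 (Cart2Cat A P (CatObjects D))\<^esub> T2 \<nu>)"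
    by (rule modul.equality) (auto simp: CartLax_simps Cart_simps S2_def a c
        simp del: T2_simps(3) intro!: restrict_ext, simp add: lact_def join_def)
next
  fix \<mu> \<nu> assume "\<mu> \<in> Ar (C2 (CartLax (VerDbl A) P D))" "\<nu> \<in> Ar (C2 (CartLax (VerDbl A) P D))"
    "Cod (C1 (CartLax (VerDbl A) P D)) (Dom (C2 (CartLax (VerDbl A) P D)) \<mu>) =
      Dom (C1 (CartLax (VerDbl A) P D)) (Dom (C2 (CartLax (VerDbl A) P D)) \<nu>)"
  then have m: "cl_modul \<mu>" "cl_modul \<nu>" "ttgt (usrc \<mu>) = tsrc (usrc \<nu>)" by (auto simp: CartLax_simps)
  \<comment> \<open>A modulation has parallel boundaries, so the target transformations compose as
    well as the source ones.\<close>
  have s: "ttgt (utgt \<mu>) = tsrc (utgt \<nu>)"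
    using m modulation.same_src[of _ _ \<nu>] modulation.same_tgt[of _ _ \<mu>] by (auto simp: cl_modul_def)
  have c: "lax_transf_cmp (VerDbl A) D (usrc \<mu>) (usrc \<nu>) = S1 (lax_nat_cmp A (CatObjects D) (T1 (usrc \<mu>)) (T1 (usrc \<nu>)))"
    "lax_transf_cmp (VerDbl A) D (utgt \<mu>) (utgt \<nu>) = S1 (lax_nat_cmp A (CatObjects D) (T1 (utgt \<mu>)) (T1 (utgt \<nu>)))"
    using m s by (auto simp: cl_modul_def intro!: cmp_transf)
  obtain G H \<alpha> \<alpha>' where v: "ver_modul A D G H \<alpha> \<alpha>' \<nu>" using m(2) by (rule ver_modulE)
  interpret \<nu>: ver_modul A D G H \<alpha> \<alpha>' \<nu> by (rule v)
  show "\<mu> *\<^bsub>CartLax (VerDbl A) P D\<^esub> \<nu> = S2 (T2 \<mu> *\<^bsub>Cart2Cat A P (CatObjects D)\<^esub> T2 \<nu>)"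
    by (rule modul.equality) (use c in \<open>auto simp: CartLax_simps Cart_simps S2_def CatObjects_simps \<nu>.ctrans_mob(2)
        simp del: T2_simps(3) intro!: restrict_ext\<close>, simp)
qed (auto simp: CartLax_simps Cart_simps T0_cart S0_cart T1_cart S1_cart T2_cart S2_cart cmp_transf,
    auto simp: cl_transf_def cl_modul_def)

end

section \<open>Spans\<close>

lemma SetCat_simps [simp]:
  "Ob (SetCat U) = U" "Dom (SetCat U) = fnDom" "Cod (SetCat U) = fnCod"
  "f \<in> Ar (SetCat U) \<longleftrightarrow> fnDom f \<in> U \<and> fnCod f \<in> U \<and> fnMap f \<in> fnDom f \<rightarrow>\<^sub>E fnCod f"
  "fnDom (Ide (SetCat U) X) = X" "fnCod (Ide (SetCat U) X) = X" "fnMap (Ide (SetCat U) X) = (\<lambda>a \<in> X. a)"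
  "fnDom (f \<cdot>\<^bsub>SetCat U\<^esub> g) = fnDom f" "fnCod (f \<cdot>\<^bsub>SetCat U\<^esub> g) = fnCod g"
  "fnMap (f \<cdot>\<^bsub>SetCat U\<^esub> g) = (\<lambda>a \<in> fnDom f. fnMap g (fnMap f a))"
  by (simp_all add: SetCat_def)

lemma fn_eqI:
  assumes "fnDom f = X" "fnDom g = X" "fnCod f = fnCod g" "fnMap f \<in> extensional X" "fnMap g \<in> extensional X"
    "\<And>a. a \<in> X \<Longrightarrow> fnMap f a = fnMap g a"
  shows "(f :: 'u fn) = g"
  using assms by (intro fn.equality extensionalityI[of "fnMap f" X]) auto

lemma category_SetCat: "category (SetCat U)"
proof (rule category.intro, goal_cases)
  case (5 f x y) then show ?case by (intro fn_eqI[of _ x]) (auto simp: hom_iff PiE_def)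
next
  case (6 f x y) then show ?case by (intro fn_eqI[of _ x]) (auto simp: hom_iff PiE_def)
next
  case (7 f w x g y h z) then show ?case by (intro fn_eqI[of _ w]) (auto simp: hom_iff PiE_def)
qed (auto simp: hom_iff)

text \<open>The pointwise premise is a bounded quantifier of the object logic, so that
  \<open>span_cmp_simps\<close> can rewrite a quantifier over a pullback into quantifiers over the
  components of pairs.\<close>

lemma span_map_eqI:
  assumes "smDom \<sigma> = m" "smDom \<tau> = m" "smCod \<sigma> = smCod \<tau>" "smSrc \<sigma> = smSrc \<tau>" "smTgt \<sigma> = smTgt \<tau>"
    "smMap \<sigma> \<in> extensional (apex m)" "smMap \<tau> \<in> extensional (apex m)" "\<forall>a \<in> apex m. smMap \<sigma> a = smMap \<tau> a"
  shows "(\<sigma> :: 'u span_map) = \<tau>"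
  using assms by (intro span_map.equality extensionalityI[of "smMap \<sigma>" "apex m"]) auto

lemma span_simps:
  assumes "is_span U m"
  shows "spSrc m \<in> U" "spTgt m \<in> U" "apex m \<in> U" "a \<in> apex m \<Longrightarrow> legL m a \<in> spSrc m"
    "a \<in> apex m \<Longrightarrow> legR m a \<in> spTgt m" "legL m \<in> extensional (apex m)" "legR m \<in> extensional (apex m)"
  using assms by (auto simp: is_span_def PiE_def)

lemma span_map_simps:
  assumes "is_span_map U \<sigma>"
  shows "is_span U (smDom \<sigma>)" "is_span U (smCod \<sigma>)" "fnDom (smSrc \<sigma>) = spSrc (smDom \<sigma>)"
    "fnCod (smSrc \<sigma>) = spSrc (smCod \<sigma>)" "fnDom (smTgt \<sigma>) = spTgt (smDom \<sigma>)"
    "fnCod (smTgt \<sigma>) = spTgt (smCod \<sigma>)" "smSrc \<sigma> \<in> Ar (SetCat U)" "smTgt \<sigma> \<in> Ar (SetCat U)"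
    "smMap \<sigma> \<in> extensional (apex (smDom \<sigma>))"
    "fnMap (smSrc \<sigma>) \<in> extensional (spSrc (smDom \<sigma>))" "fnMap (smTgt \<sigma>) \<in> extensional (spTgt (smDom \<sigma>))"
  using assms by (auto simp: is_span_map_def hom_iff PiE_def)

lemma span_map_apply:
  assumes "is_span_map U \<sigma>" "smDom \<sigma> = m" "smCod \<sigma> = n" "a \<in> apex m"
  shows "smMap \<sigma> a \<in> apex n" "legL n (smMap \<sigma> a) = fnMap (smSrc \<sigma>) (legL m a)"
    "legR n (smMap \<sigma> a) = fnMap (smTgt \<sigma>) (legR m a)"
  using assms by (auto simp: is_span_map_def hom_iff PiE_def)

lemma is_span_mapI:
  assumes "is_span U m" "is_span U n" "smDom \<sigma> = m" "smCod \<sigma> = n" "smSrc \<sigma> \<in> Ar (SetCat U)" "smTgt \<sigma> \<in> Ar (SetCat U)"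
    "fnDom (smSrc \<sigma>) = spSrc m" "fnCod (smSrc \<sigma>) = spSrc n" "fnDom (smTgt \<sigma>) = spTgt m" "fnCod (smTgt \<sigma>) = spTgt n"
    "smMap \<sigma> \<in> extensional (apex m)"
    "\<forall>a \<in> apex m. smMap \<sigma> a \<in> apex n \<and> legL n (smMap \<sigma> a) = fnMap (smSrc \<sigma>) (legL m a) \<and>
      legR n (smMap \<sigma> a) = fnMap (smTgt \<sigma>) (legR m a)"
  shows "is_span_map U \<sigma>"
  using assms by (auto simp: is_span_map_def hom_iff PiE_def)

lemma span_id_simps [simp]:
  "spSrc (span_id X) = X" "spTgt (span_id X) = X" "apex (span_id X) = X"
  "a \<in> X \<Longrightarrow> legL (span_id X) a = a" "a \<in> X \<Longrightarrow> legR (span_id X) a = a"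
  by (simp_all add: span_id_def)

lemma is_span_id [simp]: "X \<in> U \<Longrightarrow> is_span U (span_id X)"
  by (auto simp: is_span_def span_id_def)

lemma span_glob_simps [simp]:
  "smDom (span_glob U m n h) = m" "smCod (span_glob U m n h) = n"
  "smSrc (span_glob U m n h) = Ide (SetCat U) (spSrc m)" "smTgt (span_glob U m n h) = Ide (SetCat U) (spTgt m)"
  "m = k \<Longrightarrow> smMap (span_glob U m n h) \<in> extensional (apex k)"
  "m = span_id X \<Longrightarrow> smMap (span_glob U m n h) \<in> extensional X" "a \<in> apex m \<Longrightarrow> smMap (span_glob U m n h) a = h a"
  by (auto simp: span_glob_def span_id_def)

lemma is_span_glob:
  assumes "is_span U m" "is_span U n" "spSrc m = spSrc n" "spTgt m = spTgt n"
    "\<forall>a \<in> apex m. h a \<in> apex n \<and> legL n (h a) = legL m a \<and> legR n (h a) = legR m a"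
  shows "is_span_map U (span_glob U m n h)"
  by (rule is_span_mapI[where m=m and n=n]) (use assms span_simps[OF assms(1)] span_simps[OF assms(2)] in auto)

lemma Span_simps [simp]:
  "D0 (Span U pair) = SetCat U" "Ob (D1 (Span U pair)) = {m. is_span U m}"
  "Ar (D1 (Span U pair)) = {\<sigma>. is_span_map U \<sigma>}" "Dom (D1 (Span U pair)) = smDom" "Cod (D1 (Span U pair)) = smCod"
  "Ide (D1 (Span U pair)) m = span_glob U m m (\<lambda>a. a)"
  "psrc (Span U pair) = spSrc" "ptgt (Span U pair) = spTgt" "csrc (Span U pair) = smSrc" "ctgt (Span U pair) = smTgt"
  "pid (Span U pair) = span_id" "pcmp (Span U pair) = span_cmp pair"
  "assoc (Span U pair) m n p = span_glob U
       (span_cmp pair (span_cmp pair m n) p) (span_cmp pair m (span_cmp pair n p))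
       (\<lambda>c. pair (fst_of pair (fst_of pair c))
              (pair (snd_of pair (fst_of pair c)) (snd_of pair c)))"
  "lunit (Span U pair) m = span_glob U (span_cmp pair (span_id (spSrc m)) m) m (snd_of pair)"
  "runit (Span U pair) m = span_glob U (span_cmp pair m (span_id (spTgt m))) m (fst_of pair)"
  by (simp_all add: Span_def)

lemma Span_cmp_simps [simp]:
  "smDom (\<sigma> \<cdot>\<^bsub>D1 (Span U pair)\<^esub> \<tau>) = smDom \<sigma>" "smCod (\<sigma> \<cdot>\<^bsub>D1 (Span U pair)\<^esub> \<tau>) = smCod \<tau>"
  "smSrc (\<sigma> \<cdot>\<^bsub>D1 (Span U pair)\<^esub> \<tau>) = smSrc \<sigma> \<cdot>\<^bsub>SetCat U\<^esub> smSrc \<tau>"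
  "smTgt (\<sigma> \<cdot>\<^bsub>D1 (Span U pair)\<^esub> \<tau>) = smTgt \<sigma> \<cdot>\<^bsub>SetCat U\<^esub> smTgt \<tau>"
  "smDom \<sigma> = m \<Longrightarrow> smMap (\<sigma> \<cdot>\<^bsub>D1 (Span U pair)\<^esub> \<tau>) \<in> extensional (apex m)"
  "smDom \<sigma> = span_id X \<Longrightarrow> smMap (\<sigma> \<cdot>\<^bsub>D1 (Span U pair)\<^esub> \<tau>) \<in> extensional X"
  "a \<in> apex (smDom \<sigma>) \<Longrightarrow> smMap (\<sigma> \<cdot>\<^bsub>D1 (Span U pair)\<^esub> \<tau>) a = smMap \<tau> (smMap \<sigma> a)"
  "smDom (cid (Span U pair) f) = span_id (fnDom f)" "smCod (cid (Span U pair) f) = span_id (fnCod f)"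
  "smSrc (cid (Span U pair) f) = f" "smTgt (cid (Span U pair) f) = f" "smMap (cid (Span U pair) f) = fnMap f"
  "smDom (\<sigma> \<circledcirc>\<^bsub>Span U pair\<^esub> \<tau>) = span_cmp pair (smDom \<sigma>) (smDom \<tau>)"
  "smCod (\<sigma> \<circledcirc>\<^bsub>Span U pair\<^esub> \<tau>) = span_cmp pair (smCod \<sigma>) (smCod \<tau>)"
  "smSrc (\<sigma> \<circledcirc>\<^bsub>Span U pair\<^esub> \<tau>) = smSrc \<sigma>" "smTgt (\<sigma> \<circledcirc>\<^bsub>Span U pair\<^esub> \<tau>) = smTgt \<tau>"
  "smDom \<sigma> = m \<Longrightarrow> smDom \<tau> = n \<Longrightarrow>
    smMap (\<sigma> \<circledcirc>\<^bsub>Span U pair\<^esub> \<tau>) \<in> extensional (apex (span_cmp pair m n))"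
  by (auto simp: Span_def span_id_def)

section \<open>External composition of spans and its coherence cells\<close>

context set_universe
begin

lemma fst_of_pair [simp]: "fst_of pair (pair a b) = a"
  by (auto simp: fst_of_def pair_inject)

lemma snd_of_pair [simp]: "snd_of pair (pair a b) = b"
  by (auto simp: snd_of_def pair_inject)

lemma apex_span_cmp: "apex (span_cmp pair m n) = {pair a b |a b. a \<in> apex m \<and> b \<in> apex n \<and> legR m a = legL n b}"
  by (simp add: span_cmp_def Let_def)

lemma span_cmp_simps [simp]:
  "spSrc (span_cmp pair m n) = spSrc m" "spTgt (span_cmp pair m n) = spTgt n"
  "pair a b \<in> apex (span_cmp pair m n) \<longleftrightarrow> a \<in> apex m \<and> b \<in> apex n \<and> legR m a = legL n b"
  "(\<forall>c \<in> apex (span_cmp pair m n). Q c) \<longleftrightarrow>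
    (\<forall>a \<in> apex m. \<forall>b \<in> apex n. legR m a = legL n b \<longrightarrow> Q (pair a b))"
  "a \<in> apex m \<Longrightarrow> b \<in> apex n \<Longrightarrow> legR m a = legL n b \<Longrightarrow> legL (span_cmp pair m n) (pair a b) = legL m a"
  "a \<in> apex m \<Longrightarrow> b \<in> apex n \<Longrightarrow> legR m a = legL n b \<Longrightarrow> legR (span_cmp pair m n) (pair a b) = legR n b"
  "a \<in> apex (smDom \<sigma>) \<Longrightarrow> b \<in> apex (smDom \<tau>) \<Longrightarrow> legR (smDom \<sigma>) a = legL (smDom \<tau>) b \<Longrightarrow>
    smMap (\<sigma> \<circledcirc>\<^bsub>Span U pair\<^esub> \<tau>) (pair a b) = pair (smMap \<sigma> a) (smMap \<tau> b)"
  by (auto simp: span_cmp_def Let_def pair_inject Span_def)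

text \<open>The pullback is a subset of the product of the apexes, so closure of \<open>U\<close>
  under products and subsets places it in \<open>U\<close>.\<close>

lemma is_span_cmp [simp]:
  assumes "is_span U m" "is_span U n" "spTgt m = spSrc n" shows "is_span U (span_cmp pair m n)"
proof -
  have "apex (span_cmp pair m n) \<subseteq> {pair a b |a b. a \<in> apex m \<and> b \<in> apex n}" by (auto simp: apex_span_cmp)
  then have "apex (span_cmp pair m n) \<in> U"
    using subset_closed product_closed span_simps(3)[OF assms(1)] span_simps(3)[OF assms(2)] by blast
  moreover have "legL (span_cmp pair m n) \<in> apex (span_cmp pair m n) \<rightarrow>\<^sub>E spSrc m"
    "legR (span_cmp pair m n) \<in> apex (span_cmp pair m n) \<rightarrow>\<^sub>E spTgt n"
    using span_simps(4)[OF assms(1)] span_simps(5)[OF assms(2)] by (auto simp: span_cmp_def Let_def)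
  ultimately show ?thesis using assms by (simp add: is_span_def)
qed

lemma is_span_map_cid [simp]: "f \<in> Ar (SetCat U) \<Longrightarrow> is_span_map U (cid (Span U pair) f)"
  by (rule is_span_mapI[where m="span_id (fnDom f)" and n="span_id (fnCod f)"])
    (auto simp: PiE_def Pi_def)

lemma is_span_map_cmp [simp]:
  assumes "is_span_map U \<sigma>" "is_span_map U \<tau>" "smCod \<sigma> = smDom \<tau>"
  shows "is_span_map U (\<sigma> \<cdot>\<^bsub>D1 (Span U pair)\<^esub> \<tau>)"
proof -
  note [simp] = span_map_simps[OF assms(1), unfolded SetCat_simps] span_map_simps[OF assms(2), unfolded SetCat_simps]
    span_map_apply[OF assms(1) refl assms(3)] span_map_apply[OF assms(2) refl refl]
    span_simps(4,5)[OF span_map_simps(1)[OF assms(1)]]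
  have "spSrc (smCod \<sigma>) = spSrc (smDom \<tau>)" "spTgt (smCod \<sigma>) = spTgt (smDom \<tau>)" using assms(3) by simp_all
  note [simp] = this
  have [simp]: "fnMap (smSrc \<sigma>) a \<in> spSrc (smDom \<tau>)" if "a \<in> spSrc (smDom \<sigma>)" for a
    using span_map_simps(7)[OF assms(1)] that by (auto simp: PiE_def)
  have [simp]: "fnMap (smTgt \<sigma>) a \<in> spTgt (smDom \<tau>)" if "a \<in> spTgt (smDom \<sigma>)" for a
    using span_map_simps(8)[OF assms(1)] that by (auto simp: PiE_def)
  have [simp]: "fnMap (smSrc \<tau>) a \<in> spSrc (smCod \<tau>)" if "a \<in> spSrc (smDom \<tau>)" for a
    using span_map_simps(7)[OF assms(2)] that by (auto simp: PiE_def)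
  have [simp]: "fnMap (smTgt \<tau>) a \<in> spTgt (smCod \<tau>)" if "a \<in> spTgt (smDom \<tau>)" for a
    using span_map_simps(8)[OF assms(2)] that by (auto simp: PiE_def)
  show ?thesis
    by (rule is_span_mapI[where m="smDom \<sigma>" and n="smCod \<tau>"]) (auto simp: span_simps(1,2))
qed

lemma is_span_map_ccmp [simp]:
  assumes "is_span_map U \<sigma>" "is_span_map U \<tau>" "smTgt \<sigma> = smSrc \<tau>"
  shows "is_span_map U (\<sigma> \<circledcirc>\<^bsub>Span U pair\<^esub> \<tau>)"
proof -
  have e: "spTgt (smDom \<sigma>) = spSrc (smDom \<tau>)" "spTgt (smCod \<sigma>) = spSrc (smCod \<tau>)"
    using span_map_simps[OF assms(1)] span_map_simps[OF assms(2)] assms(3) by auto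
  show ?thesis
    by (rule is_span_mapI[where m="span_cmp pair (smDom \<sigma>) (smDom \<tau>)" and n="span_cmp pair (smCod \<sigma>) (smCod \<tau>)"])
      (use assms(3) e span_map_simps[OF assms(1)] span_map_simps[OF assms(2)]
      span_map_apply[OF assms(1) refl refl] span_map_apply[OF assms(2) refl refl] in \<open>simp_all\<close>)
qed

lemma is_span_assoc:
  assumes "is_span U m" "is_span U n" "is_span U p" "spTgt m = spSrc n" "spTgt n = spSrc p"
  shows "is_span_map U (assoc (Span U pair) m n p)" "iso_arrow (D1 (Span U pair)) (assoc (Span U pair) m n p)"
proof -
  let ?b = "span_glob U (span_cmp pair m (span_cmp pair n p)) (span_cmp pair (span_cmp pair m n) p)
    (\<lambda>c. pair (pair (fst_of pair c) (fst_of pair (snd_of pair c))) (snd_of pair (snd_of pair c)))"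
  show a: "is_span_map U (assoc (Span U pair) m n p)"
    unfolding Span_simps by (rule is_span_glob) (use assms in auto)
  have b: "is_span_map U ?b" by (rule is_span_glob) (use assms in auto)
  have "assoc (Span U pair) m n p \<cdot>\<^bsub>D1 (Span U pair)\<^esub> ?b = Ide (D1 (Span U pair)) (span_cmp pair (span_cmp pair m n) p)"
    by (rule span_map_eqI[where m="span_cmp pair (span_cmp pair m n) p"])
      (use assms span_simps[OF assms(1)] span_simps[OF assms(3)] in \<open>auto intro!: fn_eqI\<close>)
  moreover have "?b \<cdot>\<^bsub>D1 (Span U pair)\<^esub> assoc (Span U pair) m n p = Ide (D1 (Span U pair)) (span_cmp pair m (span_cmp pair n p))"
    by (rule span_map_eqI[where m="span_cmp pair m (span_cmp pair n p)"])
      (use assms span_simps[OF assms(1)] span_simps[OF assms(3)] in \<open>auto intro!: fn_eqI\<close>)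
  ultimately have "inverse_arrows (D1 (Span U pair)) (assoc (Span U pair) m n p) ?b"
    using a b by (simp add: inverse_arrows_def hom_iff)
  then show "iso_arrow (D1 (Span U pair)) (assoc (Span U pair) m n p)" by (auto simp: iso_arrow_def)
qed

text \<open>The inverse pairs an element with its left foot; no other first component is possible
  because the identity span has identity legs.\<close>

lemma is_span_lunit:
  assumes "is_span U m"
  shows "is_span_map U (lunit (Span U pair) m)"
    "inverse_arrows (D1 (Span U pair)) (lunit (Span U pair) m)
      (span_glob U m (span_cmp pair (span_id (spSrc m)) m) (\<lambda>a. pair (legL m a) a))"
proof -
  let ?b = "span_glob U m (span_cmp pair (span_id (spSrc m)) m) (\<lambda>a. pair (legL m a) a)"
  note [simp] = span_simps[OF assms]
  show a: "is_span_map U (lunit (Span U pair) m)"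
    unfolding Span_simps by (rule is_span_glob) (use assms in auto)
  have b: "is_span_map U ?b" by (rule is_span_glob) (use assms in auto)
  have "lunit (Span U pair) m \<cdot>\<^bsub>D1 (Span U pair)\<^esub> ?b = Ide (D1 (Span U pair)) (span_cmp pair (span_id (spSrc m)) m)"
    by (rule span_map_eqI[where m="span_cmp pair (span_id (spSrc m)) m"])
      (use assms in \<open>auto intro!: fn_eqI\<close>)
  moreover have "?b \<cdot>\<^bsub>D1 (Span U pair)\<^esub> lunit (Span U pair) m = Ide (D1 (Span U pair)) m"
    by (rule span_map_eqI[where m=m]) (use assms in \<open>auto intro!: fn_eqI\<close>)
  ultimately show "inverse_arrows (D1 (Span U pair)) (lunit (Span U pair) m) ?b"
    using a b by (simp add: inverse_arrows_def hom_iff)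
qed

lemma is_span_runit:
  assumes "is_span U m"
  shows "is_span_map U (runit (Span U pair) m)"
    "inverse_arrows (D1 (Span U pair)) (runit (Span U pair) m)
      (span_glob U m (span_cmp pair m (span_id (spTgt m))) (\<lambda>a. pair a (legR m a)))"
proof -
  let ?b = "span_glob U m (span_cmp pair m (span_id (spTgt m))) (\<lambda>a. pair a (legR m a))"
  note [simp] = span_simps[OF assms]
  show a: "is_span_map U (runit (Span U pair) m)"
    unfolding Span_simps by (rule is_span_glob) (use assms in auto)
  have b: "is_span_map U ?b" by (rule is_span_glob) (use assms in auto)
  have "runit (Span U pair) m \<cdot>\<^bsub>D1 (Span U pair)\<^esub> ?b = Ide (D1 (Span U pair)) (span_cmp pair m (span_id (spTgt m)))"
    by (rule span_map_eqI[where m="span_cmp pair m (span_id (spTgt m))"])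
      (use assms in \<open>auto intro!: fn_eqI\<close>)
  moreover have "?b \<cdot>\<^bsub>D1 (Span U pair)\<^esub> runit (Span U pair) m = Ide (D1 (Span U pair)) m"
    by (rule span_map_eqI[where m=m]) (use assms in \<open>auto intro!: fn_eqI\<close>)
  ultimately show "inverse_arrows (D1 (Span U pair)) (runit (Span U pair) m) ?b"
    using a b by (simp add: inverse_arrows_def hom_iff)
qed

end

section \<open>The double category of spans\<close>

context set_universe
begin

abbreviation "S \<equiv> Span U pair"

lemmas set_ide = category.ide_cmp[OF category_SetCat[of U], unfolded SetCat_simps]
  category.cmp_ide[OF category_SetCat[of U], unfolded SetCat_simps]

lemma fn_ide [simp]:
  assumes "is_span_map U \<sigma>"
  shows "spSrc (smDom \<sigma>) = X \<Longrightarrow> Ide (SetCat U) X \<cdot>\<^bsub>SetCat U\<^esub> smSrc \<sigma> = smSrc \<sigma>"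
    "spSrc (smCod \<sigma>) = X \<Longrightarrow> smSrc \<sigma> \<cdot>\<^bsub>SetCat U\<^esub> Ide (SetCat U) X = smSrc \<sigma>"
    "spTgt (smDom \<sigma>) = X \<Longrightarrow> Ide (SetCat U) X \<cdot>\<^bsub>SetCat U\<^esub> smTgt \<sigma> = smTgt \<sigma>"
    "spTgt (smCod \<sigma>) = X \<Longrightarrow> smTgt \<sigma> \<cdot>\<^bsub>SetCat U\<^esub> Ide (SetCat U) X = smTgt \<sigma>"
  using span_map_simps[OF assms] by (simp_all add: set_ide)

lemma fn_ide_ide [simp]:
  "X \<in> U \<Longrightarrow> Ide (SetCat U) X \<cdot>\<^bsub>SetCat U\<^esub> Ide (SetCat U) X = Ide (SetCat U) X"
  using category.ide_cmp[OF category_SetCat[of U], of "Ide (SetCat U) X" X] by simp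

lemma fn_cmp_assoc [simp]:
  assumes "f \<in> Ar (SetCat U)" "g \<in> Ar (SetCat U)" "h \<in> Ar (SetCat U)" "fnCod f = fnDom g" "fnCod g = fnDom h"
  shows "f \<cdot>\<^bsub>SetCat U\<^esub> g \<cdot>\<^bsub>SetCat U\<^esub> h = f \<cdot>\<^bsub>SetCat U\<^esub> (g \<cdot>\<^bsub>SetCat U\<^esub> h)"
  using category.assoc_cmp[OF category_SetCat[of U], of f g h] assms by simp

lemma category_Span: "category (D1 S)"
proof (rule category.intro, goal_cases)
  case (3 m) then show ?case by (auto simp: hom_iff intro: is_span_glob)
next
  case (5 \<sigma> m n)
  then have s: "is_span_map U \<sigma>" "smDom \<sigma> = m" by (auto simp: hom_iff)
  show ?case by (rule span_map_eqI[where m=m]) (use s span_map_simps[OF s(1)] in auto)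
next
  case (6 \<sigma> m n)
  then have s: "is_span_map U \<sigma>" "smDom \<sigma> = m" "smCod \<sigma> = n" by (auto simp: hom_iff)
  show ?case by (rule span_map_eqI[where m=m]) (use s span_map_simps[OF s(1)] span_map_apply[OF s] in auto)
next
  case (7 \<sigma> m n \<tau> p \<rho> q)
  then have s: "is_span_map U \<sigma>" "smDom \<sigma> = m" "smCod \<sigma> = n" and t: "is_span_map U \<tau>" "smDom \<tau> = n" "smCod \<tau> = p"
    and r: "is_span_map U \<rho>" "smDom \<rho> = p" by (auto simp: hom_iff)
  show ?case by (rule span_map_eqI[where m=m])
    (use s t r span_map_simps[OF s(1)] span_map_simps[OF t(1)] span_map_simps[OF r(1)] span_map_apply[OF s] in simp_all)
qed (auto simp: hom_iff span_map_simps)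

text \<open>Span maps with equal boundaries are equal once they agree on elements, and elements of
  an iterated composite are nested pairs. Every law becomes a computation with pairs on the apex of
  the span supplied to \<open>span_map_eqI\<close>.\<close>

lemma double_category_Span: "double_category S"
proof (rule double_category.intro, goal_cases)
  case 1 show ?case by (simp add: category_SetCat)
next
  case 2 show ?case by (rule category_Span)
next
  case (5 \<sigma> m n)
  then show ?case using span_map_simps[of U \<sigma>] by (auto simp: hom_iff)
next
  case (6 \<sigma> m n)
  then show ?case using span_map_simps[of U \<sigma>] by (auto simp: hom_iff)
next
  case (12 f x y)
  then have f: "f \<in> Ar (SetCat U)" "fnDom f = x" "fnCod f = y" by (simp_all add: hom_iff del: SetCat_simps(4))
  show ?case using f is_span_map_cid[OF f(1)] by (auto simp: cells_iff)
next
  case (13 x)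
  then show ?case by (intro span_map_eqI[where m="span_id x"]) auto
next
  case (14 f x y g z)
  then show ?case by (intro span_map_eqI[where m="span_id x"]) (auto simp: hom_iff PiE_def)
next
  case (16 m x y n z \<sigma> m' f g \<tau> n' h)
  then show ?case by (auto simp: cells_iff pro_iff)
next
  case (17 m x y n z)
  then have "is_span U m" "is_span U n" "spTgt m = spSrc n" by (auto simp: pro_iff)
  then show ?case by (intro span_map_eqI[where m="span_cmp pair m n"]) auto
next
  case (18 m x y n z \<sigma> m' f g \<sigma>' m'' f' g' \<tau> n' h \<tau>' n'' h')
  then have a: "is_span_map U \<sigma>" "smDom \<sigma> = m" "smCod \<sigma> = m'" and b: "is_span_map U \<sigma>'" "smDom \<sigma>' = m'"
    and c: "is_span_map U \<tau>" "smDom \<tau> = n" "smCod \<tau> = n'" and d: "is_span_map U \<tau>'" "smDom \<tau>' = n'"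
    and e: "smTgt \<sigma> = smSrc \<tau>"
    by (auto simp: cells_iff)
  show ?case
    by (rule span_map_eqI[where m="span_cmp pair m n"])
      (use a b c d e span_map_apply[OF a] span_map_apply[OF c] in simp_all)
next
  case (19 m w x n y p z)
  then have "is_span U m" "is_span U n" "is_span U p" "spTgt m = spSrc n" "spTgt n = spSrc p"
    "x = spSrc n" "y = spSrc p" "w = spSrc m" "z = spTgt p" by (auto simp: pro_iff)
  with is_span_assoc[of m n p] show ?case by (simp add: globular_def cells_iff)
next
  case (20 m x y)
  then have "is_span U m" "x = spSrc m" "y = spTgt m" by (auto simp: pro_iff)
  with is_span_lunit[of m] show ?case by (auto simp: globular_def cells_iff iso_arrow_def)
next
  case (21 m x y)
  then have "is_span U m" "x = spSrc m" "y = spTgt m" by (auto simp: pro_iff)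
  with is_span_runit[of m] show ?case by (auto simp: globular_def cells_iff iso_arrow_def)
next
  case (22 m w x n y p z \<sigma> m' f g \<tau> n' h \<rho> p' k)
  then have a: "is_span_map U \<sigma>" "smDom \<sigma> = m" "smCod \<sigma> = m'" and b: "is_span_map U \<tau>" "smDom \<tau> = n" "smCod \<tau> = n'"
    and c: "is_span_map U \<rho>" "smDom \<rho> = p" "smCod \<rho> = p'" and d: "smTgt \<sigma> = smSrc \<tau>" "smTgt \<tau> = smSrc \<rho>"
    and e: "spTgt m = spSrc n" "spTgt n = spSrc p"
    by (auto simp: cells_iff pro_iff)
  show ?case
    by (rule span_map_eqI[where m="span_cmp pair (span_cmp pair m n) p"])
      (use a b c d e span_map_apply[OF a] span_map_apply[OF b] span_map_apply[OF c] in simp_all)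
next
  case (23 m x y \<sigma> n f g)
  then have a: "is_span_map U \<sigma>" "smDom \<sigma> = m" "smCod \<sigma> = n" "f = smSrc \<sigma>" by (auto simp: cells_iff)
  note s = span_map_simps[OF a(1)]
  have l: "fnMap (smSrc \<sigma>) b \<in> spSrc n" if "b \<in> spSrc m" for b
    using s(7) that a s(3,4) by (auto simp: PiE_def)
  show ?case
    by (rule span_map_eqI[where m="span_cmp pair (span_id (spSrc m)) m"])
      (use a s span_map_apply[OF a(1-3)] l in auto)
next
  case (24 m x y \<sigma> n f g)
  then have a: "is_span_map U \<sigma>" "smDom \<sigma> = m" "smCod \<sigma> = n" "g = smTgt \<sigma>" by (auto simp: cells_iff)
  note s = span_map_simps[OF a(1)]
  have l: "fnMap (smTgt \<sigma>) b \<in> spTgt n" if "b \<in> spTgt m" for b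
    using s(8) that a s(5,6) by (auto simp: PiE_def)
  show ?case
    by (rule span_map_eqI[where m="span_cmp pair m (span_id (spTgt m))"])
      (use a s span_map_apply[OF a(1-3)] l span_simps(5) in simp_all)
next
  case (25 m v w n x p y q z)
  then have "is_span U m" "is_span U n" "is_span U p" "is_span U q" "spTgt m = spSrc n" "spTgt n = spSrc p" "spTgt p = spSrc q"
    by (auto simp: pro_iff)
  then show ?case
    by (intro span_map_eqI[where m="span_cmp pair (span_cmp pair (span_cmp pair m n) p) q"]) (simp_all add: span_simps(1,2))
next
  case (26 m x y n z)
  then have "is_span U m" "is_span U n" "spTgt m = spSrc n" "y = spSrc n"
    by (auto simp: pro_iff)
  then show ?case
    by (intro span_map_eqI[where m="span_cmp pair (span_cmp pair m (span_id y)) n"]) (simp_all add: span_simps)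
qed (auto simp: hom_iff pro_iff cells_iff span_simps span_map_simps)

lemma linv_Span: "is_span U m \<Longrightarrow> linv S m = span_glob U m (span_cmp pair (span_id (spSrc m)) m) (\<lambda>a. pair (legL m a) a)"
  by (rule category.inv_arrow_eqI[OF category_Span is_span_lunit(2)])

lemma rinv_Span: "is_span U m \<Longrightarrow> rinv S m = span_glob U m (span_cmp pair m (span_id (spTgt m))) (\<lambda>a. pair a (legR m a))"
  by (rule category.inv_arrow_eqI[OF category_Span is_span_runit(2)])

section \<open>Products of sets and of spans\<close>

definition set_prod :: "'u set \<Rightarrow> 'u set \<Rightarrow> 'u set"
  where "set_prod X Y = {pair a b |a b. a \<in> X \<and> b \<in> Y}"

lemma set_prod_simps [simp]:
  "pair a b \<in> set_prod X Y \<longleftrightarrow> a \<in> X \<and> b \<in> Y"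
  "(\<forall>c \<in> set_prod X Y. Q c) \<longleftrightarrow> (\<forall>a \<in> X. \<forall>b \<in> Y. Q (pair a b))"
  "X \<in> U \<Longrightarrow> Y \<in> U \<Longrightarrow> set_prod X Y \<in> U"
  using product_closed by (auto simp: set_prod_def pair_inject)

lemma set_prodE:
  assumes "c \<in> set_prod X Y" obtains a b where "c = pair a b" "a \<in> X" "b \<in> Y"
  using assms by (auto simp: set_prod_def)

text \<open>\<open>has_singleton\<close> promises a singleton without naming it; fixing one gives a
  terminal set.\<close>

definition point :: 'u where "point = (SOME a. {a} \<in> U)"

lemma point [simp]: "{point} \<in> U"
  unfolding point_def using has_singleton by (rule someI_ex)

definition set_prods :: "('u set, 'u fn) prods"
  where "set_prods = \<lparr>Prod = set_prod,
    Proj1 = (\<lambda>X Y. \<lparr>fnDom = set_prod X Y, fnCod = X, fnMap = restrict (fst_of pair) (set_prod X Y)\<rparr>),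
    Proj2 = (\<lambda>X Y. \<lparr>fnDom = set_prod X Y, fnCod = Y, fnMap = restrict (snd_of pair) (set_prod X Y)\<rparr>),
    One = {point}\<rparr>"

definition span_prod :: "'u span \<Rightarrow> 'u span \<Rightarrow> 'u span"
  where "span_prod m n = \<lparr>spSrc = set_prod (spSrc m) (spSrc n), spTgt = set_prod (spTgt m) (spTgt n),
    apex = set_prod (apex m) (apex n),
    legL = (\<lambda>c \<in> set_prod (apex m) (apex n). pair (legL m (fst_of pair c)) (legL n (snd_of pair c))),
    legR = (\<lambda>c \<in> set_prod (apex m) (apex n). pair (legR m (fst_of pair c)) (legR n (snd_of pair c)))\<rparr>"

definition span_prods :: "('u span, 'u span_map) prods"
  where "span_prods = \<lparr>Prod = span_prod,
    Proj1 = (\<lambda>m n. \<lparr>smDom = span_prod m n, smCod = m, smSrc = Proj1 set_prods (spSrc m) (spSrc n),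
      smTgt = Proj1 set_prods (spTgt m) (spTgt n), smMap = restrict (fst_of pair) (set_prod (apex m) (apex n))\<rparr>),
    Proj2 = (\<lambda>m n. \<lparr>smDom = span_prod m n, smCod = n, smSrc = Proj2 set_prods (spSrc m) (spSrc n),
      smTgt = Proj2 set_prods (spTgt m) (spTgt n), smMap = restrict (snd_of pair) (set_prod (apex m) (apex n))\<rparr>),
    One = span_id {point}\<rparr>"

lemma span_prod_simps [simp]:
  "spSrc (span_prod m n) = set_prod (spSrc m) (spSrc n)" "spTgt (span_prod m n) = set_prod (spTgt m) (spTgt n)"
  "apex (span_prod m n) = set_prod (apex m) (apex n)"
  "a \<in> apex m \<Longrightarrow> b \<in> apex n \<Longrightarrow> legL (span_prod m n) (pair a b) = pair (legL m a) (legL n b)"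
  "a \<in> apex m \<Longrightarrow> b \<in> apex n \<Longrightarrow> legR (span_prod m n) (pair a b) = pair (legR m a) (legR n b)"
  by (simp_all add: span_prod_def)

lemma is_span_prod [simp]: "is_span U m \<Longrightarrow> is_span U n \<Longrightarrow> is_span U (span_prod m n)"
  unfolding is_span_def by (auto simp: span_prod_def PiE_def Pi_def elim!: set_prodE)

lemma set_product:
  assumes "X \<in> U" "Y \<in> U"
  shows "is_product (SetCat U) X Y (set_prod X Y) (Proj1 set_prods X Y) (Proj2 set_prods X Y)"
proof (rule category.productI[OF category_SetCat], goal_cases)
  case (6 f g)
  then show ?case
    by (intro exI[of _ "\<lparr>fnDom = fnDom f, fnCod = set_prod X Y, fnMap = (\<lambda>a \<in> fnDom f. pair (fnMap f a) (fnMap g a))\<rparr>"])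
      (auto simp: set_prods_def assms PiE_def Pi_def intro!: fn_eqI)
next
  case (7 h k)
  show ?case
  proof (rule fn_eqI[of _ "fnDom k"])
    fix a assume a: "a \<in> fnDom k"
    then have "fnMap h a \<in> set_prod X Y" "fnMap k a \<in> set_prod X Y" using 7 by (auto simp: PiE_def Pi_def)
    moreover have "fst_of pair (fnMap h a) = fst_of pair (fnMap k a)" "snd_of pair (fnMap h a) = snd_of pair (fnMap k a)"
      using arg_cong[OF 7(6), of "\<lambda>f. fnMap f a"] arg_cong[OF 7(7), of "\<lambda>f. fnMap f a"] a 7(1-5) calculation
      by (simp_all add: set_prods_def)
    ultimately show "fnMap h a = fnMap k a" by (auto elim!: set_prodE)
  qed (use 7 in \<open>auto simp: PiE_def\<close>)
qed (use assms in \<open>auto simp: hom_iff set_prods_def elim!: set_prodE\<close>)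

lemma span_proj:
  assumes "is_span U m" "is_span U n"
  shows "is_span_map U (Proj1 span_prods m n)" "is_span_map U (Proj2 span_prods m n)"
  by (rule is_span_mapI[where m="span_prod m n" and n=m], use assms span_simps[OF assms(1)] span_simps[OF assms(2)] in
      \<open>auto simp: span_prods_def set_prods_def elim!: set_prodE\<close>)
    (rule is_span_mapI[where m="span_prod m n" and n=n], use assms span_simps[OF assms(1)] span_simps[OF assms(2)] in
      \<open>auto simp: span_prods_def set_prods_def elim!: set_prodE\<close>)

text \<open>Products of spans are formed on the apex and on both feet at once, so pairings are
  formed on all three, and the legs are built to make them compatible.\<close>

lemma span_product:
  assumes m: "is_span U m" and n: "is_span U n"
  shows "is_product (D1 S) m n (span_prod m n) (Proj1 span_prods m n) (Proj2 span_prods m n)"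
proof (rule category.productI[OF category_Span], goal_cases)
  case (6 \<sigma> \<tau>)
  then have s: "is_span_map U \<sigma>" "smCod \<sigma> = m" and t: "is_span_map U \<tau>" "smDom \<tau> = smDom \<sigma>" "smCod \<tau> = n" by auto
  define k where "k = smDom \<sigma>"
  note ss = span_map_simps[OF s(1), folded k_def, unfolded s] and tt = span_map_simps[OF t(1), unfolded t, folded k_def]
  note sa = span_map_apply[OF s(1) k_def[symmetric] s(2)] and ta = span_map_apply[OF t(1) t(2)[folded k_def] t(3)]
  let ?p = "\<lambda>f g. \<lparr>fnDom = fnDom f, fnCod = set_prod (fnCod f) (fnCod g), fnMap = (\<lambda>a \<in> fnDom f. pair (fnMap f a) (fnMap g a))\<rparr> :: 'u fn"
  let ?c = "\<lparr>smDom = k, smCod = span_prod m n, smSrc = ?p (smSrc \<sigma>) (smSrc \<tau>), smTgt = ?p (smTgt \<sigma>) (smTgt \<tau>),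
    smMap = (\<lambda>a \<in> apex k. pair (smMap \<sigma> a) (smMap \<tau> a))\<rparr>"
  have mem: "fnMap (smSrc \<sigma>) a \<in> spSrc m" "fnMap (smSrc \<tau>) a \<in> spSrc n" if "a \<in> spSrc k" for a
    using ss(3,4,7) tt(3,4,7) that by (auto simp: PiE_def)
  have mem': "fnMap (smTgt \<sigma>) a \<in> spTgt m" "fnMap (smTgt \<tau>) a \<in> spTgt n" if "a \<in> spTgt k" for a
    using ss(5,6,8) tt(5,6,8) that by (auto simp: PiE_def)
  have "is_span_map U ?c"
    by (rule is_span_mapI[where m=k and n="span_prod m n"])
      (use ss tt sa ta m n span_simps[OF ss(1)] in \<open>auto simp: mem mem'\<close>)
  moreover have "?c \<cdot>\<^bsub>D1 S\<^esub> Proj1 span_prods m n = \<sigma>"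
    by (rule span_map_eqI[where m=k])
      (use ss tt sa ta s t k_def in \<open>auto simp: span_prods_def set_prods_def mem mem' intro!: fn_eqI\<close>)
  moreover have "?c \<cdot>\<^bsub>D1 S\<^esub> Proj2 span_prods m n = \<tau>"
    by (rule span_map_eqI[where m=k])
      (use ss tt sa ta s t k_def in \<open>auto simp: span_prods_def set_prods_def mem mem' intro!: fn_eqI\<close>)
  ultimately show ?case by (intro exI[of _ ?c]) (simp add: k_def)
next
  case (7 h k)
  then have h: "is_span_map U h" "smDom h = smDom k" "smCod h = span_prod m n"
    and k: "is_span_map U k" "smCod k = span_prod m n" by auto
  have p: "is_product (SetCat U) (spSrc m) (spSrc n) (set_prod (spSrc m) (spSrc n)) (Proj1 set_prods (spSrc m) (spSrc n)) (Proj2 set_prods (spSrc m) (spSrc n))"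
    "is_product (SetCat U) (spTgt m) (spTgt n) (set_prod (spTgt m) (spTgt n)) (Proj1 set_prods (spTgt m) (spTgt n)) (Proj2 set_prods (spTgt m) (spTgt n))"
    using span_simps[OF m] span_simps[OF n] by (auto intro: set_product)
  \<comment> \<open>On the feet, equality of \<open>h\<close> and \<open>k\<close> follows from the
    product property of sets; on the apex both components of a pair are compared.\<close>
  have e: "smSrc h \<cdot>\<^bsub>SetCat U\<^esub> Proj1 set_prods (spSrc m) (spSrc n) = smSrc k \<cdot>\<^bsub>SetCat U\<^esub> Proj1 set_prods (spSrc m) (spSrc n)"
    "smTgt h \<cdot>\<^bsub>SetCat U\<^esub> Proj1 set_prods (spTgt m) (spTgt n) = smTgt k \<cdot>\<^bsub>SetCat U\<^esub> Proj1 set_prods (spTgt m) (spTgt n)"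
    "smSrc h \<cdot>\<^bsub>SetCat U\<^esub> Proj2 set_prods (spSrc m) (spSrc n) = smSrc k \<cdot>\<^bsub>SetCat U\<^esub> Proj2 set_prods (spSrc m) (spSrc n)"
    "smTgt h \<cdot>\<^bsub>SetCat U\<^esub> Proj2 set_prods (spTgt m) (spTgt n) = smTgt k \<cdot>\<^bsub>SetCat U\<^esub> Proj2 set_prods (spTgt m) (spTgt n)"
    using arg_cong[OF 7(6), of smSrc] arg_cong[OF 7(7), of smSrc] arg_cong[OF 7(6), of smTgt] arg_cong[OF 7(7), of smTgt]
    by (simp_all add: span_prods_def)
  show ?case
  proof (rule span_map_eqI[where m="smDom k"])
    show "smSrc h = smSrc k"
      by (rule category.product_eqI[OF category_SetCat p(1) span_map_simps(7)[OF h(1)] _ span_map_simps(7)[OF k(1)] _ _ e(1,3)])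
        (simp_all add: span_map_simps(3,4)[OF h(1)] span_map_simps(3,4)[OF k(1)] h(2,3) k(2))
    show "smTgt h = smTgt k"
      by (rule category.product_eqI[OF category_SetCat p(2) span_map_simps(8)[OF h(1)] _ span_map_simps(8)[OF k(1)] _ _ e(2,4)])
        (simp_all add: span_map_simps(5,6)[OF h(1)] span_map_simps(5,6)[OF k(1)] h(2,3) k(2))
    show "\<forall>a \<in> apex (smDom k). smMap h a = smMap k a"
    proof
      fix a assume a: "a \<in> apex (smDom k)"
      then have c: "smMap h a \<in> set_prod (apex m) (apex n)" "smMap k a \<in> set_prod (apex m) (apex n)"
        using span_map_apply(1)[OF h a] span_map_apply(1)[OF k(1) refl k(2) a] by simp_all
      have "fst_of pair (smMap h a) = fst_of pair (smMap k a)" "snd_of pair (smMap h a) = snd_of pair (smMap k a)"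
        using arg_cong[OF 7(6), of "\<lambda>f. smMap f a"] arg_cong[OF 7(7), of "\<lambda>f. smMap f a"] a c h(2)
        by (simp_all add: span_prods_def)
      with c show "smMap h a = smMap k a" by (auto elim!: set_prodE)
    qed
  qed (use h k span_map_simps[OF h(1)] span_map_simps[OF k(1)] in auto)
qed (use assms span_proj[OF m n] in \<open>auto simp: hom_iff\<close>, auto simp: span_prods_def)

lemma set_terminal: "is_terminal (SetCat U) {point}"
proof (rule category.is_terminalI[OF category_SetCat], goal_cases)
  case (2 w)
  then show ?case by (intro exI[of _ "\<lparr>fnDom = w, fnCod = {point}, fnMap = (\<lambda>a \<in> w. point)\<rparr>"]) auto
next
  case (3 h k)
  then show ?case by (intro fn_eqI[of _ "fnDom k"]) (auto simp: PiE_def Pi_def)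
qed simp

lemma span_terminal: "is_terminal (D1 S) (span_id {point})"
proof (rule category.is_terminalI[OF category_Span], goal_cases)
  case (2 w)
  let ?f = "\<lambda>X. \<lparr>fnDom = X, fnCod = {point}, fnMap = (\<lambda>a \<in> X. point)\<rparr> :: 'u fn"
  have w: "is_span U w" using 2 by simp
  have "is_span_map U \<lparr>smDom = w, smCod = span_id {point}, smSrc = ?f (spSrc w), smTgt = ?f (spTgt w), smMap = (\<lambda>a \<in> apex w. point)\<rparr>"
    by (rule is_span_mapI[where m=w and n="span_id {point}"]) (use w span_simps[OF w] in auto)
  then show ?case by (intro exI) auto
next
  case (3 h k)
  then have h: "is_span_map U h" "smCod h = span_id {point}" and k: "is_span_map U k" "smCod k = span_id {point}" and e: "smDom h = smDom k" by auto
  show ?case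
  proof (rule span_map_eqI[where m="smDom k"])
    show "smSrc h = smSrc k" "smTgt h = smTgt k"
      by (rule category.terminal_eqI[OF category_SetCat set_terminal];
          use span_map_simps[OF h(1)] span_map_simps[OF k(1)] h k e in simp)+
    show "\<forall>a \<in> apex (smDom k). smMap h a = smMap k a"
      using span_map_apply(1)[OF h(1) e h(2)] span_map_apply(1)[OF k(1) refl k(2)] by auto
  qed (use h k e span_map_simps[OF h(1)] span_map_simps[OF k(1)] in auto)
qed simp

theorem parallel_products_Span: "double_category.parallel_products S set_prods span_prods"
  unfolding double_category.parallel_products_def[OF double_category_Span]
  using set_product span_product set_terminal span_terminal
  by (auto simp: chosen_products_def, auto simp: set_prods_def span_prods_def)

end

section \<open>Small categories as category objects in spans\<close>

context set_universe
begin

interpretation Sp: double_category S by (rule double_category_Span)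

text \<open>\<open>small_category\<close> requires composition to be \<open>undefined\<close> on
  pairs that do not compose, hence the case distinction.\<close>

definition cat_of :: "('u set, 'u span, 'u span_map) cat_ob \<Rightarrow> ('u, 'u) cat"
  where "cat_of X = \<lparr>Ob = base X, Ar = apex (loop X), Dom = legL (loop X), Cod = legR (loop X),
    Ide = smMap (unit X),
    Cmp = (\<lambda>f g. if f \<in> apex (loop X) \<and> g \<in> apex (loop X) \<and> legR (loop X) f = legL (loop X) g
      then smMap (mult X) (pair f g) else undefined)\<rparr>"

definition loop_of :: "('u, 'u) cat \<Rightarrow> 'u span"
  where "loop_of C = \<lparr>spSrc = Ob C, spTgt = Ob C, apex = Ar C, legL = Dom C, legR = Cod C\<rparr>"

definition cob_of :: "('u, 'u) cat \<Rightarrow> ('u set, 'u span, 'u span_map) cat_ob"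
  where "cob_of C = \<lparr>base = Ob C, loop = loop_of C,
    mult = span_glob U (span_cmp pair (loop_of C) (loop_of C)) (loop_of C) (\<lambda>c. Cmp C (fst_of pair c) (snd_of pair c)),
    unit = span_glob U (span_id (Ob C)) (loop_of C) (Ide C)\<rparr>"

definition functor_of :: "('u set, 'u fn, 'u span, 'u span_map) cat_ob_fun \<Rightarrow> 'u small_functor"
  where "functor_of H = \<lparr>sfDom = cat_of (fsrc H), sfCod = cat_of (ftgt H),
    sfFun = \<lparr>onOb = fnMap (farr H), onAr = smMap (fcell H)\<rparr>\<rparr>"

definition cfun_of :: "'u small_functor \<Rightarrow> ('u set, 'u fn, 'u span, 'u span_map) cat_ob_fun"
  where "cfun_of F =
    (let f = \<lparr>fnDom = Ob (sfDom F), fnCod = Ob (sfCod F), fnMap = onOb (sfFun F)\<rparr>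
     in \<lparr>fsrc = cob_of (sfDom F), ftgt = cob_of (sfCod F), farr = f,
       fcell = \<lparr>smDom = loop_of (sfDom F), smCod = loop_of (sfCod F), smSrc = f, smTgt = f, smMap = onAr (sfFun F)\<rparr>\<rparr>)"

definition nat_of :: "('u set, 'u fn, 'u span, 'u span_map) cat_ob_trans \<Rightarrow> 'u small_nat"
  where "nat_of s = \<lparr>snDom = functor_of (xsrc s), snCod = functor_of (xtgt s), snMap = smMap (xcell s)\<rparr>"

definition ctrans_of :: "'u small_nat \<Rightarrow> ('u set, 'u fn, 'u span, 'u span_map) cat_ob_trans"
  where "ctrans_of s = \<lparr>xsrc = cfun_of (snDom s), xtgt = cfun_of (snCod s),
    xcell = \<lparr>smDom = span_id (Ob (sfDom (snDom s))), smCod = loop_of (sfCod (snDom s)),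
      smSrc = farr (cfun_of (snDom s)), smTgt = farr (cfun_of (snCod s)), smMap = snMap s\<rparr>\<rparr>"

lemma cat_of_simps [simp]:
  "Ob (cat_of X) = base X" "Ar (cat_of X) = apex (loop X)" "Dom (cat_of X) = legL (loop X)"
  "Cod (cat_of X) = legR (loop X)" "Ide (cat_of X) = smMap (unit X)"
  "f \<in> apex (loop X) \<Longrightarrow> g \<in> apex (loop X) \<Longrightarrow> legR (loop X) f = legL (loop X) g \<Longrightarrow>
    Cmp (cat_of X) f g = smMap (mult X) (pair f g)"
  by (simp_all add: cat_of_def)

lemma loop_of_simps [simp]:
  "spSrc (loop_of C) = Ob C" "spTgt (loop_of C) = Ob C" "apex (loop_of C) = Ar C" "legL (loop_of C) = Dom C"
  "legR (loop_of C) = Cod C"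
  by (simp_all add: loop_of_def)

lemma cob_of_simps [simp]: "base (cob_of C) = Ob C" "loop (cob_of C) = loop_of C"
  by (simp_all add: cob_of_def)

lemma functor_of_simps [simp]:
  "sfDom (functor_of H) = cat_of (fsrc H)" "sfCod (functor_of H) = cat_of (ftgt H)"
  "onOb (sfFun (functor_of H)) = fnMap (farr H)" "onAr (sfFun (functor_of H)) = smMap (fcell H)"
  by (simp_all add: functor_of_def)

lemma cfun_of_simps [simp]:
  "fsrc (cfun_of F) = cob_of (sfDom F)" "ftgt (cfun_of F) = cob_of (sfCod F)"
  "fnDom (farr (cfun_of F)) = Ob (sfDom F)" "fnCod (farr (cfun_of F)) = Ob (sfCod F)"
  "fnMap (farr (cfun_of F)) = onOb (sfFun F)"
  "smDom (fcell (cfun_of F)) = loop_of (sfDom F)" "smCod (fcell (cfun_of F)) = loop_of (sfCod F)"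
  "smSrc (fcell (cfun_of F)) = farr (cfun_of F)" "smTgt (fcell (cfun_of F)) = farr (cfun_of F)"
  "smMap (fcell (cfun_of F)) = onAr (sfFun F)"
  by (simp_all add: cfun_of_def Let_def)

lemma nat_of_simps [simp]:
  "snDom (nat_of s) = functor_of (xsrc s)" "snCod (nat_of s) = functor_of (xtgt s)" "snMap (nat_of s) = smMap (xcell s)"
  by (simp_all add: nat_of_def)

lemma ctrans_of_simps [simp]:
  "xsrc (ctrans_of s) = cfun_of (snDom s)" "xtgt (ctrans_of s) = cfun_of (snCod s)"
  "smDom (xcell (ctrans_of s)) = span_id (Ob (sfDom (snDom s)))" "smCod (xcell (ctrans_of s)) = loop_of (sfCod (snDom s))"
  "smSrc (xcell (ctrans_of s)) = farr (cfun_of (snDom s))" "smTgt (xcell (ctrans_of s)) = farr (cfun_of (snCod s))"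
  "smMap (xcell (ctrans_of s)) = snMap s"
  by (simp_all add: ctrans_of_def)

lemma cobj_parts:
  assumes "Sp.cobj X"
  shows "base X \<in> U" "is_span U (loop X)" "spSrc (loop X) = base X" "spTgt (loop X) = base X"
    "is_span_map U (mult X)" "smDom (mult X) = span_cmp pair (loop X) (loop X)" "smCod (mult X) = loop X"
    "smSrc (mult X) = Ide (SetCat U) (base X)" "smTgt (mult X) = Ide (SetCat U) (base X)"
    "is_span_map U (unit X)" "smDom (unit X) = span_id (base X)" "smCod (unit X) = loop X"
    "smSrc (unit X) = Ide (SetCat U) (base X)" "smTgt (unit X) = Ide (SetCat U) (base X)"
    "apex (loop X) \<in> U"
    "f \<in> apex (loop X) \<Longrightarrow> legL (loop X) f \<in> base X" "f \<in> apex (loop X) \<Longrightarrow> legR (loop X) f \<in> base X"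
    "legL (loop X) \<in> extensional (apex (loop X))" "legR (loop X) \<in> extensional (apex (loop X))"
proof -
  show *: "base X \<in> U" "is_span U (loop X)" "spSrc (loop X) = base X" "spTgt (loop X) = base X"
    "is_span_map U (mult X)" "smDom (mult X) = span_cmp pair (loop X) (loop X)" "smCod (mult X) = loop X"
    "smSrc (mult X) = Ide (SetCat U) (base X)" "smTgt (mult X) = Ide (SetCat U) (base X)"
    "is_span_map U (unit X)" "smDom (unit X) = span_id (base X)" "smCod (unit X) = loop X"
    "smSrc (unit X) = Ide (SetCat U) (base X)" "smTgt (unit X) = Ide (SetCat U) (base X)"
    using Sp.cobj_simps[OF assms] by simp_all
  show "apex (loop X) \<in> U"
    "f \<in> apex (loop X) \<Longrightarrow> legL (loop X) f \<in> base X" "f \<in> apex (loop X) \<Longrightarrow> legR (loop X) f \<in> base X"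
    "legL (loop X) \<in> extensional (apex (loop X))" "legR (loop X) \<in> extensional (apex (loop X))"
    using span_simps[OF *(2)] * by simp_all
qed

lemma mult_apply:
  assumes X: "Sp.cobj X" and f: "f \<in> apex (loop X)" "g \<in> apex (loop X)" "legR (loop X) f = legL (loop X) g"
  shows "smMap (mult X) (pair f g) \<in> apex (loop X)" "legL (loop X) (smMap (mult X) (pair f g)) = legL (loop X) f"
    "legR (loop X) (smMap (mult X) (pair f g)) = legR (loop X) g"
  using span_map_apply[OF cobj_parts(5-7)[OF X], of "pair f g"] f cobj_parts[OF X] by auto

lemma unit_apply:
  assumes X: "Sp.cobj X" and x: "x \<in> base X"
  shows "smMap (unit X) x \<in> apex (loop X)" "legL (loop X) (smMap (unit X) x) = x" "legR (loop X) (smMap (unit X) x) = x"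
  using span_map_apply[OF cobj_parts(10-12)[OF X], of x] x cobj_parts[OF X] by auto

text \<open>The inverse left unitor sends \<open>z\<close> to the pair of its left foot and itself,
  so the action composes the arrow chosen by \<open>\<sigma>\<close> at that foot with the arrow
  that \<open>a\<close> assigns to \<open>z\<close>.\<close>

lemma lact_apply:
  assumes Y: "Sp.cobj Y" and s: "is_span_map U \<sigma>" "smDom \<sigma> = span_id (spSrc m)" "smCod \<sigma> = loop Y"
    and a: "is_span_map U a" "smDom a = m" "smCod a = loop Y" and st: "smTgt \<sigma> = smSrc a" and z: "z \<in> apex m"
  shows "smMap (lact S Y \<sigma> a) z = smMap (mult Y) (pair (smMap \<sigma> (legL m z)) (smMap a z))"
proof -
  have m: "is_span U m" using span_map_simps(1)[OF a(1)] a by simp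
  note [simp] = cobj_parts[OF Y] s a m st z span_simps(4)[OF m z] span_simps(1)[OF m] linv_Span[OF m]
  show ?thesis by (simp add: lact_def join_def del: Span_simps(14))
qed

lemma ract_apply:
  assumes Y: "Sp.cobj Y" and s: "is_span_map U \<sigma>" "smDom \<sigma> = span_id (spTgt m)" "smCod \<sigma> = loop Y"
    and a: "is_span_map U a" "smDom a = m" "smCod a = loop Y" and st: "smTgt a = smSrc \<sigma>" and z: "z \<in> apex m"
  shows "smMap (ract S Y a \<sigma>) z = smMap (mult Y) (pair (smMap a z) (smMap \<sigma> (legR m z)))"
proof -
  have m: "is_span U m" using span_map_simps(1)[OF a(1)] a by simp
  note [simp] = cobj_parts[OF Y] s a m st z span_simps(5)[OF m z] span_simps(2)[OF m] rinv_Span[OF m]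
  show ?thesis by (simp add: ract_def join_def del: Span_simps(15))
qed

text \<open>The laws of a category object are equations of span maps; evaluated at pairs of
  composable arrows, and at nested pairs for associativity, they are the laws of a category.\<close>

lemma small_category_cat_of:
  assumes X: "Sp.cobj X" shows "small_category U (cat_of X)"
proof -
  note p = cobj_parts[OF X]
  have "category (cat_of X)"
  proof (rule category.intro, goal_cases)
    case (5 f x y)
    then show ?case
      using arg_cong[OF category_object.unit_left[OF X], of "\<lambda>\<sigma>. smMap \<sigma> (pair x f)"] p unit_apply[OF X, of x]
      by (auto simp: hom_iff)
  next
    case (6 f x y)
    then show ?case
      using arg_cong[OF category_object.unit_right[OF X], of "\<lambda>\<sigma>. smMap \<sigma> (pair f y)"] p unit_apply[OF X, of y]
      by (auto simp: hom_iff)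
  next
    case (7 f w x g y h z)
    then show ?case
      using arg_cong[OF category_object.mult_assoc[OF X], of "\<lambda>\<sigma>. smMap \<sigma> (pair (pair f g) h)"] p
        mult_apply[OF X, of f g] mult_apply[OF X, of g h]
      by (auto simp: hom_iff)
  qed (use p in \<open>auto simp: hom_iff mult_apply[OF X] unit_apply[OF X]\<close>)
  moreover have "smMap (unit X) \<in> extensional (base X)" using span_map_simps(9)[OF p(10)] p by simp
  ultimately show ?thesis using p by (auto simp: small_category_def) (auto simp: cat_of_def)
qed

lemma is_span_loop_of:
  assumes C: "small_category U C" shows "is_span U (loop_of C)"
proof -
  interpret category C using C by (simp add: small_category_def)
  show ?thesis using C by (auto simp: is_span_def small_category_def PiE_def)
qed

lemma cobj_cob_of:
  assumes C: "small_category U C" shows "Sp.cobj (cob_of C)"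
proof -
  interpret category C using C by (simp add: small_category_def)
  note [simp] = is_span_loop_of[OF C]
  have [simp]: "Ob C \<in> U" using C by (simp add: small_category_def)
  have m: "is_span_map U (mult (cob_of C))" "is_span_map U (unit (cob_of C))"
    unfolding cob_of_def cat_ob.simps by (rule is_span_glob; simp)+
  show ?thesis
  proof (rule category_object.intro, goal_cases)
    case 5
    show ?case by (rule span_map_eqI[where m="span_cmp pair (span_cmp pair (loop_of C) (loop_of C)) (loop_of C)"])
      (auto simp: cob_of_def intro!: fn_eqI)
  next
    case 6
    show ?case by (rule span_map_eqI[where m="span_cmp pair (span_id (Ob C)) (loop_of C)"])
      (auto simp: cob_of_def intro!: fn_eqI)
  next
    case 7
    show ?case by (rule span_map_eqI[where m="span_cmp pair (loop_of C) (span_id (Ob C))"])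
      (auto simp: cob_of_def intro!: fn_eqI)
  qed (use m in \<open>auto simp: globular_def cells_iff pro_iff\<close>, auto simp: cob_of_def)
qed

lemma cat_of_cob_of:
  assumes C: "small_category U C" shows "cat_of (cob_of C) = C"
proof (rule cat.equality)
  show "Ide (cat_of (cob_of C)) = Ide C"
    using C by (auto simp: cob_of_def span_glob_def small_category_def intro!: restrict_eqI)
  show "Cmp (cat_of (cob_of C)) = Cmp C"
    using C by (auto simp: cat_of_def cob_of_def small_category_def fun_eq_iff)
qed simp_all

lemma cob_of_cat_of:
  assumes X: "Sp.cobj X" shows "cob_of (cat_of X) = X"
proof -
  note p = cobj_parts[OF X]
  have l: "loop_of (cat_of X) = loop X" using p by (auto intro!: span.equality)
  show ?thesis
  proof (rule cat_ob.equality)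
    show "mult (cob_of (cat_of X)) = mult X"
      by (rule span_map_eqI[where m="span_cmp pair (loop X) (loop X)"])
        (use p span_map_simps(9)[OF p(5)] in \<open>simp_all add: cob_of_def l\<close>)
    show "unit (cob_of (cat_of X)) = unit X"
      by (rule span_map_eqI[where m="span_id (base X)"])
        (use p span_map_simps(9)[OF p(10)] in \<open>simp_all add: cob_of_def l\<close>)
  qed (simp_all add: l)
qed

section \<open>Functors between small categories\<close>

lemma cfun_parts:
  assumes "Sp.cfun H"
  shows "Sp.cobj (fsrc H)" "Sp.cobj (ftgt H)" "fnDom (farr H) = base (fsrc H)" "fnCod (farr H) = base (ftgt H)"
    "is_span_map U (fcell H)" "smDom (fcell H) = loop (fsrc H)" "smCod (fcell H) = loop (ftgt H)"
    "smSrc (fcell H) = farr H" "smTgt (fcell H) = farr H"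
    "fnMap (farr H) \<in> extensional (base (fsrc H))" "smMap (fcell H) \<in> extensional (apex (loop (fsrc H)))"
    "x \<in> base (fsrc H) \<Longrightarrow> fnMap (farr H) x \<in> base (ftgt H)"
    "f \<in> apex (loop (fsrc H)) \<Longrightarrow> smMap (fcell H) f \<in> apex (loop (ftgt H))"
    "f \<in> apex (loop (fsrc H)) \<Longrightarrow> legL (loop (ftgt H)) (smMap (fcell H) f) = fnMap (farr H) (legL (loop (fsrc H)) f)"
    "f \<in> apex (loop (fsrc H)) \<Longrightarrow> legR (loop (ftgt H)) (smMap (fcell H) f) = fnMap (farr H) (legR (loop (fsrc H)) f)"
proof -
  show *: "Sp.cobj (fsrc H)" "Sp.cobj (ftgt H)" "fnDom (farr H) = base (fsrc H)" "fnCod (farr H) = base (ftgt H)"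
    "is_span_map U (fcell H)" "smDom (fcell H) = loop (fsrc H)" "smCod (fcell H) = loop (ftgt H)"
    "smSrc (fcell H) = farr H" "smTgt (fcell H) = farr H"
    using Sp.cfun_simps[OF assms] by simp_all
  have "farr H \<in> Ar (SetCat U)" using Sp.cfun_simps(3)[OF assms] unfolding Span_simps .
  then show "fnMap (farr H) \<in> extensional (base (fsrc H))" "x \<in> base (fsrc H) \<Longrightarrow> fnMap (farr H) x \<in> base (ftgt H)"
    using * by (auto simp: PiE_def Pi_def)
  show "smMap (fcell H) \<in> extensional (apex (loop (fsrc H)))"
    "f \<in> apex (loop (fsrc H)) \<Longrightarrow> smMap (fcell H) f \<in> apex (loop (ftgt H))"
    "f \<in> apex (loop (fsrc H)) \<Longrightarrow> legL (loop (ftgt H)) (smMap (fcell H) f) = fnMap (farr H) (legL (loop (fsrc H)) f)"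
    "f \<in> apex (loop (fsrc H)) \<Longrightarrow> legR (loop (ftgt H)) (smMap (fcell H) f) = fnMap (farr H) (legR (loop (fsrc H)) f)"
    using span_map_simps(9)[OF *(5)] span_map_apply[OF *(5-7), of f] * by simp_all
qed

lemma is_small_functor_of:
  assumes H: "Sp.cfun H" shows "is_small_functor U (functor_of H)"
proof -
  note p = cfun_parts[OF H]
  have "cat_functor (cat_of (fsrc H)) (cat_of (ftgt H)) (sfFun (functor_of H))"
  proof (rule cat_functor.intro, goal_cases)
    case (5 x)
    then show ?case
      using arg_cong[OF Sp.cfun_unit[OF H], of "\<lambda>\<sigma>. smMap \<sigma> x"] p cobj_parts[OF p(1)] by simp
  next
    case (6 f x y g z)
    then show ?case
      using arg_cong[OF Sp.cfun_mult[OF H], of "\<lambda>\<sigma>. smMap \<sigma> (pair f g)"] p cobj_parts[OF p(1)]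
      by (simp add: hom_iff)
  qed (use p in \<open>auto simp: hom_iff\<close>)
  then show ?thesis using p by (simp add: is_small_functor_def small_category_cat_of)
qed

lemma small_functor_parts:
  assumes "is_small_functor U F"
  shows "small_category U (sfDom F)" "small_category U (sfCod F)" "category (sfDom F)" "category (sfCod F)"
    "cat_functor (sfDom F) (sfCod F) (sfFun F)"
    "onOb (sfFun F) \<in> extensional (Ob (sfDom F))" "onAr (sfFun F) \<in> extensional (Ar (sfDom F))"
    "x \<in> Ob (sfDom F) \<Longrightarrow> onOb (sfFun F) x \<in> Ob (sfCod F)"
    "f \<in> Ar (sfDom F) \<Longrightarrow> onAr (sfFun F) f \<in> Ar (sfCod F)"
    "f \<in> Ar (sfDom F) \<Longrightarrow> Dom (sfCod F) (onAr (sfFun F) f) = onOb (sfFun F) (Dom (sfDom F) f)"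
    "f \<in> Ar (sfDom F) \<Longrightarrow> Cod (sfCod F) (onAr (sfFun F) f) = onOb (sfFun F) (Cod (sfDom F) f)"
proof -
  show s: "small_category U (sfDom F)" "small_category U (sfCod F)" "cat_functor (sfDom F) (sfCod F) (sfFun F)"
    using assms by (simp_all add: is_small_functor_def)
  then show "category (sfDom F)" "category (sfCod F)" by (simp_all add: small_category_def)
  interpret cat_functor "sfDom F" "sfCod F" "sfFun F" by (rule s)
  show "onOb (sfFun F) \<in> extensional (Ob (sfDom F))" "onAr (sfFun F) \<in> extensional (Ar (sfDom F))"
    "x \<in> Ob (sfDom F) \<Longrightarrow> onOb (sfFun F) x \<in> Ob (sfCod F)"
    "f \<in> Ar (sfDom F) \<Longrightarrow> onAr (sfFun F) f \<in> Ar (sfCod F)"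
    "f \<in> Ar (sfDom F) \<Longrightarrow> Dom (sfCod F) (onAr (sfFun F) f) = onOb (sfFun F) (Dom (sfDom F) f)"
    "f \<in> Ar (sfDom F) \<Longrightarrow> Cod (sfCod F) (onAr (sfFun F) f) = onOb (sfFun F) (Cod (sfDom F) f)"
    by (auto simp: ob_ext ar_ext ob_in)
qed

lemma cfun_cfun_of:
  assumes F: "is_small_functor U F" shows "Sp.cfun (cfun_of F)"
proof -
  note p = small_functor_parts[OF F]
  interpret C: category "sfDom F" by (rule p)
  interpret D: category "sfCod F" by (rule p)
  interpret cat_functor "sfDom F" "sfCod F" "sfFun F" by (rule p)
  have u: "Ob (sfDom F) \<in> U" "Ob (sfCod F) \<in> U" using p(1,2) by (simp_all add: small_category_def)
  have f: "farr (cfun_of F) \<in> Ar (SetCat U)" using p u by (auto simp: PiE_def)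
  note [simp] = is_span_loop_of[OF p(1)] is_span_loop_of[OF p(2)]
  have c: "is_span_map U (fcell (cfun_of F))"
    by (rule is_span_mapI[where m="loop_of (sfDom F)" and n="loop_of (sfCod F)"]) (use p u f in auto)
  have 1: "fcell (cfun_of F) \<circledcirc>\<^bsub>S\<^esub> fcell (cfun_of F) \<cdot>\<^bsub>D1 S\<^esub> mult (ftgt (cfun_of F)) =
    mult (fsrc (cfun_of F)) \<cdot>\<^bsub>D1 S\<^esub> fcell (cfun_of F)"
    by (rule span_map_eqI[where m="span_cmp pair (loop_of (sfDom F)) (loop_of (sfDom F))"])
      (use p u f in \<open>auto simp: cob_of_def cmp_image PiE_def intro!: fn_eqI\<close>)
  have 2: "cid S (farr (cfun_of F)) \<cdot>\<^bsub>D1 S\<^esub> unit (ftgt (cfun_of F)) = unit (fsrc (cfun_of F)) \<cdot>\<^bsub>D1 S\<^esub> fcell (cfun_of F)"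
    by (rule span_map_eqI[where m="span_id (Ob (sfDom F))"])
      (use p u f in \<open>auto simp: cob_of_def pres_ide PiE_def intro!: fn_eqI\<close>)
  show ?thesis
    by (rule Sp.cfunI) (use p f c 1 2 in \<open>simp_all add: cobj_cob_of\<close>)
qed

lemma functor_of_cfun_of:
  assumes "is_small_functor U F" shows "functor_of (cfun_of F) = F"
  using small_functor_parts[OF assms]
  by (intro small_functor.equality fctr.equality) (simp_all add: cat_of_cob_of)

lemma loop_of_cat_of: "Sp.cobj X \<Longrightarrow> loop_of (cat_of X) = loop X"
  using arg_cong[OF cob_of_cat_of, of X loop] by simp

lemma cfun_of_functor_of:
  assumes "Sp.cfun H" shows "cfun_of (functor_of H) = H"
proof -
  note p = cfun_parts[OF assms]
  have f: "farr (cfun_of (functor_of H)) = farr H" using p by (intro fn.equality) auto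
  then show ?thesis using p
    by (intro cat_ob_fun.equality span_map.equality) (simp_all add: cob_of_cat_of loop_of_cat_of)
qed

section \<open>Natural transformations\<close>

lemma ctrans_parts:
  assumes s: "Sp.ctrans s"
  shows "Sp.cfun (xsrc s)" "Sp.cfun (xtgt s)" "fsrc (xtgt s) = fsrc (xsrc s)" "ftgt (xtgt s) = ftgt (xsrc s)"
    "is_span_map U (xcell s)" "smDom (xcell s) = span_id (base (fsrc (xsrc s)))" "smCod (xcell s) = loop (ftgt (xsrc s))"
    "smSrc (xcell s) = farr (xsrc s)" "smTgt (xcell s) = farr (xtgt s)"
    "smMap (xcell s) \<in> extensional (base (fsrc (xsrc s)))"
    "x \<in> base (fsrc (xsrc s)) \<Longrightarrow> smMap (xcell s) x \<in> apex (loop (ftgt (xsrc s)))"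
    "x \<in> base (fsrc (xsrc s)) \<Longrightarrow> legL (loop (ftgt (xsrc s))) (smMap (xcell s) x) = fnMap (farr (xsrc s)) x"
    "x \<in> base (fsrc (xsrc s)) \<Longrightarrow> legR (loop (ftgt (xsrc s))) (smMap (xcell s) x) = fnMap (farr (xtgt s)) x"
proof -
  show *: "Sp.cfun (xsrc s)" "Sp.cfun (xtgt s)" "fsrc (xtgt s) = fsrc (xsrc s)" "ftgt (xtgt s) = ftgt (xsrc s)"
    "is_span_map U (xcell s)" "smDom (xcell s) = span_id (base (fsrc (xsrc s)))" "smCod (xcell s) = loop (ftgt (xsrc s))"
    "smSrc (xcell s) = farr (xsrc s)" "smTgt (xcell s) = farr (xtgt s)"
    using Sp.ctransD[OF s] by simp_all
  show "smMap (xcell s) \<in> extensional (base (fsrc (xsrc s)))"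
    "x \<in> base (fsrc (xsrc s)) \<Longrightarrow> smMap (xcell s) x \<in> apex (loop (ftgt (xsrc s)))"
    "x \<in> base (fsrc (xsrc s)) \<Longrightarrow> legL (loop (ftgt (xsrc s))) (smMap (xcell s) x) = fnMap (farr (xsrc s)) x"
    "x \<in> base (fsrc (xsrc s)) \<Longrightarrow> legR (loop (ftgt (xsrc s))) (smMap (xcell s) x) = fnMap (farr (xtgt s)) x"
    using span_map_simps(9)[OF *(5)] span_map_apply[OF *(5-7), of x] * by simp_all
qed

text \<open>The induced cell sends an arrow \<open>f\<close> to the diagonal of its naturality
  square; the two actions compute this diagonal along the two sides.\<close>

lemma loop_apply:
  assumes s: "Sp.ctrans s" and f: "f \<in> apex (loop (fsrc (xsrc s)))"
  shows "smMap (cat_ob_trans_loop S s) f =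
      smMap (mult (ftgt (xsrc s))) (pair (smMap (xcell s) (legL (loop (fsrc (xsrc s))) f)) (smMap (fcell (xtgt s)) f))"
    "smMap (cat_ob_trans_loop S s) f =
      smMap (mult (ftgt (xsrc s))) (pair (smMap (fcell (xsrc s)) f) (smMap (xcell s) (legR (loop (fsrc (xsrc s))) f)))"
proof -
  note p = ctrans_parts[OF s] and q = cfun_parts[OF ctrans_parts(1)[OF s]] and r = cfun_parts[OF ctrans_parts(2)[OF s]]
  show "smMap (cat_ob_trans_loop S s) f =
      smMap (mult (ftgt (xsrc s))) (pair (smMap (xcell s) (legL (loop (fsrc (xsrc s))) f)) (smMap (fcell (xtgt s)) f))"
    unfolding Sp.ctrans_loop(1)[OF s]
    by (rule lact_apply) (use p(3-9) q(1-9) r(1-9) f cobj_parts[OF q(1)] in simp_all)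
  show "smMap (cat_ob_trans_loop S s) f =
      smMap (mult (ftgt (xsrc s))) (pair (smMap (fcell (xsrc s)) f) (smMap (xcell s) (legR (loop (fsrc (xsrc s))) f)))"
    unfolding Sp.ctrans_loop(2)[OF s]
    by (rule ract_apply) (use p(3-9) q(1-9) r(1-9) f cobj_parts[OF q(1)] in simp_all)
qed

lemma is_small_nat_of:
  assumes s: "Sp.ctrans s" shows "is_small_nat U (nat_of s)"
proof -
  note p = ctrans_parts[OF s]
  note q = cfun_parts[OF p(1)] and r = cfun_parts[OF p(2), unfolded p(3,4)]
  have "Cmp (cat_of (ftgt (xsrc s))) (smMap (fcell (xsrc s)) f) (smMap (xcell s) (legR (loop (fsrc (xsrc s))) f)) =
    Cmp (cat_of (ftgt (xsrc s))) (smMap (xcell s) (legL (loop (fsrc (xsrc s))) f)) (smMap (fcell (xtgt s)) f)"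
    if f: "f \<in> apex (loop (fsrc (xsrc s)))" for f
    using loop_apply[OF s f] f p(10-13) q(10-15) r(10-15) cobj_parts[OF q(1)] by simp
  then show ?thesis
    using p q is_small_functor_of[OF p(1)] is_small_functor_of[OF p(2)]
    by (auto simp: is_small_nat_def Let_def hom_iff)
qed

lemma small_nat_parts:
  assumes "is_small_nat U s"
  shows "is_small_functor U (snDom s)" "is_small_functor U (snCod s)" "sfDom (snCod s) = sfDom (snDom s)"
    "sfCod (snCod s) = sfCod (snDom s)" "snMap s \<in> extensional (Ob (sfDom (snDom s)))"
    "x \<in> Ob (sfDom (snDom s)) \<Longrightarrow> snMap s x \<in> Ar (sfCod (snDom s))"
    "x \<in> Ob (sfDom (snDom s)) \<Longrightarrow> Dom (sfCod (snDom s)) (snMap s x) = onOb (sfFun (snDom s)) x"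
    "x \<in> Ob (sfDom (snDom s)) \<Longrightarrow> Cod (sfCod (snDom s)) (snMap s x) = onOb (sfFun (snCod s)) x"
    "f \<in> Ar (sfDom (snDom s)) \<Longrightarrow> onAr (sfFun (snDom s)) f \<cdot>\<^bsub>sfCod (snDom s)\<^esub> snMap s (Cod (sfDom (snDom s)) f) =
      snMap s (Dom (sfDom (snDom s)) f) \<cdot>\<^bsub>sfCod (snDom s)\<^esub> onAr (sfFun (snCod s)) f"
  using assms by (auto simp: is_small_nat_def Let_def hom_iff)

lemma mult_cob_of: "f \<in> Ar C \<Longrightarrow> g \<in> Ar C \<Longrightarrow> Cod C f = Dom C g \<Longrightarrow> smMap (mult (cob_of C)) (pair f g) = Cmp C f g"
  by (simp add: cob_of_def)

text \<open>Equality of the two actions is checked arrow by arrow, where \<open>lact_apply\<close>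
  and \<open>ract_apply\<close> turn it into the naturality square of \<open>s\<close>.\<close>

lemma ctrans_ctrans_of:
  assumes s: "is_small_nat U s" shows "Sp.ctrans (ctrans_of s)"
proof -
  note p = small_nat_parts[OF s]
  note q = small_functor_parts[OF p(1)] and r = small_functor_parts[OF p(2), unfolded p(3,4)]
  note fc = cfun_cfun_of[OF p(1)] cfun_cfun_of[OF p(2)]
  note fp = cfun_parts[OF fc(1)] and fr = cfun_parts[OF fc(2)]
  have f: "farr (cfun_of (snDom s)) \<in> Ar (SetCat U)" "farr (cfun_of (snCod s)) \<in> Ar (SetCat U)"
    using Sp.cfun_simps(3)[OF fc(1)] Sp.cfun_simps(3)[OF fc(2)] unfolding Span_simps by simp_all
  have u: "Ob (sfDom (snDom s)) \<in> U" using q(1) by (simp add: small_category_def)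
  have x: "is_span_map U (xcell (ctrans_of s))"
    by (rule is_span_mapI[where m="span_id (Ob (sfDom (snDom s)))" and n="loop_of (sfCod (snDom s))"])
      (use p f u q r in \<open>simp_all add: is_span_loop_of\<close>)
  have l: "smMap (lact S (cob_of (sfCod (snDom s))) (xcell (ctrans_of s)) (fcell (cfun_of (snCod s)))) f =
      smMap (mult (cob_of (sfCod (snDom s)))) (pair (snMap s (Dom (sfDom (snDom s)) f)) (onAr (sfFun (snCod s)) f))"
    "smMap (ract S (cob_of (sfCod (snDom s))) (fcell (cfun_of (snDom s))) (xcell (ctrans_of s))) f =
      smMap (mult (cob_of (sfCod (snDom s)))) (pair (onAr (sfFun (snDom s)) f) (snMap s (Cod (sfDom (snDom s)) f)))"
    if f: "f \<in> Ar (sfDom (snDom s))" for f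
    using lact_apply[of "cob_of (sfCod (snDom s))" "xcell (ctrans_of s)" "loop_of (sfDom (snDom s))" "fcell (cfun_of (snCod s))" f]
      ract_apply[of "cob_of (sfCod (snDom s))" "xcell (ctrans_of s)" "loop_of (sfDom (snDom s))" "fcell (cfun_of (snDom s))" f]
      x f q p(3,4) fp(5) fr(5) by (simp_all add: cobj_cob_of)
  have c: "Sp.cobj (cob_of (sfCod (snDom s)))" using q by (simp add: cobj_cob_of)
  have ll: "is_span_map U (lact S (cob_of (sfCod (snDom s))) (xcell (ctrans_of s)) (fcell (cfun_of (snCod s))))"
    "is_span_map U (ract S (cob_of (sfCod (snDom s))) (fcell (cfun_of (snDom s))) (xcell (ctrans_of s)))"
    "smDom (lact S (cob_of (sfCod (snDom s))) (xcell (ctrans_of s)) (fcell (cfun_of (snCod s)))) = loop_of (sfDom (snDom s))"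
    "smDom (ract S (cob_of (sfCod (snDom s))) (fcell (cfun_of (snDom s))) (xcell (ctrans_of s))) = loop_of (sfDom (snDom s))"
    using Sp.lact_simps(1,2)[OF c, of "xcell (ctrans_of s)" "fcell (cfun_of (snCod s))"]
      Sp.ract_simps(1,2)[OF c, of "xcell (ctrans_of s)" "fcell (cfun_of (snDom s))"] x fp(5) fr(5) p(3,4) by simp_all
  have e: "lact S (cob_of (sfCod (snDom s))) (xcell (ctrans_of s)) (fcell (cfun_of (snCod s))) =
    ract S (cob_of (sfCod (snDom s))) (fcell (cfun_of (snDom s))) (xcell (ctrans_of s))"
  proof (rule span_map_eqI[where m="loop_of (sfDom (snDom s))"])
    interpret C: category "sfDom (snDom s)" by (rule q)
    show "\<forall>f \<in> apex (loop_of (sfDom (snDom s))).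
      smMap (lact S (cob_of (sfCod (snDom s))) (xcell (ctrans_of s)) (fcell (cfun_of (snCod s)))) f =
      smMap (ract S (cob_of (sfCod (snDom s))) (fcell (cfun_of (snDom s))) (xcell (ctrans_of s))) f"
      using p(6-9) q(8-11) r(8-11) by (simp add: l mult_cob_of)
  qed (use ll span_map_simps(9)[OF ll(1)] span_map_simps(9)[OF ll(2)]
      Sp.lact_simps(3-)[OF c, of "xcell (ctrans_of s)" "fcell (cfun_of (snCod s))"]
      Sp.ract_simps(3-)[OF c, of "xcell (ctrans_of s)" "fcell (cfun_of (snDom s))"] x fp(5) fr(5) p(3,4) in simp_all)
  show ?thesis
    by (rule Sp.ctransI) (use fc x e p in simp_all)
qed

lemma nat_of_ctrans_of:
  assumes "is_small_nat U s" shows "nat_of (ctrans_of s) = s"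
  using small_nat_parts[OF assms]
  by (intro small_nat.equality) (simp_all add: functor_of_cfun_of)

lemma ctrans_of_nat_of:
  assumes "Sp.ctrans s" shows "ctrans_of (nat_of s) = s"
proof -
  note p = ctrans_parts[OF assms]
  note q = cfun_parts[OF p(1)]
  show ?thesis
    using p q by (intro cat_ob_trans.equality span_map.equality) (simp_all add: cfun_of_functor_of loop_of_cat_of)
qed

lemma CAT_simps:
  "Ob (C1 (CAT U)) = {C. small_category U C}" "Ar (C1 (CAT U)) = {F. is_small_functor U F}"
  "Dom (C1 (CAT U)) = sfDom" "Cod (C1 (CAT U)) = sfCod"
  "Ide (C1 (CAT U)) C = \<lparr>sfDom = C, sfCod = C, sfFun = \<lparr>onOb = (\<lambda>x \<in> Ob C. x), onAr = (\<lambda>f \<in> Ar C. f)\<rparr>\<rparr>"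
  "Cmp (C1 (CAT U)) = small_functor_cmp"
  "Ob (C2 (CAT U)) = {F. is_small_functor U F}" "Ar (C2 (CAT U)) = {s. is_small_nat U s}"
  "Dom (C2 (CAT U)) = snDom" "Cod (C2 (CAT U)) = snCod"
  "Ide (C2 (CAT U)) F = \<lparr>snDom = F, snCod = F,
         snMap = (\<lambda>x \<in> Ob (sfDom F). Ide (sfCod F) (onOb (sfFun F) x))\<rparr>"
  "Cmp (C2 (CAT U)) s t = \<lparr>snDom = snDom s, snCod = snCod t,
         snMap = (\<lambda>x \<in> Ob (sfDom (snDom s)). snMap s x \<cdot>\<^bsub>sfCod (snDom s)\<^esub> snMap t x)\<rparr>"
  "HCmp (CAT U) s t = \<lparr>snDom = small_functor_cmp (snDom s) (snDom t),
       snCod = small_functor_cmp (snCod s) (snCod t),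
       snMap = (\<lambda>x \<in> Ob (sfDom (snDom s)).
         onAr (sfFun (snDom t)) (snMap s x) \<cdot>\<^bsub>sfCod (snDom t)\<^esub>
         snMap t (onOb (sfFun (snCod s)) x))\<rparr>"
  by (simp_all add: CAT_def)

lemma smMap_Cmp_Span: "smMap (\<sigma> \<cdot>\<^bsub>D1 S\<^esub> \<tau>) = (\<lambda>a \<in> apex (smDom \<sigma>). smMap \<tau> (smMap \<sigma> a))"
  by (simp add: Span_def)

lemma small_functor_cmp_of:
  assumes F: "is_small_functor U F" and G: "is_small_functor U G" and m: "sfCod F = sfDom G"
  shows "small_functor_cmp F G = functor_of (cat_ob_fun_cmp S (cfun_of F) (cfun_of G))"
  using small_functor_parts(1)[OF F] small_functor_parts(2)[OF G]
  by (intro small_functor.equality fctr.equality)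
    (auto simp: small_functor_cmp_def cat_of_cob_of smMap_Cmp_Span intro!: restrict_ext)

lemma snMap_eqI:
  assumes "snDom s = snDom t" "snCod s = snCod t" "snMap s \<in> extensional X" "snMap t \<in> extensional X"
    "\<And>x. x \<in> X \<Longrightarrow> snMap s x = snMap t x"
  shows "(s :: 'u small_nat) = t"
  using assms by (intro small_nat.equality extensionalityI[of "snMap s" X]) auto

lemma unit_cob_of: "x \<in> Ob C \<Longrightarrow> smMap (unit (cob_of C)) x = Ide C x"
  by (simp add: cob_of_def)

text \<open>\<open>CAT U\<close> takes the place of the 2-category whose laws are derived by
  transport, so its operations are compared with those of category objects in spans and its laws
  follow.\<close>

theorem CAT_isomorphic: "isomorphic_two_categories (CAT U) (CatObjects S)"
proof (rule isomorphic_two_categoriesI[where ?T0.0 = cob_of and ?S0.0 = cat_of and ?T1.0 = cfun_of and ?S1.0 = functor_of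
      and ?T2.0 = ctrans_of and ?S2.0 = nat_of])
  show "two_category (CatObjects S)" by (rule Sp.two_category_CatObjects)
next
  fix C assume "C \<in> Ob (C1 (CAT U))"
  then have C: "small_category U C" by (simp add: CAT_simps)
  show "Ide (C1 (CAT U)) C = functor_of (Ide (C1 (CatObjects S)) (cob_of C))"
    unfolding CAT_simps Sp.CatObjects_simps
    by (rule small_functor.equality) (simp_all add: cat_of_cob_of[OF C], simp add: functor_of_def span_glob_def)
next
  fix F assume "F \<in> Ar (C1 (CAT U))"
  then have F: "is_small_functor U F" by (simp add: CAT_simps)
  note p = small_functor_parts[OF F]
  have c: "Sp.ctrans (Sp.ide_trans (cfun_of F))" by (rule Sp.ctrans_ide[OF cfun_cfun_of[OF F]])
  show "Ide (C2 (CAT U)) F = nat_of (Ide (C2 (CatObjects S)) (cfun_of F))"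
    unfolding CAT_simps Sp.CatObjects_simps
    by (rule snMap_eqI[where X="Ob (sfDom F)"])
      (use p ctrans_parts(10)[OF c] in \<open>simp_all add: functor_of_cfun_of[OF F] unit_cob_of\<close>)
next
  fix F G assume "F \<in> Ar (C1 (CAT U))" "G \<in> Ar (C1 (CAT U))" "Cod (C1 (CAT U)) F = Dom (C1 (CAT U)) G"
  then show "F \<cdot>\<^bsub>C1 (CAT U)\<^esub> G = functor_of (cfun_of F \<cdot>\<^bsub>C1 (CatObjects S)\<^esub> cfun_of G)"
    by (simp add: CAT_simps Sp.CatObjects_simps small_functor_cmp_of)
next
  fix s t assume "s \<in> Ar (C2 (CAT U))" "t \<in> Ar (C2 (CAT U))" "Cod (C2 (CAT U)) s = Dom (C2 (CAT U)) t"
  then have s: "is_small_nat U s" and t: "is_small_nat U t" and m: "snCod s = snDom t" by (auto simp: CAT_simps)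
  note p = small_nat_parts[OF s] and q = small_nat_parts[OF t]
  note cs = ctrans_ctrans_of[OF s] and ct = ctrans_ctrans_of[OF t]
  have m': "xtgt (ctrans_of s) = xsrc (ctrans_of t)" by (simp add: m)
  have c: "Sp.ctrans (Sp.vcmp (ctrans_of s) (ctrans_of t))" by (rule Sp.ctrans_vcmp(1)[OF cs ct m'])
  have e: "ctrans_of s \<cdot>\<^bsub>C2 (CatObjects S)\<^esub> ctrans_of t = Sp.vcmp (ctrans_of s) (ctrans_of t)"
    by (rule Sp.Cmp_CatObjects[OF cs ct m'])
  have d: "sfDom (snDom t) = sfDom (snDom s)" "sfCod (snDom t) = sfCod (snDom s)" using p(3,4) m by simp_all
  \<comment> \<open>A 2-morphism starts at an identity span, where the left action is pointwise
    composition in the codomain.\<close>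
  have l: "smMap (lact S (cob_of (sfCod (snDom s))) (xcell (ctrans_of s)) (xcell (ctrans_of t))) x =
    snMap s x \<cdot>\<^bsub>sfCod (snDom s)\<^esub> snMap t x" if x: "x \<in> Ob (sfDom (snDom s))" for x
    by (subst lact_apply[where m="span_id (Ob (sfDom (snDom s)))"])
      (use x d m p(6-8)[OF x] q(6-8)[of x] ctrans_parts(5)[OF cs] ctrans_parts(5)[OF ct] small_functor_parts(2)[OF p(1)]
        in \<open>simp_all add: cobj_cob_of mult_cob_of\<close>)
  show "s \<cdot>\<^bsub>C2 (CAT U)\<^esub> t = nat_of (ctrans_of s \<cdot>\<^bsub>C2 (CatObjects S)\<^esub> ctrans_of t)"
    unfolding CAT_simps e
    by (rule snMap_eqI[where X="Ob (sfDom (snDom s))"])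
      (use ctrans_parts(10)[OF c] p q in \<open>simp_all add: functor_of_cfun_of l\<close>)
next
  fix s t assume "s \<in> Ar (C2 (CAT U))" "t \<in> Ar (C2 (CAT U))"
    "Cod (C1 (CAT U)) (Dom (C2 (CAT U)) s) = Dom (C1 (CAT U)) (Dom (C2 (CAT U)) t)"
  then have s: "is_small_nat U s" and t: "is_small_nat U t" and m: "sfCod (snDom s) = sfDom (snDom t)" by (auto simp: CAT_simps)
  note p = small_nat_parts[OF s] and q = small_nat_parts[OF t]
  note cs = ctrans_ctrans_of[OF s] and ct = ctrans_ctrans_of[OF t]
  have m': "ftgt (xsrc (ctrans_of s)) = fsrc (xsrc (ctrans_of t))" by (simp add: m)
  have c: "Sp.ctrans (Sp.tcmp (ctrans_of s) (ctrans_of t))" by (rule Sp.ctrans_hcmp(1)[OF cs ct m'])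
  have l: "smMap (xcell (Sp.tcmp (ctrans_of s) (ctrans_of t))) x =
    onAr (sfFun (snDom t)) (snMap s x) \<cdot>\<^bsub>sfCod (snDom t)\<^esub> snMap t (onOb (sfFun (snCod s)) x)"
    if x: "x \<in> Ob (sfDom (snDom s))" for x
  proof -
    have f: "snMap s x \<in> Ar (sfDom (snDom t))" "Cod (sfDom (snDom t)) (snMap s x) = onOb (sfFun (snCod s)) x"
      using p(6-8)[OF x] m by simp_all
    have y: "onOb (sfFun (snCod s)) x \<in> Ob (sfDom (snDom t))"
      using small_functor_parts(8)[OF p(2), of x] x p(3,4) m by simp
    have "smMap (xcell (Sp.tcmp (ctrans_of s) (ctrans_of t))) x = smMap (cat_ob_trans_loop S (ctrans_of t)) (snMap s x)"
      using x by simp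
    \<comment> \<open>Of the two sides of the naturality square of \<open>t\<close>, the second form
      of \<open>loop_apply\<close> gives the one used by horizontal composition in
      \<open>CAT\<close>.\<close>
    also have "\<dots> = smMap (mult (cob_of (sfCod (snDom t))))
        (pair (onAr (sfFun (snDom t)) (snMap s x)) (snMap t (onOb (sfFun (snCod s)) x)))"
      using loop_apply(2)[OF ct, of "snMap s x"] f by simp
    also have "\<dots> = onAr (sfFun (snDom t)) (snMap s x) \<cdot>\<^bsub>sfCod (snDom t)\<^esub> snMap t (onOb (sfFun (snCod s)) x)"
      by (rule mult_cob_of) (use f y q(6,7) small_functor_parts(9-11)[OF q(1)] in simp_all)
    finally show ?thesis .
  qed
  show "s *\<^bsub>CAT U\<^esub> t = nat_of (ctrans_of s *\<^bsub>CatObjects S\<^esub> ctrans_of t)"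
    unfolding CAT_simps Sp.CatObjects_simps
    by (rule snMap_eqI[where X="Ob (sfDom (snDom s))"])
      (use ctrans_parts(10)[OF c] p q m l in \<open>simp_all add: small_functor_cmp_of del: Sp.trans_ops_simps(9)\<close>)
qed (auto simp: CAT_simps Sp.CatObjects_simps cobj_cob_of cat_of_cob_of small_category_cat_of cob_of_cat_of
    cfun_cfun_of functor_of_cfun_of is_small_functor_of cfun_of_functor_of ctrans_ctrans_of nat_of_ctrans_of
    is_small_nat_of ctrans_of_nat_of small_functor_parts(1,2) small_nat_parts(1,2))

end

theorem corollary8p20:
  fixes A :: "('o, 'a, 't) two_cat" and P :: "('o, 'a) prods"
    and E :: "('eo, 'ea, 'ep, 'ec) dbl"
    and U :: "'u set set" and pair :: "'u \<Rightarrow> 'u \<Rightarrow> 'u"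
  assumes A: "cartesian_two_category A P"
  shows
    "(cartesian_equipment E \<and> local_coequalizers E \<longrightarrow>
        isomorphic_two_categories (CartLax (VerDbl A) P E) (Cart2Cat A P (CatObjects E))) \<and>
     (set_universe U pair \<longrightarrow>
        isomorphic_two_categories (CartLax (VerDbl A) P (Span U pair)) (Cart2Cat A P (CAT U)))"
proof (intro conjI impI)
  have A': "two_category A" using A by (simp add: cartesian_two_category_def)
  \<comment> \<open>\<open>D\<close> has type variables of its own, so that the statement can be
    instantiated both with \<open>E\<close> and with spans.\<close>
  have key: "isomorphic_two_categories (CartLax (VerDbl A) P D) (Cart2Cat A P (CatObjects D))"
    if D: "double_category D" and Q: "double_category.parallel_products D P' Q'"
    for D :: "('do, 'da, 'dp, 'dc) dbl" and P' Q'
  proof -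
    have "cartesian_valued A D P P' Q'"
      using A A' D Q by (simp add: cartesian_valued_def cell_valued_def cartesian_valued_axioms_def)
    then show ?thesis by (rule cartesian_valued.CartLax_isomorphic)
  qed
  show "isomorphic_two_categories (CartLax (VerDbl A) P E) (Cart2Cat A P (CatObjects E))"
    if E: "cartesian_equipment E \<and> local_coequalizers E"
  proof -
    obtain P' Q' where D: "double_category E" and PQ: "cartesian_double_structure E P' Q'"
      using E unfolding cartesian_equipment_def cartesian_double_category_def by blast
    have "double_category.parallel_products E P' Q'"
      using PQ unfolding cartesian_double_structure_def double_category.parallel_products_def[OF D] by blast
    with D show ?thesis by (rule key)
  qed
  show "isomorphic_two_categories (CartLax (VerDbl A) P (Span U pair)) (Cart2Cat A P (CAT U))"
    if "set_universe U pair"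
  proof -
    interpret set_universe U pair by (rule that)
    have "isomorphic_two_categories (CartLax (VerDbl A) P (Span U pair)) (Cart2Cat A P (CatObjects (Span U pair)))"
      by (rule key[OF double_category_Span parallel_products_Span])
    moreover have "chosen_products (C1 A) P"
      using A by (auto simp: cartesian_two_category_def chosen_products_def is_2product_def is_2terminal_def)
    \<comment> \<open>Category objects in spans are replaced by small categories; the comparison was
      built starting from \<open>CAT U\<close>, hence the use of symmetry.\<close>
    then have "isomorphic_two_categories (Cart2Cat A P (CatObjects (Span U pair))) (Cart2Cat A P (CAT U))"
      by (rule Cart2Cat_isomorphic_targets[OF A' _ isomorphic_two_categories_sym[OF CAT_isomorphic]])
    ultimately show ?thesis by (rule isomorphic_two_categories_trans)
  qed
qed

end
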